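(* Let $(X,b,m)$ be a weighted graph, let $\theta,\theta'$ be magnetic potentials on $(X,b)$ and let $v,v':X\to\mathbb{R}$ be electric potentials on $X$, and assume that $Q^{(c)}_{v,\theta}$, $Q^{(c)}_{v',\theta'}$ and $Q^{(c)}_{-\mathrm{deg},0}$ are semi-bounded from below and closable in $\ell^2(X,m)$. Then for all $t\ge0$ and all $x,y\in X$, the integral kernel of $\exp(-itL_{v,\theta})\exp(itL_{v',\theta'})$ is given by $$\big[\exp(-itL_{v,\theta})\exp(itL_{v',\theta'})\big](x,y)=\mathbb{E}_x\left[1_{\{N_t(\mathbb{X})<\infty\}}\,i^{N_t(\mathbb{X})}\exp\big(\mathscr{A}_t(v,\theta|\mathbb{X})\big)\,m(\mathbb{X}_t)^{-1}\,\mathbb{E}_y\left[1_{\{\mathbb{X}'_t=\mathbb{X}_t\}\cap\{N_t(\mathbb{X}')<\infty\}}\,\overline{i^{N_t(\mathbb{X}')}\exp\big(\mathscr{A}_t(v',\theta'|\mathbb{X}')\big)}\right]\right],$$ where $\mathbb{X}'$ denotes an independent copy of $\mathbb{X}$; that is, the inner expectation is taken over $\mathbb{X}'$ under $\mathbb{P}_y$ with the value of $\mathbb{X}_t$ held fixed, and the outer expectation is taken over $\mathbb{X}$ under $\mathbb{P}_x$.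
   Context: Weighted graph: $X$ is a countable set with the discrete topology; $b:X\times X\to[0,\infty)$ is symmetric with $b(x,x)=0$ and $\sum_{y\in X}b(x,y)<\infty$ for all $x\in X$; $m:X\to(0,\infty)$ is any function, viewed as a measure via $m(A)=\sum_{x\in A}m(x)$. No local finiteness is assumed. Write $x\sim y$ if $b(x,y)>0$. The weighted degree is $\mathrm{deg}(x)=\frac1{m(x)}\sum_{y\in X}b(x,y)$. Potentials: a magnetic potential is a function $\theta:\{b>0\}\to\mathbb{R}$ with $\theta(x,y)=-\theta(y,x)$; an electric potential is any function $v:X\to\mathbb{R}$. Forms and operators: all function spaces are complex-valued, $i=\sqrt{-1}$, and $C_c(X)$ denotes the finitely supported functions on $X$. For $f,g\in C_c(X)$, $$Q^{(c)}_{v,\theta}(f,g)=\frac12\sum_{x\sim y}b(x,y)\big(f(x)-e^{i\theta(x,y)}f(y)\big)\overline{\big(g(x)-e^{i\theta(x,y)}g(y)\big)}+\sum_{x\in X}v(x)f(x)\overline{g(x)}m(x),$$ the first sum being over ordered pairs $(x,y)$ with $x\sim y$. If this form is bounded from below and closable in $\ell^2(X,m)$, its closure is $Q_{v,\theta}$ and $L_{v,\theta}$ is the associated self-adjoint operator. $Q:=Q_{0,0}$ is always well-defined and is a regular symmetric Dirichlet form; put $L:=L_{0,0}$. The integral kernel of a bounded operator $A$ on $\ell^2(X,m)$ is the unique map $A(\cdot,\cdot):X\times X\to\mathbb{C}$ with $Af(x)=\sum_{y\in X}A(x,y)f(y)m(y)$ for all $f\in\ell^2(X,m)$, $x\in X$.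 Process: $\hat X=X\cup\{\infty_X\}$ is the Alexandrov compactification if $X$ is infinite, and $\hat X=X$ if $X$ is finite. $\Omega$ is the space of right-continuous paths $\omega:[0,\infty)\to\hat X$ having left limits, with its Borel $\sigma$-algebra, and $\mathbb{X}_t(\omega)=\omega(t)$. For $x\in X$, $\mathbb{P}_x$ (with expectation $\mathbb{E}_x$) is the unique probability measure on $\Omega$ such that for all $0=t_0<t_1<\dots<t_l$, $x_0=x$ and $x_1,\dots,x_l\in\hat X$, $$\mathbb{P}_x\{\mathbb{X}_{t_1}=x_1,\dots,\mathbb{X}_{t_l}=x_l\}=\prod_{j=0}^{l-1}p_{t_{j+1}-t_j}(x_j,x_{j+1}),$$ where $p_t(y,z)=\exp(-tL)(y,z)m(z)$ for $y,z\in X$, $p_t(y,\infty_X)=1-\sum_{z\in X}\exp(-tL)(y,z)m(z)$ for $y\in X$, $p_t(\infty_X,\infty_X)=1$ and $p_t(\infty_X,y)=0$ for $y\in X$. Under $\mathbb{P}_x$ the process is a strong Markov process for which $\infty_X$ is a cemetery. $\tau_n$ is the $n$-th jump time of $\mathbb{X}$ ($\tau_0=0$), and $N_t(\mathbb{X})\in\{0,1,2,\dots\}\cup\{\infty\}$ is the number of jumps of $\mathbb{X}|_{[0,t]}$; one has $\mathbb{X}_t\in X$ $\mathbb{P}_x$-a.s. on $\{N_t(\mathbb{X})<\infty\}$. The stochastic line integral is $\int_0^t\theta(d\mathbb{X}_s)=\sum_{n=1}^{N_t(\mathbb{X})}\theta(\mathbb{X}_{\tau_{n-1}},\mathbb{X}_{\tau_n})$,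 set to $0$ if $N_t(\mathbb{X})\in\{0,\infty\}$ or if $b(\mathbb{X}_{\tau_{n-1}},\mathbb{X}_{\tau_n})=0$ for some $n\le N_t(\mathbb{X})$. For $w:X\to\mathbb{R}$, $\int_0^tw(\mathbb{X}_s)ds$ is the usual integral of the piecewise constant function $s\mapsto w(\mathbb{X}_s)$ if $N_t(\mathbb{X})<\infty$, and is set to $0$ if $N_t(\mathbb{X})=\infty$. Finally, $$\mathscr{A}_t(v,\theta|\mathbb{X})=i\int_0^t\theta(d\mathbb{X}_s)-i\int_0^t\big(v(\mathbb{X}_s)+\mathrm{deg}(\mathbb{X}_s)\big)ds+\int_0^t\mathrm{deg}(\mathbb{X}_s)ds.$$ *)

theory Defs
  imports "HOL-Probability.Probability"
begin

section \<open>Weighted graphs and potentials\<close>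

text \<open>The countable vertex set is the universe of a (possibly finite) countable type.\<close>

definition weighted_graph :: "('a::countable \<Rightarrow> 'a \<Rightarrow> real) \<Rightarrow> ('a \<Rightarrow> real) \<Rightarrow> bool" where
  "weighted_graph b m \<longleftrightarrow>
     (\<forall>x y. 0 \<le> b x y) \<and> (\<forall>x y. b x y = b y x) \<and> (\<forall>x. b x x = 0) \<and>
     (\<forall>x. (\<lambda>y. b x y) summable_on UNIV) \<and> (\<forall>x. 0 < m x)"

definition wdeg :: "('a \<Rightarrow> 'a \<Rightarrow> real) \<Rightarrow> ('a \<Rightarrow> real) \<Rightarrow> 'a \<Rightarrow> real" where
  "wdeg b m x = (\<Sum>\<^sub>\<infinity>y. b x y) / m x"

text \<open>A magnetic potential is a partial function with domain \<open>{b > 0}\<close>; its values elsewhere are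
  irrelevant and never used.\<close>

definition magnetic_potential :: "('a \<Rightarrow> 'a \<Rightarrow> real) \<Rightarrow> ('a \<Rightarrow> 'a \<Rightarrow> real) \<Rightarrow> bool" where
  "magnetic_potential b \<theta> \<longleftrightarrow> (\<forall>x y. 0 < b x y \<longrightarrow> \<theta> x y = - \<theta> y x)"


section \<open>The Hilbert space of square summable functions\<close>

definition ell2 :: "('a \<Rightarrow> real) \<Rightarrow> ('a \<Rightarrow> complex) set" where
  "ell2 m = {f. (\<lambda>x. (cmod (f x))\<^sup>2 * m x) summable_on UNIV}"

definition ell2_inner :: "('a \<Rightarrow> real) \<Rightarrow> ('a \<Rightarrow> complex) \<Rightarrow> ('a \<Rightarrow> complex) \<Rightarrow> complex" where
  "ell2_inner m f g = (\<Sum>\<^sub>\<infinity>x. f x * cnj (g x) * of_real (m x))"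

definition ell2_norm :: "('a \<Rightarrow> real) \<Rightarrow> ('a \<Rightarrow> complex) \<Rightarrow> real" where
  "ell2_norm m f = sqrt (\<Sum>\<^sub>\<infinity>x. (cmod (f x))\<^sup>2 * m x)"

definition Cc :: "('a \<Rightarrow> complex) set" where
  "Cc = {f. finite {x. f x \<noteq> 0}}"


section \<open>Sesquilinear forms, closures and associated operators\<close>

text \<open>A form consists of a domain \<open>D\<close> (a subspace of \<open>ell2 m\<close>) and a map \<open>q\<close>, linear in the first and
  antilinear in the second argument, considered on \<open>D\<close> only.\<close>

definition semibounded_form ::
  "('a \<Rightarrow> real) \<Rightarrow> ('a \<Rightarrow> complex) set \<Rightarrow> (('a \<Rightarrow> complex) \<Rightarrow> ('a \<Rightarrow> complex) \<Rightarrow> complex) \<Rightarrow> bool" where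
  "semibounded_form m D q \<longleftrightarrow> (\<exists>C. \<forall>f\<in>D. Re (q f f) \<ge> - C * (ell2_norm m f)\<^sup>2)"

definition form_Cauchy ::
  "(('a \<Rightarrow> complex) \<Rightarrow> ('a \<Rightarrow> complex) \<Rightarrow> complex) \<Rightarrow> (nat \<Rightarrow> 'a \<Rightarrow> complex) \<Rightarrow> bool" where
  "form_Cauchy q F \<longleftrightarrow>
     (\<forall>e>0. \<exists>N. \<forall>n\<ge>N. \<forall>k\<ge>N. cmod (q (\<lambda>x. F n x - F k x) (\<lambda>x. F n x - F k x)) < e)"

text \<open>\<open>f\<close> is the limit in \<open>ell2 m\<close> of the form-Cauchy sequence \<open>F\<close> in \<open>D\<close>.\<close>

definition form_converges ::
  "('a \<Rightarrow> real) \<Rightarrow> ('a \<Rightarrow> complex) set \<Rightarrow> (('a \<Rightarrow> complex) \<Rightarrow> ('a \<Rightarrow> complex) \<Rightarrow> complex)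
     \<Rightarrow> (nat \<Rightarrow> 'a \<Rightarrow> complex) \<Rightarrow> ('a \<Rightarrow> complex) \<Rightarrow> bool" where
  "form_converges m D q F f \<longleftrightarrow>
     (\<forall>n. F n \<in> D) \<and> f \<in> ell2 m \<and> (\<lambda>n. ell2_norm m (\<lambda>x. F n x - f x)) \<longlonglongrightarrow> 0 \<and> form_Cauchy q F"

definition closable_form ::
  "('a \<Rightarrow> real) \<Rightarrow> ('a \<Rightarrow> complex) set \<Rightarrow> (('a \<Rightarrow> complex) \<Rightarrow> ('a \<Rightarrow> complex) \<Rightarrow> complex) \<Rightarrow> bool" where
  "closable_form m D q \<longleftrightarrow>
     (\<forall>F. form_converges m D q F (\<lambda>_. 0) \<longrightarrow> (\<lambda>n. q (F n) (F n)) \<longlonglongrightarrow> 0)"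

definition closure_domain ::
  "('a \<Rightarrow> real) \<Rightarrow> ('a \<Rightarrow> complex) set \<Rightarrow> (('a \<Rightarrow> complex) \<Rightarrow> ('a \<Rightarrow> complex) \<Rightarrow> complex)
     \<Rightarrow> ('a \<Rightarrow> complex) set" where
  "closure_domain m D q = {f. \<exists>F. form_converges m D q F f}"

definition closure_form ::
  "('a \<Rightarrow> real) \<Rightarrow> ('a \<Rightarrow> complex) set \<Rightarrow> (('a \<Rightarrow> complex) \<Rightarrow> ('a \<Rightarrow> complex) \<Rightarrow> complex)
     \<Rightarrow> ('a \<Rightarrow> complex) \<Rightarrow> ('a \<Rightarrow> complex) \<Rightarrow> complex" where
  "closure_form m D q f g =
     (THE c. \<forall>F G. form_converges m D q F f \<longrightarrow> form_converges m D q G g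
                \<longrightarrow> (\<lambda>n. q (F n) (G n)) \<longlonglongrightarrow> c)"

text \<open>Unbounded operators on \<open>ell2 m\<close> are represented by their graphs.\<close>

type_synonym 'a operator_graph = "(('a \<Rightarrow> complex) \<times> ('a \<Rightarrow> complex)) set"

text \<open>The self-adjoint operator associated with the closure of \<open>(D, q)\<close>.\<close>

definition form_operator ::
  "('a \<Rightarrow> real) \<Rightarrow> ('a \<Rightarrow> complex) set \<Rightarrow> (('a \<Rightarrow> complex) \<Rightarrow> ('a \<Rightarrow> complex) \<Rightarrow> complex)
     \<Rightarrow> 'a operator_graph" where
  "form_operator m D q =
     {(f, h). f \<in> closure_domain m D q \<and> h \<in> ell2 m \<and>
        (\<forall>g\<in>closure_domain m D q. closure_form m D q f g = ell2_inner m h g)}"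

definition scale_graph :: "complex \<Rightarrow> 'a operator_graph \<Rightarrow> 'a operator_graph" where
  "scale_graph c A = {(f, \<lambda>x. c * h x) | f h. (f, h) \<in> A}"


section \<open>Exponentials of unbounded operators\<close>

definition bounded_operator ::
  "('a \<Rightarrow> real) \<Rightarrow> (('a \<Rightarrow> complex) \<Rightarrow> ('a \<Rightarrow> complex)) \<Rightarrow> bool" where
  "bounded_operator m T \<longleftrightarrow>
     (\<forall>f\<in>ell2 m. T f \<in> ell2 m) \<and>
     (\<forall>f\<in>ell2 m. \<forall>g\<in>ell2 m. \<forall>c. T (\<lambda>x. c * f x + g x) = (\<lambda>x. c * T f x + T g x)) \<and>
     (\<exists>C. \<forall>f\<in>ell2 m. ell2_norm m (T f) \<le> C * ell2_norm m f)"

definition C0_semigroup ::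
  "('a \<Rightarrow> real) \<Rightarrow> (real \<Rightarrow> ('a \<Rightarrow> complex) \<Rightarrow> ('a \<Rightarrow> complex)) \<Rightarrow> bool" where
  "C0_semigroup m U \<longleftrightarrow>
     (\<forall>t\<ge>0. bounded_operator m (U t)) \<and>
     (\<forall>f\<in>ell2 m. U 0 f = f) \<and>
     (\<forall>s\<ge>0. \<forall>t\<ge>0. \<forall>f\<in>ell2 m. U (s + t) f = U s (U t f)) \<and>
     (\<forall>f\<in>ell2 m. ((\<lambda>t. ell2_norm m (\<lambda>x. U t f x - f x)) \<longlongrightarrow> 0) (at_right 0))"

definition generator ::
  "('a \<Rightarrow> real) \<Rightarrow> (real \<Rightarrow> ('a \<Rightarrow> complex) \<Rightarrow> ('a \<Rightarrow> complex)) \<Rightarrow> 'a operator_graph" where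
  "generator m U =
     {(f, h). f \<in> ell2 m \<and> h \<in> ell2 m \<and>
        ((\<lambda>t. ell2_norm m (\<lambda>x. (U t f x - f x) / of_real t - h x)) \<longlongrightarrow> 0) (at_right 0)}"

text \<open>\<open>op_exp m A t\<close> is \<open>exp(tA)\<close> for \<open>t \<ge> 0\<close>: the time-\<open>t\<close> member of the unique strongly continuous
  semigroup on \<open>ell2 m\<close> generated by \<open>A\<close>.  It is only meaningful on arguments in \<open>ell2 m\<close>.  For a
  self-adjoint \<open>L\<close> and \<open>A = c L\<close>, where \<open>c = \<plusminus>\<i>\<close>, or \<open>c = -1\<close> and \<open>L\<close> is bounded from below, this is
  \<open>exp(tcL)\<close> in the sense of the spectral calculus (Stone, Hille and Yosida).\<close>

definition op_exp ::
  "('a \<Rightarrow> real) \<Rightarrow> 'a operator_graph \<Rightarrow> real \<Rightarrow> ('a \<Rightarrow> complex) \<Rightarrow> ('a \<Rightarrow> complex)" where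
  "op_exp m A t f = (THE h. \<exists>U. C0_semigroup m U \<and> generator m U = A \<and> h = U t f)"

definition is_integral_kernel ::
  "('a \<Rightarrow> real) \<Rightarrow> (('a \<Rightarrow> complex) \<Rightarrow> ('a \<Rightarrow> complex)) \<Rightarrow> ('a \<Rightarrow> 'a \<Rightarrow> complex) \<Rightarrow> bool" where
  "is_integral_kernel m T K \<longleftrightarrow>
     (\<forall>f\<in>ell2 m. \<forall>x. ((\<lambda>y. K x y * f y * of_real (m y)) has_sum T f x) UNIV)"

definition integral_kernel ::
  "('a \<Rightarrow> real) \<Rightarrow> (('a \<Rightarrow> complex) \<Rightarrow> ('a \<Rightarrow> complex)) \<Rightarrow> 'a \<Rightarrow> 'a \<Rightarrow> complex" where
  "integral_kernel m T = (THE K. is_integral_kernel m T K)"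


section \<open>Magnetic Schroedinger operators\<close>

definition mag_form ::
  "('a \<Rightarrow> 'a \<Rightarrow> real) \<Rightarrow> ('a \<Rightarrow> real) \<Rightarrow> ('a \<Rightarrow> real) \<Rightarrow> ('a \<Rightarrow> 'a \<Rightarrow> real)
     \<Rightarrow> ('a \<Rightarrow> complex) \<Rightarrow> ('a \<Rightarrow> complex) \<Rightarrow> complex" where
  "mag_form b m v \<theta> f g =
     1 / 2 * (\<Sum>\<^sub>\<infinity>(x, y)\<in>{(x, y). 0 < b x y}.
        of_real (b x y) * (f x - exp (\<i> * of_real (\<theta> x y)) * f y)
                        * cnj (g x - exp (\<i> * of_real (\<theta> x y)) * g y))
     + (\<Sum>\<^sub>\<infinity>x. of_real (v x) * f x * cnj (g x) * of_real (m x))"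

definition mag_op ::
  "('a \<Rightarrow> 'a \<Rightarrow> real) \<Rightarrow> ('a \<Rightarrow> real) \<Rightarrow> ('a \<Rightarrow> real) \<Rightarrow> ('a \<Rightarrow> 'a \<Rightarrow> real) \<Rightarrow> 'a operator_graph" where
  "mag_op b m v \<theta> = form_operator m Cc (mag_form b m v \<theta>)"


section \<open>The Markov process\<close>

text \<open>Points of the compactified space are \<open>Some x\<close> for vertices \<open>x\<close> and \<open>None\<close> for the point at
  infinity.  The library compactification also adds an (isolated) point to a compact space, which
  is removed here when the graph is finite.\<close>

definition Xhat :: "'a option topology" where
  "Xhat = (if finite (UNIV :: 'a set)
           then subtopology (Alexandroff_compactification (discrete_topology UNIV)) (range Some)
           else Alexandroff_compactification (discrete_topology UNIV))"

text \<open>Functions defined on a part of \<open>X\<close> are extended by zero to the point at infinity.\<close>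

definition ext0 :: "('a \<Rightarrow> real) \<Rightarrow> 'a option \<Rightarrow> real" where
  "ext0 w z = (case z of None \<Rightarrow> 0 | Some x \<Rightarrow> w x)"

definition ext0_2 :: "('a \<Rightarrow> 'a \<Rightarrow> real) \<Rightarrow> 'a option \<Rightarrow> 'a option \<Rightarrow> real" where
  "ext0_2 w z z' = (case (z, z') of (Some x, Some y) \<Rightarrow> w x y | _ \<Rightarrow> 0)"

definition paths :: "(real \<Rightarrow> 'a option) set" where
  "paths = {\<omega> \<in> {0..} \<rightarrow>\<^sub>E topspace Xhat.
     (\<forall>t\<ge>0. limitin Xhat \<omega> (\<omega> t) (at_right t)) \<and>
     (\<forall>t>0. \<exists>l. limitin Xhat \<omega> l (at_left t))}"

text \<open>The sigma-algebra generated by the evaluation maps (the Borel sigma-algebra of the Skorokhod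
  topology); every subset of the countable space \<open>Xhat\<close> is a Borel set.\<close>

definition path_algebra :: "(real \<Rightarrow> 'a option) measure" where
  "path_algebra = sigma paths {{\<omega> \<in> paths. \<omega> t \<in> A} | t A. 0 \<le> t}"

definition trans_prob ::
  "('a \<Rightarrow> 'a \<Rightarrow> real) \<Rightarrow> ('a \<Rightarrow> real) \<Rightarrow> real \<Rightarrow> 'a option \<Rightarrow> 'a option \<Rightarrow> complex" where
  "trans_prob b m t z z' =
     (let k = integral_kernel m
                (op_exp m (scale_graph (-1) (mag_op b m (\<lambda>_. 0) (\<lambda>_ _. 0))) t)
      in case z of
           None \<Rightarrow> (case z' of None \<Rightarrow> 1 | Some _ \<Rightarrow> 0)
         | Some x \<Rightarrow> (case z' of None \<Rightarrow> 1 - (\<Sum>\<^sub>\<infinity>y. k x y * of_real (m y))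
                              | Some y \<Rightarrow> k x y * of_real (m y)))"

text \<open>\<open>M\<close> is the law of the process started in \<open>x\<close>.\<close>

definition process_law ::
  "('a \<Rightarrow> 'a \<Rightarrow> real) \<Rightarrow> ('a \<Rightarrow> real) \<Rightarrow> 'a \<Rightarrow> (real \<Rightarrow> 'a option) measure \<Rightarrow> bool" where
  "process_law b m x M \<longleftrightarrow>
     prob_space M \<and> space M = paths \<and> sets M = sets path_algebra \<and>
     (\<forall>l (s :: nat \<Rightarrow> real) (z :: nat \<Rightarrow> 'a option).
        s 0 = 0 \<and> (\<forall>j<l. s j < s (Suc j)) \<and> z 0 = Some x \<and> (\<forall>j\<in>{1..l}. z j \<in> topspace Xhat) \<longrightarrow>
        of_real (measure M {\<omega> \<in> space M. \<forall>j\<in>{1..l}. \<omega> (s j) = z j}) =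
          (\<Prod>j<l. trans_prob b m (s (Suc j) - s j) (z j) (z (Suc j))))"


section \<open>Jumps and stochastic integrals\<close>

definition jump_at :: "(real \<Rightarrow> 'a option) \<Rightarrow> real \<Rightarrow> bool" where
  "jump_at \<omega> s \<longleftrightarrow> 0 < s \<and> \<not> limitin Xhat \<omega> (\<omega> s) (at_left s)"

definition num_jumps :: "(real \<Rightarrow> 'a option) \<Rightarrow> real \<Rightarrow> enat" where
  "num_jumps \<omega> t = (if finite {s \<in> {0..t}. jump_at \<omega> s}
                     then enat (card {s \<in> {0..t}. jump_at \<omega> s}) else \<infinity>)"

text \<open>Only meaningful (and only used) for \<open>n\<close> up to a finite number of jumps in some \<open>[0,t]\<close>.\<close>

fun jump_time :: "(real \<Rightarrow> 'a option) \<Rightarrow> nat \<Rightarrow> real" where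
  "jump_time \<omega> 0 = 0"
| "jump_time \<omega> (Suc n) = Inf {s. jump_time \<omega> n < s \<and> jump_at \<omega> s}"

definition line_integral ::
  "('a \<Rightarrow> 'a \<Rightarrow> real) \<Rightarrow> ('a \<Rightarrow> 'a \<Rightarrow> real) \<Rightarrow> real \<Rightarrow> (real \<Rightarrow> 'a option) \<Rightarrow> real" where
  "line_integral b \<theta> t \<omega> =
     (let N = num_jumps \<omega> t in
      if N = 0 \<or> N = \<infinity> \<or>
         (\<exists>n\<in>{1..the_enat N}. ext0_2 b (\<omega> (jump_time \<omega> (n - 1))) (\<omega> (jump_time \<omega> n)) = 0)
      then 0
      else (\<Sum>n = 1..the_enat N. ext0_2 \<theta> (\<omega> (jump_time \<omega> (n - 1))) (\<omega> (jump_time \<omega> n))))"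

definition time_integral :: "('a \<Rightarrow> real) \<Rightarrow> real \<Rightarrow> (real \<Rightarrow> 'a option) \<Rightarrow> real" where
  "time_integral w t \<omega> =
     (if num_jumps \<omega> t < \<infinity> then set_lebesgue_integral lborel {0..t} (\<lambda>s. ext0 w (\<omega> s)) else 0)"

definition action ::
  "('a \<Rightarrow> 'a \<Rightarrow> real) \<Rightarrow> ('a \<Rightarrow> real) \<Rightarrow> ('a \<Rightarrow> real) \<Rightarrow> ('a \<Rightarrow> 'a \<Rightarrow> real) \<Rightarrow> real
     \<Rightarrow> (real \<Rightarrow> 'a option) \<Rightarrow> complex" where
  "action b m v \<theta> t \<omega> =
     \<i> * of_real (line_integral b \<theta> t \<omega>)
     - \<i> * of_real (time_integral (\<lambda>x. v x + wdeg b m x) t \<omega>)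
     + of_real (time_integral (wdeg b m) t \<omega>)"

text \<open>The inner and outer integrands of the path integral formula, as functions of the paths of the
  copy started in \<open>y\<close> (with the value \<open>z\<close> of the other copy at time \<open>t\<close> held fixed) and of the
  process started in \<open>x\<close>, respectively.\<close>

definition inner_integrand ::
  "('a \<Rightarrow> 'a \<Rightarrow> real) \<Rightarrow> ('a \<Rightarrow> real) \<Rightarrow> ('a \<Rightarrow> real) \<Rightarrow> ('a \<Rightarrow> 'a \<Rightarrow> real) \<Rightarrow> real
     \<Rightarrow> 'a option \<Rightarrow> (real \<Rightarrow> 'a option) \<Rightarrow> complex" where
  "inner_integrand b m v \<theta> t z \<omega> =
     indicator {\<omega>. \<omega> t = z \<and> num_jumps \<omega> t < \<infinity>} \<omega> *
     cnj (\<i> ^ the_enat (num_jumps \<omega> t) * exp (action b m v \<theta> t \<omega>))"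

definition outer_integrand ::
  "('a \<Rightarrow> 'a \<Rightarrow> real) \<Rightarrow> ('a \<Rightarrow> real) \<Rightarrow> ('a \<Rightarrow> real) \<Rightarrow> ('a \<Rightarrow> 'a \<Rightarrow> real) \<Rightarrow> ('a \<Rightarrow> real)
     \<Rightarrow> ('a \<Rightarrow> 'a \<Rightarrow> real) \<Rightarrow> real \<Rightarrow> (real \<Rightarrow> 'a option) measure \<Rightarrow> (real \<Rightarrow> 'a option) \<Rightarrow> complex" where
  "outer_integrand b m v \<theta> v' \<theta>' t Py \<omega> =
     indicator {\<omega>. num_jumps \<omega> t < \<infinity>} \<omega> *
     \<i> ^ the_enat (num_jumps \<omega> t) * exp (action b m v \<theta> t \<omega>) * of_real (inverse (ext0 m (\<omega> t))) *
     (\<integral>\<omega>'. inner_integrand b m v' \<theta>' t (\<omega> t) \<omega>' \<partial>Py)"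

end

theory Submission
  imports Defs
begin

text \<open>
  Testing the form \<open>Q(-deg, 0)\<close> with nonnegative functions shows that its semiboundedness forces the
  adjacency operator \<open>R f x = (1 / m x) (\<Sum>y. b x y f y)\<close> to be bounded on \<open>ell2 m\<close>, while
  semiboundedness of \<open>Q(v, \<theta>)\<close>, tested with point masses, bounds \<open>v + deg\<close> from below.  Hence
  \<open>L(v, \<theta>)\<close> is multiplication by \<open>v + deg\<close> minus a bounded operator whose matrix is dominated by that
  of \<open>R\<close>, and \<open>exp(ct L(v, \<theta>))\<close> for \<open>c = \<plusminus>\<i>, -1\<close> is its Dyson series: a sum over finite vertex paths of
  the product of the matrix entries along the path and a time-ordered integral of exponentials,
  dominated absolutely by the path expansion of \<open>exp(tR)\<close>.

  If the process, sampled on finer and finer grids, has finitely many jumps, then the sequence of sampled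
  vertices without repetitions is eventually its jump skeleton, and the finite dimensional distributions
  converge to the same kind of time-ordered integrals.  The factor \<open>exp(\<integral>deg)\<close> of the action cancels the
  exponential holding times, so that the expectation over a fixed skeleton is precisely the corresponding
  term of the Dyson series of \<open>exp(-it L(v, \<theta>))\<close>.  Summing over skeletons gives both expectations, and
  reversing paths turns the inner one into the kernel of \<open>exp(it L(v', \<theta>'))\<close>.
\<close>


section \<open>The Hilbert space of a weight\<close>

text \<open>The law of the process is given only through finite dimensional distributions at
  positive times, so nothing is known beforehand about jump times or holding times. Whatever is
  needed, including the starting point and the absence of jumps from a vertex to infinity, is
  extracted from sampled paths by right continuity and limits of probabilities.

  Since v + deg may be unbounded above, exp(ctL) is no convergent power series in L. Only the
  off-diagonal part is expanded, while the diagonal stays inside the time-ordered exponentials. As L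
  is v + deg minus hopping, -iL contributes the factor i exp(i theta) b / m per jump: this is the
  origin of i^N.

  An operator exponential is a definite description of the semigroup with a given generator. Hence
  the exact domain of the generator of the Dyson series and the uniqueness of semigroups are both
  required; the domains agree because each is the maximal domain of multiplication by v +
  deg.\<close>

locale weight =
  fixes m :: "'a::countable \<Rightarrow> real"
  assumes m_pos: "0 < m x"
begin

abbreviation H where "H \<equiv> ell2 m"
abbreviation nrm where "nrm \<equiv> ell2_norm m"
abbreviation wabs where "wabs f \<equiv> \<lambda>x. cmod (f x) * sqrt (m x)"

lemma m_ge[simp]: "0 \<le> m x"
  using m_pos[of x] by simp

lemma wabs_sum: "(\<Sum>x\<in>F. (cmod (f x))\<^sup>2 * m x) = (L2_set (wabs f) F)\<^sup>2"
  unfolding L2_set_def by (subst real_sqrt_pow2) (auto simp: sum_nonneg power_mult_distrib)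

text \<open>Membership and norm bound follow together from Euclidean norms over finite sets.
  Minkowski, domination and completeness are all proved on finite sets and transferred through this
  rule.\<close>

lemma ell2_boundI:
  assumes "\<And>F. finite F \<Longrightarrow> L2_set (wabs f) F \<le> c"
  shows "f \<in> H" "nrm f \<le> c"
proof -
  have c: "0 \<le> c" using assms[of "{}"] by simp
  have le: "(\<Sum>x\<in>F. (cmod (f x))\<^sup>2 * m x) \<le> c\<^sup>2" if "finite F" for F
    unfolding wabs_sum using assms[OF that] by (intro power_mono) auto
  have s: "(\<lambda>x. (cmod (f x))\<^sup>2 * m x) summable_on UNIV"
    by (rule nonneg_bounded_partial_sums_imp_summable_on[where C = "c\<^sup>2"])
      (use le in \<open>auto intro!: eventually_finite_subsets_at_top_weakI\<close>)
  then show "f \<in> H" by (simp add: ell2_def)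
  have "(\<Sum>\<^sub>\<infinity>x. (cmod (f x))\<^sup>2 * m x) \<le> c\<^sup>2"
    using s le by (intro infsum_le_finite_sums) auto
  then show "nrm f \<le> c" unfolding ell2_norm_def
    using c by (metis real_sqrt_le_iff real_sqrt_abs abs_of_nonneg)
qed

lemma nrm_sq: "(nrm f)\<^sup>2 = (\<Sum>\<^sub>\<infinity>x. (cmod (f x))\<^sup>2 * m x)"
  unfolding ell2_norm_def by (intro real_sqrt_pow2 infsum_nonneg) auto

lemma L2_set_le_nrm:
  assumes "f \<in> H" "finite F"
  shows "L2_set (wabs f) F \<le> nrm f"
proof -
  have "(\<Sum>x\<in>F. (cmod (f x))\<^sup>2 * m x) \<le> (\<Sum>\<^sub>\<infinity>x. (cmod (f x))\<^sup>2 * m x)"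
    using assms unfolding ell2_def by (intro finite_sum_le_infsum) auto
  then show ?thesis unfolding wabs_sum nrm_sq[symmetric]
    by (rule power2_le_imp_le) (simp add: ell2_norm_def infsum_nonneg)
qed

lemma nrm_ge[simp]: "0 \<le> nrm f"
  by (simp add: ell2_norm_def infsum_nonneg)

lemma zero_H[simp]: "(\<lambda>_. 0) \<in> H" and nrm_zero[simp]: "nrm (\<lambda>_. 0) = 0"
  by (auto simp: ell2_def ell2_norm_def)

lemma
  assumes "f \<in> H" "g \<in> H"
  shows add_H: "(\<lambda>x. f x + g x) \<in> H" and nrm_triangle: "nrm (\<lambda>x. f x + g x) \<le> nrm f + nrm g"
proof -
  have *: "L2_set (wabs (\<lambda>x. f x + g x)) F \<le> nrm f + nrm g" if F: "finite F" for F
  proof -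
    have "L2_set (wabs (\<lambda>x. f x + g x)) F \<le> L2_set (\<lambda>x. wabs f x + wabs g x) F"
      by (intro L2_set_mono) (auto simp: norm_triangle_ineq mult_right_mono simp flip: distrib_right)
    also have "\<dots> \<le> L2_set (wabs f) F + L2_set (wabs g) F"
      by (rule L2_set_triangle_ineq)
    also have "\<dots> \<le> nrm f + nrm g"
      using L2_set_le_nrm[OF assms(1) F] L2_set_le_nrm[OF assms(2) F] by simp
    finally show ?thesis .
  qed
  show "(\<lambda>x. f x + g x) \<in> H" "nrm (\<lambda>x. f x + g x) \<le> nrm f + nrm g"
    by (rule ell2_boundI[OF *]; assumption)+
qed

lemma dominated_H:
  assumes "g \<in> H" "\<And>x. cmod (f x) \<le> c * cmod (g x)" "0 \<le> c"
  shows "f \<in> H" "nrm f \<le> c * nrm g"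
proof -
  have *: "L2_set (wabs f) F \<le> c * nrm g" if F: "finite F" for F
  proof -
    have "L2_set (wabs f) F \<le> L2_set (\<lambda>x. c * wabs g x) F"
      by (intro L2_set_mono) (auto intro!: mult_right_mono assms(2) simp flip: mult.assoc)
    also have "\<dots> = c * L2_set (wabs g) F"
      using L2_set_right_distrib[OF assms(3), of "wabs g" F] by (simp add: mult.assoc)
    also have "\<dots> \<le> c * nrm g"
      using L2_set_le_nrm[OF assms(1) F] assms(3) by (intro mult_left_mono)
    finally show ?thesis .
  qed
  show "f \<in> H" "nrm f \<le> c * nrm g"
    by (rule ell2_boundI[OF *]; assumption)+
qed

lemma scale_H: "f \<in> H \<Longrightarrow> (\<lambda>x. c * f x) \<in> H"
  by (rule dominated_H(1)[of f _ "cmod c"]) (auto simp: norm_mult)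

lemma nrm_scale: "nrm (\<lambda>x. c * f x) = cmod c * nrm f"
  using infsum_cmult_right'[of "(cmod c)\<^sup>2" "\<lambda>x. (cmod (f x))\<^sup>2 * m x" UNIV]
  by (simp add: ell2_norm_def norm_mult power_mult_distrib mult.assoc real_sqrt_mult)

lemma nrm_minus_commute: "nrm (\<lambda>x. f x - g x) = nrm (\<lambda>x. g x - f x)"
  by (simp add: ell2_norm_def norm_minus_commute)

lemma uminus_H: "f \<in> H \<Longrightarrow> (\<lambda>x. - f x) \<in> H"
  using scale_H[of f "-1"] by simp

lemma diff_H: "f \<in> H \<Longrightarrow> g \<in> H \<Longrightarrow> (\<lambda>x. f x - g x) \<in> H"
  using add_H[of f "\<lambda>x. - g x"] uminus_H[of g] by simp

lemma nrm_uminus: "nrm (\<lambda>x. - f x) = nrm f"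
  using nrm_scale[of "-1" f] by simp

lemma nrm_diff: "f \<in> H \<Longrightarrow> g \<in> H \<Longrightarrow> nrm (\<lambda>x. f x - g x) \<le> nrm f + nrm g"
  using nrm_triangle[of f "\<lambda>x. - g x"] uminus_H[of g] by (simp add: nrm_uminus)

lemma nrm_triangle3:
  assumes "f \<in> H" "g \<in> H" "h \<in> H"
  shows "nrm (\<lambda>x. f x - h x) \<le> nrm (\<lambda>x. f x - g x) + nrm (\<lambda>x. g x - h x)"
  using nrm_triangle[OF diff_H[OF assms(1,2)] diff_H[OF assms(2,3)]] by simp

lemma nrm_diff_ge: "f \<in> H \<Longrightarrow> g \<in> H \<Longrightarrow> nrm f - nrm g \<le> nrm (\<lambda>x. f x - g x)"
  using nrm_triangle[OF diff_H[of f g], of g] by simp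

lemma point_le_nrm: "f \<in> H \<Longrightarrow> cmod (f x) \<le> nrm f / sqrt (m x)"
  using L2_set_le_nrm[of f "{x}"] m_pos[of x] by (simp add: pos_le_divide_eq)

lemma nrm_eq_0: "f \<in> H \<Longrightarrow> nrm f = 0 \<Longrightarrow> f = (\<lambda>_. 0)"
  using point_le_nrm[of f] by auto

lemma Cc_H: "f \<in> Cc \<Longrightarrow> f \<in> H"
proof (rule ell2_boundI(1))
  fix F :: "'a set" assume f: "f \<in> Cc" and F: "finite F"
  have "L2_set (wabs f) F \<le> (\<Sum>x\<in>F. wabs f x)"
    by (rule L2_set_le_sum) auto
  also have "\<dots> \<le> (\<Sum>x\<in>F \<union> {x. f x \<noteq> 0}. wabs f x)"
    using f F by (intro sum_mono2) (auto simp: Cc_def)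
  also have "\<dots> = (\<Sum>x | f x \<noteq> 0. wabs f x)"
    using f F by (intro sum.mono_neutral_right) (auto simp: Cc_def)
  finally show "L2_set (wabs f) F \<le> (\<Sum>x | f x \<noteq> 0. wabs f x)" .
qed

lemma nrm_imp_pointwise:
  assumes "((\<lambda>s. nrm (\<lambda>x. f s x - g x)) \<longlongrightarrow> 0) \<F>" "\<forall>\<^sub>F s in \<F>. f s \<in> H" "g \<in> H"
  shows "((\<lambda>s. f s x) \<longlongrightarrow> g x) \<F>"
proof (rule LIM_zero_cancel, rule Lim_null_comparison)
  show "\<forall>\<^sub>F s in \<F>. norm (f s x - g x) \<le> nrm (\<lambda>x. f s x - g x) / sqrt (m x)"
    using assms(2) by eventually_elim (use assms(3) in \<open>auto intro!: point_le_nrm diff_H\<close>)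
  show "((\<lambda>s. nrm (\<lambda>x. f s x - g x) / sqrt (m x)) \<longlongrightarrow> 0) \<F>"
    using tendsto_divide_zero[OF assms(1)] by simp
qed

text \<open>Fatou argument: in the Cauchy bound over a finite set one index tends to infinity
  pointwise, and the finite set is arbitrary. The pointwise limit is prescribed, so that it can be
  one already known from convergence in another norm (\<open>form_convergesD\<close>).\<close>

lemma complete_H:
  assumes "\<And>n. F n \<in> H" "\<And>x. (\<lambda>n. F n x) \<longlonglongrightarrow> f x"
    and C: "\<And>e. e > 0 \<Longrightarrow> \<exists>N. \<forall>n\<ge>N. \<forall>k\<ge>N. nrm (\<lambda>x. F n x - F k x) < e"
  shows "f \<in> H" "(\<lambda>n. nrm (\<lambda>x. F n x - f x)) \<longlonglongrightarrow> 0"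
proof -
  have *: "L2_set (wabs (\<lambda>x. F n x - f x)) A \<le> e"
    if "\<forall>n\<ge>N. \<forall>k\<ge>N. nrm (\<lambda>x. F n x - F k x) < e" "n \<ge> N" "finite A" for N n e A
  proof (rule tendsto_upperbound)
    show "(\<lambda>k. L2_set (wabs (\<lambda>x. F n x - F k x)) A) \<longlonglongrightarrow> L2_set (wabs (\<lambda>x. F n x - f x)) A"
      unfolding L2_set_def by (intro tendsto_intros assms)
    show "\<forall>\<^sub>F k in sequentially. L2_set (wabs (\<lambda>x. F n x - F k x)) A \<le> e"
      using eventually_ge_at_top[of N]
    proof eventually_elim
      case (elim k)
      then show ?case
        using that L2_set_le_nrm[OF diff_H[OF assms(1,1)], of A n k] by force
    qed
  qed simp
  have d: "(\<lambda>x. F n x - f x) \<in> H \<and> nrm (\<lambda>x. F n x - f x) \<le> e"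
    if "\<forall>n\<ge>N. \<forall>k\<ge>N. nrm (\<lambda>x. F n x - F k x) < e" "n \<ge> N" for N n e
    using ell2_boundI[OF *[OF that]] by auto
  obtain N where N: "\<forall>n\<ge>N. \<forall>k\<ge>N. nrm (\<lambda>x. F n x - F k x) < 1" using C[of 1] by auto
  have "(\<lambda>x. F N x - (F N x - f x)) \<in> H"
    using d[OF N, of N] diff_H[OF assms(1)[of N], of "\<lambda>x. F N x - f x"] by simp
  moreover have "(\<lambda>x. F N x - (F N x - f x)) = f" by auto
  ultimately show f: "f \<in> H" by metis
  show "(\<lambda>n. nrm (\<lambda>x. F n x - f x)) \<longlonglongrightarrow> 0"
  proof (rule LIMSEQ_I)
    fix r :: real assume "0 < r"
    then obtain N where N: "\<forall>n\<ge>N. \<forall>k\<ge>N. nrm (\<lambda>x. F n x - F k x) < r / 2" using C[of "r/2"] by auto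
    have "norm (nrm (\<lambda>x. F n x - f x) - 0) < r" if "n \<ge> N" for n
      using d[OF N that] \<open>0 < r\<close> by simp
    then show "\<exists>N. \<forall>n\<ge>N. norm (nrm (\<lambda>x. F n x - f x) - 0) < r" by blast
  qed
qed

lemma complete_H_ex:
  assumes "\<And>n. F n \<in> H"
    and C: "\<And>e. e > 0 \<Longrightarrow> \<exists>N. \<forall>n\<ge>N. \<forall>k\<ge>N. nrm (\<lambda>x. F n x - F k x) < e"
  shows "\<exists>f\<in>H. (\<lambda>n. nrm (\<lambda>x. F n x - f x)) \<longlonglongrightarrow> 0"
proof -
  have "Cauchy (\<lambda>n. F n x)" for x
  proof (rule metric_CauchyI)
    fix e :: real assume e: "0 < e"
    then obtain N where N: "\<forall>n\<ge>N. \<forall>k\<ge>N. nrm (\<lambda>x. F n x - F k x) < e * sqrt (m x)"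
      using C[of "e * sqrt (m x)"] m_pos by auto
    have "dist (F n x) (F k x) < e" if "n \<ge> N" "k \<ge> N" for n k
    proof -
      have "dist (F n x) (F k x) \<le> nrm (\<lambda>x. F n x - F k x) / sqrt (m x)"
        unfolding dist_norm using point_le_nrm[OF diff_H[OF assms(1,1)]] .
      also have "\<dots> < e" using N that m_pos[of x] by (auto simp: field_simps)
      finally show ?thesis .
    qed
    then show "\<exists>M. \<forall>n\<ge>M. \<forall>k\<ge>M. dist (F n x) (F k x) < e" by blast
  qed
  then obtain f where f: "\<And>x. (\<lambda>n. F n x) \<longlonglongrightarrow> f x"
    unfolding Cauchy_convergent_iff convergent_def by metis
  show ?thesis
    by (intro bexI[of _ f] complete_H[OF assms(1) f C])
qed

text \<open>The filter is arbitrary because the lemma serves sequences, times tending to 0 and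
  growing finite sets alike. A finite set \<open>A\<close> carries the dominating mass up to e^2/4;
  on \<open>A\<close> the convergence is finite-dimensional, outside it domination suffices.\<close>

lemma dominated_convergence_H:
  assumes g: "g \<in> H" and le: "\<forall>\<^sub>F s in \<F>. \<forall>x. cmod (f s x) \<le> c * cmod (g x)"
    and lim: "\<And>x. ((\<lambda>s. f s x) \<longlongrightarrow> 0) \<F>"
  shows "((\<lambda>s. nrm (f s)) \<longlongrightarrow> 0) \<F>"
proof (rule tendstoI)
  fix e :: real assume e: "0 < e"
  let ?g = "\<lambda>x. (c * cmod (g x))\<^sup>2 * m x"
  have sg: "?g summable_on UNIV"
    using g summable_on_cmult_right[of "\<lambda>x. (cmod (g x))\<^sup>2 * m x" UNIV "c\<^sup>2"]
    by (simp add: ell2_def power_mult_distrib mult_ac)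
  then have "(sum ?g \<longlongrightarrow> infsum ?g UNIV) (finite_subsets_at_top UNIV)"
    using has_sum_def has_sum_infsum by blast
  then have "\<forall>\<^sub>F F in finite_subsets_at_top UNIV. dist (sum ?g F) (infsum ?g UNIV) < e\<^sup>2 / 4"
    using e by (intro tendstoD) auto
  then obtain A where A: "finite A" "dist (sum ?g A) (infsum ?g UNIV) < e\<^sup>2 / 4"
    by (auto simp: eventually_finite_subsets_at_top)
  have "((\<lambda>s. L2_set (wabs (f s)) A) \<longlongrightarrow> L2_set (\<lambda>x. cmod 0 * sqrt (m x)) A) \<F>"
    unfolding L2_set_def by (intro tendsto_intros lim)
  then have "((\<lambda>s. L2_set (wabs (f s)) A) \<longlongrightarrow> 0) \<F>" by (simp add: L2_set_0')
  then have "\<forall>\<^sub>F s in \<F>. dist (L2_set (wabs (f s)) A) 0 < e / 2"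
    using e by (intro tendstoD) auto
  with le show "\<forall>\<^sub>F s in \<F>. dist (nrm (f s)) 0 < e"
  proof eventually_elim
    case (elim s)
    have "L2_set (wabs (f s)) F \<le> sqrt (e\<^sup>2 / 2)" if F: "finite F" for F
    proof -
      have "(L2_set (wabs (f s)) F)\<^sup>2 \<le> (L2_set (wabs (f s)) (A \<union> F))\<^sup>2"
        unfolding wabs_sum[symmetric] using F A by (intro sum_mono2) auto
      also have "\<dots> = (L2_set (wabs (f s)) A)\<^sup>2 + (\<Sum>x\<in>F - A. (cmod (f s x))\<^sup>2 * m x)"
        unfolding wabs_sum[symmetric] using F A
        by (subst sum.union_disjoint[symmetric]) (auto intro!: sum.cong)
      also have "(\<Sum>x\<in>F - A. (cmod (f s x))\<^sup>2 * m x) \<le> (\<Sum>x\<in>F - A. ?g x)"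
        using elim(1) by (intro sum_mono mult_right_mono power_mono) auto
      also have "(\<Sum>x\<in>F - A. ?g x) = sum ?g (F \<union> A) - sum ?g A"
        using F A by (subst eq_diff_eq, subst sum.union_disjoint[symmetric]) (auto intro!: sum.cong)
      also have "\<dots> \<le> infsum ?g UNIV - sum ?g A"
        using F A sg by (intro diff_right_mono finite_sum_le_infsum) auto
      also have "\<dots> \<le> e\<^sup>2 / 4"
        using A(2) unfolding dist_real_def by linarith
      also have "(L2_set (wabs (f s)) A)\<^sup>2 \<le> (e / 2)\<^sup>2"
        using elim(2) by (intro power_mono) (auto simp: dist_real_def)
      finally have "(L2_set (wabs (f s)) F)\<^sup>2 \<le> e\<^sup>2 / 2"
        by (simp add: power_divide)
      then show ?thesis by (simp add: real_le_rsqrt)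
    qed
    then have "nrm (f s) \<le> sqrt (e\<^sup>2 / 2)" by (rule ell2_boundI)
    also have "\<dots> < e" using e by (simp add: real_sqrt_divide field_simps)
    finally show ?case by (simp add: dist_real_def)
  qed
qed

definition trunc :: "nat \<Rightarrow> ('a \<Rightarrow> complex) \<Rightarrow> 'a \<Rightarrow> complex" where
  "trunc n f = (\<lambda>x. if to_nat x < n then f x else 0)"

lemma trunc_Cc: "trunc n f \<in> Cc"
proof -
  have "{x. trunc n f x \<noteq> 0} \<subseteq> to_nat -` {..<n}" by (auto simp: trunc_def)
  moreover have "finite ((to_nat :: 'a \<Rightarrow> nat) -` {..<n})"
    by (intro finite_vimageI) auto
  ultimately show ?thesis unfolding Cc_def by (auto intro: finite_subset)
qed

lemma trunc_lim:
  assumes "f \<in> H" shows "(\<lambda>n. nrm (\<lambda>x. trunc n f x - f x)) \<longlonglongrightarrow> 0"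
proof (rule dominated_convergence_H[OF assms, where c = 1])
  show "\<forall>\<^sub>F s in sequentially. \<forall>x. cmod (trunc s f x - f x) \<le> 1 * cmod (f x)"
    by (auto simp: trunc_def)
  fix x
  have "\<forall>\<^sub>F n in sequentially. trunc n f x - f x = 0"
    using eventually_gt_at_top[of "to_nat x"] by eventually_elim (auto simp: trunc_def)
  then show "(\<lambda>n. trunc n f x - f x) \<longlonglongrightarrow> 0" by (rule tendsto_eventually)
qed

end


section \<open>Uniform boundedness and uniqueness of semigroups\<close>

context weight
begin

lemma bop_H: "bounded_operator m T \<Longrightarrow> f \<in> H \<Longrightarrow> T f \<in> H"
  by (simp add: bounded_operator_def)

lemma bop_lin:
  "bounded_operator m T \<Longrightarrow> f \<in> H \<Longrightarrow> g \<in> H \<Longrightarrow> T (\<lambda>x. c * f x + g x) = (\<lambda>x. c * T f x + T g x)"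
  by (simp add: bounded_operator_def)

lemma bop_add:
  "bounded_operator m T \<Longrightarrow> f \<in> H \<Longrightarrow> g \<in> H \<Longrightarrow> T (\<lambda>x. f x + g x) = (\<lambda>x. T f x + T g x)"
  using bop_lin[of T f g 1] by simp

lemma bop_zero: "bounded_operator m T \<Longrightarrow> T (\<lambda>_. 0) = (\<lambda>_. 0)"
  using bop_lin[of T "\<lambda>_. 0" "\<lambda>_. 0" "-1"] by simp

lemma bop_scale:
  "bounded_operator m T \<Longrightarrow> f \<in> H \<Longrightarrow> T (\<lambda>x. c * f x) = (\<lambda>x. c * T f x)"
  using bop_lin[of T f "\<lambda>_. 0" c] bop_zero[of T] by simp

lemma bop_diff:
  "bounded_operator m T \<Longrightarrow> f \<in> H \<Longrightarrow> g \<in> H \<Longrightarrow> T (\<lambda>x. f x - g x) = (\<lambda>x. T f x - T g x)"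
  using bop_lin[of T g f "-1"] by simp

lemma bop_bound:
  assumes "bounded_operator m T"
  obtains C where "0 < C" "\<And>f. f \<in> H \<Longrightarrow> nrm (T f) \<le> C * nrm f"
proof -
  from assms obtain C where C: "\<forall>f\<in>H. nrm (T f) \<le> C * nrm f"
    unfolding bounded_operator_def by blast
  have "nrm (T f) \<le> (\<bar>C\<bar> + 1) * nrm f" if "f \<in> H" for f
    using C that by (smt (verit) mult_right_mono nrm_ge)
  then show ?thesis using that[of "\<bar>C\<bar> + 1"] by auto
qed

text \<open>Gliding hump: the next vector of the sequence is added with the sign chosen by this lemma.\<close>

lemma two_point_bound:
  assumes "bounded_operator m T" "f \<in> H" "g \<in> H"
  shows "nrm (T g) \<le> nrm (T (\<lambda>x. f x + g x)) \<or> nrm (T g) \<le> nrm (T (\<lambda>x. f x - g x))"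
proof -
  have "nrm (\<lambda>x. 2 * T g x) = nrm (\<lambda>x. T (\<lambda>x. f x + g x) x - T (\<lambda>x. f x - g x) x)"
    using assms by (simp add: bop_add bop_diff)
  also have "\<dots> \<le> nrm (T (\<lambda>x. f x + g x)) + nrm (T (\<lambda>x. f x - g x))"
    using assms by (intro nrm_diff bop_H[OF assms(1)] add_H diff_H)
  finally show ?thesis unfolding nrm_scale by simp linarith
qed

text \<open>Nested balls: each is chosen inside the previous one so that some operator of the family
  has norm at least k at all its points. The common point of the balls contradicts pointwise
  boundedness.\<close>

lemma uniform_boundedness:
  fixes T :: "nat \<Rightarrow> ('a \<Rightarrow> complex) \<Rightarrow> 'a \<Rightarrow> complex"
  assumes T: "\<And>n. bounded_operator m (T n)"
    and bdd: "\<And>f. f \<in> H \<Longrightarrow> \<exists>c. \<forall>n. nrm (T n f) \<le> c"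
  shows "\<exists>c. \<forall>n. \<forall>f\<in>H. nrm (T n f) \<le> c * nrm f"
proof (rule ccontr)
  assume unb: "\<nexists>c. \<forall>n. \<forall>f\<in>H. nrm (T n f) \<le> c * nrm f"
  \<comment> \<open>A pair is a centre and a radius. In \<open>Q\<close> the sum condition nests the
    next ball in the present one, the halving makes the centres Cauchy, and the last clause makes
    the k-th lower bound survive in the limit.\<close>
  define P where "P = (\<lambda>(k::nat) (p :: ('a \<Rightarrow> complex) \<times> real). fst p \<in> H \<and> 0 < snd p)"
  define Q where "Q = (\<lambda>(k::nat) (p :: ('a \<Rightarrow> complex) \<times> real) q.
    nrm (\<lambda>x. fst q x - fst p x) + snd q \<le> snd p \<and> snd q \<le> snd p / 2 \<and>
    (\<exists>n. \<forall>y\<in>H. nrm (\<lambda>x. y x - fst q x) \<le> snd q \<longrightarrow> real k \<le> nrm (T n y)))"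
  have "\<exists>f. \<forall>n. P n (f n) \<and> Q n (f n) (f (Suc n))"
  proof (rule dependent_nat_choice)
    show "\<exists>x. P 0 x" by (auto simp: P_def intro!: exI[of _ "\<lambda>_. 0"] exI[of _ 1])
  next
    fix p k assume "P k p"
    then obtain a r where p: "p = (a, r)" "a \<in> H" "0 < r" by (cases p) (auto simp: P_def)
    \<comment> \<open>Rescaled to norm r/2, \<open>f\<close> has image norm above k + 1. The spare 1
      is spent on the ball of radius at most 1/C around the new centre.\<close>
    let ?c = "2 * (real k + 1) / r"
    obtain n f where f: "f \<in> H" "nrm (T n f) > ?c * nrm f"
      using unb by (meson not_le)
    have "nrm f \<noteq> 0"
    proof
      assume "nrm f = 0"
      then have "f = (\<lambda>_. 0)" using f nrm_eq_0 by auto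
      then show False using f bop_zero[OF T, of n] by simp
    qed
    then have fp: "0 < nrm f" using nrm_ge[of f] by linarith
    define g where "g = (\<lambda>x. of_real (r / (2 * nrm f)) * f x)"
    have g: "g \<in> H" using f unfolding g_def by (intro scale_H)
    have ng: "nrm g = r / 2" using fp p unfolding g_def nrm_scale by (simp add: norm_divide norm_mult)
    have "nrm (T n g) = r / (2 * nrm f) * nrm (T n f)"
      unfolding g_def bop_scale[OF T f(1)] nrm_scale using fp p by (simp add: norm_divide norm_mult)
    also have "\<dots> > r / (2 * nrm f) * (?c * nrm f)"
      using f fp p by (intro mult_strict_left_mono) auto
    also have "r / (2 * nrm f) * (?c * nrm f) = real k + 1" using fp p by (simp add: field_simps)
    finally have Tg: "nrm (T n g) > real k + 1" .
    obtain b where b: "b \<in> H" "nrm (\<lambda>x. b x - a x) = r / 2" "nrm (T n b) \<ge> real k + 1"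
    proof (cases "nrm (T n g) \<le> nrm (T n (\<lambda>x. a x + g x))")
      case True
      then show ?thesis using that[of "\<lambda>x. a x + g x"] g p ng Tg by (simp add: add_H)
    next
      case False
      then have "nrm (T n g) \<le> nrm (T n (\<lambda>x. a x - g x))"
        using two_point_bound[OF T p(2) g, of n] by auto
      then show ?thesis using that[of "\<lambda>x. a x - g x"] g p ng Tg
        by (simp add: diff_H nrm_uminus)
    qed
    obtain C where C: "0 < C" "\<And>f. f \<in> H \<Longrightarrow> nrm (T n f) \<le> C * nrm f"
      using bop_bound[OF T] by blast
    define s where "s = min (r / 2) (1 / C)"
    have "real k \<le> nrm (T n y)" if y: "y \<in> H" "nrm (\<lambda>x. y x - b x) \<le> s" for y
    proof -
      have "nrm (T n b) - nrm (T n y) \<le> nrm (\<lambda>x. T n b x - T n y x)"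
        using b y by (intro nrm_diff_ge bop_H[OF T])
      also have "\<dots> = nrm (T n (\<lambda>x. b x - y x))" using bop_diff[OF T b(1) y(1)] by simp
      also have "\<dots> \<le> C * nrm (\<lambda>x. b x - y x)" by (intro C diff_H b y)
      also have "\<dots> \<le> C * s" using y C by (subst nrm_minus_commute) auto
      also have "\<dots> \<le> C * (1 / C)" using C by (intro mult_left_mono) (auto simp: s_def)
      finally show ?thesis using b C by simp
    qed
    then show "\<exists>q. P (Suc k) q \<and> Q k p q"
      using b C p by (intro exI[of _ "(b, s)"]) (auto simp: P_def Q_def s_def)
  qed
  then obtain F where F: "\<And>n. P n (F n)" "\<And>n. Q n (F n) (F (Suc n))" by blast
  define X where "X n = fst (F n)" for n
  define r where "r n = snd (F n)" for n
  have X: "X n \<in> H" and rp: "0 < r n" for n using F(1)[of n] by (auto simp: P_def X_def r_def)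
  have step: "nrm (\<lambda>x. X (Suc n) x - X n x) + r (Suc n) \<le> r n" and half: "r (Suc n) \<le> r n / 2" for n
    using F(2)[of n] by (auto simp: Q_def X_def r_def)
  have big: "\<exists>i. \<forall>y\<in>H. nrm (\<lambda>x. y x - X (Suc n) x) \<le> r (Suc n) \<longrightarrow> real n \<le> nrm (T i y)" for n
    using F(2)[of n] by (auto simp: Q_def X_def r_def)
  have nest: "nrm (\<lambda>x. X (n + k) x - X n x) + r (n + k) \<le> r n" for n k
  proof (induction k)
    case (Suc k)
    show ?case using nrm_triangle3[OF X[of "n + Suc k"] X[of "n + k"] X[of n]] step[of "n + k"] Suc by simp
  qed simp
  have near: "nrm (\<lambda>x. X k x - X n x) \<le> r n" if "n \<le> k" for n k
    using nest[of n "k - n"] rp[of k] that by simp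
  have rn: "r n \<le> r 0 / 2 ^ n" for n
  proof (induction n)
    case (Suc n)
    have "r (Suc n) \<le> r n / 2" by (rule half)
    also have "\<dots> \<le> (r 0 / 2 ^ n) / 2" using Suc by (intro divide_right_mono) auto
    finally show ?case by (simp add: mult.commute)
  qed simp
  have r0: "r \<longlonglongrightarrow> 0"
  proof (rule Lim_null_comparison)
    show "\<forall>\<^sub>F n in sequentially. norm (r n) \<le> r 0 * (1 / 2) ^ n"
      using rn rp by (intro always_eventually allI) (simp add: power_one_over field_simps less_imp_le)
    show "(\<lambda>n. r 0 * (1 / 2) ^ n) \<longlonglongrightarrow> 0"
      by (intro tendsto_mult_right_zero LIMSEQ_realpow_zero) auto
  qed
  have "\<exists>f\<in>H. (\<lambda>n. nrm (\<lambda>x. X n x - f x)) \<longlonglongrightarrow> 0"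
  proof (rule complete_H_ex[OF X])
    fix e :: real assume "0 < e"
    then have "\<forall>\<^sub>F n in sequentially. r n < e / 2" using order_tendstoD(2)[OF r0, of "e / 2"] by simp
    then obtain N where N: "r N < e / 2" by (auto simp: eventually_sequentially)
    have "nrm (\<lambda>x. X n x - X k x) < e" if "n \<ge> N" "k \<ge> N" for n k
      using nrm_triangle3[OF X[of n] X[of N] X[of k]] near[OF that(1)] near[OF that(2)] N
        nrm_minus_commute[of "X N" "X k"] by linarith
    then show "\<exists>N. \<forall>n\<ge>N. \<forall>k\<ge>N. nrm (\<lambda>x. X n x - X k x) < e" by blast
  qed
  then obtain y where y: "y \<in> H" "(\<lambda>n. nrm (\<lambda>x. X n x - y x)) \<longlonglongrightarrow> 0" by blast
  have ball: "nrm (\<lambda>x. y x - X n x) \<le> r n" for n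
  proof (rule field_le_epsilon)
    fix e :: real assume "0 < e"
    then have "\<forall>\<^sub>F k in sequentially. nrm (\<lambda>x. X k x - y x) < e" using order_tendstoD(2)[OF y(2)] by simp
    then obtain N where N: "\<And>k. k \<ge> N \<Longrightarrow> nrm (\<lambda>x. X k x - y x) < e"
      unfolding eventually_sequentially by blast
    define k where "k = max n N"
    have k: "k \<ge> n" "nrm (\<lambda>x. X k x - y x) < e" by (auto simp: k_def N)
    then show "nrm (\<lambda>x. y x - X n x) \<le> r n + e"
      using nrm_triangle3[OF y(1) X[of k] X[of n]] near[OF k(1)] nrm_minus_commute[of y "X k"] by linarith
  qed
  obtain c where c: "\<And>n. nrm (T n y) \<le> c" using bdd[OF y(1)] by blast
  obtain n where "c < real n" using reals_Archimedean2 by blast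
  moreover obtain i where "real n \<le> nrm (T i y)" using big[of n] ball y by blast
  ultimately show False using c[of i] by simp
qed

end

section \<open>Strongly continuous semigroups: local bounds, continuity and derivatives of
  orbits\<close>

locale semigroup = weight +
  fixes V :: "real \<Rightarrow> ('a \<Rightarrow> complex) \<Rightarrow> 'a \<Rightarrow> complex"
  assumes C0: "C0_semigroup m V"
begin

lemma bop: "0 \<le> t \<Longrightarrow> bounded_operator m (V t)"
  and V_0: "f \<in> H \<Longrightarrow> V 0 f = f"
  and V_add: "0 \<le> s \<Longrightarrow> 0 \<le> t \<Longrightarrow> f \<in> H \<Longrightarrow> V (s + t) f = V s (V t f)"
  and V_cont0: "f \<in> H \<Longrightarrow> ((\<lambda>t. nrm (\<lambda>x. V t f x - f x)) \<longlongrightarrow> 0) (at_right 0)"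
  using C0 unfolding C0_semigroup_def by blast+

lemma V_H: "0 \<le> t \<Longrightarrow> f \<in> H \<Longrightarrow> V t f \<in> H"
  using bop bop_H by blast

text \<open>If no bound held near 0, there would be times t_n at most 1/(n + 1) with operator norm
  above n. Strong continuity at 0 makes these operators pointwise bounded, against uniform
  boundedness.\<close>

lemma local_bound: "\<exists>d>0. \<exists>M. \<forall>t\<in>{0..d}. \<forall>f\<in>H. nrm (V t f) \<le> M * nrm f"
proof (rule ccontr)
  assume "\<not> ?thesis"
  then have "\<exists>t\<in>{0..1 / real (Suc n)}. \<exists>f\<in>H. \<not> nrm (V t f) \<le> real n * nrm f" for n
    by (meson of_nat_0_less_iff zero_less_Suc zero_less_divide_1_iff)
  then obtain t where t: "\<And>n. t n \<in> {0..1 / real (Suc n)}"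
    and bad: "\<And>n. \<exists>f\<in>H. \<not> nrm (V (t n) f) \<le> real n * nrm f"
    by metis
  have t0: "t \<longlonglongrightarrow> 0"
    by (rule tendsto_sandwich[OF _ _ tendsto_const LIMSEQ_inverse_real_of_nat])
      (use t in \<open>auto simp: inverse_eq_divide\<close>)
  have "\<exists>c. \<forall>n. nrm (V (t n) f) \<le> c" if f: "f \<in> H" for f
  proof -
    have "\<forall>\<^sub>F s in at_right 0. nrm (\<lambda>x. V s f x - f x) < 1"
      using order_tendstoD(2)[OF V_cont0[OF f], of 1] by simp
    then obtain d where d: "0 < d" "\<And>s. 0 < s \<Longrightarrow> s < d \<Longrightarrow> nrm (\<lambda>x. V s f x - f x) < 1"
      unfolding eventually_at_right_field by auto
    have bd: "nrm (V s f) \<le> nrm f + 1" if "0 \<le> s" "s < d" for s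
    proof (cases "s = 0")
      case False
      then show ?thesis using d(2)[of s] that nrm_diff_ge[OF V_H[OF that(1) f] f] by auto
    qed (use V_0 f in auto)
    obtain N where N: "\<And>n. n \<ge> N \<Longrightarrow> t n < d"
      using order_tendstoD(2)[OF t0 d(1)] by (auto simp: eventually_sequentially)
    let ?c = "nrm f + 1 + (\<Sum>n<N. nrm (V (t n) f))"
    have "nrm (V (t n) f) \<le> ?c" for n
    proof (cases "n < N")
      case True
      then have "nrm (V (t n) f) \<le> (\<Sum>n<N. nrm (V (t n) f))" by (intro member_le_sum) auto
      then show ?thesis using nrm_ge[of f] by linarith
    next
      case False
      have "0 \<le> (\<Sum>n<N. nrm (V (t n) f))" by (intro sum_nonneg) auto
      moreover have "nrm (V (t n) f) \<le> nrm f + 1" using False N[of n] t[of n] by (intro bd) auto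
      ultimately show ?thesis by linarith
    qed
    then show ?thesis by blast
  qed
  then have "\<exists>c. \<forall>n. \<forall>f\<in>H. nrm (V (t n) f) \<le> c * nrm f"
    using bop t by (intro uniform_boundedness) auto
  then obtain c where c: "\<And>n f. f \<in> H \<Longrightarrow> nrm (V (t n) f) \<le> c * nrm f" by blast
  obtain n where "c < real n" using reals_Archimedean2 by blast
  then have "c * nrm f \<le> real n * nrm f" for f by (intro mult_right_mono) auto
  then show False using c bad[of n] order_trans by blast
qed

text \<open>The interval is exhausted in steps of length d, each costing a factor \<open>M1\<close>.
  Since \<open>M1\<close> is at least 1 its powers increase, so one power serves all times up to
  b.\<close>

lemma bound_upto: "\<exists>M>0. \<forall>t\<in>{0..b}. \<forall>f\<in>H. nrm (V t f) \<le> M * nrm f"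
proof -
  obtain d M where d: "0 < d" and M': "\<And>t f. t \<in> {0..d} \<Longrightarrow> f \<in> H \<Longrightarrow> nrm (V t f) \<le> M * nrm f"
    using local_bound by blast
  define M1 where "M1 = max M 1"
  have M: "nrm (V t f) \<le> M1 * nrm f" if "t \<in> {0..d}" "f \<in> H" for t f
    using M'[OF that] mult_right_mono[of M M1 "nrm f"] by (auto simp: M1_def)
  have M1: "M1 \<ge> 1" by (simp add: M1_def)
  have *: "nrm (V t f) \<le> M1 ^ Suc k * nrm f" if "0 \<le> t" "t \<le> d * real (Suc k)" "f \<in> H" for t k f
    using that
  proof (induction k arbitrary: t f)
    case 0
    then show ?case using M[of t f] by auto
  next
    case (Suc k)
    show ?case
    proof (cases "t \<le> d")
      case True
      then have "nrm (V t f) \<le> M1 * nrm f" using M[of t f] Suc by auto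
      also have "\<dots> \<le> M1 ^ Suc (Suc k) * nrm f"
        using M1 by (intro mult_right_mono) (auto simp: self_le_power simp del: power_Suc)
      finally show ?thesis .
    next
      case False
      have "V t f = V d (V (t - d) f)" using V_add[of d "t - d" f] False d Suc by auto
      then have "nrm (V t f) \<le> M1 * nrm (V (t - d) f)"
        using M[of d "V (t - d) f"] d False V_H[of "t - d" f] Suc by auto
      also have "\<dots> \<le> M1 * (M1 ^ Suc k * nrm f)"
        using Suc.prems False M1 by (intro mult_left_mono Suc.IH) (auto simp: algebra_simps)
      finally show ?thesis by (simp add: mult_ac)
    qed
  qed
  obtain k where k: "b / d < real k" using reals_Archimedean2 by blast
  have "t \<le> d * real (Suc k)" if "t \<le> b" for t
    using k d that by (simp add: field_simps)
  then show ?thesis using * M1 by (intro exI[of _ "M1 ^ Suc k"]) (auto simp del: power_Suc)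
qed

lemma V_diff:
  assumes "0 \<le> s" "0 \<le> r" "f \<in> H" "s \<le> r"
  shows "(\<lambda>x. V r f x - V s f x) = V s (\<lambda>x. V (r - s) f x - f x)"
  using V_add[of s "r - s" f] assms by (simp add: bop_diff[OF bop] V_H)

text \<open>By \<open>V_diff\<close> the earlier of two times can be factored out, so continuity and
  derivatives at s0 from both sides reduce to the right limit at 0, taken at |s - s0|.\<close>

lemma tendsto_abs_diff:
  assumes "((\<phi> :: real \<Rightarrow> real) \<longlongrightarrow> l) (at_right 0)"
  shows "((\<lambda>s. \<phi> \<bar>s - s0\<bar>) \<longlongrightarrow> l) (at s0 within S)"
proof -
  have "((\<lambda>s. \<bar>s - s0\<bar>) \<longlongrightarrow> \<bar>s0 - s0\<bar>) (at s0 within S)" by (intro tendsto_intros)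
  then have "filterlim (\<lambda>s. \<bar>s - s0\<bar>) (at_right 0) (at s0 within S)"
    by (auto simp: filterlim_at eventually_at_filter)
  with assms show ?thesis by (rule filterlim_compose)
qed

lemma V_cont:
  assumes f: "f \<in> H" and s0: "0 \<le> s0"
  shows "((\<lambda>s. nrm (\<lambda>x. V s f x - V s0 f x)) \<longlongrightarrow> 0) (at s0 within {0..})"
proof -
  obtain M where M: "M > 0" "\<And>t f. t \<in> {0..s0} \<Longrightarrow> f \<in> H \<Longrightarrow> nrm (V t f) \<le> M * nrm f"
    using bound_upto[of s0] by blast
  show ?thesis
  proof (rule Lim_null_comparison)
    show "((\<lambda>s. M * nrm (\<lambda>x. V \<bar>s - s0\<bar> f x - f x)) \<longlongrightarrow> 0) (at s0 within {0..})"
      by (intro tendsto_mult_right_zero tendsto_abs_diff V_cont0 f)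
    have "nrm (\<lambda>x. V s f x - V s0 f x) \<le> M * nrm (\<lambda>x. V \<bar>s - s0\<bar> f x - f x)" if "0 \<le> s" for s
    proof (cases "s \<le> s0")
      case True
      then have "nrm (\<lambda>x. V s f x - V s0 f x) = nrm (V s (\<lambda>x. V (s0 - s) f x - f x))"
        using V_diff[of s s0 f] that f s0 by (subst nrm_minus_commute) simp
      also have "\<dots> \<le> M * nrm (\<lambda>x. V (s0 - s) f x - f x)"
        using True that f by (intro M diff_H V_H) auto
      finally show ?thesis using True by (simp add: abs_of_nonpos)
    next
      case False
      then have "nrm (\<lambda>x. V s f x - V s0 f x) = nrm (V s0 (\<lambda>x. V (s - s0) f x - f x))"
        using V_diff[of s0 s f] that f s0 by simp
      also have "\<dots> \<le> M * nrm (\<lambda>x. V (s - s0) f x - f x)"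
        using False that f s0 by (intro M diff_H V_H) auto
      finally show ?thesis using False by (simp add: abs_if)
    qed
    then show "\<forall>\<^sub>F s in at s0 within {0..}.
        norm (nrm (\<lambda>x. V s f x - V s0 f x)) \<le> M * nrm (\<lambda>x. V \<bar>s - s0\<bar> f x - f x)"
      by (auto simp: eventually_at_filter)
  qed
qed

lemma generator_invariant:
  assumes fh: "(f, h) \<in> generator m V" and s0: "0 \<le> s0"
  shows "(V s0 f, V s0 h) \<in> generator m V"
proof -
  have f: "f \<in> H" and h: "h \<in> H"
    and lim: "((\<lambda>t. nrm (\<lambda>x. (V t f x - f x) / of_real t - h x)) \<longlongrightarrow> 0) (at_right 0)"
    using fh by (auto simp: generator_def)
  obtain M where M: "M > 0" "\<And>f. f \<in> H \<Longrightarrow> nrm (V s0 f) \<le> M * nrm f"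
    using bop_bound[OF bop[OF s0]] by blast
  have "((\<lambda>t. nrm (\<lambda>x. (V t (V s0 f) x - V s0 f x) / of_real t - V s0 h x)) \<longlongrightarrow> 0) (at_right 0)"
  proof (rule Lim_null_comparison[OF _ tendsto_mult_right_zero[OF lim]])
    have "nrm (\<lambda>x. (V t (V s0 f) x - V s0 f x) / of_real t - V s0 h x)
       \<le> M * nrm (\<lambda>x. (V t f x - f x) / of_real t - h x)" if t: "t > 0" for t
    proof -
      have "V t (V s0 f) = V s0 (V t f)"
        using V_add[of t s0 f] V_add[of s0 t f] t s0 f by (simp add: add.commute)
      then have "(\<lambda>x. (V t (V s0 f) x - V s0 f x) / of_real t - V s0 h x)
        = (\<lambda>x. (1 / of_real t) * (V s0 (V t f) x - V s0 f x) - V s0 h x)" by simp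
      also have "\<dots> = V s0 (\<lambda>x. (1 / of_real t) * (V t f x - f x) - h x)"
        using s0 t f h by (simp add: bop_diff[OF bop] bop_scale[OF bop] V_H diff_H scale_H del: times_divide_eq_left)
      finally show ?thesis using M(2)[of "\<lambda>x. (1 / of_real t) * (V t f x - f x) - h x"] t f h
        by (simp add: V_H diff_H scale_H del: times_divide_eq_left) simp
    qed
    then show "\<forall>\<^sub>F t in at_right 0. norm (nrm (\<lambda>x. (V t (V s0 f) x - V s0 f x) / of_real t - V s0 h x))
       \<le> M * nrm (\<lambda>x. (V t f x - f x) / of_real t - h x)"
      by (auto simp: eventually_at_filter)
  qed
  then show ?thesis using f h s0 by (auto simp: generator_def V_H)
qed

text \<open>From the right the prefactor is the fixed \<open>V s0\<close>. From the left it is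
  \<open>V s\<close> and moves with s; the resulting defect \<open>V s h - V s0 h\<close> is
  absorbed by strong continuity.\<close>

lemma V_deriv:
  assumes fh: "(f, h) \<in> generator m V" and s0: "0 \<le> s0"
  shows "((\<lambda>s. nrm (\<lambda>x. (V s f x - V s0 f x) / of_real (s - s0) - V s0 h x)) \<longlongrightarrow> 0) (at s0 within {0..})"
proof -
  have f: "f \<in> H" and h: "h \<in> H"
    and lim: "((\<lambda>t. nrm (\<lambda>x. (V t f x - f x) / of_real t - h x)) \<longlongrightarrow> 0) (at_right 0)"
    using fh by (auto simp: generator_def)
  obtain M where M: "M > 0" "\<And>t f. t \<in> {0..s0} \<Longrightarrow> f \<in> H \<Longrightarrow> nrm (V t f) \<le> M * nrm f"
    using bound_upto[of s0] by blast
  let ?D = "\<lambda>t x. (1 / of_real t) * (V t f x - f x) - h x"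
  have DH: "?D t \<in> H" if "t \<ge> 0" for t
    using that f h by (intro diff_H scale_H V_H)
  have lim': "((\<lambda>t. nrm (?D t)) \<longlongrightarrow> 0) (at_right 0)" using lim by simp
  have VD: "V s (?D t) = (\<lambda>x. (1 / of_real t) * (V (s + t) f x - V s f x) - V s h x)" if "0 \<le> s" "0 \<le> t" for s t
    using that f h by (simp add: bop_diff[OF bop] bop_scale[OF bop] V_H diff_H scale_H V_add del: times_divide_eq_left)
  show ?thesis
  proof (rule Lim_null_comparison)
    show "((\<lambda>s. M * nrm (?D \<bar>s - s0\<bar>) + nrm (\<lambda>x. V s h x - V s0 h x)) \<longlongrightarrow> 0) (at s0 within {0..})"
      by (intro tendsto_add_zero tendsto_mult_right_zero tendsto_abs_diff lim' V_cont h s0)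
    have "nrm (\<lambda>x. (V s f x - V s0 f x) / of_real (s - s0) - V s0 h x)
        \<le> M * nrm (?D \<bar>s - s0\<bar>) + nrm (\<lambda>x. V s h x - V s0 h x)" if "0 \<le> s" "s \<noteq> s0" for s
    proof (cases "s \<le> s0")
      case True
      have "nrm (\<lambda>x. (V s f x - V s0 f x) / of_real (s - s0) - V s0 h x)
         = nrm (\<lambda>x. V s (?D (s0 - s)) x + (V s h x - V s0 h x))"
        using True that VD[of s "s0 - s"]
        by (intro arg_cong[where f = nrm]) (auto simp: fun_eq_iff field_simps)
      also have "\<dots> \<le> nrm (V s (?D (s0 - s))) + nrm (\<lambda>x. V s h x - V s0 h x)"
        using True that s0 h by (intro nrm_triangle diff_H V_H DH) auto
      also have "nrm (V s (?D (s0 - s))) \<le> M * nrm (?D (s0 - s))"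
        using True that by (intro M DH) auto
      finally show ?thesis using True by (simp add: abs_of_nonpos)
    next
      case False
      have "(\<lambda>x. (V s f x - V s0 f x) / of_real (s - s0) - V s0 h x) = V s0 (?D (s - s0))"
        using False that VD[of s0 "s - s0"] s0 by (auto simp: fun_eq_iff field_simps)
      moreover have "nrm (V s0 (?D (s - s0))) \<le> M * nrm (?D (s - s0))"
        using False that s0 by (intro M DH) auto
      moreover have "\<bar>s - s0\<bar> = s - s0" using False by simp
      ultimately show ?thesis using nrm_ge[of "\<lambda>x. V s h x - V s0 h x"]
        by (simp only:)
    qed
    then show "\<forall>\<^sub>F s in at s0 within {0..}. norm (nrm (\<lambda>x. (V s f x - V s0 f x) / of_real (s - s0) - V s0 h x))
        \<le> M * nrm (?D \<bar>s - s0\<bar>) + nrm (\<lambda>x. V s h x - V s0 h x)"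
      by (auto simp: eventually_at_filter)
  qed
qed

end

section \<open>Uniqueness of the semigroup with a given generator\<close>

context weight
begin

text \<open>U(t - s) V(s) f interpolates between U(t) f at s = 0 and V(t) f at s = t, and its
  derivative vanishes because the generators agree. Freezing the point x leaves a complex function
  of one real variable.\<close>

lemma semigroup_eq_on_generator:
  assumes U: "C0_semigroup m U" and V: "C0_semigroup m V" and G: "generator m U = generator m V"
    and fh: "(f, h) \<in> generator m V" and t: "0 \<le> t"
  shows "U t f = V t f"
proof
  fix x
  interpret U: semigroup m U by unfold_locales (rule U)
  interpret V: semigroup m V by unfold_locales (rule V)
  have f: "f \<in> H" and h: "h \<in> H" using fh by (auto simp: generator_def)
  obtain M where M: "M > 0" "\<And>r f. r \<in> {0..t} \<Longrightarrow> f \<in> H \<Longrightarrow> nrm (U r f) \<le> M * nrm f"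
    using U.bound_upto[of t] by blast
  define \<phi> where "\<phi> s = U (t - s) (V s f) x" for s
  have "(\<phi> has_derivative (\<lambda>_. 0)) (at s0 within {0..t})" if s0: "s0 \<in> {0..t}" for s0
  proof -
    let ?w = "V s0 f" and ?k = "V s0 h"
    have wk: "(?w, ?k) \<in> generator m U" using V.generator_invariant[OF fh, of s0] s0 G by auto
    have w: "?w \<in> H" and k: "?k \<in> H" using wk by (auto simp: generator_def)
    have flip: "filterlim (\<lambda>s. t - s) (at (t - s0) within {0..}) (at s0 within {0..t})"
      by (auto simp: filterlim_at eventually_at_filter intro!: tendsto_eq_intros)
    have sub: "at s0 within {0..t} \<le> at s0 within {0..}" by (intro at_le) auto
    let ?a = "\<lambda>s. nrm (\<lambda>x. (V s f x - ?w x) / of_real (s - s0) - ?k x)"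
    let ?b = "\<lambda>s. nrm (\<lambda>x. U (t - s) ?k x - U (t - s0) ?k x)"
    let ?c = "\<lambda>s. nrm (\<lambda>x. (U (t - s) ?w x - U (t - s0) ?w x) / of_real ((t - s) - (t - s0)) - U (t - s0) ?k x)"
    have a: "(?a \<longlongrightarrow> 0) (at s0 within {0..t})"
      by (rule tendsto_mono[OF sub V.V_deriv]) (use fh s0 in auto)
    have b: "(?b \<longlongrightarrow> 0) (at s0 within {0..t})"
      by (rule filterlim_compose[OF U.V_cont flip]) (use k s0 in auto)
    have c: "(?c \<longlongrightarrow> 0) (at s0 within {0..t})"
      by (rule filterlim_compose[OF U.V_deriv[OF wk] flip]) (use s0 in auto)
    have lim: "((\<lambda>s. (M * ?a s + ?b s + ?c s) / sqrt (m x)) \<longlongrightarrow> 0) (at s0 within {0..t})"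
      by (intro tendsto_divide_zero tendsto_add_zero tendsto_mult_right_zero a b c)
    have le: "norm ((1 / norm (s - s0)) *\<^sub>R (\<phi> s - \<phi> s0)) \<le> (M * ?a s + ?b s + ?c s) / sqrt (m x)"
      if s: "s \<in> {0..t}" "s \<noteq> s0" for s
    proof -
      let ?E = "\<lambda>x. (1 / of_real (s - s0)) * (V s f x - ?w x) - ?k x"
      have E: "?E \<in> H" using s s0 f h w k by (intro diff_H scale_H V.V_H) auto
      have Vs: "V s f \<in> H" using s f V.V_H by auto
      let ?B = "\<lambda>x. U (t - s) ?k x - U (t - s0) ?k x"
      let ?C = "\<lambda>x. (U (t - s) ?w x - U (t - s0) ?w x) / of_real ((t - s) - (t - s0)) - U (t - s0) ?k x"
      have B: "?B \<in> H" using s s0 k by (intro diff_H U.V_H) auto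
      have C: "?C \<in> H"
        using s s0 k w scale_H[OF diff_H[OF U.V_H[of "t - s" ?w] U.V_H[of "t - s0" ?w]], of "1 / of_real ((t - s) - (t - s0))"]
        by (intro diff_H U.V_H) auto
      have UE: "U (t - s) ?E = (\<lambda>x. (1 / of_real (s - s0)) * (U (t - s) (V s f) x - U (t - s) ?w x) - U (t - s) ?k x)"
        using s Vs w k by (simp add: bop_diff[OF U.bop] bop_scale[OF U.bop] diff_H scale_H del: times_divide_eq_left)
      \<comment> \<open>Product rule: the derivative of the inner orbit and that of the outer orbit
        cancel at \<open>?k\<close>. What remains are three errors: the inner quotient, the
        continuity of \<open>U\<close> at \<open>?k\<close>, and the outer quotient.\<close>
      have "(U (t - s) (V s f) x - U (t - s0) ?w x) / of_real (s - s0) = (U (t - s) ?E x + ?B x) - ?C x" for x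
      proof -
        define d where "d = complex_of_real (s - s0)"
        have d: "d \<noteq> 0" and e: "complex_of_real ((t - s) - (t - s0)) = - d"
          using s by (simp_all add: d_def)
        show ?thesis unfolding UE unfolding e d_def[symmetric] using d by (simp add: field_simps)
      qed
      then have "(\<phi> s - \<phi> s0) / of_real (s - s0) = (\<lambda>x. (U (t - s) ?E x + ?B x) - ?C x) x"
        by (simp add: \<phi>_def)
      moreover have UEH: "U (t - s) ?E \<in> H" using s by (intro U.V_H E) auto
      note UEB = add_H[OF UEH B]
      ultimately have "cmod ((\<phi> s - \<phi> s0) / of_real (s - s0)) \<le> nrm (\<lambda>x. (U (t - s) ?E x + ?B x) - ?C x) / sqrt (m x)"
        using point_le_nrm[OF diff_H[OF UEB C], of x] by (simp only:)
      also have "\<dots> \<le> (M * ?a s + ?b s + ?c s) / sqrt (m x)"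
      proof (intro divide_right_mono)
        have "nrm (\<lambda>x. (U (t - s) ?E x + ?B x) - ?C x) \<le> nrm (\<lambda>x. U (t - s) ?E x + ?B x) + ?c s"
          by (rule nrm_diff[OF UEB C])
        also have "nrm (\<lambda>x. U (t - s) ?E x + ?B x) \<le> nrm (U (t - s) ?E) + ?b s"
          by (rule nrm_triangle[OF UEH B])
        also have "nrm (U (t - s) ?E) \<le> M * nrm ?E" using s by (intro M E) auto
        also have "nrm ?E = ?a s" by simp
        finally show "nrm (\<lambda>x. (U (t - s) ?E x + ?B x) - ?C x) \<le> M * ?a s + ?b s + ?c s" by simp
      qed simp
      finally have F: "cmod ((\<phi> s - \<phi> s0) / of_real (s - s0)) \<le> (M * ?a s + ?b s + ?c s) / sqrt (m x)" .
      have "norm ((1 / norm (s - s0)) *\<^sub>R (\<phi> s - \<phi> s0)) = cmod ((\<phi> s - \<phi> s0) / of_real (s - s0))"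
        unfolding norm_divide norm_scaleR norm_of_real by (simp add: divide_inverse mult.commute)
      then show ?thesis using F by (simp only:)
    qed
    have "((\<lambda>s. (1 / norm (s - s0)) *\<^sub>R (\<phi> s - \<phi> s0)) \<longlongrightarrow> 0) (at s0 within {0..t})"
      by (rule Lim_null_comparison[OF _ lim]) (use le in \<open>auto simp: eventually_at_filter\<close>)
    then show ?thesis by (simp add: has_derivative_within)
  qed
  then have "\<exists>c. \<forall>s\<in>{0..t}. \<phi> s = c"
    by (intro has_derivative_zero_constant) auto
  then have "\<phi> 0 = \<phi> t" using t by auto
  then show "U t f x = V t f x"
    using f t by (simp add: \<phi>_def V.V_0 U.V_0 V.V_H)
qed

text \<open>The finitely supported functions are dense and lie in the domain of the generator, so
  equality there extends by boundedness at time t.\<close>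

lemma semigroup_unique:
  assumes U: "C0_semigroup m U" and V: "C0_semigroup m V" and G: "generator m U = generator m V"
    and dense: "\<And>f. f \<in> Cc \<Longrightarrow> f \<in> Domain (generator m V)"
    and f: "f \<in> H" and t: "0 \<le> t"
  shows "U t f = V t f"
proof -
  interpret U: semigroup m U by unfold_locales (rule U)
  interpret V: semigroup m V by unfold_locales (rule V)
  obtain C where C: "\<And>f. f \<in> H \<Longrightarrow> nrm (U t f) \<le> C * nrm f" using bop_bound[OF U.bop[OF t]] by blast
  obtain D where D: "\<And>f. f \<in> H \<Longrightarrow> nrm (V t f) \<le> D * nrm f" using bop_bound[OF V.bop[OF t]] by blast
  let ?e = "\<lambda>n x. trunc n f x - f x"
  have tr: "trunc n f \<in> H" for n by (rule Cc_H[OF trunc_Cc])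
  have "nrm (\<lambda>x. U t f x - V t f x) \<le> C * nrm (?e n) + D * nrm (?e n)" for n
  proof -
    have "U t (trunc n f) = V t (trunc n f)"
      using dense[OF trunc_Cc] semigroup_eq_on_generator[OF U V G _ t] by blast
    then have "nrm (\<lambda>x. U t f x - V t f x) = nrm (\<lambda>x. V t (?e n) x - U t (?e n) x)"
      using bop_diff[OF U.bop[OF t] tr f, of n] bop_diff[OF V.bop[OF t] tr f, of n] by (simp add: fun_eq_iff)
    also have "\<dots> \<le> nrm (V t (?e n)) + nrm (U t (?e n))"
      using tr f t by (intro nrm_diff U.V_H V.V_H diff_H)
    finally show ?thesis using C[OF diff_H[OF tr f], of n] D[OF diff_H[OF tr f], of n] by simp
  qed
  moreover have "(\<lambda>n. C * nrm (?e n) + D * nrm (?e n)) \<longlonglongrightarrow> 0"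
    by (intro tendsto_add_zero tendsto_mult_right_zero trunc_lim f)
  ultimately have "nrm (\<lambda>x. U t f x - V t f x) \<le> 0"
    by (intro tendsto_lowerbound[where f = "\<lambda>n. C * nrm (?e n) + D * nrm (?e n)"]) auto
  then have "(\<lambda>x. U t f x - V t f x) = (\<lambda>_. 0)"
    using nrm_eq_0[OF diff_H[OF U.V_H[OF t f] V.V_H[OF t f]]] nrm_ge[of "\<lambda>x. U t f x - V t f x"]
    by linarith
  then show ?thesis by (auto simp: fun_eq_iff)
qed

lemma op_exp_eq:
  assumes U: "C0_semigroup m U" and G: "generator m U = A"
    and dense: "\<And>f. f \<in> Cc \<Longrightarrow> f \<in> Domain A" and f: "f \<in> H" and t: "0 \<le> t"
  shows "op_exp m A t f = U t f"
  unfolding op_exp_def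
proof (rule the_equality)
  fix h assume "\<exists>V. C0_semigroup m V \<and> generator m V = A \<and> h = V t f"
  then show "h = U t f" using semigroup_unique[OF _ U _ _ f t] G dense by metis
qed (use U G in blast)

end


section \<open>Time-ordered exponential integrals\<close>

text \<open>\<open>dexp [a\<^sub>0, \<dots>, a\<^sub>n] t\<close> integrates \<open>exp (\<Sum>j. a\<^sub>j s\<^sub>j)\<close> over all holding times \<open>s\<^sub>j \<ge> 0\<close> with sum \<open>t\<close>, which
  is the divided difference of \<open>\<lambda>a. exp (a t)\<close> at \<open>a\<^sub>0, \<dots>, a\<^sub>n\<close>.\<close>

fun dexp :: "complex list \<Rightarrow> real \<Rightarrow> complex" where
  "dexp [] t = 0"
| "dexp [a] t = exp (a * of_real t)"
| "dexp (a # c # cs) t =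
     exp (a * of_real t) * integral {0..t} (\<lambda>s. exp (- a * of_real s) * dexp (c # cs) s)"

text \<open>The derivative of \<open>dexp cs\<close> in time. The value 0 of \<open>dexp []\<close>
  lets one formula cover singletons as well.\<close>

definition dexp_rate :: "complex list \<Rightarrow> real \<Rightarrow> complex" where
  "dexp_rate cs t = hd cs * dexp cs t + dexp (tl cs) t"

lemma exp_deriv: "((\<lambda>s. exp (a * of_real s)) has_vector_derivative a * exp (a * of_real t)) (at t within S)"
  for a :: complex
proof -
  have "((\<lambda>s. exp (a * of_real s)) has_vector_derivative exp (a * of_real t) * a) (at t within S)"
    by (rule has_vector_derivative_real_field) (auto intro!: derivative_eq_intros)
  then show ?thesis by (simp add: mult.commute)
qed

lemma dexp_single: "dexp [a] = (\<lambda>t. exp (a * of_real t))"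
  by auto

lemma dexp_Cons:
  "dexp (a # c # cs) = (\<lambda>t. exp (a * of_real t) * integral {0..t} (\<lambda>s. exp (- a * of_real s) * dexp (c # cs) s))"
  by auto

text \<open>The tail must be known to be continuous before the integral over it can be
  differentiated, hence the induction. It runs on a compact interval, where the fundamental theorem
  of calculus applies.\<close>

lemma dexp_deriv_upto:
  assumes "cs \<noteq> []" "t \<in> {0..T}"
  shows "(dexp cs has_vector_derivative dexp_rate cs t) (at t within {0..T})"
  using assms
proof (induction cs arbitrary: t)
  case (Cons a cs)
  show ?case
  proof (cases cs)
    case Nil
    then show ?thesis using exp_deriv[of a t "{0..T}"] by (simp add: dexp_rate_def dexp_single)
  next
    case (Cons c cs')
    let ?f = "\<lambda>s. exp (- a * of_real s) * dexp (c # cs') s"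
    have "(dexp (c # cs') has_vector_derivative dexp_rate (c # cs') x) (at x within {0..T})" if "x \<in> {0..T}" for x
      using Cons.IH[OF _ that] Cons by simp
    then have "continuous_on {0..T} (dexp (c # cs'))"
      unfolding continuous_on_eq_continuous_within by (blast intro: has_vector_derivative_continuous)
    then have "continuous_on {0..T} ?f" by (intro continuous_intros)
    then have I: "((\<lambda>u. integral {0..u} ?f) has_vector_derivative ?f t) (at t within {0..T})"
      using Cons.prems by (intro integral_has_vector_derivative) auto
    have e: "exp (a * of_real t) * ?f t = dexp (c # cs') t"
      by (simp add: exp_minus)
    show ?thesis
      using has_vector_derivative_mult[OF exp_deriv[of a t] I] unfolding e
      unfolding Cons dexp_Cons dexp_rate_def by (simp add: mult.assoc add.commute)
  qed
qed simp

lemma dexp_deriv: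
  assumes "cs \<noteq> []" "0 \<le> t"
  shows "(dexp cs has_vector_derivative dexp_rate cs t) (at t within {0..})"
proof -
  have "at t within {0..t+1} = at t within {0..}"
    by (rule at_within_nhd[of t "{..<t+1}"]) auto
  then show ?thesis using dexp_deriv_upto[OF assms(1), of t "t + 1"] assms(2) by simp
qed

lemma dexp_cont: "cs \<noteq> [] \<Longrightarrow> continuous_on {0..} (dexp cs)"
  unfolding continuous_on_eq_continuous_within
  using dexp_deriv by (auto intro: has_vector_derivative_continuous)

lemma dexp_at_0: "dexp cs 0 = (if length cs = 1 then 1 else 0)"
  by (induction cs "0::real" rule: dexp.induct) auto

text \<open>The common device for identities between time-ordered integrals: the difference of the
  two sides solves y' = a y and vanishes at 0.\<close>

lemma linear_ode_zero:
  fixes y :: "real \<Rightarrow> complex"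
  assumes d: "\<And>t. 0 \<le> t \<Longrightarrow> (y has_vector_derivative a * y t) (at t within {0..})"
    and 0: "y 0 = 0" and t: "0 \<le> t"
  shows "y t = 0"
proof -
  have "((\<lambda>t. exp (- a * of_real t) * y t) has_vector_derivative 0) (at s within {0..})" if "s \<in> {0..}" for s
  proof -
    have e: "exp (- a * of_real s) * (a * y s) + - a * exp (- a * of_real s) * y s = 0" by simp
    show ?thesis
      using has_vector_derivative_mult[OF exp_deriv[of "-a" s "{0..}"] d[of s]] that unfolding e by simp
  qed
  then obtain c where "\<And>s. s \<in> {0..} \<Longrightarrow> exp (- a * of_real s) * y s = c"
    using has_vector_derivative_zero_constant[of "{0..}" "\<lambda>s. exp (- a * of_real s) * y s"] by auto
  then have "exp (- a * of_real t) * y t = exp (- a * of_real 0) * y 0" using t by (metis atLeast_iff order_refl)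
  then show ?thesis using 0 by simp
qed

text \<open>The real part of the exponent is at most w t on the simplex of holding times, whose
  volume is t^n / n!.\<close>

lemma dexp_bound:
  assumes "\<And>c. c \<in> set (a # cs) \<Longrightarrow> Re c \<le> w" "0 \<le> t"
  shows "cmod (dexp (a # cs) t) \<le> exp (w * t) * t ^ length cs / fact (length cs)"
  using assms
proof (induction cs arbitrary: a t)
  case Nil
  then show ?case by (simp add: mult_right_mono)
next
  case (Cons c cs)
  let ?n = "length cs"
  let ?f = "\<lambda>s. exp (- a * of_real s) * dexp (c # cs) s"
  let ?g = "\<lambda>s. exp ((w - Re a) * t) * (s ^ ?n / fact ?n)"
  have "cmod (integral {0..t} ?f) \<le> integral {0..t} ?g"
  proof (rule integral_norm_bound_integral)
    have "continuous_on {0..t} (dexp (c # cs))"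
      by (rule continuous_on_subset[OF dexp_cont]) auto
    then show "?f integrable_on {0..t}" by (intro integrable_continuous_real continuous_intros)
    show "?g integrable_on {0..t}" by (intro integrable_continuous_real continuous_intros) auto
    fix s assume s: "s \<in> {0..t}"
    have "cmod (?f s) \<le> exp (- Re a * s) * (exp (w * s) * s ^ ?n / fact ?n)"
      unfolding norm_mult using Cons.IH[of c s] Cons.prems s by (intro mult_mono) auto
    also have "\<dots> = exp ((w - Re a) * s) * (s ^ ?n / fact ?n)"
      by (simp add: exp_add[symmetric] algebra_simps exp_diff exp_minus field_simps)
    also have "\<dots> \<le> ?g s"
      using s Cons.prems(1)[of a] by (intro mult_right_mono) (auto intro!: mult_left_mono)
    finally show "cmod (?f s) \<le> ?g s" .
  qed
  also have "integral {0..t} ?g = exp ((w - Re a) * t) * (t ^ Suc ?n / fact (Suc ?n))"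
  proof -
    have "((\<lambda>s. s ^ Suc ?n / fact (Suc ?n)) has_vector_derivative s ^ ?n / fact ?n) (at s within {0..t})" for s :: real
    proof -
      have "((\<lambda>s. s ^ Suc ?n / fact (Suc ?n)) has_real_derivative real (Suc ?n) * s ^ ?n / fact (Suc ?n)) (at s within {0..t})"
        by (auto intro!: derivative_eq_intros simp del: power_Suc fact_Suc)
      then show ?thesis
        by (simp add: has_real_derivative_iff_has_vector_derivative del: of_nat_Suc)
    qed
    then have "((\<lambda>s. s ^ ?n / fact ?n) has_integral t ^ Suc ?n / fact (Suc ?n) - 0 ^ Suc ?n / fact (Suc ?n)) {0..t}"
      using Cons.prems by (intro fundamental_theorem_of_calculus) auto
    then show ?thesis by (intro integral_unique has_integral_mult_right) simp
  qed
  finally have I: "cmod (integral {0..t} ?f) \<le> exp ((w - Re a) * t) * (t ^ Suc ?n / fact (Suc ?n))" .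
  have "cmod (dexp (a # c # cs) t) = exp (Re a * t) * cmod (integral {0..t} ?f)"
    by (simp add: norm_mult)
  also have "\<dots> \<le> exp (Re a * t) * (exp ((w - Re a) * t) * (t ^ Suc ?n / fact (Suc ?n)))"
    using I by (intro mult_left_mono) auto
  also have "\<dots> = exp (w * t) * t ^ Suc ?n / fact (Suc ?n)"
  proof -
    have "exp (Re a * t) * exp ((w - Re a) * t) = exp (w * t)"
      by (simp add: exp_add[symmetric] algebra_simps)
    then show ?thesis by (metis mult.assoc times_divide_eq_right)
  qed
  finally show ?case by simp
qed

text \<open>Cut the trajectory at time s, when it is in its j-th state: the holding interval of that
  state is cut in two, so entry j appears in both factors. This is the Leibniz rule for the divided
  differences of exp(a s) exp(a t).\<close>

lemma dexp_split:
  assumes "cs \<noteq> []" "0 \<le> s" "0 \<le> t"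
  shows "dexp cs (s + t) = (\<Sum>j<length cs. dexp (take (Suc j) cs) s * dexp (drop j cs) t)"
  using assms
proof (induction cs arbitrary: s)
  case (Cons a cs)
  define y where "y s = dexp (a # cs) (s + t) - (\<Sum>j<length (a # cs). dexp (take (Suc j) (a # cs)) s * dexp (drop j (a # cs)) t)" for s
  have "(y has_vector_derivative a * y s) (at s within {0..})" if s: "0 \<le> s" for s
  proof -
    have sh: "((\<lambda>s. dexp (a # cs) (s + t)) has_vector_derivative 1 *\<^sub>R dexp_rate (a # cs) (s + t)) (at s within {0..})"
    proof -
      have "((\<lambda>s. s + t) has_vector_derivative 1) (at s within {0..})"
        by (auto intro!: derivative_eq_intros)
      moreover have "(dexp (a # cs) has_vector_derivative dexp_rate (a # cs) (s + t)) (at (s + t) within (\<lambda>s. s + t) ` {0..})"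
        by (rule has_vector_derivative_within_subset[OF dexp_deriv]) (use s Cons.prems in auto)
      ultimately show ?thesis using vector_diff_chain_within[of "\<lambda>s. s + t" 1 s "{0..}" "dexp (a # cs)"] by (simp add: o_def)
    qed
    have d: "((\<lambda>s. \<Sum>j<length (a # cs). dexp (take (Suc j) (a # cs)) s * dexp (drop j (a # cs)) t) has_vector_derivative
        (\<Sum>j<length (a # cs). dexp_rate (take (Suc j) (a # cs)) s * dexp (drop j (a # cs)) t)) (at s within {0..})"
      using s by (intro has_vector_derivative_sum has_vector_derivative_mult_left dexp_deriv) auto
    have "(\<Sum>j<length (a # cs). dexp_rate (take (Suc j) (a # cs)) s * dexp (drop j (a # cs)) t)
       = a * (\<Sum>j<length (a # cs). dexp (take (Suc j) (a # cs)) s * dexp (drop j (a # cs)) t)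
         + (\<Sum>j<length (a # cs). dexp (take j cs) s * dexp (drop j (a # cs)) t)"
      by (simp add: dexp_rate_def sum_distrib_left sum.distrib algebra_simps)
    also have "(\<Sum>j<length (a # cs). dexp (take j cs) s * dexp (drop j (a # cs)) t)
       = (\<Sum>j<length cs. dexp (take (Suc j) cs) s * dexp (drop j cs) t)"
      by (simp add: sum.lessThan_Suc_shift del: sum.lessThan_Suc)
    also have "\<dots> = dexp cs (s + t)"
      using Cons.IH[of s] s Cons.prems by (cases "cs = []") auto
    finally have e: "(\<Sum>j<length (a # cs). dexp_rate (take (Suc j) (a # cs)) s * dexp (drop j (a # cs)) t)
       = a * (\<Sum>j<length (a # cs). dexp (take (Suc j) (a # cs)) s * dexp (drop j (a # cs)) t) + dexp cs (s + t)" .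
    have "(y has_vector_derivative dexp_rate (a # cs) (s + t) -
      (\<Sum>j<length (a # cs). dexp_rate (take (Suc j) (a # cs)) s * dexp (drop j (a # cs)) t)) (at s within {0..})"
      unfolding y_def using has_vector_derivative_diff[OF sh d] by simp
    also have "dexp_rate (a # cs) (s + t) -
      (\<Sum>j<length (a # cs). dexp_rate (take (Suc j) (a # cs)) s * dexp (drop j (a # cs)) t) = a * y s"
      unfolding e y_def by (simp add: dexp_rate_def algebra_simps)
    finally show ?thesis .
  qed
  moreover have "y 0 = 0"
  proof -
    have "(\<Sum>j<length (a # cs). dexp (take (Suc j) (a # cs)) 0 * dexp (drop j (a # cs)) t) =
       (\<Sum>j<length (a # cs). if j = 0 then dexp (a # cs) t else 0)"
      by (intro sum.cong) (auto simp: dexp_at_0)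
    then show ?thesis by (simp add: y_def)
  qed
  ultimately have "y s = 0" using linear_ode_zero[of y a s] Cons.prems by blast
  then show ?case by (simp add: y_def)
qed simp

text \<open>The defining recursion differentiates at the head of the list. Having the same rule at
  the last entry is what yields the symmetry under reversal.\<close>

lemma dexp_snoc_deriv:
  assumes "0 \<le> t"
  shows "(dexp (cs @ [a]) has_vector_derivative a * dexp (cs @ [a]) t + dexp cs t) (at t within {0..})"
  using assms
proof (induction cs arbitrary: t)
  case Nil
  then show ?case using exp_deriv[of a t "{0..}"] by (simp add: dexp_single)
next
  case (Cons c cs)
  define y where "y t = dexp_rate (c # cs @ [a]) t - (a * dexp (c # cs @ [a]) t + dexp (c # cs) t)" for t
  have "(y has_vector_derivative c * y t) (at t within {0..})" if t: "0 \<le> t" for t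
  proof -
    have "(y has_vector_derivative (c * dexp_rate (c # cs @ [a]) t + (a * dexp (cs @ [a]) t + dexp cs t))
       - (a * dexp_rate (c # cs @ [a]) t + dexp_rate (c # cs) t)) (at t within {0..})"
      unfolding y_def using t
      by (subst (1) dexp_rate_def, simp, intro has_vector_derivative_diff has_vector_derivative_add
        has_vector_derivative_mult_right dexp_deriv Cons.IH) auto
    then show ?thesis by (simp add: y_def dexp_rate_def algebra_simps)
  qed
  moreover have "y 0 = 0" by (simp add: y_def dexp_rate_def dexp_at_0)
  ultimately have "y t = 0" using linear_ode_zero[of y c t] Cons.prems by blast
  then show ?case using dexp_deriv[of "c # cs @ [a]" t] Cons.prems by (simp add: y_def)
qed

text \<open>Divided differences are symmetric in their nodes; reversal is the instance needed for
  running paths backwards.\<close>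

lemma dexp_rev: "0 \<le> t \<Longrightarrow> dexp (rev cs) t = dexp cs t"
proof (induction cs arbitrary: t)
  case (Cons c cs)
  define y where "y t = dexp (rev cs @ [c]) t - dexp (c # cs) t" for t
  have "(y has_vector_derivative c * y t) (at t within {0..})" if t: "0 \<le> t" for t
  proof -
    have "(y has_vector_derivative (c * dexp (rev cs @ [c]) t + dexp (rev cs) t) - dexp_rate (c # cs) t) (at t within {0..})"
      unfolding y_def using t by (intro has_vector_derivative_diff dexp_snoc_deriv dexp_deriv) auto
    then show ?thesis using Cons.IH[OF t] by (simp add: y_def dexp_rate_def algebra_simps)
  qed
  moreover have "y 0 = 0" by (simp add: y_def dexp_at_0)
  ultimately have "y t = 0" using linear_ode_zero[of y c t] Cons.prems by blast
  then show ?case by (simp add: y_def)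
qed simp


section \<open>Path sums\<close>

abbreviation esum :: "('i \<Rightarrow> ennreal) \<Rightarrow> ennreal" where
  "esum F \<equiv> \<integral>\<^sup>+x. F x \<partial>count_space UNIV"

lemma esum_swap: "esum (\<lambda>x. esum (\<lambda>y. F x y)) = esum (\<lambda>y. esum (\<lambda>x. F x y))"
  using nn_integral_fst_count_space[of "case_prod F"] nn_integral_snd_count_space[of "case_prod F"] by simp

lemma esum_point: "F x \<le> esum F"
proof -
  have "F x = esum (\<lambda>y. F x * indicator {x} y)"
    by (simp add: nn_integral_cmult)
  also have "\<dots> \<le> esum F" by (intro nn_integral_mono) (auto simp: indicator_def)
  finally show ?thesis .
qed

text \<open>First-step decomposition of sums over paths.\<close>

lemma esum_list: "esum F = F [] + esum (\<lambda>y. esum (\<lambda>q. F (y # q)))"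
proof -
  let ?C = "\<lambda>p :: 'a \<times> 'a list. fst p # snd p"
  have b: "bij_betw ?C UNIV (range ?C)"
    by (intro inj_on_imp_bij_betw) (auto simp: inj_on_def prod_eq_iff)
  have r: "range ?C = - {[]}"
  proof (intro set_eqI iffI)
    fix l :: "'a list" assume "l \<in> - {[]}"
    then show "l \<in> range ?C" by (cases l) (auto intro: image_eqI[of _ _ "(_, _)"])
  qed auto
  have "esum F = esum (\<lambda>q. F q * indicator {[]} q + F q * indicator (- {[]}) q)"
    by (intro nn_integral_cong) (auto simp: indicator_def)
  also have "\<dots> = esum (\<lambda>q. F q * indicator {[]} q) + esum (\<lambda>q. F q * indicator (- {[]}) q)"
    by (rule nn_integral_add) auto
  also have "esum (\<lambda>q. F q * indicator {[]} q) = F []"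
    by (subst nn_integral_indicator_finite) auto
  also have "esum (\<lambda>q. F q * indicator (- {[]}) q) = (\<integral>\<^sup>+q. F q \<partial>count_space (- {[]}))"
    by (simp add: nn_integral_count_space_indicator)
  also have "\<dots> = esum (\<lambda>p. F (?C p))"
    using nn_integral_bij_count_space[OF b, of F] r by simp
  also have "\<dots> = esum (\<lambda>y. esum (\<lambda>q. F (y # q)))"
    by (simp add: nn_integral_fst_count_space[symmetric])
  finally show ?thesis .
qed

text \<open>An exhaustion of the countable type along its enumeration, turning unordered sums into
  limits of sequences.\<close>

definition initial_set :: "nat \<Rightarrow> 'a::countable set" where
  "initial_set n = {x. to_nat x < n}"

lemma finite_initial_set[simp]: "finite (initial_set n :: 'a::countable set)"
proof -
  have "finite ((to_nat :: 'a \<Rightarrow> nat) -` {..<n})"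
    by (intro finite_vimageI) auto
  then show ?thesis by (simp add: initial_set_def vimage_def)
qed

lemma esum_lim: "(\<lambda>n. \<Sum>x\<in>initial_set n. F x) \<longlonglongrightarrow> esum (F :: 'a::countable \<Rightarrow> ennreal)"
proof -
  have "(\<lambda>n. esum (\<lambda>x. F x * indicator (initial_set n) x)) \<longlonglongrightarrow> esum F"
  proof (rule nn_integral_LIMSEQ)
    show "incseq (\<lambda>n x. F x * indicator (initial_set n) x)"
      by (auto simp: incseq_def le_fun_def indicator_def initial_set_def)
    fix x
    have "\<forall>\<^sub>F n in sequentially. F x * indicator (initial_set n) x = F x"
      using eventually_gt_at_top[of "to_nat x"] by eventually_elim (auto simp: initial_set_def)
    then show "(\<lambda>n. F x * indicator (initial_set n) x) \<longlonglongrightarrow> F x" by (rule tendsto_eventually)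
  qed auto
  then show ?thesis by (subst (asm) nn_integral_indicator_finite) auto
qed

lemma esum_le: "(\<And>n. (\<Sum>x\<in>initial_set n. F x) \<le> c) \<Longrightarrow> esum F \<le> c"
  by (rule LIMSEQ_le_const2[OF esum_lim]) auto

text \<open>A path is a start vertex together with the list of later vertices. It is thus never
  empty, and the empty list is the path that does not move.\<close>

fun pathw :: "('a \<Rightarrow> 'a \<Rightarrow> 'b::comm_semiring_1) \<Rightarrow> 'a \<Rightarrow> 'a list \<Rightarrow> 'b" where
  "pathw K x [] = 1"
| "pathw K x (y # q) = K x y * pathw K y q"

lemma pathw_append: "pathw K x (q @ r) = pathw K x q * pathw K (last (x # q)) r"
  by (induction q arbitrary: x) (auto simp: mult.assoc)

lemma pathw_nonneg: "(\<And>x y. 0 \<le> R x y) \<Longrightarrow> 0 \<le> (pathw R x q :: real)"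
  by (induction q arbitrary: x) auto

lemma pathw_norm_le:
  fixes K :: "'a \<Rightarrow> 'a \<Rightarrow> complex"
  assumes "\<And>x y. cmod (K x y) \<le> R x y"
  shows "cmod (pathw K x q) \<le> pathw R x q"
proof (induction q arbitrary: x)
  case (Cons y q)
  have "0 \<le> R x y" using assms[of x y] norm_ge_zero order_trans by blast
  then show ?case by (auto simp: norm_mult intro!: mult_mono Cons assms)
qed simp

text \<open>The sums over paths take place in \<open>ennreal\<close> first, so that the bound on \<open>R\<close> yields absolute
  convergence of all dominated path sums.\<close>

locale bounded_matrix = weight m for m :: "'a::countable \<Rightarrow> real" +
  fixes R :: "'a \<Rightarrow> 'a \<Rightarrow> real" and C :: real
  assumes R_ge: "0 \<le> R x y" and C_pos: "0 < C"
    and R_bound: "esum (\<lambda>x. (esum (\<lambda>y. ennreal (R x y) * f y))\<^sup>2 * ennreal (m x))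
                    \<le> ennreal (C\<^sup>2) * esum (\<lambda>x. (f x)\<^sup>2 * ennreal (m x))"
begin

abbreviation esq :: "('a \<Rightarrow> ennreal) \<Rightarrow> ennreal" where
  "esq f \<equiv> esum (\<lambda>x. (f x)\<^sup>2 * ennreal (m x))"

definition Rop :: "('a \<Rightarrow> ennreal) \<Rightarrow> 'a \<Rightarrow> ennreal" where
  "Rop f x = esum (\<lambda>y. ennreal (R x y) * f y)"

text \<open>The exponential series of t R applied to f, with the powers of R expanded over
  paths.\<close>

definition Rexp :: "real \<Rightarrow> ('a \<Rightarrow> ennreal) \<Rightarrow> 'a \<Rightarrow> ennreal" where
  "Rexp t f x = esum (\<lambda>q. ennreal (pathw R x q * (t ^ length q / fact (length q))) * f (last (x # q)))"

lemma pathR_ge[simp]: "0 \<le> pathw R x q"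
  by (rule pathw_nonneg) (rule R_ge)

lemma Rop_pow:
  "esum (\<lambda>q. indicator {k} (length q) * (ennreal (pathw R x q) * f (last (x # q)))) = (Rop ^^ k) f x"
proof (induction k arbitrary: x)
  case 0
  then show ?case by (subst esum_list) (auto simp: indicator_def)
next
  case (Suc k)
  have "esum (\<lambda>q. indicator {Suc k} (length q) * (ennreal (pathw R x q) * f (last (x # q))))
     = esum (\<lambda>y. esum (\<lambda>q. ennreal (R x y) * (indicator {k} (length q) * (ennreal (pathw R y q) * f (last (y # q))))))"
    by (subst esum_list) (auto simp: indicator_def ennreal_mult R_ge mult_ac intro!: nn_integral_cong)
  also have "\<dots> = esum (\<lambda>y. ennreal (R x y) * (Rop ^^ k) f y)"
    by (intro nn_integral_cong, subst nn_integral_cmult) (simp_all add: Suc.IH del: last.simps)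
  finally show ?case by (simp add: Rop_def[of "(Rop ^^ k) f" x] del: last.simps)
qed

lemma esq_Rop_pow: "esq ((Rop ^^ k) f) \<le> ennreal (C ^ (2 * k)) * esq f"
proof (induction k)
  case (Suc k)
  have "esq ((Rop ^^ Suc k) f) \<le> ennreal (C\<^sup>2) * esq ((Rop ^^ k) f)"
    using R_bound[of "(Rop ^^ k) f"] by (simp add: Rop_def)
  also have "\<dots> \<le> ennreal (C\<^sup>2) * (ennreal (C ^ (2 * k)) * esq f)"
    by (intro mult_left_mono Suc) auto
  also have "\<dots> = ennreal (C ^ (2 * Suc k)) * esq f"
    using C_pos by (simp add: mult.assoc[symmetric] ennreal_mult[symmetric] power2_eq_square)
  finally show ?case .
qed simp

lemma Rexp_eq:
  assumes "0 \<le> t"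
  shows "Rexp t f x = esum (\<lambda>k. ennreal (t ^ k / fact k) * (Rop ^^ k) f x)"
proof -
  have "esum (\<lambda>k. ennreal (t ^ k / fact k) * (Rop ^^ k) f x)
     = esum (\<lambda>k. esum (\<lambda>q. ennreal (t ^ k / fact k) * (indicator {k} (length q) * (ennreal (pathw R x q) * f (last (x # q))))))"
    by (subst nn_integral_cmult) (simp_all add: Rop_pow del: last.simps)
  also have "\<dots> = esum (\<lambda>q. esum (\<lambda>k. (ennreal (t ^ k / fact k) * (ennreal (pathw R x q) * f (last (x # q)))) * indicator {length q} k))"
    by (subst esum_swap) (auto simp: indicator_def intro!: nn_integral_cong)
  also have "\<dots> = Rexp t f x"
    unfolding Rexp_def
    by (subst nn_integral_indicator_finite)
      (auto simp: ennreal_mult[symmetric] assms mult.assoc[symmetric] mult.commute intro!: nn_integral_cong)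
  finally show ?thesis by simp
qed

lemma esum_exp: "0 \<le> u \<Longrightarrow> esum (\<lambda>k. ennreal (u ^ k / fact k)) = ennreal (exp u)"
proof -
  assume u: "0 \<le> u"
  have s: "(\<lambda>k. u ^ k / fact k) sums exp u"
    using exp_converges[of u] by (simp add: divide_inverse mult.commute)
  have "(\<Sum>k. ennreal (u ^ k / fact k)) = ennreal (\<Sum>k. u ^ k / fact k)"
    by (rule suminf_ennreal2) (use u in \<open>auto intro: sums_summable[OF s]\<close>)
  then show ?thesis unfolding nn_integral_count_space_nat sums_unique[OF s, symmetric] .
qed

text \<open>Cauchy-Schwarz with the weights (tC)^k / k! takes the role of Minkowski's inequality for
  the series: the weights sum to exp(tC), and R^k / C^k is a contraction. Each factor exp(tC) of the
  bound comes from one summation of the weights.\<close>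

lemma esq_Rexp:
  assumes t: "0 \<le> t"
  shows "esq (Rexp t f) \<le> ennreal ((exp (t * C))\<^sup>2) * esq f"
proof -
  let ?c = "\<lambda>k. ennreal ((t * C) ^ k / fact k)"
  let ?u = "\<lambda>k. (Rop ^^ k) f"
  have cs: "(Rexp t f x)\<^sup>2 \<le> ennreal (exp (t * C)) * esum (\<lambda>k. ?c k * (ennreal (1 / C ^ k) * ?u k x)\<^sup>2)" for x
  proof -
    let ?s = "\<lambda>k. ennreal (sqrt ((t * C) ^ k / fact k))"
    have sq: "(?s k)\<^sup>2 = ?c k" for k
      using t C_pos by (subst ennreal_power) auto
    have "Rexp t f x = esum (\<lambda>k. ?s k * (?s k * (ennreal (1 / C ^ k) * ?u k x)))"
      unfolding Rexp_eq[OF t]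
    proof (intro nn_integral_cong)
      fix k
      have "?s k * (?s k * (ennreal (1 / C ^ k) * ?u k x)) = (?s k)\<^sup>2 * ennreal (1 / C ^ k) * ?u k x"
        by (simp add: power2_eq_square mult.assoc)
      also have "(?s k)\<^sup>2 * ennreal (1 / C ^ k) = ennreal (t ^ k / fact k)"
        unfolding sq using t C_pos by (subst ennreal_mult[symmetric]) (auto simp: power_mult_distrib)
      finally show "ennreal (t ^ k / fact k) * ?u k x = ?s k * (?s k * (ennreal (1 / C ^ k) * ?u k x))" by simp
    qed
    then have "(Rexp t f x)\<^sup>2 \<le> esum (\<lambda>k. (?s k)\<^sup>2) * esum (\<lambda>k. (?s k * (ennreal (1 / C ^ k) * ?u k x))\<^sup>2)"
      using Cauchy_Schwarz_nn_integral[of ?s "count_space UNIV" "\<lambda>k. ?s k * (ennreal (1 / C ^ k) * ?u k x)"] by simp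
    also have "\<dots> = ennreal (exp (t * C)) * esum (\<lambda>k. ?c k * (ennreal (1 / C ^ k) * ?u k x)\<^sup>2)"
      unfolding power_mult_distrib[of "?s _"] sq using esum_exp[of "t * C"] t C_pos by simp
    finally show ?thesis .
  qed
  have "esq (Rexp t f) \<le> esum (\<lambda>x. ennreal (exp (t * C)) * esum (\<lambda>k. ?c k * (ennreal (1 / C ^ k) * ?u k x)\<^sup>2) * ennreal (m x))"
    by (intro nn_integral_mono mult_right_mono cs) auto
  also have "\<dots> = ennreal (exp (t * C)) * esum (\<lambda>x. esum (\<lambda>k. ?c k * (ennreal (1 / C ^ k) * ?u k x)\<^sup>2 * ennreal (m x)))"
    by (simp add: nn_integral_cmult nn_integral_multc[symmetric] mult.assoc)
  also have "esum (\<lambda>x. esum (\<lambda>k. ?c k * (ennreal (1 / C ^ k) * ?u k x)\<^sup>2 * ennreal (m x)))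
     = esum (\<lambda>k. ?c k * (ennreal (1 / C ^ k))\<^sup>2 * esq (?u k))"
    by (subst esum_swap) (simp add: nn_integral_cmult power_mult_distrib mult.assoc)
  also have "\<dots> \<le> esum (\<lambda>k. ?c k * esq f)"
  proof (intro nn_integral_mono)
    fix k
    have "?c k * (ennreal (1 / C ^ k))\<^sup>2 * esq (?u k) \<le> ?c k * (ennreal (1 / C ^ k))\<^sup>2 * (ennreal (C ^ (2 * k)) * esq f)"
      by (intro mult_left_mono esq_Rop_pow) auto
    also have "\<dots> = ?c k * ((ennreal (1 / C ^ k))\<^sup>2 * ennreal (C ^ (2 * k))) * esq f"
      by (simp add: mult.assoc)
    also have "(ennreal (1 / C ^ k))\<^sup>2 * ennreal (C ^ (2 * k)) = 1"
    proof -
      have "(1 / C ^ k)\<^sup>2 * C ^ (2 * k) = 1" using C_pos by (simp add: power_divide power_mult[symmetric] mult.commute)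
      then show ?thesis using C_pos by (simp add: ennreal_power ennreal_mult[symmetric] del: power_divide)
    qed
    finally show "?c k * (ennreal (1 / C ^ k))\<^sup>2 * esq (?u k) \<le> ?c k * esq f" by simp
  qed
  also have "\<dots> = ennreal (exp (t * C)) * esq f"
    using t C_pos by (simp add: nn_integral_multc esum_exp)
  finally have "esq (Rexp t f) \<le> ennreal (exp (t * C)) * (ennreal (exp (t * C)) * esq f)"
    by (simp add: mult_left_mono)
  then show ?thesis by (simp add: mult.assoc[symmetric] ennreal_mult[symmetric] power2_eq_square)
qed

end

context weight
begin

lemma H_iff: "f \<in> H \<longleftrightarrow> esum (\<lambda>x. (ennreal (cmod (f x)))\<^sup>2 * ennreal (m x)) < \<infinity>"
  and nrm_esum: "f \<in> H \<Longrightarrow> esum (\<lambda>x. (ennreal (cmod (f x)))\<^sup>2 * ennreal (m x)) = ennreal ((nrm f)\<^sup>2)"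
proof -
  let ?g = "\<lambda>x. (cmod (f x))\<^sup>2 * m x"
  have e: "esum (\<lambda>x. (ennreal (cmod (f x)))\<^sup>2 * ennreal (m x)) = esum (\<lambda>x. ennreal (?g x))"
    by (intro nn_integral_cong) (simp add: ennreal_power ennreal_mult[symmetric])
  have i: "f \<in> H \<longleftrightarrow> integrable (count_space UNIV) ?g"
    unfolding ell2_def abs_summable_on_def[symmetric] abs_summable_equivalent[symmetric] by simp
  then show "f \<in> H \<longleftrightarrow> esum (\<lambda>x. (ennreal (cmod (f x)))\<^sup>2 * ennreal (m x)) < \<infinity>"
    unfolding e by (simp add: integrable_iff_bounded)
  assume "f \<in> H"
  then show "esum (\<lambda>x. (ennreal (cmod (f x)))\<^sup>2 * ennreal (m x)) = ennreal ((nrm f)\<^sup>2)"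
    unfolding e nrm_sq using i nn_integral_conv_infsetsum[of ?g UNIV] infsetsum_infsum[of ?g UNIV] by (simp add: abs_summable_on_def)
qed

lemma H_esumI:
  assumes "esum (\<lambda>x. (g x)\<^sup>2 * ennreal (m x)) \<le> ennreal (c\<^sup>2)" "\<And>x. ennreal (cmod (f x)) \<le> g x" "0 \<le> c"
  shows "f \<in> H" "nrm f \<le> c"
proof -
  have le: "esum (\<lambda>x. (ennreal (cmod (f x)))\<^sup>2 * ennreal (m x)) \<le> ennreal (c\<^sup>2)"
    by (rule order_trans[OF _ assms(1)]) (intro nn_integral_mono mult_right_mono power_mono assms(2); simp)
  then show f: "f \<in> H" unfolding H_iff by (rule le_less_trans) simp
  have "(nrm f)\<^sup>2 \<le> c\<^sup>2" using le unfolding nrm_esum[OF f] by simp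
  then show "nrm f \<le> c" using assms(3) by (rule power2_le_imp_le)
qed

end


section \<open>Semigroups given by path sums\<close>

abbreviation tsum :: "('i \<Rightarrow> complex) \<Rightarrow> complex" where
  "tsum F \<equiv> infsetsum F UNIV"

abbreviation tsummable :: "('i \<Rightarrow> complex) \<Rightarrow> bool" where
  "tsummable F \<equiv> integrable (count_space UNIV) F"

lemma tsummableI: "esum (\<lambda>x. ennreal (cmod (F x))) < \<infinity> \<Longrightarrow> tsummable F"
  by (simp add: integrable_iff_bounded)

lemma tsummableD: "tsummable F \<Longrightarrow> esum (\<lambda>x. ennreal (cmod (F x))) < \<infinity>"
  by (simp add: integrable_iff_bounded)

lemma tsum_norm_le: "ennreal (cmod (tsum F)) \<le> esum (\<lambda>x. ennreal (cmod (F x)))"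
proof (cases "tsummable F")
  case True
  have "cmod (tsum F) \<le> (\<integral>x. cmod (F x) \<partial>count_space UNIV)"
    unfolding infsetsum_def by (rule integral_norm_bound)
  then show ?thesis using True by (subst nn_integral_eq_integral) (auto intro!: ennreal_leI)
qed (simp add: infsetsum_def not_integrable_integral_eq)

lemma tsum_dominated:
  fixes F :: "'s::{first_countable_topology, metric_space} \<Rightarrow> 'i \<Rightarrow> complex"
  assumes g: "esum (\<lambda>y. ennreal (g y)) < \<infinity>"
    and le: "\<And>s y. s \<in> S \<Longrightarrow> s \<noteq> a \<Longrightarrow> cmod (F s y) \<le> g y"
    and lim: "\<And>y. ((\<lambda>s. F s y) \<longlongrightarrow> l y) (at a within S)"
  shows "((\<lambda>s. tsum (F s)) \<longlongrightarrow> tsum l) (at a within S)"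
  unfolding tendsto_at_iff_sequentially
proof (intro allI impI)
  fix X :: "nat \<Rightarrow> 's" assume X: "\<forall>i. X i \<in> S - {a}" "X \<longlonglongrightarrow> a"
  have g0: "0 \<le> g y" for y
    using le[of "X 0" y] X(1) norm_ge_zero order_trans by blast
  have "(\<lambda>n. integral\<^sup>L (count_space UNIV) (F (X n))) \<longlonglongrightarrow> integral\<^sup>L (count_space UNIV) l"
  proof (rule integral_dominated_convergence[where w = g])
    show "integrable (count_space UNIV) g" using g g0 by (simp add: integrable_iff_bounded)
    show "AE y in count_space UNIV. (\<lambda>n. F (X n) y) \<longlonglongrightarrow> l y"
      using lim X unfolding tendsto_at_iff_sequentially by (auto simp: AE_count_space o_def)
    show "AE y in count_space UNIV. norm (F (X n) y) \<le> g y" for n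
      using le X by (auto simp: AE_count_space)
  qed auto
  then show "((\<lambda>s. tsum (F s)) \<circ> X) \<longlonglongrightarrow> tsum l" by (simp add: infsetsum_def o_def)
qed

lemma exp_minus_1_eq_dexp:
  assumes "0 \<le> t" shows "exp (a * of_real t) - 1 = a * dexp [a, 0] t"
proof -
  define y where "y t = a * dexp [a, 0] t - (exp (a * of_real t) - 1)" for t
  have "(y has_vector_derivative a * y t) (at t within {0..})" if t: "0 \<le> t" for t
  proof -
    have "(y has_vector_derivative a * dexp_rate [a, 0] t - (a * exp (a * of_real t) - 0)) (at t within {0..})"
      unfolding y_def using t
      by (intro has_vector_derivative_diff has_vector_derivative_mult_right dexp_deriv exp_deriv has_vector_derivative_const) auto
    moreover have "a * dexp_rate [a, 0] t - (a * exp (a * of_real t) - 0) = a * y t"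
      by (simp add: y_def dexp_rate_def algebra_simps)
    ultimately show ?thesis by simp
  qed
  moreover have "y 0 = 0" by (simp add: y_def)
  ultimately have "y t = 0" using assms by (rule linear_ode_zero)
  then show ?thesis by (simp add: y_def)
qed

text \<open>The derivative at 0 is \<open>dexp [c] 0\<close>, which is 1: a single jump during a
  short time t has time-ordered integral t to first order, whatever the exponents are.\<close>

lemma dexp2_quotient_lim: "((\<lambda>t. dexp [a, c] t / of_real t) \<longlongrightarrow> 1) (at_right 0)"
proof -
  have "(dexp [a, c] has_vector_derivative 1) (at 0 within {0..})"
    using dexp_deriv[of "[a, c]" 0] by (simp add: dexp_rate_def)
  then have "(dexp [a, c] has_vector_derivative 1) (at_right 0)"
    by (rule has_vector_derivative_within_subset) auto
  then have "((\<lambda>t. (1 / norm t) *\<^sub>R (dexp [a, c] t - of_real t)) \<longlongrightarrow> 0) (at_right 0)"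
    unfolding has_vector_derivative_def has_derivative_within
    by (simp add: scaleR_conv_of_real)
  then have "((\<lambda>t. dexp [a, c] t / of_real t - 1) \<longlongrightarrow> 0) (at_right 0)"
    by (rule Lim_transform_eventually)
      (auto simp: eventually_at_filter scaleR_conv_of_real field_simps)
  then show ?thesis by (rule LIM_zero_cancel)
qed

locale bounded_kernel = bounded_matrix m R C for m :: "'a::countable \<Rightarrow> real" and R C +
  fixes K :: "'a \<Rightarrow> 'a \<Rightarrow> complex"
  assumes K_le: "cmod (K x y) \<le> R x y"
begin

abbreviation eabs :: "('a \<Rightarrow> complex) \<Rightarrow> 'a \<Rightarrow> ennreal" where
  "eabs f \<equiv> \<lambda>x. ennreal (cmod (f x))"

text \<open>R applied to |f| is finite everywhere. It thus becomes an element of the Hilbert space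
  that dominates \<open>Kop f\<close> and, up to constants, its time-dependent
  perturbations.\<close>

lemma
  assumes "f \<in> H"
  shows Rop_finite: "Rop (eabs f) x < \<infinity>"
    and Rop_H: "(\<lambda>x. complex_of_real (enn2real (Rop (eabs f) x))) \<in> H"
    and esq_Rop: "esq (Rop (eabs f)) \<le> ennreal ((C * nrm f)\<^sup>2)"
proof -
  have 1: "esq (Rop (eabs f)) \<le> ennreal ((C * nrm f)\<^sup>2)"
    using esq_Rop_pow[of 1 "eabs f"] nrm_esum[OF assms] C_pos
    by (simp add: ennreal_mult[symmetric] power_mult_distrib)
  have fin: "Rop (eabs f) x < \<infinity>" for x
  proof -
    have "(Rop (eabs f) x)\<^sup>2 * ennreal (m x) < \<infinity>"
      using order_trans[OF esum_point 1] le_less_trans by (metis ennreal_less_top infinity_ennreal_def)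
    then show ?thesis
      using m_pos[of x] by (cases "Rop (eabs f) x") (auto simp: power2_eq_square ennreal_top_mult ennreal_mult_top)
  qed
  then show "Rop (eabs f) x < \<infinity>" .
  show "esq (Rop (eabs f)) \<le> ennreal ((C * nrm f)\<^sup>2)" by (rule 1)
  show "(\<lambda>x. complex_of_real (enn2real (Rop (eabs f) x))) \<in> H"
    by (rule H_esumI(1)[OF 1]) (use fin C_pos in auto)
qed

definition Kop :: "('a \<Rightarrow> complex) \<Rightarrow> 'a \<Rightarrow> complex" where
  "Kop f x = tsum (\<lambda>y. K x y * f y)"

lemma Kop_term_le: "ennreal (cmod (K x y * f y)) \<le> ennreal (R x y) * eabs f y"
proof -
  have "cmod (K x y * f y) \<le> R x y * cmod (f y)"
    unfolding norm_mult by (intro mult_right_mono K_le) simp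
  then show ?thesis by (simp add: ennreal_mult[symmetric] R_ge ennreal_leI)
qed

lemma esum_Kop_le: "esum (\<lambda>y. ennreal (cmod (K x y * f y))) \<le> Rop (eabs f) x"
  unfolding Rop_def by (intro nn_integral_mono Kop_term_le)

lemma tsummable_Kop: "f \<in> H \<Longrightarrow> tsummable (\<lambda>y. K x y * f y)"
  using esum_Kop_le[of x f] Rop_finite[of f x] by (intro tsummableI) (auto intro: le_less_trans)

lemma
  assumes f: "f \<in> H"
  shows Kop_H: "Kop f \<in> H" and Kop_bound: "nrm (Kop f) \<le> C * nrm f"
proof -
  have "ennreal (cmod (Kop f x)) \<le> Rop (eabs f) x" for x
    unfolding Kop_def by (rule order_trans[OF tsum_norm_le esum_Kop_le])
  from H_esumI[OF esq_Rop[OF f] this]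
  show "Kop f \<in> H" "nrm (Kop f) \<le> C * nrm f" using C_pos by auto
qed

end

section \<open>Dyson series for multiplication by a function plus a dominated kernel\<close>

locale path_semigroup = bounded_kernel m R C K for m :: "'a::countable \<Rightarrow> real" and R C K +
  fixes a :: "'a \<Rightarrow> complex" and w :: real
  assumes a_le: "Re (a x) \<le> w" and w_ge: "0 \<le> w"
begin

definition pterm :: "real \<Rightarrow> ('a \<Rightarrow> complex) \<Rightarrow> 'a \<Rightarrow> 'a list \<Rightarrow> complex" where
  "pterm t f x q = pathw K x q * dexp (map a (x # q)) t * f (last (x # q))"

definition U :: "real \<Rightarrow> ('a \<Rightarrow> complex) \<Rightarrow> 'a \<Rightarrow> complex" where
  "U t f x = tsum (pterm t f x)"

lemma dexp_a_le: "0 \<le> t \<Longrightarrow> cmod (dexp (map a (x # q)) t) \<le> exp (w * t) * (t ^ length q / fact (length q))"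
  using dexp_bound[of "a x" "map a q" w t] a_le by auto

lemma pterm_le:
  assumes "0 \<le> t"
  shows "cmod (pterm t f x q) \<le> exp (w * t) * (pathw R x q * (t ^ length q / fact (length q))) * cmod (f (last (x # q)))"
proof -
  have "cmod (pterm t f x q) \<le> pathw R x q * (exp (w * t) * (t ^ length q / fact (length q))) * cmod (f (last (x # q)))"
    unfolding pterm_def norm_mult
    using pathw_norm_le[of K R x q] K_le dexp_a_le[OF assms, of x q]
    by (intro mult_right_mono mult_mono) auto
  then show ?thesis by (simp add: mult_ac)
qed

lemma esum_pterm_le:
  assumes "0 \<le> t"
  shows "esum (\<lambda>q. ennreal (cmod (pterm t f x q))) \<le> ennreal (exp (w * t)) * Rexp t (eabs f) x"
proof -
  have "esum (\<lambda>q. ennreal (cmod (pterm t f x q)))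
    \<le> esum (\<lambda>q. ennreal (exp (w * t)) * (ennreal (pathw R x q * (t ^ length q / fact (length q))) * ennreal (cmod (f (last (x # q))))))"
  proof (intro nn_integral_mono)
    fix q
    have "ennreal (cmod (pterm t f x q)) \<le> ennreal (exp (w * t) * (pathw R x q * (t ^ length q / fact (length q)) * cmod (f (last (x # q)))))"
      using pterm_le[OF assms, of f x q] by (intro ennreal_leI) (simp add: mult.assoc)
    also have "\<dots> = ennreal (exp (w * t)) * (ennreal (pathw R x q * (t ^ length q / fact (length q))) * ennreal (cmod (f (last (x # q)))))"
      by (subst ennreal_mult', simp, subst ennreal_mult'', simp, rule refl)
    finally show "ennreal (cmod (pterm t f x q)) \<le> \<dots>" .
  qed
  also have "\<dots> = ennreal (exp (w * t)) * Rexp t (eabs f) x"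
    unfolding Rexp_def by (rule nn_integral_cmult) simp
  finally show ?thesis .
qed

lemma Rexp_H:
  assumes "f \<in> H" "0 \<le> t"
  shows "esq (Rexp t (eabs f)) \<le> ennreal ((exp (t * C) * nrm f)\<^sup>2)" "Rexp t (eabs f) x < \<infinity>"
proof -
  show 1: "esq (Rexp t (eabs f)) \<le> ennreal ((exp (t * C) * nrm f)\<^sup>2)"
    using esq_Rexp[OF assms(2), of "eabs f"] nrm_esum[OF assms(1)]
    by (simp add: ennreal_mult[symmetric] power_mult_distrib)
  have "(Rexp t (eabs f) x)\<^sup>2 * ennreal (m x) < \<infinity>"
    using order_trans[OF esum_point 1] le_less_trans by (metis ennreal_less_top infinity_ennreal_def)
  then show "Rexp t (eabs f) x < \<infinity>"
    using m_pos[of x] by (cases "Rexp t (eabs f) x") (auto simp: power2_eq_square ennreal_top_mult ennreal_mult_top)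
qed

lemma tsummable_pterm: "f \<in> H \<Longrightarrow> 0 \<le> t \<Longrightarrow> tsummable (pterm t f x)"
  using esum_pterm_le[of t f x] Rexp_H(2)[of f t x]
  by (intro tsummableI) (auto simp: ennreal_mult_less_top intro: le_less_trans)

lemma U_le: "0 \<le> t \<Longrightarrow> ennreal (cmod (U t f x)) \<le> ennreal (exp (w * t)) * Rexp t (eabs f) x"
  unfolding U_def by (rule order_trans[OF tsum_norm_le esum_pterm_le])

lemma
  assumes f: "f \<in> H" and t: "0 \<le> t"
  shows U_H: "U t f \<in> H" and U_bound: "nrm (U t f) \<le> exp (w * t) * exp (t * C) * nrm f"
proof -
  have "esq (\<lambda>x. ennreal (exp (w * t)) * Rexp t (eabs f) x) = ennreal ((exp (w * t))\<^sup>2) * esq (Rexp t (eabs f))"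
    by (simp add: power_mult_distrib ennreal_power nn_integral_cmult mult.assoc)
  also have "\<dots> \<le> ennreal ((exp (w * t))\<^sup>2) * ennreal ((exp (t * C) * nrm f)\<^sup>2)"
    by (intro mult_left_mono Rexp_H f t) auto
  also have "\<dots> = ennreal ((exp (w * t) * exp (t * C) * nrm f)\<^sup>2)"
    by (simp add: ennreal_mult[symmetric] power_mult_distrib mult.assoc)
  finally have "esq (\<lambda>x. ennreal (exp (w * t)) * Rexp t (eabs f) x) \<le> ennreal ((exp (w * t) * exp (t * C) * nrm f)\<^sup>2)" .
  from H_esumI[OF this U_le[OF t]]
  show "U t f \<in> H" "nrm (U t f) \<le> exp (w * t) * exp (t * C) * nrm f" by auto
qed

lemma U_lin:
  assumes "f \<in> H" "g \<in> H" "0 \<le> t"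
  shows "U t (\<lambda>x. c * f x + g x) x = c * U t f x + U t g x"
proof -
  have "pterm t (\<lambda>x. c * f x + g x) x = (\<lambda>q. c * pterm t f x q + pterm t g x q)"
    by (simp add: pterm_def fun_eq_iff algebra_simps del: last.simps)
  then show ?thesis
    unfolding U_def infsetsum_def using tsummable_pterm assms by simp
qed

lemma U_bop: "0 \<le> t \<Longrightarrow> bounded_operator m (U t)"
  unfolding bounded_operator_def using U_H U_lin U_bound by blast

lemma tsum_single: "(\<And>q. q \<noteq> z \<Longrightarrow> F q = 0) \<Longrightarrow> tsum F = F z"
  by (subst infsetsum_cong_neutral[where B = "{z}" and g = F]) auto

lemma U_0: "U 0 f = f"
proof
  fix x
  have "U 0 f x = pterm 0 f x []"
    unfolding U_def by (rule tsum_single) (simp add: pterm_def dexp_at_0)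
  then show "U 0 f x = f x" by (simp add: pterm_def)
qed

text \<open>Two composable paths correspond to one path with a marked position, namely that of the
  vertex at which they are joined.\<close>

lemma bij_split: "bij_betw (\<lambda>(q, r). (q @ r, length q)) UNIV (Sigma UNIV (\<lambda>l :: 'a list. {..length l}))"
  by (rule bij_betwI[where g = "\<lambda>(l, j). (take j l, drop j l)"]) auto

text \<open>The double sum is regrouped by concatenated path and marked position; for a fixed path
  the sum over positions is the splitting formula \<open>dexp_split\<close>.\<close>

lemma U_add:
  assumes f: "f \<in> H" and s: "0 \<le> s" and t: "0 \<le> t"
  shows "U (s + t) f = U s (U t f)"
proof
  fix x
  define G where "G = (\<lambda>(q :: 'a list, r). pathw K x q * dexp (map a (x # q)) s * pterm t f (last (x # q)) r)"
  have "esum (\<lambda>q. esum (\<lambda>r. ennreal (cmod (G (q, r))))) < \<infinity>"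
  proof -
    \<comment> \<open>The inner absolute sums are at most exp(wt) times \<open>Rexp t\<close> of
      |f|. As this function lies in the Hilbert space, the outer sum is again a convergent path sum,
      now for \<open>g\<close>.\<close>
    define g where "g = (\<lambda>x. complex_of_real (enn2real (Rexp t (eabs f) x)))"
    have ge: "eabs g = Rexp t (eabs f)"
      using Rexp_H(2)[OF f t] by (auto simp: g_def fun_eq_iff)
    have g: "g \<in> H"
      using H_esumI(1)[of "Rexp t (eabs f)" "exp (t * C) * nrm f" g] Rexp_H(1)[OF f t] by (simp add: ge[unfolded fun_eq_iff])
    have "esum (\<lambda>q. esum (\<lambda>r. ennreal (cmod (G (q, r))))) \<le> esum (\<lambda>q. ennreal (exp (w * t)) * ennreal (cmod (pterm s g x q)))"
    proof (intro nn_integral_mono)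
      fix q
      let ?c = "pathw K x q * dexp (map a (x # q)) s"
      have "esum (\<lambda>r. ennreal (cmod (G (q, r)))) = ennreal (cmod ?c) * esum (\<lambda>r. ennreal (cmod (pterm t f (last (x # q)) r)))"
        by (subst nn_integral_cmult[symmetric]) (auto simp: G_def norm_mult ennreal_mult mult.assoc simp del: last.simps)
      also have "\<dots> \<le> ennreal (cmod ?c) * (ennreal (exp (w * t)) * Rexp t (eabs f) (last (x # q)))"
        by (intro mult_left_mono esum_pterm_le t) auto
      also have "\<dots> = ennreal (cmod ?c) * (ennreal (exp (w * t)) * eabs g (last (x # q)))"
        by (simp only: fun_cong[OF ge, of "last (x # q)"])
      also have "\<dots> = ennreal (exp (w * t)) * ennreal (cmod (pterm s g x q))"
        by (simp add: pterm_def norm_mult ennreal_mult mult_ac del: last.simps)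
      finally show "esum (\<lambda>r. ennreal (cmod (G (q, r)))) \<le> \<dots>" .
    qed
    also have "\<dots> = ennreal (exp (w * t)) * esum (\<lambda>q. ennreal (cmod (pterm s g x q)))"
      by (rule nn_integral_cmult) simp
    also have "\<dots> < \<infinity>"
      using tsummableD[OF tsummable_pterm[OF g s]] by (simp add: ennreal_mult_less_top)
    finally show ?thesis .
  qed
  then have G: "tsummable G"
    by (intro tsummableI) (simp add: nn_integral_fst_count_space[symmetric])
  define F where "F = (\<lambda>(l, j). pathw K x l * dexp (map a (take (Suc j) (x # l))) s * dexp (map a (drop j (x # l))) t * f (last (x # l)))"
  have GF: "G (q, r) = F (q @ r, length q)" for q r
  proof -
    have *: "drop (length q) (x # q @ r) = last (x # q) # r"
      by (cases q rule: rev_cases) auto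
    have **: "last (x # q @ r) = last (last (x # q) # r)" by (cases r) auto
    show ?thesis unfolding G_def F_def pterm_def prod.case * ** pathw_append
      by (simp add: mult_ac del: last.simps)
  qed
  have GF': "G = (\<lambda>p. F ((\<lambda>(q, r). (q @ r, length q)) p))"
    using GF by (auto simp: fun_eq_iff)
  have Fs: "integrable (count_space (Sigma UNIV (\<lambda>l :: 'a list. {..length l}))) F"
    using G unfolding GF' abs_summable_on_def[symmetric] abs_summable_on_reindex_bij_betw[OF bij_split] .
  have "U s (U t f) x = tsum (\<lambda>q. tsum (\<lambda>r. G (q, r)))"
  proof -
    have "tsum (\<lambda>r. G (q, r)) = pterm s (U t f) x q" for q
      unfolding G_def prod.case U_def pterm_def[of s] infsetsum_def
      using tsummable_pterm[OF f t, of "last (x # q)"] by simp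
    then show ?thesis by (simp add: U_def)
  qed
  also have "\<dots> = tsum G"
    using infsetsum_Times[of UNIV UNIV G] G by (simp add: abs_summable_on_def UNIV_Times_UNIV)
  also have "\<dots> = infsetsum F (Sigma UNIV (\<lambda>l. {..length l}))"
    unfolding GF' by (rule infsetsum_reindex_bij_betw[OF bij_split])
  also have "\<dots> = tsum (\<lambda>l. infsetsum (\<lambda>j. F (l, j)) {..length l})"
    by (rule infsetsum_Sigma) (use Fs in \<open>auto simp: abs_summable_on_def\<close>)
  also have "\<dots> = U (s + t) f x"
    unfolding U_def
  proof (intro infsetsum_cong refl)
    fix l :: "'a list"
    have "pterm (s + t) f x l = pathw K x l * (\<Sum>j<length (map a (x # l)). dexp (take (Suc j) (map a (x # l))) s * dexp (drop j (map a (x # l))) t) * f (last (x # l))"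
      unfolding pterm_def by (subst dexp_split[OF _ s t]) auto
    also have "\<dots> = (\<Sum>j<Suc (length l). F (l, j))"
      unfolding sum_distrib_left sum_distrib_right F_def prod.case
      by (intro sum.cong) (simp, simp only: take_map drop_map mult.assoc)
    finally show "infsetsum (\<lambda>j. F (l, j)) {..length l} = pterm (s + t) f x l"
      by (simp add: lessThan_Suc_atMost)
  qed
  finally show "U (s + t) f x = U s (U t f) x" by simp
qed

text \<open>For t at most 1, a path of at least n steps contributes at most t^n exp(w) times its
  dominating weight at time 1. All remainders are thus controlled by the single envelope
  \<open>Rexp 1\<close>.\<close>

lemma remainder_le:
  assumes f: "f \<in> H" and t: "0 \<le> t" "t \<le> 1"
  shows "ennreal (cmod (U t f x - tsum (\<lambda>q. if length q < n then pterm t f x q else 0)))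
     \<le> ennreal (exp w * t ^ n) * Rexp 1 (eabs f) x"
proof -
  let ?F = "\<lambda>q. if length q < n then 0 else pterm t f x q"
  have s: "tsummable (\<lambda>q. if length q < n then pterm t f x q else 0)"
    by (rule Bochner_Integration.integrable_bound[OF tsummable_pterm[OF f t(1), of x]]) auto
  have "U t f x - tsum (\<lambda>q. if length q < n then pterm t f x q else 0)
     = tsum (\<lambda>q. pterm t f x q - (if length q < n then pterm t f x q else 0))"
    unfolding U_def infsetsum_def using tsummable_pterm[OF f t(1), of x] s by simp
  also have "\<dots> = tsum ?F" by (intro infsetsum_cong) auto
  finally have "ennreal (cmod (U t f x - tsum (\<lambda>q. if length q < n then pterm t f x q else 0)))
     \<le> esum (\<lambda>q. ennreal (cmod (?F q)))" using tsum_norm_le[of ?F] by simp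
  also have "\<dots> \<le> esum (\<lambda>q. ennreal (exp w * t ^ n) *
      (ennreal (pathw R x q * (1 ^ length q / fact (length q))) * eabs f (last (x # q))))"
  proof (intro nn_integral_mono)
    fix q
    let ?P = "pathw R x q * (1 ^ length q / fact (length q))"
    have "cmod (?F q) \<le> exp w * t ^ n * (?P * cmod (f (last (x # q))))"
    proof (cases "length q < n")
      case False
      have "t ^ length q \<le> t ^ n" using t False by (intro power_decreasing) auto
      moreover have "exp (w * t) \<le> exp w" using w_ge t by (simp add: mult_left_le)
      ultimately have "exp (w * t) * t ^ length q \<le> exp w * t ^ n"
        using t by (intro mult_mono) auto
      then have "(exp (w * t) * t ^ length q) * (?P * cmod (f (last (x # q)))) \<le> (exp w * t ^ n) * (?P * cmod (f (last (x # q))))"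
        by (intro mult_right_mono) auto
      then show ?thesis using pterm_le[OF t(1), of f x q] False by (simp add: mult_ac del: last.simps)
    qed (use t in auto)
    then have "ennreal (cmod (?F q)) \<le> ennreal (exp w * t ^ n * (?P * cmod (f (last (x # q)))))"
      by (rule ennreal_leI)
    also have "\<dots> = ennreal (exp w * t ^ n) * (ennreal ?P * eabs f (last (x # q)))"
      by (subst ennreal_mult', simp add: t, subst ennreal_mult'', simp, rule refl)
    finally show "ennreal (cmod (?F q)) \<le> \<dots>" .
  qed
  also have "\<dots> = ennreal (exp w * t ^ n) * Rexp 1 (eabs f) x"
    unfolding Rexp_def by (rule nn_integral_cmult) simp
  finally show ?thesis .
qed

lemma nrm_le_Rexp:
  assumes f: "f \<in> H" and c: "0 \<le> c" and le: "\<And>x. ennreal (cmod (g x)) \<le> ennreal c * Rexp 1 (eabs f) x"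
  shows "g \<in> H" "nrm g \<le> c * (exp C * nrm f)"
proof -
  have "esq (\<lambda>x. ennreal c * Rexp 1 (eabs f) x) = ennreal (c\<^sup>2) * esq (Rexp 1 (eabs f))"
    using c by (simp add: power_mult_distrib ennreal_power nn_integral_cmult mult.assoc)
  also have "\<dots> \<le> ennreal (c\<^sup>2) * ennreal ((exp (1 * C) * nrm f)\<^sup>2)"
    by (intro mult_left_mono Rexp_H f) auto
  also have "\<dots> = ennreal ((c * (exp C * nrm f))\<^sup>2)"
    by (simp add: ennreal_mult[symmetric] power_mult_distrib)
  finally have 1: "esq (\<lambda>x. ennreal c * Rexp 1 (eabs f) x) \<le> ennreal ((c * (exp C * nrm f))\<^sup>2)" .
  show "g \<in> H" "nrm g \<le> c * (exp C * nrm f)"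
    by (rule H_esumI[OF 1 le]; use c in simp)+
qed

lemma first_order:
  "tsum (\<lambda>q. if length q < 1 then pterm t f x q else 0) = exp (a x * of_real t) * f x"
  by (subst tsum_single[of "[]"]) (auto simp: pterm_def)

lemma second_order:
  assumes f: "f \<in> H" and t: "0 \<le> t"
  shows "tsum (\<lambda>q. if length q < 2 then pterm t f x q else 0)
     = exp (a x * of_real t) * f x + tsum (\<lambda>y. K x y * f y * dexp [a x, a y] t)"
proof -
  let ?F = "\<lambda>n q. if length q = n then pterm t f x q else 0"
  have s: "tsummable (?F n)" for n
    by (rule Bochner_Integration.integrable_bound[OF tsummable_pterm[OF f t, of x]]) auto
  have "tsum (\<lambda>q. if length q < 2 then pterm t f x q else 0) = tsum (\<lambda>q. ?F 0 q + ?F 1 q)"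
    by (intro infsetsum_cong) (auto simp: less_2_cases_iff)
  also have "\<dots> = tsum (?F 0) + tsum (?F 1)"
    unfolding infsetsum_def using s[of 0] s[of 1] by (intro Bochner_Integration.integral_add) auto
  also have "tsum (?F 0) = exp (a x * of_real t) * f x"
    by (subst tsum_single[of "[]"]) (auto simp: pterm_def)
  also have "tsum (?F 1) = infsetsum (pterm t f x) (range (\<lambda>y. [y]))"
    by (intro infsetsum_cong_neutral) (auto simp: length_Suc_conv)
  also have "\<dots> = tsum (\<lambda>y. pterm t f x [y])"
    by (intro infsetsum_reindex) (auto simp: inj_on_def)
  also have "\<dots> = tsum (\<lambda>y. K x y * f y * dexp [a x, a y] t)"
    by (intro infsetsum_cong) (auto simp: pterm_def mult_ac simp del: dexp.simps)
  finally show ?thesis .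
qed

lemma exp_a_le: "0 \<le> t \<Longrightarrow> t \<le> 1 \<Longrightarrow> cmod (exp (a x * of_real t)) \<le> exp w"
proof -
  assume t: "0 \<le> t" "t \<le> 1"
  have "Re (a x) * t \<le> w * t" using a_le t by (intro mult_right_mono) auto
  also have "\<dots> \<le> w" using t w_ge by (simp add: mult_left_le)
  finally show ?thesis by simp
qed

lemma eventually_small: "\<forall>\<^sub>F t in at_right 0. 0 < t \<and> t \<le> (1::real)"
  unfolding eventually_at_right_field by (intro exI[of _ 1]) auto

lemma U_cont0:
  assumes f: "f \<in> H"
  shows "((\<lambda>t. nrm (\<lambda>x. U t f x - f x)) \<longlongrightarrow> 0) (at_right 0)"
proof (rule Lim_null_comparison)
  let ?e = "\<lambda>t x. exp (a x * of_real t) * f x"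
  have lim2: "((\<lambda>t. nrm (\<lambda>x. ?e t x - f x)) \<longlongrightarrow> 0) (at_right 0)"
  proof (rule dominated_convergence_H[OF f, where c = "exp w + 1"])
    show "\<forall>\<^sub>F t in at_right 0. \<forall>x. cmod (?e t x - f x) \<le> (exp w + 1) * cmod (f x)"
      using eventually_small
    proof eventually_elim
      case (elim t)
      show ?case
      proof
        fix x
        have "cmod (?e t x - f x) \<le> cmod (?e t x) + cmod (f x)" by (rule norm_triangle_ineq4)
        also have "cmod (?e t x) \<le> exp w * cmod (f x)"
          unfolding norm_mult using elim by (intro mult_right_mono exp_a_le) auto
        finally show "cmod (?e t x - f x) \<le> (exp w + 1) * cmod (f x)" by (simp add: algebra_simps)
      qed
    qed
    show "((\<lambda>t. ?e t x - f x) \<longlongrightarrow> 0) (at_right 0)" for x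
      by (rule tendsto_eq_intros refl | simp)+
  qed
  show "((\<lambda>t. exp w * t ^ 1 * (exp C * nrm f) + nrm (\<lambda>x. ?e t x - f x)) \<longlongrightarrow> 0) (at_right 0)"
    by (rule tendsto_add_zero[OF _ lim2]) (rule tendsto_eq_intros refl | simp)+
  show "\<forall>\<^sub>F t in at_right 0. norm (nrm (\<lambda>x. U t f x - f x))
      \<le> exp w * t ^ 1 * (exp C * nrm f) + nrm (\<lambda>x. ?e t x - f x)"
    using eventually_small
  proof eventually_elim
    case (elim t)
    have *: "ennreal (cmod (U t f x - ?e t x)) \<le> ennreal (exp w * t ^ 1) * Rexp 1 (eabs f) x" for x
      using remainder_le[OF f, of t x 1] elim first_order[of t f x] by simp
    have A: "(\<lambda>x. U t f x - ?e t x) \<in> H" "nrm (\<lambda>x. U t f x - ?e t x) \<le> exp w * t ^ 1 * (exp C * nrm f)"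
      by (rule nrm_le_Rexp[OF f _ *]; use elim in simp)+
    have "?e t \<in> H"
      by (rule dominated_H(1)[OF f, where c = "exp w"])
        (use elim in \<open>auto simp: norm_mult intro!: mult_right_mono exp_a_le[simplified]\<close>)
    then have B: "(\<lambda>x. ?e t x - f x) \<in> H" using f by (intro diff_H)
    show ?case using nrm_triangle[OF A(1) B] A(2) by simp
  qed
qed

lemma U_C0: "C0_semigroup m U"
  unfolding C0_semigroup_def using U_bop U_0 U_add U_cont0 by blast

lemma dexp2_le:
  assumes t: "0 < t" "t \<le> 1" and c: "Re c1 \<le> w" "Re c2 \<le> w"
  shows "cmod (dexp [c1, c2] t / of_real t - 1) \<le> exp w + 1"
proof -
  have "cmod (dexp [c1, c2] t) \<le> exp (w * t) * t"
    using dexp_bound[of c1 "[c2]" w t] t c by auto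
  also have "\<dots> \<le> exp w * t" using t w_ge by (simp add: mult_left_le)
  finally have "cmod (dexp [c1, c2] t / of_real t) \<le> exp w"
    using t by (simp add: norm_divide field_simps)
  then show ?thesis using norm_triangle_ineq4[of "dexp [c1, c2] t / of_real t" 1] by simp
qed

text \<open>The diagonal error is written with \<open>dexp [a x, 0] t\<close>, which stands for
  (exp(a t) - 1) / a without a division by a. Diagonal and off-diagonal errors then vanish for the
  same reason, \<open>dexp2_quotient_lim\<close>.\<close>

lemma U_quotient:
  assumes f: "f \<in> H" and t: "0 < t"
  shows "(U t f x - f x) / of_real t - (a x * f x + Kop f x)
    = (U t f x - tsum (\<lambda>q. if length q < 2 then pterm t f x q else 0)) / of_real t
      + a x * f x * (dexp [a x, 0] t / of_real t - 1)
      + tsum (\<lambda>y. K x y * f y * (dexp [a x, a y] t / of_real t - 1))"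
proof -
  have s1: "tsummable (\<lambda>y. K x y * f y)" by (rule tsummable_Kop[OF f])
  have s2: "tsummable (\<lambda>y. K x y * f y * (dexp [a x, a y] t / of_real t))"
  proof (rule Bochner_Integration.integrable_bound)
    show "integrable (count_space UNIV) (\<lambda>y. of_real (exp (w * t)) * (K x y * f y))" using s1 by simp
    have "cmod (dexp [a x, a y] t / of_real t) \<le> exp (w * t)" for y
      using dexp_bound[of "a x" "[a y]" w t] t a_le by (auto simp: norm_divide field_simps)
    then have "norm (K x y * f y * (dexp [a x, a y] t / of_real t)) \<le> cmod (K x y * f y) * exp (w * t)" for y
      unfolding norm_mult[of "K x y * f y"] by (intro mult_left_mono) auto
    then show "AE y in count_space UNIV. norm (K x y * f y * (dexp [a x, a y] t / of_real t))
        \<le> norm (of_real (exp (w * t)) * (K x y * f y))"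
      by (simp add: AE_count_space norm_mult mult_ac del: dexp.simps)
  qed simp
  have "tsum (\<lambda>y. K x y * f y * (dexp [a x, a y] t / of_real t - 1))
     = tsum (\<lambda>y. K x y * f y * (dexp [a x, a y] t / of_real t)) - Kop f x"
    unfolding Kop_def infsetsum_def right_diff_distrib mult_1_right using s1 s2
    by (rule Bochner_Integration.integral_diff[rotated])
  also have "tsum (\<lambda>y. K x y * f y * (dexp [a x, a y] t / of_real t)) = tsum (\<lambda>y. K x y * f y * dexp [a x, a y] t) / of_real t"
    unfolding infsetsum_def times_divide_eq_right by (rule integral_divide_zero)
  finally have 1: "tsum (\<lambda>y. K x y * f y * (dexp [a x, a y] t / of_real t - 1)) =
     tsum (\<lambda>y. K x y * f y * dexp [a x, a y] t) / of_real t - Kop f x" .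
  have 2: "a x * f x * (dexp [a x, 0] t / of_real t - 1) = (exp (a x * of_real t) - 1) * f x / of_real t - a x * f x"
    unfolding exp_minus_1_eq_dexp[OF less_imp_le[OF t]] using t by (simp add: field_simps del: dexp.simps)
  show ?thesis
    unfolding 1 2 second_order[OF f less_imp_le[OF t]] using t by (simp add: field_simps)
qed

lemma Kop_error_lim:
  assumes f: "f \<in> H"
  shows "((\<lambda>t. tsum (\<lambda>y. K x y * f y * (dexp [a x, a y] t / of_real t - 1))) \<longlongrightarrow> 0) (at_right 0)"
proof -
  have "((\<lambda>t. tsum (\<lambda>y. K x y * f y * (dexp [a x, a y] t / of_real t - 1))) \<longlongrightarrow> tsum (\<lambda>y. K x y * f y * (1 - 1))) (at 0 within {0<..1})"
  proof (rule tsum_dominated)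
    show "esum (\<lambda>y. ennreal ((exp w + 1) * cmod (K x y * f y))) < \<infinity>"
      using tsummableD[OF tsummable_Kop[OF f, of x]]
      by (simp add: ennreal_mult nn_integral_cmult ennreal_mult_less_top)
    fix t :: real and y assume t: "t \<in> {0<..1}"
    have "cmod (K x y * f y * (dexp [a x, a y] t / of_real t - 1)) \<le> cmod (K x y * f y) * (exp w + 1)"
      unfolding norm_mult[of "K x y * f y"] using t a_le by (intro mult_left_mono dexp2_le) auto
    then show "cmod (K x y * f y * (dexp [a x, a y] t / of_real t - 1)) \<le> (exp w + 1) * cmod (K x y * f y)"
      by (simp only: mult.commute)
  next
    fix y
    have "((\<lambda>t. dexp [a x, a y] t / of_real t) \<longlongrightarrow> 1) (at 0 within {0<..1})"
      by (rule tendsto_mono[OF _ dexp2_quotient_lim]) (auto intro: at_le)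
    then show "((\<lambda>t. K x y * f y * (dexp [a x, a y] t / of_real t - 1)) \<longlongrightarrow> K x y * f y * (1 - 1)) (at 0 within {0<..1})"
      by (intro tendsto_intros)
  qed
  moreover have "at 0 within {0<..1} = at_right (0::real)"
    by (rule at_within_nhd[of 0 "{..<1}"]) auto
  ultimately show ?thesis by simp
qed

lemma remainder2:
  assumes f: "f \<in> H" and t: "0 < t" "t \<le> 1"
  defines "r \<equiv> \<lambda>x. (U t f x - tsum (\<lambda>q. if length q < 2 then pterm t f x q else 0)) / of_real t"
  shows "r \<in> H" "nrm r \<le> exp w * t * (exp C * nrm f)"
proof -
  have *: "ennreal (cmod (r x)) \<le> ennreal (exp w * t) * Rexp 1 (eabs f) x" for x
  proof -
    let ?d = "U t f x - tsum (\<lambda>q. if length q < 2 then pterm t f x q else 0)"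
    have "ennreal (cmod (r x)) = ennreal (1 / t) * ennreal (cmod ?d)"
      using t by (simp add: r_def norm_divide ennreal_mult[symmetric])
    also have "\<dots> \<le> ennreal (1 / t) * (ennreal (exp w * t ^ 2) * Rexp 1 (eabs f) x)"
      using t by (intro mult_left_mono remainder_le f) auto
    also have "\<dots> = ennreal (exp w * t) * Rexp 1 (eabs f) x"
      using t by (simp add: mult.assoc[symmetric] ennreal_mult[symmetric] power2_eq_square)
    finally show ?thesis .
  qed
  show "r \<in> H" "nrm r \<le> exp w * t * (exp C * nrm f)"
    by (rule nrm_le_Rexp[OF f _ *]; use t in simp)+
qed

lemma remainder2_lim: "((\<lambda>t. exp w * t * (exp C * nrm f)) \<longlongrightarrow> 0) (at_right 0)"
  by (rule tendsto_eq_intros refl | simp)+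

text \<open>At a fixed point the orbit of every f in H is differentiable at 0, even if a f is not in
  H. This identifies any strong derivative and so yields the domain in
  \<open>generator_U\<close>.\<close>

lemma U_pointwise_deriv:
  assumes f: "f \<in> H"
  shows "((\<lambda>t. (U t f x - f x) / of_real t) \<longlongrightarrow> a x * f x + Kop f x) (at_right 0)"
proof (rule LIM_zero_cancel, rule Lim_transform_eventually)
  let ?r = "\<lambda>t x. (U t f x - tsum (\<lambda>q. if length q < 2 then pterm t f x q else 0)) / of_real t"
  have 1: "((\<lambda>t. ?r t x) \<longlongrightarrow> 0) (at_right 0)"
  proof (rule Lim_null_comparison)
    show "\<forall>\<^sub>F t in at_right 0. norm (?r t x) \<le> exp w * t * (exp C * nrm f) / sqrt (m x)"
      using eventually_small
    proof eventually_elim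
      case (elim t)
      have "norm (?r t x) \<le> nrm (?r t) / sqrt (m x)"
        using elim by (intro point_le_nrm remainder2 f) auto
      also have "\<dots> \<le> exp w * t * (exp C * nrm f) / sqrt (m x)"
        using elim by (intro divide_right_mono remainder2 f) auto
      finally show ?case .
    qed
    show "((\<lambda>t. exp w * t * (exp C * nrm f) / sqrt (m x)) \<longlongrightarrow> 0) (at_right 0)"
      using tendsto_divide_zero[OF remainder2_lim] .
  qed
  have 2: "((\<lambda>t. a x * f x * (dexp [a x, 0] t / of_real t - 1)) \<longlongrightarrow> 0) (at_right 0)"
    using tendsto_mult_left[OF LIM_zero[OF dexp2_quotient_lim[of "a x" 0]], of "a x * f x"] by (simp del: dexp.simps)
  show "((\<lambda>t. ?r t x + a x * f x * (dexp [a x, 0] t / of_real t - 1)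
      + tsum (\<lambda>y. K x y * f y * (dexp [a x, a y] t / of_real t - 1))) \<longlongrightarrow> 0) (at_right 0)"
    by (intro tendsto_add_zero 1 2 Kop_error_lim f)
  show "\<forall>\<^sub>F t in at_right 0. ?r t x + a x * f x * (dexp [a x, 0] t / of_real t - 1)
      + tsum (\<lambda>y. K x y * f y * (dexp [a x, a y] t / of_real t - 1))
      = (U t f x - f x) / of_real t - (a x * f x + Kop f x)"
    using eventually_small by eventually_elim (subst U_quotient[OF f], auto)
qed

lemma U_deriv:
  assumes f: "f \<in> H" and af: "(\<lambda>x. a x * f x) \<in> H"
  shows "((\<lambda>t. nrm (\<lambda>x. (U t f x - f x) / of_real t - (a x * f x + Kop f x))) \<longlongrightarrow> 0) (at_right 0)"
proof (rule Lim_null_comparison)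
  let ?r = "\<lambda>t x. (U t f x - tsum (\<lambda>q. if length q < 2 then pterm t f x q else 0)) / of_real t"
  let ?p = "\<lambda>t x. a x * f x * (dexp [a x, 0] t / of_real t - 1)"
  let ?k = "\<lambda>t x. tsum (\<lambda>y. K x y * f y * (dexp [a x, a y] t / of_real t - 1))"
  let ?g = "\<lambda>x. complex_of_real (enn2real (Rop (eabs f) x))"
  have p_le: "cmod (?p t x) \<le> (exp w + 1) * cmod (a x * f x)" if "0 < t" "t \<le> 1" for t x
  proof -
    have "cmod (?p t x) \<le> cmod (a x * f x) * (exp w + 1)"
      unfolding norm_mult[of "a x * f x"] using that a_le w_ge by (intro mult_left_mono dexp2_le) auto
    then show ?thesis by (simp only: mult.commute)
  qed
  have p: "((\<lambda>t. nrm (?p t)) \<longlongrightarrow> 0) (at_right 0)"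
  proof (rule dominated_convergence_H[OF af])
    show "\<forall>\<^sub>F t in at_right 0. \<forall>x. cmod (?p t x) \<le> (exp w + 1) * cmod (a x * f x)"
      using eventually_small by eventually_elim (use p_le in blast)
    show "((\<lambda>t. ?p t x) \<longlongrightarrow> 0) (at_right 0)" for x
      using tendsto_mult_left[OF LIM_zero[OF dexp2_quotient_lim[of "a x" 0]], of "a x * f x"] by (simp del: dexp.simps)
  qed
  have k_le: "cmod (?k t x) \<le> (exp w + 1) * cmod (?g x)" if t: "0 < t" "t \<le> 1" for t x
  proof -
    have "ennreal (cmod (?k t x)) \<le> esum (\<lambda>y. ennreal (cmod (K x y * f y * (dexp [a x, a y] t / of_real t - 1))))"
      by (rule tsum_norm_le)
    also have "\<dots> \<le> esum (\<lambda>y. ennreal (exp w + 1) * ennreal (cmod (K x y * f y)))"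
    proof (intro nn_integral_mono)
      fix y
      have "cmod (K x y * f y * (dexp [a x, a y] t / of_real t - 1)) \<le> cmod (K x y * f y) * (exp w + 1)"
        unfolding norm_mult[of "K x y * f y"] using t a_le by (intro mult_left_mono dexp2_le) auto
      then have "ennreal (cmod (K x y * f y * (dexp [a x, a y] t / of_real t - 1))) \<le> ennreal ((exp w + 1) * cmod (K x y * f y))"
        by (intro ennreal_leI) (simp only: mult.commute)
      then show "ennreal (cmod (K x y * f y * (dexp [a x, a y] t / of_real t - 1))) \<le> ennreal (exp w + 1) * ennreal (cmod (K x y * f y))"
        by (simp add: ennreal_mult del: dexp.simps)
    qed
    also have "\<dots> = ennreal (exp w + 1) * esum (\<lambda>y. ennreal (cmod (K x y * f y)))"
      by (rule nn_integral_cmult) simp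
    also have "\<dots> \<le> ennreal (exp w + 1) * Rop (eabs f) x"
      by (intro mult_left_mono esum_Kop_le) simp
    also have "\<dots> = ennreal ((exp w + 1) * cmod (?g x))"
      using Rop_finite[OF f, of x] by (simp add: ennreal_mult)
    finally show ?thesis by (subst (asm) ennreal_le_iff) auto
  qed
  have k: "((\<lambda>t. nrm (?k t)) \<longlongrightarrow> 0) (at_right 0)"
  proof (rule dominated_convergence_H[OF Rop_H[OF f]])
    show "\<forall>\<^sub>F t in at_right 0. \<forall>x. cmod (?k t x) \<le> (exp w + 1) * cmod (?g x)"
      using eventually_small by eventually_elim (use k_le in blast)
    show "((\<lambda>t. ?k t x) \<longlongrightarrow> 0) (at_right 0)" for x by (rule Kop_error_lim[OF f])
  qed
  show "((\<lambda>t. exp w * t * (exp C * nrm f) + nrm (?p t) + nrm (?k t)) \<longlongrightarrow> 0) (at_right 0)"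
    by (intro tendsto_add_zero remainder2_lim p k)
  show "\<forall>\<^sub>F t in at_right 0. norm (nrm (\<lambda>x. (U t f x - f x) / of_real t - (a x * f x + Kop f x)))
      \<le> exp w * t * (exp C * nrm f) + nrm (?p t) + nrm (?k t)"
    using eventually_small
  proof eventually_elim
    case (elim t)
    have r: "?r t \<in> H" "nrm (?r t) \<le> exp w * t * (exp C * nrm f)" using remainder2[OF f] elim by auto
    have pH: "?p t \<in> H" by (rule dominated_H(1)[OF af p_le]) (use elim in auto)
    have kH: "?k t \<in> H" by (rule dominated_H(1)[OF Rop_H[OF f] k_le]) (use elim in auto)
    have "nrm (\<lambda>x. (U t f x - f x) / of_real t - (a x * f x + Kop f x)) = nrm (\<lambda>x. ?r t x + ?p t x + ?k t x)"
      using U_quotient[OF f, of t] elim by (intro arg_cong[where f = nrm]) auto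
    also have "\<dots> \<le> nrm (\<lambda>x. ?r t x + ?p t x) + nrm (?k t)" by (rule nrm_triangle[OF add_H[OF r(1) pH] kH])
    also have "nrm (\<lambda>x. ?r t x + ?p t x) \<le> nrm (?r t) + nrm (?p t)" by (rule nrm_triangle[OF r(1) pH])
    finally show ?case using r(2) by simp
  qed
qed

text \<open>A strong derivative h agrees with the pointwise one, and then a f = h - K f is in H
  because K is bounded. So the domain is the maximal domain of multiplication by a.\<close>

lemma generator_U:
  "generator m U = {(f, h). f \<in> H \<and> (\<lambda>x. a x * f x) \<in> H \<and> h = (\<lambda>x. a x * f x + Kop f x)}"
proof (intro set_eqI iffI; clarify)
  fix f h assume "(f, h) \<in> generator m U"
  then have f: "f \<in> H" and h: "h \<in> H"
    and lim: "((\<lambda>t. nrm (\<lambda>x. (U t f x - f x) / of_real t - h x)) \<longlongrightarrow> 0) (at_right 0)"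
    by (auto simp: generator_def)
  have "h x = a x * f x + Kop f x" for x
  proof (rule tendsto_unique[OF _ nrm_imp_pointwise[OF lim _ h] U_pointwise_deriv[OF f]])
    show "\<forall>\<^sub>F t in at_right 0. (\<lambda>x. (U t f x - f x) / of_real t) \<in> H"
      using eventually_small
    proof eventually_elim
      case (elim t)
      show ?case
        using scale_H[OF diff_H[OF U_H[OF f, of t] f], of "1 / of_real t"] elim by simp
    qed
  qed simp
  then have h': "h = (\<lambda>x. a x * f x + Kop f x)" by auto
  have "(\<lambda>x. h x - Kop f x) \<in> H" by (intro diff_H h Kop_H f)
  then show "f \<in> H \<and> (\<lambda>x. a x * f x) \<in> H \<and> h = (\<lambda>x. a x * f x + Kop f x)"
    using f h' by simp
next
  fix f h assume "f \<in> H" "(\<lambda>x. a x * f x) \<in> H"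
  then show "(f, \<lambda>x. a x * f x + Kop f x) \<in> generator m U"
    unfolding generator_def using U_deriv Kop_H add_H by auto
qed

lemma Cc_scale: "f \<in> Cc \<Longrightarrow> (\<lambda>x. c x * f x) \<in> Cc"
  unfolding Cc_def by (auto elim!: finite_subset[rotated])

lemma op_exp_U:
  assumes "f \<in> H" "0 \<le> t"
  shows "op_exp m {(f, h). f \<in> H \<and> (\<lambda>x. a x * f x) \<in> H \<and> h = (\<lambda>x. a x * f x + Kop f x)} t f = U t f"
  by (rule op_exp_eq[OF U_C0 generator_U _ assms]) (auto simp: Domain_iff Cc_H Cc_scale)

end


section \<open>Bounded perturbations of multiplication forms\<close>

lemma infsum_diff:
  fixes f g :: "'i \<Rightarrow> complex"
  assumes "f summable_on A" "g summable_on A"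
  shows "infsum (\<lambda>x. f x - g x) A = infsum f A - infsum g A"
  using infsum_add[OF assms(1), of "\<lambda>x. - g x"] assms(2)
  by (simp add: infsum_uminus summable_on_uminus)

context weight
begin

lemma
  assumes "f \<in> H" "g \<in> H"
  shows inner_summable: "(\<lambda>x. f x * cnj (g x) * of_real (m x)) summable_on UNIV"
    and inner_le: "cmod (ell2_inner m f g) \<le> nrm f * nrm g"
proof -
  let ?F = "\<lambda>x. f x * cnj (g x) * of_real (m x)"
  have le: "(\<Sum>x\<in>A. cmod (?F x)) \<le> nrm f * nrm g" if A: "finite A" for A
  proof -
    have "(\<Sum>x\<in>A. cmod (?F x)) = (\<Sum>x\<in>A. \<bar>wabs f x\<bar> * \<bar>wabs g x\<bar>)"
      by (intro sum.cong) (auto simp: norm_mult abs_mult)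
    also have "\<dots> \<le> L2_set (wabs f) A * L2_set (wabs g) A" by (rule L2_set_mult_ineq)
    also have "\<dots> \<le> nrm f * nrm g"
      using A assms by (intro mult_mono L2_set_le_nrm) auto
    finally show ?thesis .
  qed
  have s: "(\<lambda>x. cmod (?F x)) summable_on UNIV"
    by (rule nonneg_bounded_partial_sums_imp_summable_on[where C = "nrm f * nrm g"])
      (use le in \<open>auto intro!: eventually_finite_subsets_at_top_weakI\<close>)
  then show "?F summable_on UNIV" by (rule abs_summable_summable)
  have "cmod (ell2_inner m f g) \<le> (\<Sum>\<^sub>\<infinity>x. cmod (?F x))"
    unfolding ell2_inner_def using s by (rule norm_infsum_bound)
  also have "\<dots> \<le> nrm f * nrm g"
    using s le by (intro infsum_le_finite_sums) auto
  finally show "cmod (ell2_inner m f g) \<le> nrm f * nrm g" .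
qed

lemma inner_diff_left:
  assumes "f \<in> H" "g \<in> H" "h \<in> H"
  shows "ell2_inner m (\<lambda>x. f x - g x) h = ell2_inner m f h - ell2_inner m g h"
  unfolding ell2_inner_def left_diff_distrib
  by (rule infsum_diff[OF inner_summable[OF assms(1,3)] inner_summable[OF assms(2,3)]])

lemma inner_diff_right:
  assumes "f \<in> H" "g \<in> H" "h \<in> H"
  shows "ell2_inner m h (\<lambda>x. f x - g x) = ell2_inner m h f - ell2_inner m h g"
  unfolding ell2_inner_def left_diff_distrib right_diff_distrib complex_cnj_diff
  by (rule infsum_diff[OF inner_summable[OF assms(3,1)] inner_summable[OF assms(3,2)]])

lemma inner_self: "f \<in> H \<Longrightarrow> ell2_inner m f f = of_real ((nrm f)\<^sup>2)"
proof -
  assume f: "f \<in> H"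
  have "ell2_inner m f f = (\<Sum>\<^sub>\<infinity>x. complex_of_real ((cmod (f x))\<^sup>2 * m x))"
    unfolding ell2_inner_def
    by (simp add: complex_norm_square del: of_real_power)
  also have "\<dots> = of_real (\<Sum>\<^sub>\<infinity>x. (cmod (f x))\<^sup>2 * m x)"
    using f by (intro infsumI has_sum_bounded_linear[OF bounded_linear_of_real] has_sum_infsum) (simp add: ell2_def)
  finally show ?thesis unfolding nrm_sq .
qed

lemma inner_single: "ell2_inner m f (\<lambda>y. if y = x then 1 else 0) = f x * of_real (m x)"
proof -
  have "ell2_inner m f (\<lambda>y. if y = x then 1 else 0) = infsum (\<lambda>y. f y * of_real (m y)) {x}"
    unfolding ell2_inner_def by (intro infsum_cong_neutral) auto
  then show ?thesis by simp
qed

lemma single_Cc: "(\<lambda>y. if y = x then c else 0) \<in> Cc"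
  unfolding Cc_def using finite_subset[of _ "{x}"] by auto

lemma inner_tendsto:
  assumes "(\<lambda>n. nrm (\<lambda>x. F n x - f x)) \<longlonglongrightarrow> 0" "(\<lambda>n. nrm (\<lambda>x. G n x - g x)) \<longlonglongrightarrow> 0"
    and F: "\<And>n. F n \<in> H" and G: "\<And>n. G n \<in> H" and f: "f \<in> H" and g: "g \<in> H"
  shows "(\<lambda>n. ell2_inner m (F n) (G n)) \<longlonglongrightarrow> ell2_inner m f g"
proof (rule LIM_zero_cancel, rule Lim_null_comparison)
  let ?a = "\<lambda>n. nrm (\<lambda>x. F n x - f x)" and ?b = "\<lambda>n. nrm (\<lambda>x. G n x - g x)"
  have "(\<lambda>n. ?a n * ?b n + ?a n * nrm g + nrm f * ?b n) \<longlonglongrightarrow> 0 * 0 + 0 * nrm g + nrm f * 0"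
    by (intro tendsto_intros assms)
  then show "(\<lambda>n. ?a n * ?b n + ?a n * nrm g + nrm f * ?b n) \<longlonglongrightarrow> 0" by simp
  show "\<forall>\<^sub>F n in sequentially. norm (ell2_inner m (F n) (G n) - ell2_inner m f g) \<le> ?a n * ?b n + ?a n * nrm g + nrm f * ?b n"
  proof (intro always_eventually allI)
    fix n
    have A: "(\<lambda>x. F n x - f x) \<in> H" and B: "(\<lambda>x. G n x - g x) \<in> H" by (intro diff_H F G f g)+
    have eq: "ell2_inner m (F n) (G n) - ell2_inner m f g =
      ell2_inner m (\<lambda>x. F n x - f x) (\<lambda>x. G n x - g x) + ell2_inner m (\<lambda>x. F n x - f x) g
        + ell2_inner m f (\<lambda>x. G n x - g x)"
      unfolding inner_diff_right[OF G g A] inner_diff_right[OF G g f]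
        inner_diff_left[OF F f G] inner_diff_left[OF F f g] by simp
    have "norm (ell2_inner m (F n) (G n) - ell2_inner m f g) \<le> cmod (ell2_inner m (\<lambda>x. F n x - f x) (\<lambda>x. G n x - g x))
        + cmod (ell2_inner m (\<lambda>x. F n x - f x) g) + cmod (ell2_inner m f (\<lambda>x. G n x - g x))"
      unfolding eq by (intro order_trans[OF norm_triangle_ineq] add_right_mono norm_triangle_ineq)
    also have "\<dots> \<le> ?a n * ?b n + ?a n * nrm g + nrm f * ?b n"
      using inner_le[OF A B] inner_le[OF A g] inner_le[OF f B] by linarith
    finally show "norm (ell2_inner m (F n) (G n) - ell2_inner m f g) \<le> ?a n * ?b n + ?a n * nrm g + nrm f * ?b n" .
  qed
qed

end

text \<open>The form norm is equivalent to the norm of \<open>ell2 \<mu>\<close> with \<open>\<mu> = (D + c0 + 1) m\<close>, which is therefore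
  the domain of the closure.\<close>

locale perturbed_form = bounded_kernel m R C K
  for m :: "'a::countable \<Rightarrow> real" and R C K +
  fixes D :: "'a \<Rightarrow> real" and c0 :: real
    and q :: "('a \<Rightarrow> complex) \<Rightarrow> ('a \<Rightarrow> complex) \<Rightarrow> complex"
  assumes D_ge: "- c0 \<le> D x" and c0_ge: "0 \<le> c0"
    and q_Cc: "f \<in> Cc \<Longrightarrow> g \<in> Cc \<Longrightarrow> q f g = ell2_inner m (\<lambda>x. of_real (D x) * f x) g - ell2_inner m (Kop f) g"
begin

definition \<mu> :: "'a \<Rightarrow> real" where "\<mu> x = (D x + c0 + 1) * m x"

lemma m_le_\<mu>: "m x \<le> \<mu> x"
  using D_ge[of x] m_ge[of x] mult_right_mono[of 1 "D x + c0 + 1" "m x"] by (simp add: \<mu>_def)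

lemma \<mu>_pos: "0 < \<mu> x"
  using m_le_\<mu>[of x] m_pos[of x] by linarith

sublocale w: weight \<mu>
  by unfold_locales (rule \<mu>_pos)

lemma
  assumes "f \<in> w.H" shows \<mu>_H: "f \<in> H" and nrm_le_\<mu>: "nrm f \<le> w.nrm f"
proof -
  have *: "L2_set (wabs f) F \<le> w.nrm f" if "finite F" for F
    by (rule order_trans[OF _ w.L2_set_le_nrm[OF assms that]])
      (intro L2_set_mono mult_left_mono; simp add: m_le_\<mu>)
  show "f \<in> H" "nrm f \<le> w.nrm f" by (rule ell2_boundI[OF *]; assumption)+
qed

text \<open>The extension of \<open>q\<close> to the form domain. There D f may fail to be in H, so
  its pairing with g is expressed by two inner products that do converge.\<close>

definition qb :: "('a \<Rightarrow> complex) \<Rightarrow> ('a \<Rightarrow> complex) \<Rightarrow> complex" where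
  "qb f g = ell2_inner \<mu> f g - of_real (c0 + 1) * ell2_inner m f g - ell2_inner m (Kop f) g"

lemma inner_D:
  assumes "f \<in> w.H" "g \<in> w.H"
  shows "ell2_inner m (\<lambda>x. of_real (D x) * f x) g = ell2_inner \<mu> f g - of_real (c0 + 1) * ell2_inner m f g"
proof -
  have "ell2_inner m (\<lambda>x. of_real (D x) * f x) g = (\<Sum>\<^sub>\<infinity>x. f x * cnj (g x) * of_real (\<mu> x) - of_real (c0 + 1) * (f x * cnj (g x) * of_real (m x)))"
    unfolding ell2_inner_def by (intro infsum_cong) (simp add: \<mu>_def algebra_simps)
  also have "\<dots> = ell2_inner \<mu> f g - (\<Sum>\<^sub>\<infinity>x. of_real (c0 + 1) * (f x * cnj (g x) * of_real (m x)))"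
    unfolding ell2_inner_def
    by (intro infsum_diff w.inner_summable assms summable_on_cmult_right inner_summable \<mu>_H)
  also have "(\<Sum>\<^sub>\<infinity>x. of_real (c0 + 1) * (f x * cnj (g x) * of_real (m x))) = of_real (c0 + 1) * ell2_inner m f g"
    unfolding ell2_inner_def by (intro infsum_cmult_right inner_summable \<mu>_H assms)
  finally show ?thesis .
qed

lemma q_eq_qb: "f \<in> Cc \<Longrightarrow> g \<in> Cc \<Longrightarrow> q f g = qb f g"
  by (simp add: q_Cc qb_def inner_D w.Cc_H)

text \<open>Both estimates come from q(h, h) = |h|_mu^2 - (c0 + 1) |h|^2 - <K h, h>, where the last
  term is at most C |h|^2 in modulus.\<close>

lemma q_self:
  assumes "h \<in> Cc"
  shows "(w.nrm h)\<^sup>2 \<le> cmod (q h h) + (c0 + 1 + C) * (nrm h)\<^sup>2"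
    and "cmod (q h h) \<le> (c0 + 2 + C) * (w.nrm h)\<^sup>2"
proof -
  have h: "h \<in> w.H" using assms by (rule w.Cc_H)
  have hm: "h \<in> H" by (rule \<mu>_H[OF h])
  have q: "q h h = of_real ((w.nrm h)\<^sup>2) - of_real (c0 + 1) * of_real ((nrm h)\<^sup>2) - ell2_inner m (Kop h) h"
    unfolding q_eq_qb[OF assms assms] qb_def w.inner_self[OF h] inner_self[OF hm] ..
  have K: "cmod (ell2_inner m (Kop h) h) \<le> C * (nrm h)\<^sup>2"
    using order_trans[OF inner_le[OF Kop_H[OF hm] hm] mult_right_mono[OF Kop_bound[OF hm] nrm_ge]]
    by (simp add: power2_eq_square mult.assoc)
  have "complex_of_real ((w.nrm h)\<^sup>2) = q h h + of_real ((c0 + 1) * (nrm h)\<^sup>2) + ell2_inner m (Kop h) h"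
    unfolding q by simp
  then have "(w.nrm h)\<^sup>2 = cmod (q h h + of_real ((c0 + 1) * (nrm h)\<^sup>2) + ell2_inner m (Kop h) h)"
    by (metis norm_of_real abs_of_nonneg zero_le_power2)
  also have "\<dots> \<le> cmod (q h h) + cmod (of_real ((c0 + 1) * (nrm h)\<^sup>2)) + cmod (ell2_inner m (Kop h) h)"
    by (intro order_trans[OF norm_triangle_ineq] add_right_mono norm_triangle_ineq)
  also have "cmod (of_real ((c0 + 1) * (nrm h)\<^sup>2)) = (c0 + 1) * (nrm h)\<^sup>2"
    unfolding norm_of_real using c0_ge by (intro abs_of_nonneg mult_nonneg_nonneg) auto
  finally show "(w.nrm h)\<^sup>2 \<le> cmod (q h h) + (c0 + 1 + C) * (nrm h)\<^sup>2"
    using K by (simp add: algebra_simps)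
  have "cmod (q h h) \<le> cmod (of_real ((w.nrm h)\<^sup>2)) + cmod (of_real (c0 + 1) * of_real ((nrm h)\<^sup>2)) + cmod (ell2_inner m (Kop h) h)"
    unfolding q by (intro order_trans[OF norm_triangle_ineq4] add_right_mono norm_triangle_ineq4)
  also have "\<dots> = (w.nrm h)\<^sup>2 + (c0 + 1) * (nrm h)\<^sup>2 + cmod (ell2_inner m (Kop h) h)"
    unfolding norm_mult norm_of_real using c0_ge by simp
  also have "\<dots> \<le> (w.nrm h)\<^sup>2 + (c0 + 1) * (nrm h)\<^sup>2 + C * (nrm h)\<^sup>2" using K by simp
  also have "\<dots> = (w.nrm h)\<^sup>2 + (c0 + 1 + C) * (nrm h)\<^sup>2" by (simp add: algebra_simps)
  also have "\<dots> \<le> (w.nrm h)\<^sup>2 + (c0 + 1 + C) * (w.nrm h)\<^sup>2"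
    using nrm_le_\<mu>[OF h] c0_ge C_pos by (intro add_left_mono mult_left_mono power_mono) auto
  finally show "cmod (q h h) \<le> (c0 + 2 + C) * (w.nrm h)\<^sup>2" by (simp add: algebra_simps)
qed

lemma Cc_diff: "f \<in> Cc \<Longrightarrow> g \<in> Cc \<Longrightarrow> (\<lambda>x. f x - g x) \<in> Cc"
  unfolding Cc_def by (auto intro: finite_subset[of _ "{x. f x \<noteq> 0} \<union> {x. g x \<noteq> 0}"])

text \<open>A form-Cauchy sequence that converges in H is Cauchy in the norm of
  \<open>\<mu>\<close>. Completeness there gives a limit, and the common pointwise limit identifies
  it with f.\<close>

lemma form_convergesD:
  assumes "form_converges m Cc q F f"
  shows "f \<in> w.H" "(\<lambda>n. w.nrm (\<lambda>x. F n x - f x)) \<longlonglongrightarrow> 0"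
proof -
  have F: "\<And>n. F n \<in> Cc" and f: "f \<in> H" and lim: "(\<lambda>n. nrm (\<lambda>x. F n x - f x)) \<longlonglongrightarrow> 0"
    and C: "form_Cauchy q F" using assms by (auto simp: form_converges_def)
  have FH: "F n \<in> H" for n by (rule Cc_H[OF F])
  have pw: "(\<lambda>n. F n x) \<longlonglongrightarrow> f x" for x
    by (rule nrm_imp_pointwise[OF lim _ f]) (simp add: FH)
  let ?c = "c0 + 1 + C"
  have c: "0 < ?c" using c0_ge C_pos by simp
  have "\<exists>N. \<forall>n\<ge>N. \<forall>k\<ge>N. w.nrm (\<lambda>x. F n x - F k x) < e" if e: "e > 0" for e
  proof -
    \<comment> \<open>Chosen so that (c0 + 1 + C) (2 d)^2 = e^2 / 2, half of the budget; the
      form-Cauchy condition pays the other half.\<close>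
    define d where "d = e / (2 * sqrt (2 * ?c))"
    have d: "0 < d" using e c by (simp add: d_def)
    obtain N1 where N1: "\<And>n k. n \<ge> N1 \<Longrightarrow> k \<ge> N1 \<Longrightarrow> cmod (q (\<lambda>x. F n x - F k x) (\<lambda>x. F n x - F k x)) < e\<^sup>2 / 2"
      using C e unfolding form_Cauchy_def by (metis half_gt_zero zero_less_power)
    obtain N2 where N2: "\<And>n. n \<ge> N2 \<Longrightarrow> nrm (\<lambda>x. F n x - f x) < d"
      using order_tendstoD(2)[OF lim d] by (auto simp: eventually_sequentially)
    have "w.nrm (\<lambda>x. F n x - F k x) < e" if n: "n \<ge> max N1 N2" "k \<ge> max N1 N2" for n k
    proof -
      have "nrm (\<lambda>x. F n x - F k x) \<le> 2 * d"
        using nrm_triangle3[OF FH[of n] f FH[of k]] N2[of n] N2[of k] n nrm_minus_commute[of f "F k"] by simp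
      then have "(nrm (\<lambda>x. F n x - F k x))\<^sup>2 \<le> (2 * d)\<^sup>2" by (intro power_mono) auto
      also have "(2 * d)\<^sup>2 = e\<^sup>2 / (2 * ?c)" using c by (simp add: d_def power_divide real_sqrt_pow2)
      finally have "?c * (nrm (\<lambda>x. F n x - F k x))\<^sup>2 \<le> e\<^sup>2 / 2"
        using c by (simp add: field_simps)
      then have "(w.nrm (\<lambda>x. F n x - F k x))\<^sup>2 < e\<^sup>2"
        using q_self(1)[OF Cc_diff[OF F F], of n k] N1[of n k] n by simp
      then show ?thesis using e power2_less_imp_less[of "w.nrm (\<lambda>x. F n x - F k x)" e] by simp
    qed
    then show ?thesis by blast
  qed
  from w.complete_H[OF w.Cc_H[OF F] pw this]
  show "f \<in> w.H" "(\<lambda>n. w.nrm (\<lambda>x. F n x - f x)) \<longlonglongrightarrow> 0" by auto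
qed

lemma trunc_form_converges:
  assumes f: "f \<in> w.H"
  shows "form_converges m Cc q (\<lambda>n. trunc n f) f"
proof -
  have T: "trunc n f \<in> w.H" for n by (rule w.Cc_H[OF trunc_Cc])
  have lim: "(\<lambda>n. w.nrm (\<lambda>x. trunc n f x - f x)) \<longlonglongrightarrow> 0"
    using w.trunc_lim[OF f] by (simp add: w.trunc_def trunc_def)
  have "(\<lambda>n. nrm (\<lambda>x. trunc n f x - f x)) \<longlonglongrightarrow> 0"
    by (rule Lim_null_comparison[OF _ lim]) (intro always_eventually allI, use nrm_le_\<mu>[OF w.diff_H[OF T f]] in simp)
  moreover have "form_Cauchy q (\<lambda>n. trunc n f)"
    unfolding form_Cauchy_def
  proof (intro allI impI)
    fix e :: real assume e: "0 < e"
    let ?c = "c0 + 2 + C"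
    have c: "0 < ?c" using c0_ge C_pos by simp
    define d where "d = sqrt (e / ?c) / 2"
    have d: "0 < d" using e c by (simp add: d_def)
    obtain N where N: "\<And>n. n \<ge> N \<Longrightarrow> w.nrm (\<lambda>x. trunc n f x - f x) < d"
      using order_tendstoD(2)[OF lim d] by (auto simp: eventually_sequentially)
    have "cmod (q (\<lambda>x. trunc n f x - trunc k f x) (\<lambda>x. trunc n f x - trunc k f x)) < e" if n: "n \<ge> N" "k \<ge> N" for n k
    proof -
      have "w.nrm (\<lambda>x. trunc n f x - trunc k f x) < 2 * d"
        using w.nrm_triangle3[OF T[of n] f T[of k]] N[of n] N[of k] n w.nrm_minus_commute[of f "trunc k f"] by simp
      then have "(w.nrm (\<lambda>x. trunc n f x - trunc k f x))\<^sup>2 < (2 * d)\<^sup>2" by (intro power_strict_mono) auto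
      also have "(2 * d)\<^sup>2 = e / ?c" using c e by (simp add: d_def)
      finally have "?c * (w.nrm (\<lambda>x. trunc n f x - trunc k f x))\<^sup>2 < e" using c by (simp add: field_simps)
      then show ?thesis using q_self(2)[OF Cc_diff[OF trunc_Cc trunc_Cc], of n f k f] by simp
    qed
    then show "\<exists>N. \<forall>n\<ge>N. \<forall>k\<ge>N. cmod (q (\<lambda>x. trunc n f x - trunc k f x) (\<lambda>x. trunc n f x - trunc k f x)) < e"
      by blast
  qed
  ultimately show ?thesis unfolding form_converges_def using trunc_Cc \<mu>_H[OF f] by auto
qed

lemma closure_domain_eq: "closure_domain m Cc q = w.H"
  unfolding closure_domain_def by (auto dest: form_convergesD(1) intro!: exI trunc_form_converges)

lemma q_tendsto:
  assumes F: "form_converges m Cc q F f" and G: "form_converges m Cc q G g"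
  shows "(\<lambda>n. q (F n) (G n)) \<longlonglongrightarrow> qb f g"
proof -
  have Fc: "F n \<in> Cc" and Gc: "G n \<in> Cc" for n using F G by (auto simp: form_converges_def)
  have Fm: "(\<lambda>n. nrm (\<lambda>x. F n x - f x)) \<longlonglongrightarrow> 0" and Gm: "(\<lambda>n. nrm (\<lambda>x. G n x - g x)) \<longlonglongrightarrow> 0"
    and f: "f \<in> H" and g: "g \<in> H"
    using F G by (auto simp: form_converges_def)
  have FH: "F n \<in> H" for n by (rule Cc_H[OF Fc])
  have "(\<lambda>n. nrm (\<lambda>x. Kop (F n) x - Kop f x)) \<longlonglongrightarrow> 0"
  proof (rule Lim_null_comparison[OF _ tendsto_mult_right_zero[OF Fm]])
    have "Kop (\<lambda>x. F n x - f x) = (\<lambda>x. Kop (F n) x - Kop f x)" for n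
      unfolding Kop_def fun_eq_iff right_diff_distrib infsetsum_def
      using tsummable_Kop[OF FH] tsummable_Kop[OF f] by simp
    then show "\<forall>\<^sub>F n in sequentially. norm (nrm (\<lambda>x. Kop (F n) x - Kop f x)) \<le> C * nrm (\<lambda>x. F n x - f x)"
      using Kop_bound[OF diff_H[OF FH f]] by simp
  qed
  then have "(\<lambda>n. qb (F n) (G n)) \<longlonglongrightarrow> qb f g"
    unfolding qb_def
    by (intro tendsto_intros inner_tendsto w.inner_tendsto form_convergesD[OF F] form_convergesD[OF G]
      Fm Gm f g Cc_H w.Cc_H Fc Gc Kop_H)
  then show ?thesis using q_eq_qb[OF Fc Gc] by simp
qed

lemma closure_form_eq:
  assumes "f \<in> w.H" "g \<in> w.H"
  shows "closure_form m Cc q f g = qb f g"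
  unfolding closure_form_def
proof (rule the_equality)
  show "\<forall>F G. form_converges m Cc q F f \<longrightarrow> form_converges m Cc q G g \<longrightarrow> (\<lambda>n. q (F n) (G n)) \<longlonglongrightarrow> qb f g"
    by (intro allI impI q_tendsto)
  fix c assume c: "\<forall>F G. form_converges m Cc q F f \<longrightarrow> form_converges m Cc q G g \<longrightarrow> (\<lambda>n. q (F n) (G n)) \<longlonglongrightarrow> c"
  note T = trunc_form_converges[OF assms(1)] trunc_form_converges[OF assms(2)]
  show "c = qb f g"
    by (rule LIMSEQ_unique[OF c[rule_format, OF T] q_tendsto[OF T]])
qed

text \<open>Point masses as test functions force the formula for h. Conversely, if f and D f are in
  H, then pairing (D + c0 + 1) f with f gives the squared norm of f for \<open>\<mu>\<close>, so f
  lies in the form domain.\<close>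

lemma form_operator_eq:
  "form_operator m Cc q = {(f, h). f \<in> H \<and> (\<lambda>x. of_real (D x) * f x) \<in> H \<and> h = (\<lambda>x. of_real (D x) * f x - Kop f x)}"
proof (intro set_eqI iffI; clarify)
  fix f h assume fh: "(f, h) \<in> form_operator m Cc q"
  then have f: "f \<in> w.H" and h: "h \<in> H" and cf: "\<And>g. g \<in> w.H \<Longrightarrow> closure_form m Cc q f g = ell2_inner m h g"
    unfolding form_operator_def closure_domain_eq by auto
  have eq: "qb f g = ell2_inner m h g" if "g \<in> w.H" for g
    using cf[OF that] unfolding closure_form_eq[OF f that] .
  have "h x = of_real (D x) * f x - Kop f x" for x
  proof -
    let ?d = "\<lambda>y. if y = x then 1 else 0 :: complex"
    have "qb f ?d = ell2_inner m h ?d" by (rule eq[OF w.Cc_H[OF single_Cc]])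
    then have "(of_real (D x) * f x - Kop f x) * of_real (m x) = h x * of_real (m x)"
      unfolding qb_def inner_single w.inner_single by (simp add: \<mu>_def algebra_simps)
    then show ?thesis using m_pos[of x] by simp
  qed
  then have h': "h = (\<lambda>x. of_real (D x) * f x - Kop f x)" by auto
  have "(\<lambda>x. h x + Kop f x) \<in> H" by (intro add_H h Kop_H \<mu>_H f)
  then show "f \<in> H \<and> (\<lambda>x. of_real (D x) * f x) \<in> H \<and> h = (\<lambda>x. of_real (D x) * f x - Kop f x)"
    using h' \<mu>_H[OF f] by simp
next
  fix f assume f: "f \<in> H" and Df: "(\<lambda>x. of_real (D x) * f x) \<in> H"
  let ?g = "\<lambda>x. of_real (D x) * f x + of_real (c0 + 1) * f x"
  have g: "?g \<in> H" by (intro add_H Df scale_H f)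
  have "(\<lambda>x. ?g x * cnj (f x) * of_real (m x)) = (\<lambda>x. complex_of_real ((cmod (f x))\<^sup>2 * \<mu> x))"
    by (simp add: fun_eq_iff \<mu>_def complex_norm_square algebra_simps del: of_real_power)
  then have "(\<lambda>x. complex_of_real ((cmod (f x))\<^sup>2 * \<mu> x)) summable_on UNIV"
    using inner_summable[OF g f] by simp
  then have "(\<lambda>x. (cmod (f x))\<^sup>2 * \<mu> x) summable_on UNIV"
    using summable_on_Re by fastforce
  then have fw: "f \<in> w.H" by (simp add: ell2_def)
  have "closure_form m Cc q f k = ell2_inner m (\<lambda>x. of_real (D x) * f x - Kop f x) k" if k: "k \<in> w.H" for k
    unfolding closure_form_eq[OF fw k] qb_def inner_diff_left[OF Df Kop_H[OF f] \<mu>_H[OF k]] inner_D[OF fw k] ..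
  moreover have "(\<lambda>x. of_real (D x) * f x - Kop f x) \<in> H" by (intro diff_H Df Kop_H f)
  ultimately show "(f, \<lambda>x. of_real (D x) * f x - Kop f x) \<in> form_operator m Cc q"
    unfolding form_operator_def closure_domain_eq using fw by auto
qed

end


section \<open>Weighted graphs with bounded adjacency operator\<close>

lemma sum_le_esum: "finite A \<Longrightarrow> sum F A \<le> esum F"
proof -
  assume "finite A"
  then have "sum F A = esum (\<lambda>x. F x * indicator A x)"
    by (subst nn_integral_indicator_finite) auto
  also have "\<dots> \<le> esum F" by (intro nn_integral_mono) (auto simp: indicator_def)
  finally show ?thesis .
qed

locale wgraph =
  fixes b :: "'a::countable \<Rightarrow> 'a \<Rightarrow> real" and m :: "'a \<Rightarrow> real"
  assumes wg: "weighted_graph b m"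
begin

lemma b_ge[simp]: "0 \<le> b x y" and b_sym: "b x y = b y x" and b_diag[simp]: "b x x = 0"
  and b_summable: "(\<lambda>y. b x y) summable_on UNIV" and m_gt: "0 < m x"
  using wg unfolding weighted_graph_def by blast+

sublocale weight m by unfold_locales (rule m_gt)

definition rate :: "'a \<Rightarrow> 'a \<Rightarrow> real" where "rate x y = b x y / m x"

lemma rate_ge[simp]: "0 \<le> rate x y"
  by (simp add: rate_def)

lemma b_integrable: "integrable (count_space UNIV) (b x)"
  using b_summable[of x] unfolding abs_summable_on_def[symmetric] abs_summable_equivalent[symmetric] by simp

lemma wdeg_m: "wdeg b m x * m x = infsetsum (b x) UNIV"
  using m_gt[of x] infsetsum_infsum[of "b x" UNIV] b_integrable[of x]
  by (simp add: wdeg_def abs_summable_on_def)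

lemma wdeg_ge[simp]: "0 \<le> wdeg b m x"
  unfolding wdeg_def using b_ge m_gt by (intro divide_nonneg_pos infsum_nonneg) auto

text \<open>Expanding the product gives two diagonal terms, each summing to the degree, and two
  cross terms exchanged by swapping x and y because theta is antisymmetric. The factor 1/2
  compensates the doubling.\<close>

lemma mag_form_Cc:
  assumes \<theta>: "magnetic_potential b \<theta>" and A: "finite A" "\<And>x. x \<notin> A \<Longrightarrow> f x = 0" "\<And>x. x \<notin> A \<Longrightarrow> g x = 0"
  shows "mag_form b m v \<theta> f g = (\<Sum>x\<in>A. of_real (v x + wdeg b m x) * f x * cnj (g x) * of_real (m x))
     - (\<Sum>x\<in>A. \<Sum>y\<in>A. of_real (b x y) * exp (\<i> * of_real (\<theta> x y)) * f y * cnj (g x))"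
proof -
  define e where "e x y = exp (\<i> * complex_of_real (\<theta> x y))" for x y
  have ee: "e x y * cnj (e x y) = 1" for x y
    by (simp add: e_def exp_cnj exp_minus[symmetric] mult_exp_exp)
  have esym: "of_real (b x y) * cnj (e x y) = of_real (b y x) * e y x" for x y
  proof (cases "0 < b x y")
    case True
    then have "\<theta> y x = - \<theta> x y" using \<theta> by (auto simp: magnetic_potential_def)
    then show ?thesis by (simp add: e_def exp_cnj b_sym[of x y])
  next
    case False
    then have "b x y = 0" using b_ge[of x y] by linarith
    then show ?thesis using b_sym[of x y] by simp
  qed
  define T1 where "T1 = (\<lambda>(x, y). complex_of_real (b x y) * (f x * cnj (g x)))"
  define T3 where "T3 = (\<lambda>(x, y). complex_of_real (b x y) * e x y * f y * cnj (g x))"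
  define B where "B x = infsetsum (b x) UNIV" for x
  let ?s = "\<lambda>(x, y). (y :: 'a, x :: 'a)"
  have sw: "bij_betw ?s UNIV UNIV" by (rule bij_betwI[where g = ?s]) auto
  \<comment> \<open>Without local finiteness the diagonal term can be nonzero at infinitely many
    pairs even for finitely supported f and g. Its absolute summability comes from the finite total
    of b at each vertex.\<close>
  have T1s: "tsummable T1"
  proof (rule tsummableI)
    have "esum (\<lambda>p. ennreal (cmod (T1 p))) = esum (\<lambda>x. esum (\<lambda>y. ennreal (cmod (f x * cnj (g x))) * ennreal (b x y)))"
      unfolding nn_integral_fst_count_space[symmetric]
      by (intro nn_integral_cong) (simp add: T1_def norm_mult ennreal_mult[symmetric] mult.commute)
    also have "\<dots> = esum (\<lambda>x. ennreal (cmod (f x * cnj (g x))) * ennreal (B x))"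
      using nn_integral_conv_infsetsum[of "b _" UNIV] b_integrable
      by (simp add: nn_integral_cmult B_def abs_summable_on_def)
    also have "\<dots> = (\<Sum>x\<in>A. ennreal (cmod (f x * cnj (g x))) * ennreal (B x))"
      using A by (intro nn_integral_count_space') auto
    also have "\<dots> < \<infinity>" using A(1) by (simp add: ennreal_mult_less_top)
    finally show "esum (\<lambda>p. ennreal (cmod (T1 p))) < \<infinity>" .
  qed
  have T1: "tsum T1 = (\<Sum>x\<in>A. f x * cnj (g x) * of_real (B x))"
  proof -
    have "tsum T1 = tsum (\<lambda>x. tsum (\<lambda>y. T1 (x, y)))"
      using infsetsum_Times[of UNIV UNIV T1] T1s by (simp add: abs_summable_on_def UNIV_Times_UNIV)
    also have "\<dots> = tsum (\<lambda>x. f x * cnj (g x) * of_real (B x))"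
    proof (intro infsetsum_cong refl)
      fix x
      have "tsum (\<lambda>y. T1 (x, y)) = tsum (\<lambda>y. of_real (b x y)) * (f x * cnj (g x))"
        unfolding T1_def prod.case infsetsum_def by (rule integral_mult_left_zero)
      also have "tsum (\<lambda>y. complex_of_real (b x y)) = of_real (B x)"
        unfolding B_def by (rule infsetsum_of_real)
      finally show "tsum (\<lambda>y. T1 (x, y)) = f x * cnj (g x) * of_real (B x)" by simp
    qed
    also have "\<dots> = infsetsum (\<lambda>x. f x * cnj (g x) * of_real (B x)) A"
      using A by (intro infsetsum_cong_neutral) auto
    finally show ?thesis using A(1) by simp
  qed
  have T2s: "tsummable (\<lambda>p. T1 (?s p))" and T2: "tsum (\<lambda>p. T1 (?s p)) = tsum T1"
    using T1s infsetsum_reindex_bij_betw[OF sw, of T1] abs_summable_on_reindex_bij_betw[OF sw, of T1]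
    by (simp_all add: abs_summable_on_def)
  have T30: "T3 p = 0" if "p \<notin> A \<times> A" for p
    using that A by (cases p) (auto simp: T3_def)
  have T3s: "tsummable T3"
  proof (rule tsummableI)
    have "esum (\<lambda>p. ennreal (cmod (T3 p))) = (\<Sum>p\<in>A \<times> A. ennreal (cmod (T3 p)))"
      using A T30 by (intro nn_integral_count_space') auto
    then show "esum (\<lambda>p. ennreal (cmod (T3 p))) < \<infinity>" using A(1) by simp
  qed
  have T3: "tsum T3 = (\<Sum>x\<in>A. \<Sum>y\<in>A. T3 (x, y))"
  proof -
    have "tsum T3 = infsetsum T3 (A \<times> A)" using T30 by (intro infsetsum_cong_neutral) auto
    also have "\<dots> = (\<Sum>p\<in>A \<times> A. T3 p)" using A(1) by simp
    also have "\<dots> = (\<Sum>x\<in>A. \<Sum>y\<in>A. T3 (x, y))" by (simp add: sum.cartesian_product)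
    finally show ?thesis .
  qed
  have T4s: "tsummable (\<lambda>p. T3 (?s p))" and T4: "tsum (\<lambda>p. T3 (?s p)) = tsum T3"
    using T3s infsetsum_reindex_bij_betw[OF sw, of T3] abs_summable_on_reindex_bij_betw[OF sw, of T3]
    by (simp_all add: abs_summable_on_def)
  let ?F = "\<lambda>(x, y). of_real (b x y) * (f x - e x y * f y) * cnj (g x - e x y * g y)"
  have F': "of_real (b x y) * (f x - e x y * f y) * cnj (g x - e x y * g y)
      = (T1 (x, y) + T1 (?s (x, y))) - (T3 (x, y) + T3 (?s (x, y)))" for x y
  proof -
    have "of_real (b x y) * (f x - e x y * f y) * cnj (g x - e x y * g y)
      = of_real (b x y) * (f x * cnj (g x)) + of_real (b x y) * (e x y * cnj (e x y)) * (f y * cnj (g y))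
        - (of_real (b x y) * e x y * f y * cnj (g x) + (of_real (b x y) * cnj (e x y)) * f x * cnj (g y))"
      by (simp add: algebra_simps)
    then show ?thesis
      unfolding ee esym by (simp add: T1_def T3_def b_sym[of x y])
  qed
  have F: "?F = (\<lambda>p. (T1 p + T1 (?s p)) - (T3 p + T3 (?s p)))"
  proof
    show "?F p = (T1 p + T1 (?s p)) - (T3 p + T3 (?s p))" for p
      using F'[of "fst p" "snd p"] by (cases p) simp
  qed
  have Fs: "tsummable ?F" unfolding F
    by (intro Bochner_Integration.integrable_diff Bochner_Integration.integrable_add T1s T2s T3s T4s)
  have "tsum ?F = (tsum T1 + tsum T1) - (tsum T3 + tsum T3)"
    unfolding F infsetsum_def using T1s T2s T3s T4s T2 T4 unfolding infsetsum_def by simp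
  moreover have "(\<Sum>\<^sub>\<infinity>(x, y)\<in>{(x, y). 0 < b x y}. of_real (b x y) * (f x - e x y * f y) * cnj (g x - e x y * g y)) = tsum ?F"
  proof -
    have "infsum ?F {(x, y). 0 < b x y} = infsum ?F UNIV"
    proof (intro infsum_cong_neutral)
      fix p assume "p \<in> UNIV - {(x, y). 0 < b x y}"
      then show "?F p = 0" using b_ge[of "fst p" "snd p"] by (cases p) (auto simp del: b_ge)
    qed auto
    then show ?thesis using infsetsum_infsum[of ?F UNIV] Fs by (simp add: abs_summable_on_def)
  qed
  moreover have "(\<Sum>\<^sub>\<infinity>x. of_real (v x) * f x * cnj (g x) * of_real (m x)) = (\<Sum>x\<in>A. of_real (v x) * f x * cnj (g x) * of_real (m x))"
  proof -
    have "(\<Sum>\<^sub>\<infinity>x. of_real (v x) * f x * cnj (g x) * of_real (m x)) = (\<Sum>\<^sub>\<infinity>x\<in>A. of_real (v x) * f x * cnj (g x) * of_real (m x))"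
      using A by (intro infsum_cong_neutral) auto
    then show ?thesis using A(1) by simp
  qed
  moreover have "(\<Sum>x\<in>A. of_real (v x + wdeg b m x) * f x * cnj (g x) * of_real (m x))
     = tsum T1 + (\<Sum>x\<in>A. of_real (v x) * f x * cnj (g x) * of_real (m x))"
    unfolding T1 B_def wdeg_m[symmetric] sum.distrib[symmetric]
    by (intro sum.cong) (auto simp: algebra_simps)
  ultimately show ?thesis
    unfolding mag_form_def e_def[symmetric] T3 by (simp add: T3_def)
qed

lemma mag_form_single:
  assumes "magnetic_potential b \<theta>"
  shows "mag_form b m v \<theta> (\<lambda>y. if y = x then 1 else 0) (\<lambda>y. if y = x then 1 else 0) = of_real ((v x + wdeg b m x) * m x)"
  by (subst mag_form_Cc[OF assms, of "{x}"]) auto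

lemma nrm_single: "nrm (\<lambda>y. if y = x then 1 else 0) ^ 2 = m x"
proof -
  have "(\<Sum>\<^sub>\<infinity>y. (cmod (if y = x then 1 else 0))\<^sup>2 * m y) = (\<Sum>\<^sub>\<infinity>y\<in>{x}. m y)"
    by (intro infsum_cong_neutral) auto
  then show ?thesis unfolding nrm_sq by simp
qed

lemma potential_bounded_below:
  assumes "magnetic_potential b \<theta>" and "semibounded_form m Cc (mag_form b m v \<theta>)"
  shows "\<exists>c\<ge>0. \<forall>x. - c \<le> v x + wdeg b m x"
proof -
  obtain c where c: "\<And>f. f \<in> Cc \<Longrightarrow> - c * (nrm f)\<^sup>2 \<le> Re (mag_form b m v \<theta> f f)"
    using assms(2) unfolding semibounded_form_def by auto
  have "- c \<le> v x + wdeg b m x" for x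
  proof (rule mult_right_le_imp_le[OF _ m_gt])
    show "- c * m x \<le> (v x + wdeg b m x) * m x"
      using c[OF single_Cc[of x 1]] unfolding mag_form_single[OF assms(1)] nrm_single by simp
  qed
  then have "- \<bar>c\<bar> \<le> v x + wdeg b m x" for x
    using abs_ge_self[of c] by (meson neg_le_iff_le order_trans)
  then show ?thesis by (intro exI[of _ "\<bar>c\<bar>"]) auto
qed

text \<open>For v = -deg the diagonal of the form vanishes, and what remains is minus the quadratic
  form of b. The constant is enlarged to |c| + 1 to make it positive.\<close>

lemma finite_form_bound:
  assumes "semibounded_form m Cc (mag_form b m (\<lambda>x. - wdeg b m x) (\<lambda>_ _. 0))"
  shows "\<exists>c>0. \<forall>A f. finite A \<longrightarrow> (\<Sum>x\<in>A. \<Sum>y\<in>A. b x y * f x * f y) \<le> c * (\<Sum>x\<in>A. (f x)\<^sup>2 * m x)"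
proof -
  obtain c where c: "\<And>f. f \<in> Cc \<Longrightarrow> - c * (nrm f)\<^sup>2 \<le> Re (mag_form b m (\<lambda>x. - wdeg b m x) (\<lambda>_ _. 0) f f)"
    using assms unfolding semibounded_form_def by auto
  have "(\<Sum>x\<in>A. \<Sum>y\<in>A. b x y * f x * f y) \<le> (\<bar>c\<bar> + 1) * (\<Sum>x\<in>A. (f x)\<^sup>2 * m x)" if A: "finite A" for A and f :: "'a \<Rightarrow> real"
  proof -
    define g where "g x = (if x \<in> A then complex_of_real (f x) else 0)" for x
    have g: "g \<in> Cc" using A unfolding Cc_def g_def by (auto intro: finite_subset[of _ A])
    have "mag_form b m (\<lambda>x. - wdeg b m x) (\<lambda>_ _. 0) g g = - of_real (\<Sum>x\<in>A. \<Sum>y\<in>A. b x y * f x * f y)"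
      by (subst mag_form_Cc[OF _ A]) (auto simp: magnetic_potential_def g_def mult_ac intro!: sum.cong)
    moreover have "(nrm g)\<^sup>2 = (\<Sum>x\<in>A. (f x)\<^sup>2 * m x)"
    proof -
      have "(nrm g)\<^sup>2 = (\<Sum>\<^sub>\<infinity>x\<in>A. (f x)\<^sup>2 * m x)"
        unfolding nrm_sq by (intro infsum_cong_neutral) (auto simp: g_def)
      then show ?thesis using A by simp
    qed
    ultimately have "(\<Sum>x\<in>A. \<Sum>y\<in>A. b x y * f x * f y) \<le> c * (\<Sum>x\<in>A. (f x)\<^sup>2 * m x)"
      using c[OF g] by simp
    also have "\<dots> \<le> (\<bar>c\<bar> + 1) * (\<Sum>x\<in>A. (f x)\<^sup>2 * m x)"
      by (intro mult_right_mono sum_nonneg) auto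
    finally show ?thesis .
  qed
  then show ?thesis by (intro exI[of _ "\<bar>c\<bar> + 1"]) auto
qed

text \<open>Testing the form with \<open>f + s g\<close>, where \<open>g\<close> is the image of \<open>f\<close> under the adjacency operator.\<close>

lemma finite_rate_bound:
  assumes c: "0 < c" and form: "\<And>A f. finite A \<Longrightarrow> (\<Sum>x\<in>A. \<Sum>y\<in>A. b x y * f x * f y) \<le> c * (\<Sum>x\<in>A. (f x)\<^sup>2 * m x)"
    and A: "finite A" and F: "finite F" and f: "\<And>x. 0 \<le> f x"
  shows "(\<Sum>x\<in>A. (\<Sum>y\<in>F. rate x y * f y)\<^sup>2 * m x) \<le> (2 * c)\<^sup>2 * (\<Sum>x\<in>F. (f x)\<^sup>2 * m x)"
proof -
  define g where "g x = (\<Sum>y\<in>F. rate x y * f y)" for x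
  have g: "0 \<le> g x" for x unfolding g_def using f by (intro sum_nonneg) auto
  \<comment> \<open>The final estimate contains \<open>?X\<close> with the coefficient 2 s - 2 c
    s^2, which is largest at this value.\<close>
  define s where "s = 1 / (2 * c)"
  have s: "0 < s" using c by (simp add: s_def)
  let ?f = "\<lambda>x. if x \<in> F then f x else 0" and ?g = "\<lambda>x. if x \<in> A then g x else 0"
  define h where "h x = ?f x + s * ?g x" for x
  let ?X = "\<Sum>x\<in>A. (g x)\<^sup>2 * m x" and ?Y = "\<Sum>x\<in>F. (f x)\<^sup>2 * m x" and ?S = "A \<union> F"
  have S: "finite ?S" using A F by simp
  have X: "(\<Sum>x\<in>?S. (?g x)\<^sup>2 * m x) = ?X" using A F by (intro sum.mono_neutral_cong_right) auto
  have Y: "(\<Sum>x\<in>?S. (?f x)\<^sup>2 * m x) = ?Y" using A F by (intro sum.mono_neutral_cong_right) auto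
  have XX: "(\<Sum>x\<in>?S. \<Sum>y\<in>?S. b x y * ?g x * ?f y) = ?X"
  proof -
    have "(\<Sum>x\<in>?S. \<Sum>y\<in>?S. b x y * ?g x * ?f y) = (\<Sum>x\<in>A. \<Sum>y\<in>?S. b x y * ?g x * ?f y)"
      using A F by (intro sum.mono_neutral_right) auto
    also have "\<dots> = (\<Sum>x\<in>A. \<Sum>y\<in>F. b x y * g x * f y)"
      using A F by (intro sum.cong[OF refl] sum.mono_neutral_cong_right) auto
    also have "\<dots> = (\<Sum>x\<in>A. (g x)\<^sup>2 * m x)"
    proof (intro sum.cong refl)
      fix x
      have "(\<Sum>y\<in>F. b x y * g x * f y) = g x * m x * (\<Sum>y\<in>F. rate x y * f y)"
        unfolding sum_distrib_left using m_gt[of x] by (intro sum.cong) (auto simp: rate_def)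
      then show "(\<Sum>y\<in>F. b x y * g x * f y) = (g x)\<^sup>2 * m x"
        by (simp add: g_def[symmetric] power2_eq_square)
    qed
    finally show ?thesis .
  qed
  have XX': "(\<Sum>x\<in>?S. \<Sum>y\<in>?S. b x y * ?f x * ?g y) = ?X"
    unfolding XX[symmetric] by (subst sum.swap) (simp add: b_sym mult_ac)
  have "2 * s * ?X = (\<Sum>x\<in>?S. \<Sum>y\<in>?S. b x y * (s * ?g x) * ?f y + b x y * ?f x * (s * ?g y))"
    unfolding sum.distrib using XX XX' by (simp add: mult_ac sum_distrib_left[symmetric])
  \<comment> \<open>Expanding \<open>h\<close> twice, the two unmixed products are nonnegative since
    b, f and g are, and may be dropped.\<close>
  also have "\<dots> \<le> (\<Sum>x\<in>?S. \<Sum>y\<in>?S. b x y * h x * h y)"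
  proof (intro sum_mono)
    fix x y
    have "b x y * h x * h y = b x y * (s * ?g x) * ?f y + b x y * ?f x * (s * ?g y)
       + b x y * (?f x * ?f y) + b x y * (s * ?g x * (s * ?g y))"
      unfolding h_def by (simp only: distrib_left distrib_right)
    moreover have "0 \<le> b x y * (?f x * ?f y)" using f by (intro mult_nonneg_nonneg) auto
    moreover have "0 \<le> b x y * (s * ?g x * (s * ?g y))" using g s by (intro mult_nonneg_nonneg) auto
    ultimately show "b x y * (s * ?g x) * ?f y + b x y * ?f x * (s * ?g y) \<le> b x y * h x * h y" by linarith
  qed
  also have "\<dots> \<le> c * (\<Sum>x\<in>?S. (h x)\<^sup>2 * m x)" by (rule form[OF S])
  also have "\<dots> \<le> c * (\<Sum>x\<in>?S. 2 * ((?f x)\<^sup>2 * m x) + 2 * s\<^sup>2 * ((?g x)\<^sup>2 * m x))"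
  proof (intro mult_left_mono sum_mono)
    fix x
    have "(h x)\<^sup>2 \<le> 2 * (?f x)\<^sup>2 + 2 * s\<^sup>2 * (?g x)\<^sup>2"
      unfolding h_def using sum_squares_ge_zero[of "?f x - s * ?g x" 0]
      by (simp only: power2_sum power_mult_distrib) (simp add: power2_eq_square algebra_simps)
    then have "(h x)\<^sup>2 * m x \<le> (2 * (?f x)\<^sup>2 + 2 * s\<^sup>2 * (?g x)\<^sup>2) * m x" by (intro mult_right_mono) auto
    then show "(h x)\<^sup>2 * m x \<le> 2 * ((?f x)\<^sup>2 * m x) + 2 * s\<^sup>2 * ((?g x)\<^sup>2 * m x)" by (simp only: distrib_right mult.assoc)
  qed (use c in auto)
  also have "\<dots> = 2 * c * ?Y + 2 * c * s\<^sup>2 * ?X"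
    unfolding sum.distrib sum_distrib_left[symmetric] X Y by (simp add: algebra_simps)
  finally have "2 * s * ?X \<le> 2 * c * ?Y + 2 * c * s\<^sup>2 * ?X" .
  then have "?X / (2 * c) \<le> 2 * c * ?Y" using c by (simp add: s_def power2_eq_square field_simps)
  then have "?X \<le> (2 * c)\<^sup>2 * ?Y" using c by (simp add: field_simps power2_eq_square)
  then show ?thesis by (simp add: g_def)
qed

lemma tendsto_power2_ennreal: "(f \<longlongrightarrow> (l::ennreal)) F \<Longrightarrow> ((\<lambda>x. (f x)\<^sup>2) \<longlongrightarrow> l\<^sup>2) F"
  unfolding power2_eq_square by (intro tendsto_mult_ennreal) auto

text \<open>The finite inequality is passed to the limit first in the inner summation set, then in
  the outer one. An infinite value of f makes the right-hand side infinite, which leaves real-valued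
  f.\<close>

lemma bounded_rate:
  assumes "semibounded_form m Cc (mag_form b m (\<lambda>x. - wdeg b m x) (\<lambda>_ _. 0))"
  shows "\<exists>C. bounded_matrix m rate C"
proof -
  obtain c where c: "0 < c" and form: "\<And>A f. finite A \<Longrightarrow> (\<Sum>x\<in>A. \<Sum>y\<in>A. b x y * f x * f y) \<le> c * (\<Sum>x\<in>A. (f x)\<^sup>2 * m x)"
    using finite_form_bound[OF assms] by blast
  have "esum (\<lambda>x. (esum (\<lambda>y. ennreal (rate x y) * f y))\<^sup>2 * ennreal (m x))
      \<le> ennreal ((2 * c)\<^sup>2) * esum (\<lambda>x. (f x)\<^sup>2 * ennreal (m x))" for f
  proof (cases "\<exists>x. f x = \<infinity>")
    case True
    then obtain x where "f x = \<infinity>" by blast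
    then have "(f x)\<^sup>2 * ennreal (m x) = \<infinity>" using m_gt[of x] by (simp add: power2_eq_square ennreal_top_mult)
    then have "esum (\<lambda>x. (f x)\<^sup>2 * ennreal (m x)) = \<infinity>"
      using esum_point[of "\<lambda>x. (f x)\<^sup>2 * ennreal (m x)" x] by (simp add: top_unique)
    then show ?thesis using c by (simp add: ennreal_mult_top)
  next
    case False
    define g where "g x = enn2real (f x)" for x
    have fg: "f = (\<lambda>x. ennreal (g x))" using False by (auto simp: g_def fun_eq_iff less_top)
    have g: "0 \<le> g x" for x by (simp add: g_def)
    show ?thesis
    proof (rule esum_le)
      fix n
      let ?A = "initial_set n :: 'a set"
      have lim: "(\<lambda>k. \<Sum>x\<in>?A. (\<Sum>y\<in>initial_set k. ennreal (rate x y) * f y)\<^sup>2 * ennreal (m x))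
         \<longlonglongrightarrow> (\<Sum>x\<in>?A. (esum (\<lambda>y. ennreal (rate x y) * f y))\<^sup>2 * ennreal (m x))"
        by (intro tendsto_sum tendsto_mult_ennreal tendsto_power2_ennreal esum_lim tendsto_const)
          (use m_gt in \<open>auto simp: ennreal_eq_0_iff not_le\<close>)
      show "(\<Sum>x\<in>?A. (esum (\<lambda>y. ennreal (rate x y) * f y))\<^sup>2 * ennreal (m x)) \<le> ennreal ((2 * c)\<^sup>2) * esum (\<lambda>x. (f x)\<^sup>2 * ennreal (m x))"
      proof (rule LIMSEQ_le_const2[OF lim], intro exI allI impI)
        fix k :: nat
        have "(\<Sum>x\<in>?A. (\<Sum>y\<in>initial_set k. ennreal (rate x y) * f y)\<^sup>2 * ennreal (m x))
          = ennreal (\<Sum>x\<in>?A. (\<Sum>y\<in>initial_set k. rate x y * g y)\<^sup>2 * m x)"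
          unfolding fg using g
          by (simp add: ennreal_mult[symmetric] sum_ennreal ennreal_power sum_nonneg)
        also have "\<dots> \<le> ennreal ((2 * c)\<^sup>2 * (\<Sum>x\<in>initial_set k. (g x)\<^sup>2 * m x))"
          by (intro ennreal_leI finite_rate_bound[OF c form] g) auto
        also have "\<dots> = ennreal ((2 * c)\<^sup>2) * (\<Sum>x\<in>initial_set k. (f x)\<^sup>2 * ennreal (m x))"
          unfolding fg using g c
          by (simp add: ennreal_mult ennreal_power sum_ennreal[symmetric] sum_nonneg del: sum_ennreal)
        also have "(\<Sum>x\<in>initial_set k. (f x)\<^sup>2 * ennreal (m x)) \<le> esum (\<lambda>x. (f x)\<^sup>2 * ennreal (m x))"
          by (rule sum_le_esum) simp
        finally show "(\<Sum>x\<in>?A. (\<Sum>y\<in>initial_set k. ennreal (rate x y) * f y)\<^sup>2 * ennreal (m x))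
          \<le> ennreal ((2 * c)\<^sup>2) * esum (\<lambda>x. (f x)\<^sup>2 * ennreal (m x))" by (simp add: mult_left_mono)
      qed
    qed
  qed
  then have "bounded_matrix m rate (2 * c)"
    using c by unfold_locales auto
  then show ?thesis ..
qed

end

section \<open>Operator exponentials on a graph with bounded adjacency operator\<close>

locale bounded_graph = wgraph b m + bounded_matrix m "wgraph.rate b m" C
  for b :: "'a::countable \<Rightarrow> 'a \<Rightarrow> real" and m C
begin

text \<open>The off-diagonal part of c L(v, theta). The sign is minus because hopping is subtracted
  in L, so for c = -i every step carries the factor i.\<close>

definition hop :: "complex \<Rightarrow> ('a \<Rightarrow> 'a \<Rightarrow> real) \<Rightarrow> 'a \<Rightarrow> 'a \<Rightarrow> complex" where
  "hop c \<theta> x y = - c * exp (\<i> * of_real (\<theta> x y)) * of_real (rate x y)"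

lemma hop_le: "cmod c \<le> 1 \<Longrightarrow> cmod (hop c \<theta> x y) \<le> rate x y"
  using mult_right_mono[of "cmod c" 1 "rate x y"] by (simp add: hop_def norm_mult)

lemma op_exp_mag:
  assumes \<theta>: "magnetic_potential b \<theta>" and c: "cmod c = 1"
    and d: "0 \<le> d" "\<And>x. - d \<le> v x + wdeg b m x"
    and w: "0 \<le> w" "\<And>x. Re (c * of_real (v x + wdeg b m x)) \<le> w"
  shows "path_semigroup m rate C (hop c \<theta>) (\<lambda>x. c * of_real (v x + wdeg b m x)) w"
    and "f \<in> H \<Longrightarrow> 0 \<le> t \<Longrightarrow> op_exp m (scale_graph c (mag_op b m v \<theta>)) t f
       = path_semigroup.U (hop c \<theta>) (\<lambda>x. c * of_real (v x + wdeg b m x)) t f"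
proof -
  let ?D = "\<lambda>x. v x + wdeg b m x"
  show ps: "path_semigroup m rate C (hop c \<theta>) (\<lambda>x. c * of_real (?D x)) w"
    by unfold_locales (use hop_le c w in auto)
  interpret ps: path_semigroup m rate C "hop c \<theta>" "\<lambda>x. c * of_real (?D x)" w by (rule ps)
  \<comment> \<open>The kernel subtracted from the diagonal of L itself is \<open>hop (-1)\<close>,
    whose entries are exp(i theta) b / m with a plus sign.\<close>
  interpret B: perturbed_form m rate C "hop (-1) \<theta>" ?D d "mag_form b m v \<theta>"
  proof unfold_locales
    show B_le: "cmod (hop (-1) \<theta> x y) \<le> rate x y" for x y by (rule hop_le) simp
    interpret B: bounded_kernel m rate C "hop (-1) \<theta>" by unfold_locales (rule B_le)
    show "- d \<le> v x + wdeg b m x" for x by (rule d)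
    show "0 \<le> d" by (rule d)
    fix f g :: "'a \<Rightarrow> complex" assume fg: "f \<in> Cc" "g \<in> Cc"
    define A where "A = {x. f x \<noteq> 0} \<union> {x. g x \<noteq> 0}"
    have A: "finite A" "\<And>x. x \<notin> A \<Longrightarrow> f x = 0" "\<And>x. x \<notin> A \<Longrightarrow> g x = 0"
      using fg by (auto simp: A_def Cc_def)
    have K: "B.Kop f x = (\<Sum>y\<in>A. hop (-1) \<theta> x y * f y)" for x
    proof -
      have "B.Kop f x = infsetsum (\<lambda>y. hop (-1) \<theta> x y * f y) A"
        unfolding B.Kop_def using A by (intro infsetsum_cong_neutral) auto
      then show ?thesis using A(1) by simp
    qed
    have inn: "ell2_inner m k g = (\<Sum>x\<in>A. k x * cnj (g x) * of_real (m x))" for k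
    proof -
      have "ell2_inner m k g = (\<Sum>\<^sub>\<infinity>x\<in>A. k x * cnj (g x) * of_real (m x))"
        unfolding ell2_inner_def using A by (intro infsum_cong_neutral) auto
      then show ?thesis using A(1) by simp
    qed
    have "(\<Sum>x\<in>A. B.Kop f x * cnj (g x) * of_real (m x))
       = (\<Sum>x\<in>A. \<Sum>y\<in>A. of_real (b x y) * exp (\<i> * of_real (\<theta> x y)) * f y * cnj (g x))"
      unfolding K sum_distrib_right
    proof (intro sum.cong refl)
      fix x y
      have e: "complex_of_real (rate x y) * of_real (m x) = of_real (b x y)"
        using m_gt[of x] by (simp add: rate_def)
      have "hop (-1) \<theta> x y * f y * cnj (g x) * of_real (m x)
        = (of_real (rate x y) * of_real (m x)) * (exp (\<i> * of_real (\<theta> x y)) * f y * cnj (g x))"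
        by (simp add: hop_def mult_ac)
      then show "hop (-1) \<theta> x y * f y * cnj (g x) * of_real (m x) = of_real (b x y) * exp (\<i> * of_real (\<theta> x y)) * f y * cnj (g x)"
        unfolding e by (simp only: mult.assoc)
    qed
    then show "mag_form b m v \<theta> f g = ell2_inner m (\<lambda>x. of_real (?D x) * f x) g - ell2_inner m (B.Kop f) g"
      unfolding inn using mag_form_Cc[OF \<theta> A(1), of f g v] A(2,3) by metis
  qed
  have Kop: "ps.Kop f x = - c * B.Kop f x" for f x
    unfolding ps.Kop_def B.Kop_def infsetsum_def
    by (subst integral_mult_right_zero[symmetric]) (simp add: hop_def mult_ac)
  have c0: "c \<noteq> 0" using c by auto
  have cD: "(\<lambda>x. c * of_real (?D x) * f x) \<in> H \<longleftrightarrow> (\<lambda>x. of_real (?D x) * f x) \<in> H" for f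
    using scale_H[of "\<lambda>x. of_real (?D x) * f x" c] scale_H[of "\<lambda>x. c * of_real (?D x) * f x" "inverse c"] c0
    by (auto simp: mult.assoc[symmetric])
  have "scale_graph c (mag_op b m v \<theta>) = {(f, h). f \<in> H \<and> (\<lambda>x. c * of_real (?D x) * f x) \<in> H \<and> h = (\<lambda>x. c * of_real (?D x) * f x + ps.Kop f x)}"
    unfolding scale_graph_def mag_op_def B.form_operator_eq cD Kop
    by (auto simp: algebra_simps)
  then show "f \<in> H \<Longrightarrow> 0 \<le> t \<Longrightarrow> op_exp m (scale_graph c (mag_op b m v \<theta>)) t f = ps.U t f"
    using ps.op_exp_U by simp
qed

end


section \<open>Paths with finitely many jumps\<close>

lemma topspace_Xhat: "topspace (Xhat :: 'a option topology) = (if finite (UNIV :: 'a set) then range Some else UNIV)"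
proof -
  have "insert None (range Some) = (UNIV :: 'a option set)"
    using UNIV_option_conv by auto
  then show ?thesis by (auto simp: Xhat_def)
qed

lemma openin_Xhat_Some: "openin Xhat {Some x}"
proof -
  have o: "openin (Alexandroff_compactification (discrete_topology UNIV)) {Some x}"
    by (auto simp: openin_Alexandroff_compactification intro!: exI[of _ "{x}"])
  have "openin (subtopology (Alexandroff_compactification (discrete_topology UNIV)) (range Some)) {Some x}"
    unfolding openin_subtopology by (intro exI[of _ "{Some x}"] conjI o) auto
  with o show ?thesis by (simp add: Xhat_def)
qed

lemma openin_Xhat_not_Some: "openin Xhat (topspace Xhat - {Some x})"
proof (cases "finite (UNIV :: 'a set)")
  case True
  have o: "openin Xhat (\<Union>y\<in>-{x}. {Some y})" by (intro openin_Union) (auto intro: openin_Xhat_Some)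
  moreover have "(\<Union>y\<in>-{x}. {Some y}) = topspace Xhat - {Some x}"
    using True by (auto simp: topspace_Xhat)
  ultimately show ?thesis by simp
next
  case False
  have e: "topspace Xhat - {Some x} = insert None (Some ` (UNIV - {x}))"
    using False by (auto simp: topspace_Xhat)
  have "openin (Alexandroff_compactification (discrete_topology UNIV)) (insert None (Some ` (UNIV - {x})))"
    unfolding openin_Alexandroff_compactification
    by (intro disjI2 exI[of _ "{x}"]) (auto simp: finite_imp_compactin)
  then show ?thesis unfolding e using False by (simp add: Xhat_def)
qed

text \<open>Convergence in the compactification is exploited only through this lemma and the next
  one: near a limit, a path is eventually at a given vertex or eventually away from it.\<close>

lemma limitin_Xhat_Some: "limitin Xhat f (Some x) F \<Longrightarrow> \<forall>\<^sub>F s in F. f s = Some x"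
  using openin_Xhat_Some[of x] by (auto simp: limitin_def)

lemma limitin_Xhat_not_Some: "limitin Xhat f l F \<Longrightarrow> l \<noteq> Some x \<Longrightarrow> \<forall>\<^sub>F s in F. f s \<noteq> Some x"
  using openin_Xhat_not_Some[of x] unfolding limitin_def
  by (auto elim!: eventually_mono)

lemma option_eqI_Some: "(\<And>x. z = Some x \<longleftrightarrow> z' = Some x) \<Longrightarrow> z = z'"
  by (cases z; cases z') auto

context
  fixes \<omega> :: "real \<Rightarrow> 'a option"
  assumes \<omega>: "\<omega> \<in> paths"
begin

lemma path_topspace: "0 \<le> t \<Longrightarrow> \<omega> t \<in> topspace Xhat"
  using \<omega> by (auto simp: paths_def)

lemma path_right: "0 \<le> t \<Longrightarrow> limitin Xhat \<omega> (\<omega> t) (at_right t)"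
  using \<omega> by (auto simp: paths_def)

lemma path_left: "0 < t \<Longrightarrow> \<exists>l. limitin Xhat \<omega> l (at_left t)"
  using \<omega> by (auto simp: paths_def)

text \<open>For each vertex x the indicator of being at x is continuous on the interval and has
  finite range, hence is constant. Infinity is recognised as being at no vertex.\<close>

lemma constant_without_jumps:
  assumes s: "0 \<le> s" "s \<le> s'" and no: "\<And>u. s < u \<Longrightarrow> u \<le> s' \<Longrightarrow> \<not> jump_at \<omega> u"
  shows "\<omega> s = \<omega> s'"
proof (rule option_eqI_Some)
  fix x
  define h where "h u = (if \<omega> u = Some x then 1 else 0 :: real)" for u
  have ev: "\<forall>\<^sub>F v in F. h v = h u" if "limitin Xhat \<omega> (\<omega> u) F" for u F
  proof (cases "\<omega> u = Some x")
    case True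
    then show ?thesis using limitin_Xhat_Some[of \<omega> x F] that by (auto elim!: eventually_mono simp: h_def)
  next
    case False
    then show ?thesis using limitin_Xhat_not_Some[OF that False] by (auto elim!: eventually_mono simp: h_def)
  qed
  have "continuous_on {s..s'} h"
    unfolding continuous_on_def
  proof
    fix u assume u: "u \<in> {s..s'}"
    have R: "\<forall>\<^sub>F v in at_right u. h v = h u" using u s by (intro ev path_right) auto
    have "\<forall>\<^sub>F v in at u within {s..s'}. h v = h u"
    proof (cases "u = s")
      case True
      then show ?thesis using R by (auto simp: eventually_at_filter elim!: eventually_mono)
    next
      case False
      then have "limitin Xhat \<omega> (\<omega> u) (at_left u)"
        using no[of u] u s by (auto simp: jump_at_def)
      then have "\<forall>\<^sub>F v in at_left u. h v = h u" by (rule ev)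
      with R have "\<forall>\<^sub>F v in at u. h v = h u" by (simp add: eventually_at_split)
      then show ?thesis by (auto simp: eventually_at_filter elim: eventually_mono)
    qed
    then show "(h \<longlongrightarrow> h u) (at u within {s..s'})" by (rule tendsto_eventually)
  qed
  moreover have "finite (h ` {s..s'})" by (rule finite_subset[of _ "{0, 1}"]) (auto simp: h_def)
  ultimately have "h constant_on {s..s'}"
    using continuous_finite_range_constant[of "{s..s'}" h] by auto
  then have "h s = h s'" using s unfolding constant_on_def by auto
  then show "\<omega> s = Some x \<longleftrightarrow> \<omega> s' = Some x" by (auto simp: h_def split: if_splits)
qed

text \<open>The left limit and the value differ, so some vertex x equals exactly one of them. The
  path itself may vary near u, but the answer to whether it is at x is constant on either
  side.\<close>

lemma jump_separates:
  assumes "jump_at \<omega> u"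
  shows "\<exists>e>0. \<forall>v v'. u - e < v \<longrightarrow> v < u \<longrightarrow> u \<le> v' \<longrightarrow> v' < u + e \<longrightarrow> \<omega> v \<noteq> \<omega> v'"
proof -
  have u: "0 < u" using assms by (simp add: jump_at_def)
  obtain l where l: "limitin Xhat \<omega> l (at_left u)" using path_left[OF u] by blast
  have r: "limitin Xhat \<omega> (\<omega> u) (at_right u)" using u by (intro path_right) auto
  have "l \<noteq> \<omega> u" using l assms by (auto simp: jump_at_def)
  then obtain x where x: "(l = Some x) \<noteq> (\<omega> u = Some x)" using option_eqI_Some[of l "\<omega> u"] by blast
  have L: "\<forall>\<^sub>F v in at_left u. (\<omega> v = Some x) = (l = Some x)"
    using limitin_Xhat_Some[of \<omega> x "at_left u"] limitin_Xhat_not_Some[OF l, of x] l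
    by (cases "l = Some x") auto
  have R: "\<forall>\<^sub>F v in at_right u. (\<omega> v = Some x) = (\<omega> u = Some x)"
    using limitin_Xhat_Some[of \<omega> x "at_right u"] limitin_Xhat_not_Some[OF r, of x] r
    by (cases "\<omega> u = Some x") auto
  from L obtain a where a: "a < u" "\<And>v. a < v \<Longrightarrow> v < u \<Longrightarrow> (\<omega> v = Some x) = (l = Some x)"
    unfolding eventually_at_left_field by blast
  from R obtain c where c: "u < c" "\<And>v. u < v \<Longrightarrow> v < c \<Longrightarrow> (\<omega> v = Some x) = (\<omega> u = Some x)"
    unfolding eventually_at_right_field by blast
  show ?thesis
  proof (intro exI[of _ "min (u - a) (c - u)"] conjI allI impI)
    show "0 < min (u - a) (c - u)" using a c by simp
    fix v v' assume v: "u - min (u - a) (c - u) < v" "v < u" and v': "u \<le> v'" "v' < u + min (u - a) (c - u)"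
    have "(\<omega> v = Some x) = (l = Some x)" using v by (intro a) auto
    moreover have "(\<omega> v' = Some x) = (\<omega> u = Some x)" using v' c(2)[of v'] by (cases "v' = u") auto
    ultimately show "\<omega> v \<noteq> \<omega> v'" using x by auto
  qed
qed

end

section \<open>Jump skeletons and sampled paths\<close>

definition jumps :: "(real \<Rightarrow> 'a option) \<Rightarrow> real \<Rightarrow> real set" where
  "jumps \<omega> t = {s \<in> {0..t}. jump_at \<omega> s}"

lemma num_jumps_finite: "num_jumps \<omega> t < \<infinity> \<longleftrightarrow> finite (jumps \<omega> t)"
  and the_num_jumps: "finite (jumps \<omega> t) \<Longrightarrow> num_jumps \<omega> t = enat (card (jumps \<omega> t))"
  by (auto simp: num_jumps_def jumps_def)

definition skel :: "(real \<Rightarrow> 'a option) \<Rightarrow> real \<Rightarrow> 'a option list" where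
  "skel \<omega> t = map (\<lambda>j. \<omega> (jump_time \<omega> j)) [0..<Suc (card (jumps \<omega> t))]"

definition grid :: "(real \<Rightarrow> 'a option) \<Rightarrow> real \<Rightarrow> nat \<Rightarrow> 'a option list" where
  "grid \<omega> t n = map (\<lambda>i. \<omega> (t * real i / real n)) [0..<Suc n]"

definition grid_skel :: "(real \<Rightarrow> 'a option) \<Rightarrow> real \<Rightarrow> nat \<Rightarrow> 'a option list" where
  "grid_skel \<omega> t n = remdups_adj (grid \<omega> t n)"

locale finite_jumps =
  fixes \<omega> :: "real \<Rightarrow> 'a option" and t :: real
  assumes path: "\<omega> \<in> paths" and fin: "finite (jumps \<omega> t)" and t_ge: "0 \<le> t"
begin

abbreviation J where "J \<equiv> jumps \<omega> t"
abbreviation N where "N \<equiv> card J"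
abbreviation \<tau> where "\<tau> \<equiv> jump_time \<omega>"

text \<open>The index of the skeleton entry that is occupied at time s
  (\<open>path_rk\<close>).\<close>

definition rk :: "real \<Rightarrow> nat" where "rk s = card {u \<in> J. u \<le> s}"

lemma J_pos: "u \<in> J \<Longrightarrow> 0 < u \<and> u \<le> t"
  by (auto simp: jumps_def jump_at_def)

lemma rk_mono: "s \<le> s' \<Longrightarrow> rk s \<le> rk s'"
  unfolding rk_def using fin by (intro card_mono) auto

lemma rk_le: "rk s \<le> N"
  unfolding rk_def using fin by (intro card_mono) auto

lemma rk_t: "rk t = N"
  unfolding rk_def using J_pos by (intro arg_cong[where f = card]) auto

lemma rk_less:
  assumes "u \<in> J" "s < u" "u \<le> s'"
  shows "rk s < rk s'"
  unfolding rk_def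
proof (rule psubset_card_mono)
  have "u \<in> {u \<in> J. u \<le> s'}" "u \<notin> {u \<in> J. u \<le> s}" using assms by auto
  moreover have "{u \<in> J. u \<le> s} \<subseteq> {u \<in> J. u \<le> s'}" using assms by auto
  ultimately show "{u \<in> J. u \<le> s} \<subset> {u \<in> J. u \<le> s'}" by blast
qed (use fin in auto)

text \<open>The infimum defining the next jump time ranges over all later jumps, including those
  after t. As long as fewer than N jumps have occurred, a later one exists in \<open>J\<close>, and
  the infimum is the minimum of these finitely many.\<close>

lemma jump_time_aux: "j \<le> N \<Longrightarrow> rk (\<tau> j) = j \<and> (if j = 0 then \<tau> j = 0 else \<tau> j \<in> J)"
proof (induction j)
  case 0
  have "{u \<in> J. u \<le> 0} = {}" using J_pos by force
  then have "rk 0 = 0" unfolding rk_def by (simp only: card.empty)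
  then show ?case by simp
next
  case (Suc j)
  then have IH: "rk (\<tau> j) = j" "if j = 0 then \<tau> j = 0 else \<tau> j \<in> J" by auto
  have ge: "0 \<le> \<tau> j" using IH(2) J_pos by (auto split: if_splits intro: less_imp_le)
  define S where "S = {u \<in> J. \<tau> j < u}"
  have "S \<noteq> {}"
  proof
    assume "S = {}"
    then have "{u \<in> J. u \<le> \<tau> j} = J" by (auto simp: S_def not_less)
    then have "rk (\<tau> j) = N" by (simp add: rk_def)
    then show False using IH Suc.prems by simp
  qed
  moreover have "finite S" using fin by (simp add: S_def)
  ultimately have M: "Min S \<in> S" "\<And>u. u \<in> S \<Longrightarrow> Min S \<le> u" by auto
  have "\<tau> (Suc j) = Min S"
    unfolding jump_time.simps
  proof (rule cInf_eq_minimum)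
    show "Min S \<in> {s. \<tau> j < s \<and> jump_at \<omega> s}" using M(1) by (auto simp: S_def jumps_def)
    fix u assume u: "u \<in> {s. \<tau> j < s \<and> jump_at \<omega> s}"
    show "Min S \<le> u"
    proof (cases "u \<le> t")
      case True
      then have "u \<in> S" using u ge by (auto simp: S_def jumps_def)
      then show ?thesis by (rule M)
    next
      case False
      then show ?thesis using M(1) J_pos[of "Min S"] by (auto simp: S_def)
    qed
  qed
  moreover have "rk (Min S) = Suc j"
  proof -
    have "{u \<in> J. u \<le> Min S} = insert (Min S) {u \<in> J. u \<le> \<tau> j}"
      using M by (auto simp: S_def) (meson leI order.antisym)
    moreover have "Min S \<notin> {u \<in> J. u \<le> \<tau> j}" using M(1) by (auto simp: S_def)
    ultimately show ?thesis using IH(1) fin unfolding rk_def by simp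
  qed
  ultimately show ?case using M(1) by (simp add: S_def)
qed

lemma rk_jump_time: "j \<le> N \<Longrightarrow> rk (\<tau> j) = j"
  using jump_time_aux by blast

lemma jump_time_J: "0 < j \<Longrightarrow> j \<le> N \<Longrightarrow> \<tau> j \<in> J"
  using jump_time_aux[of j] by auto

lemma jump_time_range: "j \<le> N \<Longrightarrow> 0 \<le> \<tau> j \<and> \<tau> j \<le> t"
  using jump_time_aux[of j] J_pos[of "\<tau> j"] t_ge by (cases "j = 0") auto

lemma jump_time_le_iff: "j \<le> N \<Longrightarrow> 0 \<le> s \<Longrightarrow> \<tau> j \<le> s \<longleftrightarrow> j \<le> rk s"
proof
  assume "j \<le> N" "\<tau> j \<le> s"
  then show "j \<le> rk s" using rk_mono[of "\<tau> j" s] rk_jump_time[of j] by simp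
next
  assume j: "j \<le> N" "0 \<le> s" "j \<le> rk s"
  show "\<tau> j \<le> s"
  proof (rule ccontr)
    assume "\<not> \<tau> j \<le> s"
    then have "s < \<tau> j" by simp
    have "0 < j" using j \<open>s < \<tau> j\<close> by (cases j) auto
    then have "rk s < rk (\<tau> j)" using jump_time_J[of j] j \<open>s < \<tau> j\<close> \<open>0 < j\<close> by (intro rk_less[of "\<tau> j"]) auto
    then show False using rk_jump_time[of j] j by simp
  qed
qed

lemma path_rk: "0 \<le> s \<Longrightarrow> s \<le> t \<Longrightarrow> \<omega> s = \<omega> (\<tau> (rk s))"
proof -
  assume s: "0 \<le> s" "s \<le> t"
  have "\<omega> (\<tau> (rk s)) = \<omega> s"
  proof (rule constant_without_jumps[OF path])
    show "0 \<le> \<tau> (rk s)" using jump_time_range[OF rk_le] by blast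
    show "\<tau> (rk s) \<le> s" using jump_time_le_iff[OF rk_le s(1)] by simp
    fix u assume u: "\<tau> (rk s) < u" "u \<le> s"
    show "\<not> jump_at \<omega> u"
    proof
      assume "jump_at \<omega> u"
      then have "u \<in> J" using u s by (auto simp: jumps_def jump_at_def)
      then have "rk (\<tau> (rk s)) < rk s" using u by (intro rk_less) auto
      then show False using rk_jump_time[OF rk_le] by simp
    qed
  qed
  then show ?thesis by simp
qed

lemma jump_time_less: "j < N \<Longrightarrow> \<tau> j < \<tau> (Suc j)"
  using jump_time_le_iff[of "Suc j" "\<tau> j"] jump_time_range[of j] rk_jump_time[of j] by auto

lemma consecutive_neq:
  assumes j: "j < N" shows "\<omega> (\<tau> j) \<noteq> \<omega> (\<tau> (Suc j))"
proof -
  let ?u = "\<tau> (Suc j)"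
  have "jump_at \<omega> ?u" using jump_time_J[of "Suc j"] j by (auto simp: jumps_def)
  from jump_separates[OF path this] obtain e where e: "0 < e"
    "\<And>v v'. ?u - e < v \<Longrightarrow> v < ?u \<Longrightarrow> ?u \<le> v' \<Longrightarrow> v' < ?u + e \<Longrightarrow> \<omega> v \<noteq> \<omega> v'" by blast
  define v where "v = max (\<tau> j) (?u - e / 2)"
  have v: "?u - e < v" "v < ?u" "\<tau> j \<le> v" using e(1) jump_time_less[OF j] by (auto simp: v_def)
  have v0: "0 \<le> v" "v \<le> t" using v jump_time_range[of j] jump_time_range[of "Suc j"] j by auto
  have "rk v = j"
  proof (rule antisym)
    show "rk v \<le> j" using jump_time_le_iff[of "Suc j" v] v v0 j by auto
    show "j \<le> rk v" using jump_time_le_iff[of j v] v v0 j by auto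
  qed
  then have "\<omega> v = \<omega> (\<tau> j)" using path_rk[OF v0] by simp
  then show ?thesis using e(2)[of v ?u] v e(1) by simp
qed

lemma length_skel: "length (skel \<omega> t) = Suc N"
  by (simp add: skel_def)

lemma skel_nth: "j \<le> N \<Longrightarrow> skel \<omega> t ! j = \<omega> (\<tau> j)"
  unfolding skel_def by (subst nth_map) (auto simp del: upt_Suc)

lemma last_skel: "last (skel \<omega> t) = \<omega> t"
proof -
  have "last (skel \<omega> t) = skel \<omega> t ! N"
    using length_skel by (subst last_conv_nth) auto
  then show ?thesis using path_rk[of t] t_ge rk_t by (simp add: skel_nth)
qed

lemma gap: "\<exists>g>0. \<forall>j<N. \<tau> j + g < \<tau> (Suc j)"
proof (cases "N = 0")
  case True
  then show ?thesis by (intro exI[of _ 1]) auto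
next
  case False
  define g where "g = Min ((\<lambda>j. \<tau> (Suc j) - \<tau> j) ` {..<N}) / 2"
  have ne: "(\<lambda>j. \<tau> (Suc j) - \<tau> j) ` {..<N} \<noteq> {}" using False by auto
  have "0 < g" unfolding g_def using jump_time_less ne by (subst half_gt_zero_iff, subst Min_gr_iff) auto
  moreover have "\<tau> j + g < \<tau> (Suc j)" if "j < N" for j
  proof -
    have "2 * g \<le> \<tau> (Suc j) - \<tau> j" unfolding g_def using that by (auto intro!: Min_le)
    then show ?thesis using \<open>0 < g\<close> by linarith
  qed
  ultimately show ?thesis by blast
qed

text \<open>Once the mesh is below the smallest gap between consecutive jump times, no grid step
  skips a state and every completed holding interval contains a grid point. The last one may be
  shorter than the mesh, but it contains the grid point t.\<close>

lemma grid_skel_eventually: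
  assumes t: "0 < t"
  shows "\<forall>\<^sub>F n in sequentially. grid_skel \<omega> t n = skel \<omega> t"
proof -
  obtain g where g: "0 < g" "\<And>j. j < N \<Longrightarrow> \<tau> j + g < \<tau> (Suc j)" using gap by blast
  have "(\<lambda>n. t / real n) \<longlonglongrightarrow> 0" by (rule lim_const_over_n)
  then have "\<forall>\<^sub>F n in sequentially. t / real n < g" using order_tendstoD(2) g(1) by blast
  with eventually_gt_at_top[of 0] show ?thesis
  proof eventually_elim
    case (elim n)
    define p where "p i = t * real i / real n" for i
    have p_step: "p (Suc i) = p i + t / real n" for i by (simp add: p_def add_divide_distrib distrib_left)
    have p0: "0 \<le> p i" for i using t by (simp add: p_def)
    have pt: "p i \<le> t" if "i \<le> n" for i using that t elim by (simp add: p_def field_simps)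
    have pn: "p n = t" using elim by (simp add: p_def)
    have pm: "mono p" using t elim unfolding p_def mono_def by (auto intro!: divide_right_mono mult_left_mono)
    define f where "f i = rk (p i)" for i
    have f_step: "f (Suc i) \<le> Suc (f i)" if i: "Suc i \<le> n" for i
    proof (rule ccontr)
      assume "\<not> ?thesis"
      then have 2: "Suc (Suc (f i)) \<le> f (Suc i)" by simp
      then have le: "Suc (Suc (f i)) \<le> N" using rk_le unfolding f_def by (meson order_trans)
      have "p i < \<tau> (Suc (f i))" using jump_time_le_iff[of "Suc (f i)" "p i"] le p0 unfolding f_def by auto
      moreover have "\<tau> (Suc (Suc (f i))) \<le> p (Suc i)" using jump_time_le_iff[OF le p0] 2 unfolding f_def by auto
      ultimately show False using g(2)[of "Suc (f i)"] le p_step[of i] elim by linarith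
    qed
    have surj: "\<exists>i\<le>n. f i = j" if j: "j \<le> N" for j
    proof (cases "j = N")
      case True
      then show ?thesis using pn rk_t by (intro exI[of _ n]) (simp add: f_def)
    next
      case False
      then have jN: "j < N" using j by simp
      \<comment> \<open>The first grid index whose time is at or after the j-th jump time.\<close>
      define i where "i = nat \<lceil>\<tau> j * real n / t\<rceil>"
      have \<tau>0: "0 \<le> \<tau> j" "\<tau> j \<le> t" using jump_time_range[OF j] by auto
      have ri: "real i = of_int \<lceil>\<tau> j * real n / t\<rceil>"
        using \<tau>0 t unfolding i_def by (simp add: of_nat_nat ceiling_le_iff zero_le_ceiling less_le_trans[of "-1" 0])
      have lo: "\<tau> j * real n / t \<le> real i" and hi: "real i < \<tau> j * real n / t + 1"
        unfolding ri by linarith+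
      have a: "\<tau> j \<le> p i" using lo t elim by (simp add: p_def field_simps)
      have b: "p i < \<tau> j + t / real n" using hi t elim by (simp add: p_def field_simps)
      have "p i < \<tau> (Suc j)" using b g(2)[OF jN] elim by linarith
      then have "f i = j"
        using jump_time_le_iff[of j "p i"] jump_time_le_iff[of "Suc j" "p i"] a p0 jN unfolding f_def by auto
      moreover have "i \<le> n"
      proof (rule ccontr)
        assume "\<not> i \<le> n"
        then have "p n \<le> p (i - 1)" using pm by (auto simp: mono_def)
        moreover have "p i = p (i - 1) + t / real n" using p_step[of "i - 1"] \<open>\<not> i \<le> n\<close> by simp
        ultimately show False using pn b \<tau>0 by linarith
      qed
      ultimately show ?thesis by blast
    qed
    have len: "length (grid \<omega> t n) = Suc n" by (simp add: grid_def)
    have nth: "grid \<omega> t n ! i = \<omega> (p i)" if "i \<le> n" for i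
      using that unfolding grid_def p_def by (subst nth_map) (auto simp del: upt_Suc)
    have val: "\<omega> (p i) = \<omega> (\<tau> (f i))" if "i \<le> n" for i
      unfolding f_def using path_rk[OF p0 pt[OF that]] .
    show ?case
      unfolding grid_skel_def remdups_adj_altdef
    \<comment> \<open>\<open>f\<close> is the index map that characterises
      \<open>remdups_adj\<close>: monotone, onto, and stationary exactly between equal
      neighbours.\<close>
    proof (intro exI[of _ f] conjI allI impI)
      show "mono f" unfolding f_def using pm rk_mono by (auto simp: mono_def)
      show "f ` {0..<length (grid \<omega> t n)} = {0..<length (skel \<omega> t)}"
        unfolding len length_skel using rk_le surj
        by (fastforce simp: f_def less_Suc_eq_le image_iff)
      fix i assume i: "i < length (grid \<omega> t n)"
      show "grid \<omega> t n ! i = skel \<omega> t ! f i"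
        using i rk_le by (simp add: len nth val skel_nth f_def)
    next
      fix i assume i: "i + 1 < length (grid \<omega> t n)"
      then have i': "Suc i \<le> n" by (simp add: len)
      have eq: "grid \<omega> t n ! i = \<omega> (\<tau> (f i))" "grid \<omega> t n ! (i + 1) = \<omega> (\<tau> (f (Suc i)))"
        using nth[of i] nth[of "Suc i"] val[of i] val[of "Suc i"] i' by auto
      have m: "f i \<le> f (Suc i)" unfolding f_def using pm by (intro rk_mono) (auto simp: mono_def)
      show "grid \<omega> t n ! i = grid \<omega> t n ! (i + 1) \<longleftrightarrow> f i = f (i + 1)"
      proof (cases "f i = f (Suc i)")
        case False
        then have S: "f (Suc i) = Suc (f i)" using m f_step[OF i'] by simp
        then have "f i < N" using rk_le[of "p (Suc i)"] by (simp add: f_def)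
        then show ?thesis using consecutive_neq[of "f i"] S eq by simp
      qed (use eq in simp)
    qed
  qed
qed

section \<open>Riemann sums along a path with finitely many jumps\<close>

definition step :: "('a \<Rightarrow> real) \<Rightarrow> nat \<Rightarrow> real" where
  "step w j = ext0 w (\<omega> (\<tau> j)) - (if j = 0 then 0 else ext0 w (\<omega> (\<tau> (j - 1))))"

text \<open>Abel summation: the path function is a combination of indicators of the half-lines
  starting at the jump times, so that Riemann sums and integrals need computing for such indicators
  only.\<close>

lemma path_step:
  assumes s: "0 \<le> s" "s \<le> t"
  shows "ext0 w (\<omega> s) = (\<Sum>j\<le>N. step w j * (if \<tau> j \<le> s then 1 else 0))"
proof -
  have tele: "(\<Sum>j\<le>k. step w j) = ext0 w (\<omega> (\<tau> k))" for k
    by (induction k) (auto simp: step_def)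
  have "(\<Sum>j\<le>N. step w j * (if \<tau> j \<le> s then 1 else 0)) = (\<Sum>j\<le>N. if j \<le> rk s then step w j else 0)"
    using jump_time_le_iff s by (intro sum.cong) auto
  also have "\<dots> = (\<Sum>j\<le>rk s. step w j)"
    using rk_le[of s] by (simp add: sum.If_cases) (intro sum.cong, auto)
  finally show ?thesis using tele path_rk[OF s] by simp
qed

lemma grid_count_lim:
  assumes t: "0 < t" and u: "0 \<le> u" "u \<le> t"
  shows "(\<lambda>n. \<Sum>i<n. t / real n * (if u \<le> t * real i / real n then 1 else 0)) \<longlonglongrightarrow> t - u"
proof (rule LIM_zero_cancel, rule Lim_null_comparison)
  show "(\<lambda>n. t / real n) \<longlonglongrightarrow> 0" by (rule lim_const_over_n)
  show "\<forall>\<^sub>F n in sequentially. norm ((\<Sum>i<n. t / real n * (if u \<le> t * real i / real n then 1 else 0)) - (t - u)) \<le> t / real n"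
    using eventually_gt_at_top[of 0]
  proof eventually_elim
    case (elim n)
    \<comment> \<open>The least grid index whose time is at least u. The left-endpoint sum counts
      the indices from k to n - 1.\<close>
    define k where "k = nat \<lceil>u * real n / t\<rceil>"
    have iff: "u \<le> t * real i / real n \<longleftrightarrow> k \<le> i" for i
    proof -
      have "u \<le> t * real i / real n \<longleftrightarrow> u * real n / t \<le> real i" using t elim by (simp add: field_simps)
      then show ?thesis by (simp add: k_def nat_le_iff ceiling_le_iff)
    qed
    have "0 \<le> u * real n / t" using t u by simp
    then have rk: "real k = of_int \<lceil>u * real n / t\<rceil>" by (simp add: k_def of_nat_nat)
    have lo: "u * real n / t \<le> real k" and hi: "real k \<le> u * real n / t + 1" unfolding rk by linarith+
    have "u * real n / t \<le> real n" using u t mult_right_mono[of u t "real n"] by (simp add: pos_divide_le_eq mult.commute)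
    then have kn: "k \<le> n" by (simp add: k_def nat_le_iff ceiling_le_iff)
    have "(\<Sum>i<n. t / real n * (if u \<le> t * real i / real n then 1 else 0)) = t / real n * (\<Sum>i<n. if k \<le> i then 1 else 0)"
      unfolding iff by (simp add: sum_distrib_left)
    also have "(\<Sum>i<n. if k \<le> i then 1 else 0 :: real) = real (card {k..<n})"
    proof -
      have "{..<n} \<inter> {i. k \<le> i} = {k..<n}" by auto
      then show ?thesis by (simp add: sum.If_cases)
    qed
    also have "\<dots> = real n - real k" using kn by simp
    finally have e: "(\<Sum>i<n. t / real n * (if u \<le> t * real i / real n then 1 else 0)) - (t - u) = u - t * real k / real n"
      using elim by (simp add: field_simps)
    have "u \<le> t * real k / real n" using lo t elim by (simp add: field_simps)
    moreover have "t * real k / real n \<le> u + t / real n" using hi t elim by (simp add: field_simps)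
    ultimately show ?case unfolding e by simp
  qed
qed

lemma riemann_sum_lim:
  assumes t: "0 < t"
  shows "(\<lambda>n. \<Sum>i<n. t / real n * ext0 w (\<omega> (t * real i / real n))) \<longlonglongrightarrow> time_integral w t \<omega>"
proof -
  have "(\<lambda>n. \<Sum>j\<le>N. step w j * (\<Sum>i<n. t / real n * (if \<tau> j \<le> t * real i / real n then 1 else 0)))
    \<longlonglongrightarrow> (\<Sum>j\<le>N. step w j * (t - \<tau> j))"
    using jump_time_range by (intro tendsto_sum tendsto_mult tendsto_const grid_count_lim t) auto
  moreover have "(\<Sum>j\<le>N. step w j * (\<Sum>i<n. t / real n * (if \<tau> j \<le> t * real i / real n then 1 else 0)))
      = (\<Sum>i<n. t / real n * ext0 w (\<omega> (t * real i / real n)))" for n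
  proof -
    have "(\<Sum>i<n. t / real n * ext0 w (\<omega> (t * real i / real n)))
      = (\<Sum>i<n. \<Sum>j\<le>N. step w j * (t / real n * (if \<tau> j \<le> t * real i / real n then 1 else 0)))"
    proof (intro sum.cong refl)
      fix i assume "i \<in> {..<n}"
      then have "0 \<le> t * real i / real n" "t * real i / real n \<le> t" using t by (auto simp: field_simps)
      from path_step[OF this, of w]
      show "t / real n * ext0 w (\<omega> (t * real i / real n)) = (\<Sum>j\<le>N. step w j * (t / real n * (if \<tau> j \<le> t * real i / real n then 1 else 0)))"
        by (simp add: sum_distrib_left mult_ac)
    qed
    also have "\<dots> = (\<Sum>j\<le>N. step w j * (\<Sum>i<n. t / real n * (if \<tau> j \<le> t * real i / real n then 1 else 0)))"
      by (subst sum.swap) (simp only: sum_distrib_left)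
    finally show ?thesis by simp
  qed
  moreover have "time_integral w t \<omega> = (\<Sum>j\<le>N. step w j * (t - \<tau> j))"
  proof -
    have "set_lebesgue_integral lborel {0..t} (\<lambda>s. ext0 w (\<omega> s))
      = (\<integral>s. (\<Sum>j\<le>N. step w j * indicator {\<tau> j..t} s) \<partial>lborel)"
      unfolding set_lebesgue_integral_def
    proof (intro Bochner_Integration.integral_cong refl)
      fix s
      show "indicator {0..t} s *\<^sub>R ext0 w (\<omega> s) = (\<Sum>j\<le>N. step w j * indicator {\<tau> j..t} s)"
      proof (cases "s \<in> {0..t}")
        case True
        have "(\<Sum>j\<le>N. step w j * indicator {\<tau> j..t} s) = (\<Sum>j\<le>N. step w j * (if \<tau> j \<le> s then 1 else 0))"
          using True by (intro sum.cong) (auto simp: indicator_def)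
        then show ?thesis using True path_step[of s w] by simp
      next
        case False
        have "(\<Sum>j\<le>N. step w j * indicator {\<tau> j..t} s) = 0"
          using False jump_time_range by (intro sum.neutral) (force simp: indicator_def)
        then show ?thesis using False by simp
      qed
    qed
    also have "\<dots> = (\<Sum>j\<le>N. step w j * (t - \<tau> j))"
    proof -
      have "integrable lborel (\<lambda>s. step w j * indicator {\<tau> j..t} s)" for j
        by (intro integrable_mult_right integrable_real_indicator) (auto simp: emeasure_lborel_Icc_eq)
      then have "(\<integral>s. (\<Sum>j\<le>N. step w j * indicator {\<tau> j..t} s) \<partial>lborel) = (\<Sum>j\<le>N. \<integral>s. step w j * indicator {\<tau> j..t} s \<partial>lborel)"
        by (intro Bochner_Integration.integral_sum) auto
      also have "\<dots> = (\<Sum>j\<le>N. step w j * (t - \<tau> j))"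
        using jump_time_range by (intro sum.cong) auto
      finally show ?thesis .
    qed
    finally show ?thesis
      unfolding time_integral_def using fin num_jumps_finite[of \<omega> t] by simp
  qed
  ultimately show ?thesis by simp
qed

end

text \<open>The index map of \<open>remdups_adj\<close> strictly increases at each change between
  neighbours, so its last value is at least the number of changes.\<close>

lemma length_remdups_adj_ge:
  "card {i. Suc i < length xs \<and> xs ! i \<noteq> xs ! Suc i} < length (remdups_adj xs)" if "xs \<noteq> []"
proof -
  define ys where "ys = remdups_adj xs"
  obtain f :: "nat \<Rightarrow> nat" where f: "mono f" "f ` {0..<length xs} = {0..<length ys}"
    "\<And>i. i + 1 < length xs \<Longrightarrow> xs ! i = xs ! (i + 1) \<longleftrightarrow> f i = f (i + 1)"
    using remdups_adj_altdef[of xs ys] ys_def by auto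
  have fin: "finite {i'. i' < i \<and> P i'}" for i :: nat and P by simp
  have "i < length xs \<Longrightarrow> card {i'. i' < i \<and> xs ! i' \<noteq> xs ! Suc i'} \<le> f i" for i
  proof (induction i)
    case (Suc i)
    have "f i \<le> f (Suc i)" using f(1) by (auto simp: mono_def)
    have sub: "{i'. i' < Suc i \<and> xs ! i' \<noteq> xs ! Suc i'} = (if xs ! i \<noteq> xs ! Suc i then insert i {i'. i' < i \<and> xs ! i' \<noteq> xs ! Suc i'} else {i'. i' < i \<and> xs ! i' \<noteq> xs ! Suc i'})"
      by (auto simp: less_Suc_eq)
    show ?case
    proof (cases "xs ! i = xs ! Suc i")
      case True
      then show ?thesis using Suc \<open>f i \<le> f (Suc i)\<close> unfolding sub by simp
    next
      case False
      then have "f i < f (Suc i)" using f(3)[of i] Suc.prems \<open>f i \<le> f (Suc i)\<close> by auto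
      then show ?thesis using Suc False unfolding sub by (simp add: card_insert_if)
    qed
  qed simp
  from this[of "length xs - 1"] that
  have "card {i'. i' < length xs - 1 \<and> xs ! i' \<noteq> xs ! Suc i'} \<le> f (length xs - 1)" by simp
  moreover have "f (length xs - 1) < length ys" using f(2) that by force
  moreover have "{i. Suc i < length xs \<and> xs ! i \<noteq> xs ! Suc i} = {i'. i' < length xs - 1 \<and> xs ! i' \<noteq> xs ! Suc i'}" by auto
  ultimately show ?thesis by (simp add: ys_def)
qed

text \<open>Pick as many jumps as \<open>p\<close> has entries. On a fine grid they lie in different
  cells, and each forces different values at the two ends of its cell, so the reduced sample is
  longer than \<open>p\<close>.\<close>

lemma infinite_jumps_grid_skel:
  assumes path: "\<omega> \<in> paths" and inf: "infinite (jumps \<omega> t)"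
  shows "\<forall>\<^sub>F n in sequentially. grid_skel \<omega> t n \<noteq> p"
proof -
  obtain F where F: "F \<subseteq> jumps \<omega> t" "finite F" "card F = length p"
    using infinite_arbitrarily_large[OF inf] by blast
  have Ft: "0 < u \<and> u \<le> t" "jump_at \<omega> u" if "u \<in> F" for u
    using F(1) that by (auto simp: jumps_def jump_at_def)
  have "jumps \<omega> t \<noteq> {}" using inf by auto
  then have t: "0 < t" by (auto simp: jumps_def jump_at_def)
  have lim: "(\<lambda>n. t / real n) \<longlonglongrightarrow> 0" by (rule lim_const_over_n)
  have sep: "\<forall>\<^sub>F n in sequentially. \<forall>u\<in>F. \<forall>v v'. u - t / real n \<le> v \<longrightarrow> v < u \<longrightarrow> u \<le> v' \<longrightarrow> v' < u + t / real n \<longrightarrow> \<omega> v \<noteq> \<omega> v'"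
  proof (rule eventually_ball_finite[OF F(2)], rule ballI)
    fix u assume "u \<in> F"
    from jump_separates[OF path Ft(2)[OF this]] obtain e where e: "0 < e"
      "\<And>v v'. u - e < v \<Longrightarrow> v < u \<Longrightarrow> u \<le> v' \<Longrightarrow> v' < u + e \<Longrightarrow> \<omega> v \<noteq> \<omega> v'" by blast
    have "\<forall>\<^sub>F n in sequentially. t / real n < e" using order_tendstoD(2)[OF lim e(1)] .
    then show "\<forall>\<^sub>F n in sequentially. \<forall>v v'. u - t / real n \<le> v \<longrightarrow> v < u \<longrightarrow> u \<le> v' \<longrightarrow> v' < u + t / real n \<longrightarrow> \<omega> v \<noteq> \<omega> v'"
      by eventually_elim (use e in force)
  qed
  have "\<forall>\<^sub>F n in sequentially. \<forall>u\<in>F. \<forall>u'\<in>F. u \<noteq> u' \<longrightarrow> t / real n < \<bar>u - u'\<bar>"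
  proof (intro eventually_ball_finite[OF F(2)] ballI)
    fix u u' assume "u \<in> F" "u' \<in> F"
    show "\<forall>\<^sub>F n in sequentially. u \<noteq> u' \<longrightarrow> t / real n < \<bar>u - u'\<bar>"
    proof (cases "u = u'")
      case False
      then have "\<forall>\<^sub>F n in sequentially. t / real n < \<bar>u - u'\<bar>" using order_tendstoD(2)[OF lim, of "\<bar>u - u'\<bar>"] by simp
      then show ?thesis by eventually_elim simp
    qed simp
  qed
  with sep eventually_gt_at_top[of 0] show ?thesis
  proof eventually_elim
    case (elim n)
    define q where "q i = t * real i / real n" for i
    have q_step: "q (Suc i) = q i + t / real n" for i by (simp add: q_def add_divide_distrib distrib_left)
    \<comment> \<open>The cell between the grid times k and k + 1 is taken open on the left and
      closed on the right, so a jump exactly at a grid time belongs to the cell that ends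
      there.\<close>
    define k where "k u = nat \<lceil>u * real n / t\<rceil> - 1" for u
    have k: "q (k u) < u" "u \<le> q (Suc (k u))" "Suc (k u) \<le> n" if u: "u \<in> F" for u
    proof -
      let ?c = "\<lceil>u * real n / t\<rceil>"
      have u': "0 < u" "u \<le> t" using Ft(1)[OF u] by auto
      have pos: "0 < ?c" using u' t elim by (simp add: zero_less_ceiling)
      then have Sk: "Suc (k u) = nat ?c" by (simp add: k_def)
      then have rS: "real (Suc (k u)) = of_int ?c" using pos by simp
      have lo: "u * real n / t \<le> real (Suc (k u))" and hi: "real (k u) < u * real n / t"
        using rS by linarith+
      show "u \<le> q (Suc (k u))" using lo t elim by (simp add: q_def field_simps)
      show "q (k u) < u" using hi t elim by (simp add: q_def field_simps)
      have "u * real n / t \<le> real n" using u' t mult_right_mono[of u t "real n"] by (simp add: pos_divide_le_eq mult.commute)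
      then have "?c \<le> int n" by (simp add: ceiling_le_iff)
      then show "Suc (k u) \<le> n" using Sk by linarith
    qed
    have inj: "inj_on k F"
    proof (rule inj_onI, rule ccontr)
      fix u u' assume uu: "u \<in> F" "u' \<in> F" "k u = k u'" "u \<noteq> u'"
      then have "\<bar>u - u'\<bar> \<le> t / real n" using k[of u] k[of u'] q_step[of "k u"] by auto
      then show False using elim uu by force
    qed
    let ?x = "grid \<omega> t n"
    have len: "length ?x = Suc n" by (simp add: grid_def)
    have nth: "?x ! i = \<omega> (q i)" if "i \<le> n" for i
      using that unfolding grid_def q_def by (subst nth_map) (auto simp del: upt_Suc)
    have "k ` F \<subseteq> {i. Suc i < length ?x \<and> ?x ! i \<noteq> ?x ! Suc i}"
    proof clarify
      fix u assume u: "u \<in> F"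
      have "\<omega> (q (k u)) \<noteq> \<omega> (q (Suc (k u)))"
        using elim(1)[rule_format, OF u, of "q (k u)" "q (Suc (k u))"] k[OF u] q_step[of "k u"] by auto
      then show "Suc (k u) < length ?x \<and> ?x ! k u \<noteq> ?x ! Suc (k u)"
        using k(3)[OF u] nth[of "k u"] nth[of "Suc (k u)"] by (simp add: len)
    qed
    moreover have "finite {i. Suc i < length ?x \<and> ?x ! i \<noteq> ?x ! Suc i}" by (rule finite_subset[of _ "{..<length ?x}"]) auto
    ultimately have "card (k ` F) \<le> card {i. Suc i < length ?x \<and> ?x ! i \<noteq> ?x ! Suc i}" by (rule card_mono[rotated])
    also have "\<dots> < length (grid_skel \<omega> t n)"
      unfolding grid_skel_def by (rule length_remdups_adj_ge) (simp add: grid_def)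
    finally have "length p < length (grid_skel \<omega> t n)" using card_image[OF inj] F(3) by simp
    then show ?case by auto
  qed
qed


section \<open>Euler discretisation\<close>

text \<open>For lists without equal neighbours this is the total weight of all k-step walks that
  reduce to x # q, each step being weighted by T (\<open>sum_fine_paths\<close>). The first step
  either stays or moves to the next entry.\<close>

fun euler :: "('a \<Rightarrow> 'a \<Rightarrow> complex) \<Rightarrow> 'a \<Rightarrow> 'a list \<Rightarrow> nat \<Rightarrow> complex" where
  "euler T x q 0 = (if q = [] then 1 else 0)"
| "euler T x [] (Suc k) = T x x * euler T x [] k"
| "euler T x (y # q) (Suc k) = T x x * euler T x (y # q) k + T x y * euler T y q k"

definition fine_paths :: "'a list \<Rightarrow> nat \<Rightarrow> 'a list set" where
  "fine_paths p k = {zs. length zs = Suc k \<and> remdups_adj zs = p}"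

lemma finite_fine_paths: "finite (fine_paths p k)"
proof (rule finite_subset)
  show "fine_paths p k \<subseteq> {zs. set zs \<subseteq> set p \<and> length zs = Suc k}"
    unfolding fine_paths_def by (auto simp: remdups_adj_set)
qed (simp add: finite_lists_length_eq)

text \<open>Either the second entry repeats the first, and deleting the first leaves the reduction
  unchanged, or the first entry is the only copy of the head, and deleting it removes the head from
  the reduction.\<close>

lemma fine_paths_Suc:
  "fine_paths (x # q) (Suc k) = (#) x ` fine_paths (x # q) k \<union> (if q \<noteq> [] \<and> hd q \<noteq> x then (#) x ` fine_paths q k else {})"
proof (intro set_eqI iffI)
  fix zs assume "zs \<in> fine_paths (x # q) (Suc k)"
  then have zs: "length zs = Suc (Suc k)" "remdups_adj zs = x # q" by (auto simp: fine_paths_def)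
  then obtain z z' zs' where e: "zs = z # z' # zs'" by (cases zs; cases "tl zs") auto
  have zx: "z = x" using zs(2) unfolding e by (auto split: if_splits simp: hd_remdups_adj dest: arg_cong[of _ _ hd])
  show "zs \<in> (#) x ` fine_paths (x # q) k \<union> (if q \<noteq> [] \<and> hd q \<noteq> x then (#) x ` fine_paths q k else {})"
  proof (cases "z = z'")
    case True
    then have "z' # zs' \<in> fine_paths (x # q) k" using zs unfolding e by (auto simp: fine_paths_def)
    then show ?thesis using e zx by auto
  next
    case False
    then have "remdups_adj (z' # zs') = q" using zs(2) unfolding e by simp
    moreover from this have "hd q = z'" "q \<noteq> []" by (metis hd_remdups_adj list.sel(1), metis list.distinct(1) remdups_adj_Nil_iff)
    ultimately have "z' # zs' \<in> fine_paths q k" "q \<noteq> []" "hd q \<noteq> x"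
      using zs(1) False zx unfolding e by (auto simp: fine_paths_def)
    then show ?thesis using e zx by auto
  qed
next
  fix zs assume "zs \<in> (#) x ` fine_paths (x # q) k \<union> (if q \<noteq> [] \<and> hd q \<noteq> x then (#) x ` fine_paths q k else {})"
  then consider zs' where "zs = x # zs'" "zs' \<in> fine_paths (x # q) k"
    | zs' where "zs = x # zs'" "zs' \<in> fine_paths q k" "q \<noteq> []" "hd q \<noteq> x" by (auto split: if_splits)
  then show "zs \<in> fine_paths (x # q) (Suc k)"
  proof cases
    case 1
    then have "hd zs' = x" "zs' \<noteq> []" by (auto simp: fine_paths_def) (metis hd_remdups_adj list.sel(1))
    then show ?thesis using 1 by (cases zs') (auto simp: fine_paths_def)
  next
    case 2
    then have "hd zs' \<noteq> x" "zs' \<noteq> []" by (auto simp: fine_paths_def)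
    then show ?thesis using 2 by (cases zs') (auto simp: fine_paths_def)
  qed
qed

lemma fine_paths_hd: "zs \<in> fine_paths p k \<Longrightarrow> hd zs = hd p"
  by (auto simp: fine_paths_def)

lemma sum_fine_paths_Cons:
  fixes T :: "'a \<Rightarrow> 'a \<Rightarrow> complex"
  shows
  "(\<Sum>zs\<in>(#) x ` fine_paths p k. \<Prod>i<Suc k. T (zs ! i) (zs ! Suc i))
     = T x (hd p) * (\<Sum>zs\<in>fine_paths p k. \<Prod>i<k. T (zs ! i) (zs ! Suc i))"
proof -
  have "(\<Sum>zs\<in>(#) x ` fine_paths p k. \<Prod>i<Suc k. T (zs ! i) (zs ! Suc i))
     = (\<Sum>zs\<in>fine_paths p k. \<Prod>i<Suc k. T ((x # zs) ! i) ((x # zs) ! Suc i))"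
    by (subst sum.reindex) (auto simp: inj_on_def)
  also have "\<dots> = (\<Sum>zs\<in>fine_paths p k. T x (hd p) * (\<Prod>i<k. T (zs ! i) (zs ! Suc i)))"
  proof (intro sum.cong refl)
    fix zs assume zs: "zs \<in> fine_paths p k"
    then have "zs \<noteq> []" by (auto simp: fine_paths_def)
    then have "zs ! 0 = hd p" using fine_paths_hd[OF zs] by (simp add: hd_conv_nth)
    then show "(\<Prod>i<Suc k. T ((x # zs) ! i) ((x # zs) ! Suc i)) = T x (hd p) * (\<Prod>i<k. T (zs ! i) (zs ! Suc i))"
      by (subst prod.lessThan_Suc_shift) simp
  qed
  also have "\<dots> = T x (hd p) * (\<Sum>zs\<in>fine_paths p k. \<Prod>i<k. T (zs ! i) (zs ! Suc i))"
    by (rule sum_distrib_left[symmetric])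
  finally show ?thesis .
qed

lemma sum_fine_paths:
  assumes "distinct_adj (x # q)"
  shows "(\<Sum>zs\<in>fine_paths (x # q) k. \<Prod>i<k. T (zs ! i) (zs ! Suc i)) = euler T x q k"
  using assms
proof (induction k arbitrary: x q)
  case 0
  have "fine_paths (x # q) 0 = (if q = [] then {[x]} else {})"
    by (auto simp: fine_paths_def length_Suc_conv)
  then show ?case by simp
next
  case (Suc k)
  let ?s = "\<lambda>A n. \<Sum>zs\<in>A. \<Prod>i<n. T (zs ! i) (zs ! Suc i)"
  show ?case
  proof (cases q)
    case Nil
    then have "?s (fine_paths (x # q) (Suc k)) (Suc k) = ?s ((#) x ` fine_paths (x # q) k) (Suc k)"
      by (simp add: fine_paths_Suc)
    then show ?thesis using Suc Nil unfolding sum_fine_paths_Cons by simp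
  next
    case (Cons y q')
    then have y: "y \<noteq> x" "distinct_adj (y # q')" using Suc.prems by auto
    have "(#) x ` fine_paths (x # q) k \<inter> (#) x ` fine_paths q k = {}"
      using Cons by (auto simp: fine_paths_def)
    then have "?s (fine_paths (x # q) (Suc k)) (Suc k)
      = ?s ((#) x ` fine_paths (x # q) k) (Suc k) + ?s ((#) x ` fine_paths q k) (Suc k)"
      using y Cons by (subst fine_paths_Suc, simp, subst sum.union_disjoint)
        (auto simp: finite_fine_paths)
    then show ?thesis using Suc.IH[OF Suc.prems] Suc.IH[OF y(2)] Cons unfolding sum_fine_paths_Cons by simp
  qed
qed

lemma dexp_bound_upto:
  assumes "\<And>c. c \<in> set (a # cs) \<Longrightarrow> Re c \<le> w" "0 \<le> w" "0 \<le> s" "s \<le> t"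
  shows "cmod (dexp (a # cs) s) \<le> exp (w * t) * s ^ length cs"
proof -
  have "exp (w * s) \<le> exp (w * t)" using assms by (simp add: mult_left_mono)
  moreover have "s ^ length cs / fact (length cs) \<le> s ^ length cs"
    using assms fact_ge_1[of "length cs"] by (simp add: divide_le_eq mult_ge1_I mult_le_cancel_left1)
  ultimately have "exp (w * s) * (s ^ length cs / fact (length cs)) \<le> exp (w * t) * s ^ length cs"
    using assms by (intro mult_mono) auto
  then show ?thesis using dexp_bound[of a cs w s] assms by force
qed

lemma dexp_bounded: "\<exists>M\<ge>0. \<forall>s\<in>{0..t}. cmod (dexp cs s) \<le> M"
proof (cases cs)
  case (Cons a cs')
  define w where "w = Max (insert 0 (Re ` set cs))"
  have w: "0 \<le> w" "\<And>c. c \<in> set cs \<Longrightarrow> Re c \<le> w" unfolding w_def by (rule Max_ge; force)+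
  have "cmod (dexp cs s) \<le> exp (w * t) * \<bar>t\<bar> ^ length cs'" if "s \<in> {0..t}" for s
  proof -
    have "cmod (dexp cs s) \<le> exp (w * t) * s ^ length cs'"
      unfolding Cons using that w Cons by (intro dexp_bound_upto) auto
    also have "\<dots> \<le> exp (w * t) * \<bar>t\<bar> ^ length cs'" using that by (intro mult_left_mono power_mono) auto
    finally show ?thesis .
  qed
  then show ?thesis by (intro exI[of _ "exp (w * t) * \<bar>t\<bar> ^ length cs'"]) auto
qed (auto intro: exI[of _ 0])

text \<open>In the splitting formula the terms with at least two changes of state during time d are
  of order d^2; those with none or one are the terms retained.\<close>

lemma dexp_local_error:
  "\<exists>M\<ge>0. \<forall>d\<in>{0..t}. \<forall>s\<in>{0..t}.
     cmod (dexp (a # c # cs) (d + s) - (exp (a * of_real d) * dexp (a # c # cs) s + dexp [a, c] d * dexp (c # cs) s)) \<le> M * d\<^sup>2"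
proof -
  let ?p = "a # c # cs"
  define w where "w = Max (insert 0 (Re ` set ?p))"
  have w: "0 \<le> w" "\<And>c. c \<in> set ?p \<Longrightarrow> Re c \<le> w" unfolding w_def by (rule Max_ge; force)+
  have "\<exists>B. \<forall>j. 0 \<le> B j \<and> (\<forall>s\<in>{0..t}. cmod (dexp (drop j ?p) s) \<le> B j)"
    using dexp_bounded by (intro choice) blast
  then obtain B where B: "\<And>j. 0 \<le> B j" "\<And>j s. s \<in> {0..t} \<Longrightarrow> cmod (dexp (drop j ?p) s) \<le> B j" by blast
  define L where "L = length cs"
  define M where "M = (\<Sum>j<L. exp (w * t) * \<bar>t\<bar> ^ j * B (Suc (Suc j)))"
  have M: "0 \<le> M" unfolding M_def using B(1) by (intro sum_nonneg mult_nonneg_nonneg) auto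
  show ?thesis
  proof (intro exI[of _ M] conjI ballI M)
    fix d s assume d: "d \<in> {0..t}" and s: "s \<in> {0..t}"
    let ?t = "\<lambda>j. dexp (take (Suc j) ?p) d * dexp (drop j ?p) s"
    have "dexp ?p (d + s) = (\<Sum>j<Suc (Suc L). ?t j)"
      using dexp_split[of ?p d s] d s by (simp add: L_def del: sum.lessThan_Suc dexp.simps)
    also have "\<dots> = ?t 0 + ?t 1 + (\<Sum>j<L. ?t (Suc (Suc j)))"
      unfolding sum.lessThan_Suc_shift by (simp add: add.assoc del: dexp.simps)
    finally have e: "dexp ?p (d + s) - (exp (a * of_real d) * dexp ?p s + dexp [a, c] d * dexp (c # cs) s) = (\<Sum>j<L. ?t (Suc (Suc j)))"
      by (simp add: dexp_single del: dexp.simps)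
    have "cmod (\<Sum>j<L. ?t (Suc (Suc j))) \<le> (\<Sum>j<L. exp (w * t) * \<bar>t\<bar> ^ j * B (Suc (Suc j)) * d\<^sup>2)"
    proof (rule sum_norm_le)
      fix j assume j: "j \<in> {..<L}"
      have "cmod (dexp (take (Suc (Suc (Suc j))) ?p) d) \<le> exp (w * t) * d ^ length (take (Suc (Suc j)) (c # cs))"
        unfolding take_Suc_Cons[of _ a] using w d by (intro dexp_bound_upto) (auto dest: in_set_takeD)
      also have "length (take (Suc (Suc j)) (c # cs)) = Suc (Suc j)" using j by (simp add: L_def)
      also have "d ^ Suc (Suc j) = d ^ j * d\<^sup>2" by (simp add: power2_eq_square)
      also have "exp (w * t) * (d ^ j * d\<^sup>2) \<le> exp (w * t) * (\<bar>t\<bar> ^ j * d\<^sup>2)"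
        using d by (intro mult_left_mono mult_right_mono power_mono) auto
      finally have 1: "cmod (dexp (take (Suc (Suc (Suc j))) ?p) d) \<le> exp (w * t) * (\<bar>t\<bar> ^ j * d\<^sup>2)" .
      have "cmod (?t (Suc (Suc j))) \<le> (exp (w * t) * (\<bar>t\<bar> ^ j * d\<^sup>2)) * B (Suc (Suc j))"
        unfolding norm_mult by (rule mult_mono[OF 1 B(2)[OF s]]) (use d in auto)
      then show "cmod (?t (Suc (Suc j))) \<le> exp (w * t) * \<bar>t\<bar> ^ j * B (Suc (Suc j)) * d\<^sup>2" by (simp only: mult_ac)
    qed
    also have "\<dots> = M * d\<^sup>2" unfolding M_def by (simp add: sum_distrib_right)
    finally show "cmod (dexp ?p (d + s) - (exp (a * of_real d) * dexp ?p s + dexp [a, c] d * dexp (c # cs) s)) \<le> M * d\<^sup>2"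
      unfolding e .
  qed
qed

text \<open>Each of the at most n defects eta/n is amplified by at most (1 + L/n)^n, which is below
  exp(L).\<close>

lemma discrete_gronwall:
  fixes u :: "nat \<Rightarrow> real"
  assumes "u 0 = 0" "\<And>k. k < n \<Longrightarrow> u (Suc k) \<le> (1 + L / real n) * u k + \<eta> / real n"
    and "0 \<le> L" "0 \<le> \<eta>" "0 < n" "k \<le> n"
  shows "u k \<le> \<eta> * exp L"
proof -
  have 1: "k \<le> n \<Longrightarrow> u k \<le> real k * (\<eta> / real n) * (1 + L / real n) ^ k" for k
  proof (induction k)
    case 0
    then show ?case using assms by simp
  next
    case (Suc k)
    let ?l = "1 + L / real n"
    have l: "1 \<le> ?l" using assms by simp
    have "u (Suc k) \<le> ?l * u k + \<eta> / real n" using assms(2)[of k] Suc.prems by simp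
    also have "\<dots> \<le> ?l * (real k * (\<eta> / real n) * ?l ^ k) + \<eta> / real n * ?l ^ Suc k"
    proof (rule add_mono)
      show "?l * u k \<le> ?l * (real k * (\<eta> / real n) * ?l ^ k)"
        using Suc l by (intro mult_left_mono) auto
      have "\<eta> / real n * 1 \<le> \<eta> / real n * ?l ^ Suc k"
        using l assms by (intro mult_left_mono one_le_power) auto
      then show "\<eta> / real n \<le> \<eta> / real n * ?l ^ Suc k" by simp
    qed
    also have "\<dots> = real (Suc k) * (\<eta> / real n) * ?l ^ Suc k"
    proof -
      have "l * (real k * h * l ^ k) + h * l ^ Suc k = real (Suc k) * h * l ^ Suc k" for l h :: real
        by (simp add: algebra_simps)
      then show ?thesis .
    qed
    finally show ?case .
  qed
  have "(1 + L / real n) ^ k \<le> exp (L / real n) ^ k"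
    using assms by (intro power_mono exp_ge_add_one_self) auto
  also have "\<dots> = exp (real k * (L / real n))" by (rule exp_of_nat_mult[symmetric])
  also have "\<dots> \<le> exp L"
    using assms mult_left_mono[of "real k" "real n" L] by (simp add: pos_divide_le_eq mult.commute)
  finally have 2: "(1 + L / real n) ^ k \<le> exp L" .
  have 3: "real k * (\<eta> / real n) \<le> \<eta>" using assms by (simp add: field_simps mult_left_mono)
  have "u k \<le> real k * (\<eta> / real n) * (1 + L / real n) ^ k" using 1 assms by simp
  also have "\<dots> \<le> \<eta> * exp L" using 2 3 assms by (intro mult_mono) auto
  finally show ?thesis .
qed

lemma n_dexp2_lim:
  assumes "0 < t"
  shows "(\<lambda>n. of_nat n * dexp [a, c] (t / real n)) \<longlonglongrightarrow> of_real t"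
proof -
  have "filterlim (\<lambda>n. t / real n) (at_right 0) sequentially"
    unfolding filterlim_at using lim_const_over_n[of t] assms
    by (auto intro!: eventually_mono[OF eventually_gt_at_top[of 0]])
  from filterlim_compose[OF dexp2_quotient_lim this]
  have "(\<lambda>n. dexp [a, c] (t / real n) / of_real (t / real n) * of_real t) \<longlonglongrightarrow> 1 * of_real t"
    by (intro tendsto_intros)
  moreover have "\<forall>\<^sub>F n in sequentially. dexp [a, c] (t / real n) / of_real (t / real n) * of_real t = of_nat n * dexp [a, c] (t / real n)"
    using eventually_gt_at_top[of 0] by eventually_elim (use assms in \<open>simp del: dexp.simps\<close>)
  ultimately show ?thesis by (simp add: tendsto_cong del: dexp.simps)
qed

lemma n_exp_lim:
  fixes a :: complex
  assumes "0 < t"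
  shows "(\<lambda>n. of_nat n * (exp (a * of_real (t / real n)) - 1)) \<longlonglongrightarrow> a * of_real t"
proof -
  have "(\<lambda>n. a * (of_nat n * dexp [a, 0] (t / real n))) \<longlonglongrightarrow> a * of_real t"
    by (intro tendsto_intros n_dexp2_lim assms)
  moreover have "a * (of_nat n * dexp [a, 0] (t / real n)) = of_nat n * (exp (a * of_real (t / real n)) - 1)" for n
    using exp_minus_1_eq_dexp[of "t / real n" a] assms by (simp add: mult.left_commute del: dexp.simps)
  ultimately show ?thesis by (simp only:)
qed

text \<open>One step of the Euler recursion agrees with the exact splitting formula for \<open>dexp\<close> up to an
  error that is small relative to the step size, so the errors do not accumulate.\<close>

lemma euler_converges:
  fixes T :: "nat \<Rightarrow> 'a \<Rightarrow> 'a \<Rightarrow> complex" and r :: "'a \<Rightarrow> 'a \<Rightarrow> complex"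
  assumes t: "0 < t"
    and T0: "\<And>x. (\<lambda>n. of_nat n * (T n x x - exp (a x * of_real (t / real n)))) \<longlonglongrightarrow> 0"
    and T1: "\<And>x y. x \<noteq> y \<Longrightarrow> (\<lambda>n. of_nat n * (T n x y - r x y * dexp [a x, a y] (t / real n))) \<longlonglongrightarrow> 0"
    and "distinct_adj (x # q)" "0 < e"
  shows "\<forall>\<^sub>F n in sequentially. \<forall>k\<le>n. cmod (euler (T n) x q k - pathw r x q * dexp (map a (x # q)) (t * real k / real n)) \<le> e"
  using assms(4,5)
proof (induction q arbitrary: x e)
  case (Nil x)
  let ?E = "\<lambda>n k. euler (T n) x [] k - exp (a x * of_real (t * real k / real n))"
  \<comment> \<open>Strictly above the modulus of the limit of n (T x x - 1), so that T x x has
    modulus at most 1 + L/n eventually.\<close>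
  define L where "L = cmod (a x * of_real t) + 1"
  have L: "0 \<le> L" by (simp add: L_def)
  obtain M where M: "0 \<le> M" "\<And>s. s \<in> {0..t} \<Longrightarrow> cmod (dexp [a x] s) \<le> M" using dexp_bounded[of t "[a x]"] by blast
  have "(\<lambda>n. of_nat n * (T n x x - exp (a x * of_real (t / real n))) + of_nat n * (exp (a x * of_real (t / real n)) - 1)) \<longlonglongrightarrow> 0 + a x * of_real t"
    by (intro tendsto_add T0 n_exp_lim t)
  then have "(\<lambda>n. of_nat n * (T n x x - 1)) \<longlonglongrightarrow> a x * of_real t" by (simp add: algebra_simps)
  then have ev1: "\<forall>\<^sub>F n in sequentially. cmod (of_nat n * (T n x x - 1)) < L"
    using order_tendstoD(2)[OF tendsto_norm, of _ "a x * of_real t" sequentially L] by (simp add: L_def)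
  \<comment> \<open>Cancels the growth factor exp(L) of the Gronwall bound, which then equals
    e.\<close>
  define \<eta> where "\<eta> = e * exp (- L)"
  have \<eta>: "0 < \<eta>" using Nil by (simp add: \<eta>_def)
  have "(\<lambda>n. cmod (of_nat n * (T n x x - exp (a x * of_real (t / real n)))) * M) \<longlonglongrightarrow> 0"
    using tendsto_mult_left_zero[OF tendsto_norm_zero[OF T0]] .
  then have ev2: "\<forall>\<^sub>F n in sequentially. cmod (of_nat n * (T n x x - exp (a x * of_real (t / real n)))) * M < \<eta>"
    using order_tendstoD(2) \<eta> by blast
  from ev1 ev2 eventually_gt_at_top[of 0] show ?case
  proof eventually_elim
    case (elim n)
    have nn: "0 < real n" using elim by simp
    have T: "cmod (T n x x) \<le> 1 + L / real n"
    proof -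
      have "cmod (T n x x) \<le> 1 + cmod (T n x x - 1)" using norm_triangle_ineq[of 1 "T n x x - 1"] by simp
      also have "cmod (T n x x - 1) \<le> L / real n" using elim(1)[unfolded norm_mult] nn by (simp add: pos_le_divide_eq mult.commute)
      finally show ?thesis by simp
    qed
    have "cmod (?E n k) \<le> \<eta> * exp L" if "k \<le> n" for k
    proof (rule discrete_gronwall[OF _ _ L _ _ that])
      fix k assume k: "k < n"
      let ?s = "t * real k / real n" and ?d = "t / real n"
      have s: "?s \<in> {0..t}" using k nn t by (simp add: field_simps)
      have e: "exp (a x * of_real (t * real (Suc k) / real n)) = exp (a x * of_real ?d) * exp (a x * of_real ?s)"
        by (simp add: exp_add[symmetric] add_divide_distrib distrib_left)
      have "?E n (Suc k) = T n x x * ?E n k + (T n x x - exp (a x * of_real ?d)) * exp (a x * of_real ?s)"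
        unfolding e by (simp add: algebra_simps)
      then have "cmod (?E n (Suc k)) \<le> cmod (T n x x) * cmod (?E n k) + cmod (T n x x - exp (a x * of_real ?d)) * cmod (exp (a x * of_real ?s))"
        using norm_triangle_ineq[of "T n x x * ?E n k" "(T n x x - exp (a x * of_real ?d)) * exp (a x * of_real ?s)"] by (simp only: norm_mult)
      also have "\<dots> \<le> (1 + L / real n) * cmod (?E n k) + \<eta> / real n"
      proof (rule add_mono)
        show "cmod (T n x x) * cmod (?E n k) \<le> (1 + L / real n) * cmod (?E n k)" using T by (intro mult_right_mono) auto
        have "cmod (exp (a x * of_real ?s)) \<le> M" using M(2)[OF s] unfolding dexp_single .
        then have "cmod (T n x x - exp (a x * of_real ?d)) * cmod (exp (a x * of_real ?s)) \<le> cmod (T n x x - exp (a x * of_real ?d)) * M"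
          by (intro mult_left_mono) auto
        also have "\<dots> \<le> \<eta> / real n" using elim(2)[unfolded norm_mult] nn by (simp add: pos_le_divide_eq mult_ac)
        finally show "cmod (T n x x - exp (a x * of_real ?d)) * cmod (exp (a x * of_real ?s)) \<le> \<eta> / real n" .
      qed
      finally show "cmod (?E n (Suc k)) \<le> (1 + L / real n) * cmod (?E n k) + \<eta> / real n" .
    qed (use \<eta> elim in auto)
    moreover have "\<eta> * exp L = e" by (simp add: \<eta>_def exp_minus)
    ultimately show ?case by (simp add: dexp_single)
  qed
next
  case (Cons y q x)
  have xy: "x \<noteq> y" and dq: "distinct_adj (y # q)" using Cons.prems by auto
  let ?G = "\<lambda>s. pathw r x (y # q) * dexp (map a (x # y # q)) s"
  let ?H = "\<lambda>s. pathw r y q * dexp (map a (y # q)) s"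
  let ?E = "\<lambda>n k. euler (T n) x (y # q) k - ?G (t * real k / real n)"
  let ?F = "\<lambda>n k. euler (T n) y q k - ?H (t * real k / real n)"
  obtain B0 where B0: "0 \<le> B0" "\<And>s. s \<in> {0..t} \<Longrightarrow> cmod (dexp (map a (x # y # q)) s) \<le> B0" using dexp_bounded[of t] by blast
  obtain B1 where B1: "0 \<le> B1" "\<And>s. s \<in> {0..t} \<Longrightarrow> cmod (dexp (map a (y # q)) s) \<le> B1" using dexp_bounded[of t] by blast
  obtain M where M: "0 \<le> M" "\<And>d s. d \<in> {0..t} \<Longrightarrow> s \<in> {0..t} \<Longrightarrow>
     cmod (dexp (map a (x # y # q)) (d + s) - (exp (a x * of_real d) * dexp (map a (x # y # q)) s + dexp [a x, a y] d * dexp (map a (y # q)) s)) \<le> M * d\<^sup>2"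
    using dexp_local_error[of t "a x" "a y" "map a q"] unfolding list.map by blast
  define P where "P = cmod (pathw r x (y # q))"
  define Q where "Q = cmod (pathw r y q)"
  define L where "L = cmod (a x * of_real t) + cmod (r x y * of_real t) + 1"
  have L: "0 \<le> L" by (simp add: L_def)
  have "(\<lambda>n. of_nat n * (T n x x - exp (a x * of_real (t / real n))) + of_nat n * (exp (a x * of_real (t / real n)) - 1)) \<longlonglongrightarrow> 0 + a x * of_real t"
    by (intro tendsto_add T0 n_exp_lim t)
  then have "(\<lambda>n. of_nat n * (T n x x - 1)) \<longlonglongrightarrow> a x * of_real t" by (simp add: algebra_simps)
  then have ev1: "\<forall>\<^sub>F n in sequentially. cmod (of_nat n * (T n x x - 1)) < L"
    using order_tendstoD(2)[OF tendsto_norm, of _ "a x * of_real t" sequentially L] by (simp add: L_def add_strict_increasing2)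
  have "(\<lambda>n. of_nat n * (T n x y - r x y * dexp [a x, a y] (t / real n)) + r x y * (of_nat n * dexp [a x, a y] (t / real n))) \<longlonglongrightarrow> 0 + r x y * of_real t"
    by (intro tendsto_add T1 xy tendsto_mult tendsto_const n_dexp2_lim t)
  then have "(\<lambda>n. of_nat n * T n x y) \<longlonglongrightarrow> r x y * of_real t" by (simp add: algebra_simps del: dexp.simps)
  then have ev2: "\<forall>\<^sub>F n in sequentially. cmod (of_nat n * T n x y) < L"
    using order_tendstoD(2)[OF tendsto_norm, of _ "r x y * of_real t" sequentially L] by (simp add: L_def add_strict_increasing2)
  define \<eta> where "\<eta> = e * exp (- L)"
  have \<eta>: "0 < \<eta>" using Cons.prems by (simp add: \<eta>_def)
  \<comment> \<open>The error of the tail enters each step with the factor L/n, so half of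
    \<open>\<eta>\<close> is reserved for it. The other half pays for the two one-step defects and
    the quadratic error.\<close>
  define \<epsilon> where "\<epsilon> = \<eta> / (2 * (L + 1))"
  have \<epsilon>: "0 < \<epsilon>" "L * \<epsilon> \<le> \<eta> / 2" using \<eta> L by (auto simp: \<epsilon>_def field_simps)
  let ?a = "\<lambda>n. cmod (of_nat n * (T n x x - exp (a x * of_real (t / real n))))"
  let ?b = "\<lambda>n. cmod (of_nat n * (T n x y - r x y * dexp [a x, a y] (t / real n)))"
  have "(\<lambda>n. ?a n * (P * B0) + ?b n * (Q * B1) + P * M * t\<^sup>2 / real n) \<longlonglongrightarrow> 0 + 0 + 0"
    by (intro tendsto_add tendsto_mult_left_zero tendsto_norm_zero T0 T1 xy lim_const_over_n)
  then have ev3: "\<forall>\<^sub>F n in sequentially. ?a n * (P * B0) + ?b n * (Q * B1) + P * M * t\<^sup>2 / real n < \<eta> / 2"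
    by (rule order_tendstoD(2)) (use \<eta> in simp)
  have ev4: "\<forall>\<^sub>F n in sequentially. \<forall>k\<le>n. cmod (?F n k) \<le> \<epsilon>"
    using Cons.IH[OF dq \<epsilon>(1)] .
  from ev1 ev2 ev3 ev4 eventually_gt_at_top[of 0] show ?case
  proof eventually_elim
    case (elim n)
    have nn: "0 < real n" using elim by simp
    have T: "cmod (T n x x) \<le> 1 + L / real n"
    proof -
      have "cmod (T n x x) \<le> 1 + cmod (T n x x - 1)" using norm_triangle_ineq[of 1 "T n x x - 1"] by simp
      also have "cmod (T n x x - 1) \<le> L / real n" using elim(1)[unfolded norm_mult] nn by (simp add: pos_le_divide_eq mult.commute)
      finally show ?thesis by simp
    qed
    have T': "cmod (T n x y) \<le> L / real n" using elim(2)[unfolded norm_mult] nn by (simp add: pos_le_divide_eq mult.commute)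
    have "cmod (?E n k) \<le> \<eta> * exp L" if "k \<le> n" for k
    proof (rule discrete_gronwall[OF _ _ L _ _ that])
      fix k assume k: "k < n"
      define s where "s = t * real k / real n"
      define d where "d = t / real n"
      have s: "s \<in> {0..t}" using k nn t by (simp add: field_simps s_def)
      have d: "d \<in> {0..t}" using k nn t by (simp add: field_simps d_def)
      have ds: "t * real (Suc k) / real n = d + s" by (simp add: d_def s_def add_divide_distrib distrib_left)
      define rest where "rest = dexp (map a (x # y # q)) (d + s) - (exp (a x * of_real d) * dexp (map a (x # y # q)) s + dexp [a x, a y] d * dexp (map a (y # q)) s)"
      have Gds: "?G (d + s) = exp (a x * of_real d) * ?G s + r x y * dexp [a x, a y] d * ?H s + pathw r x (y # q) * rest"
        unfolding rest_def by (simp add: algebra_simps del: dexp.simps)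
      let ?A = "T n x x - exp (a x * of_real d)" and ?B = "T n x y - r x y * dexp [a x, a y] d"
      have "?E n (Suc k) = T n x x * ?E n k + T n x y * ?F n k + ?A * ?G s + ?B * ?H s - pathw r x (y # q) * rest"
        unfolding ds Gds s_def[symmetric] by (simp add: algebra_simps del: dexp.simps)
      then have "cmod (?E n (Suc k)) \<le> cmod (T n x x * ?E n k) + cmod (T n x y * ?F n k) + cmod (?A * ?G s) + cmod (?B * ?H s) + cmod (pathw r x (y # q) * rest)"
        by (simp only:) (intro order_trans[OF norm_triangle_ineq4] add_right_mono order_trans[OF norm_triangle_ineq] norm_triangle_ineq order_refl)
      also have "\<dots> \<le> (1 + L / real n) * cmod (?E n k) + L / real n * \<epsilon> + ?a n / real n * (P * B0) + ?b n / real n * (Q * B1) + P * (M * d\<^sup>2)"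
      proof (intro add_mono)
        show "cmod (T n x x * ?E n k) \<le> (1 + L / real n) * cmod (?E n k)" unfolding norm_mult using T by (intro mult_right_mono) auto
        show "cmod (T n x y * ?F n k) \<le> L / real n * \<epsilon>"
          unfolding norm_mult[of "T n x y"] using T' elim(4) k L nn by (intro mult_mono) auto
        have "?a n / real n = cmod ?A" using nn by (simp add: norm_mult d_def)
        moreover have "cmod (?G s) \<le> P * B0" unfolding norm_mult P_def using B0(2)[OF s] by (intro mult_left_mono) auto
        ultimately show "cmod (?A * ?G s) \<le> ?a n / real n * (P * B0)"
          unfolding norm_mult[of ?A] by (intro mult_mono) auto
        have "?b n / real n = cmod ?B" using nn by (simp add: norm_mult d_def del: dexp.simps)
        moreover have "cmod (?H s) \<le> Q * B1" unfolding norm_mult Q_def using B1(2)[OF s] by (intro mult_left_mono) auto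
        ultimately show "cmod (?B * ?H s) \<le> ?b n / real n * (Q * B1)"
          unfolding norm_mult[of ?B] by (intro mult_mono) auto
        show "cmod (pathw r x (y # q) * rest) \<le> P * (M * d\<^sup>2)"
          unfolding norm_mult P_def rest_def using M(2)[OF d s] by (intro mult_left_mono) auto
      qed
      also have "P * (M * d\<^sup>2) = (P * M * t\<^sup>2 / real n) / real n" by (simp add: d_def power2_eq_square)
      also have "(1 + L / real n) * cmod (?E n k) + L / real n * \<epsilon> + ?a n / real n * (P * B0) + ?b n / real n * (Q * B1) + (P * M * t\<^sup>2 / real n) / real n
        = (1 + L / real n) * cmod (?E n k) + (L * \<epsilon> + (?a n * (P * B0) + ?b n * (Q * B1) + P * M * t\<^sup>2 / real n)) / real n"
        by (simp add: add_divide_distrib del: dexp.simps)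
      also have "\<dots> \<le> (1 + L / real n) * cmod (?E n k) + \<eta> / real n"
      proof (intro add_left_mono divide_right_mono)
        show "L * \<epsilon> + (?a n * (P * B0) + ?b n * (Q * B1) + P * M * t\<^sup>2 / real n) \<le> \<eta>"
          using elim(3) \<epsilon>(2) by linarith
      qed simp
      finally show "cmod (?E n (Suc k)) \<le> (1 + L / real n) * cmod (?E n k) + \<eta> / real n" .
    qed (use \<eta> elim in \<open>auto simp: dexp_at_0 simp del: dexp.simps\<close>)
    moreover have "\<eta> * exp L = e" by (simp add: \<eta>_def exp_minus)
    ultimately show ?case by simp
  qed
qed


section \<open>The heat kernel and the process on grids\<close>

context weight
begin

abbreviation single :: "'a \<Rightarrow> 'a \<Rightarrow> complex" where
  "single y \<equiv> \<lambda>z. if z = y then 1 else 0"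

lemma single_H: "single y \<in> H"
  by (rule Cc_H[OF single_Cc])

text \<open>The restrictions of f to finite sets converge to f in the Hilbert space. Boundedness of
  T carries this over, and convergence in norm implies convergence at x.\<close>

lemma bop_has_sum:
  assumes T: "bounded_operator m T" and f: "f \<in> H"
  shows "((\<lambda>y. T (single y) x * f y) has_sum T f x) UNIV"
proof -
  obtain C where C: "0 < C" "\<And>f. f \<in> H \<Longrightarrow> nrm (T f) \<le> C * nrm f" using bop_bound[OF T] by blast
  let ?r = "\<lambda>F y. if y \<in> F then f y else 0"
  have rH: "?r F \<in> H" for F by (rule dominated_H(1)[OF f, where c = 1]) auto
  have fin: "T (?r F) x = (\<Sum>y\<in>F. T (single y) x * f y)" if "finite F" for F
    using that
  proof (induction F rule: finite_induct)
    case empty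
    then show ?case using bop_zero[OF T] by simp
  next
    case (insert y F)
    have "?r (insert y F) = (\<lambda>z. f y * single y z + ?r F z)" using insert by auto
    then show ?case using insert bop_lin[OF T single_H rH, of "f y" y F] by (simp add: mult.commute)
  qed
  have "((\<lambda>F. nrm (\<lambda>y. ?r F y - f y)) \<longlongrightarrow> 0) (finite_subsets_at_top UNIV)"
  proof (rule dominated_convergence_H[OF f, where c = 1])
    show "\<forall>\<^sub>F F in finite_subsets_at_top UNIV. \<forall>y. cmod (?r F y - f y) \<le> 1 * cmod (f y)" by auto
    fix y
    have "\<forall>\<^sub>F F in finite_subsets_at_top UNIV. ?r F y - f y = 0"
      unfolding eventually_finite_subsets_at_top by (intro exI[of _ "{y}"]) auto
    then show "((\<lambda>F. ?r F y - f y) \<longlongrightarrow> 0) (finite_subsets_at_top UNIV)" by (rule tendsto_eventually)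
  qed
  from tendsto_mult_right_zero[OF this, of C]
  have "((\<lambda>F. nrm (\<lambda>y. T (?r F) y - T f y)) \<longlongrightarrow> 0) (finite_subsets_at_top UNIV)"
  proof (rule Lim_null_comparison[rotated], intro always_eventually allI)
    fix F
    show "norm (nrm (\<lambda>y. T (?r F) y - T f y)) \<le> C * nrm (\<lambda>y. ?r F y - f y)"
      using C(2)[OF diff_H[OF rH f], of F] bop_diff[OF T rH f, of F] by simp
  qed
  then have "((\<lambda>F. T (?r F) x) \<longlongrightarrow> T f x) (finite_subsets_at_top UNIV)"
    by (rule nrm_imp_pointwise) (use bop_H[OF T] rH f in auto)
  then show ?thesis unfolding has_sum_def
    by (rule Lim_transform_eventually) (use fin in \<open>auto intro: eventually_finite_subsets_at_top_weakI\<close>)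
qed

text \<open>Testing a kernel with the point mass at y yields its entry times m y, which explains the
  factor in the last hypothesis; the same test gives uniqueness.\<close>

lemma bop_integral_kernel:
  assumes T: "bounded_operator m T" and T': "\<And>f. f \<in> H \<Longrightarrow> T' f = T f"
    and K: "\<And>x y. K x y * of_real (m y) = T (single y) x"
  shows "is_integral_kernel m T' K" and "integral_kernel m T' = K"
proof -
  show ik: "is_integral_kernel m T' K"
    unfolding is_integral_kernel_def
  proof (intro ballI allI)
    fix f x assume f: "f \<in> H"
    have "(\<lambda>y. K x y * f y * of_real (m y)) = (\<lambda>y. T (single y) x * f y)"
      unfolding K[symmetric] by (simp add: mult_ac)
    then show "((\<lambda>y. K x y * f y * of_real (m y)) has_sum T' f x) UNIV"
      using bop_has_sum[OF T f] T'[OF f] by simp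
  qed
  show "integral_kernel m T' = K"
    unfolding integral_kernel_def
  proof (rule the_equality, rule ik, intro ext)
    fix K' x y assume K': "is_integral_kernel m T' K'"
    have "((\<lambda>z. K' x z * single y z * of_real (m z)) has_sum T' (single y) x) UNIV"
      by (rule K'[unfolded is_integral_kernel_def, rule_format, OF single_H])
    moreover have "((\<lambda>z. K' x z * single y z * of_real (m z)) has_sum (K' x y * of_real (m y))) UNIV"
      by (rule has_sum_finite_neutralI[of "{y}"]) auto
    ultimately have "K' x y * of_real (m y) = T' (single y) x" using has_sum_unique by blast
    then have "K' x y * of_real (m y) = K x y * of_real (m y)" using K T'[OF single_H] by simp
    then show "K' x y = K x y" using m_pos[of y] by simp
  qed
qed

end

context bounded_graph
begin

lemma zero_potential: "magnetic_potential b (\<lambda>_ _. 0)"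
  by (simp add: magnetic_potential_def)

text \<open>This contains the weight of the target: it is the kernel of exp(-tL) at (x, y) times m
  y, that is, the transition probability.\<close>

definition heat :: "real \<Rightarrow> 'a \<Rightarrow> 'a \<Rightarrow> complex" where
  "heat t x y = path_semigroup.U (hop (-1) (\<lambda>_ _. 0)) (\<lambda>x. - 1 * of_real (0 + wdeg b m x)) t (single y) x"

lemma heat_semigroup: "path_semigroup m rate C (hop (-1) (\<lambda>_ _. 0)) (\<lambda>x. - 1 * of_real (0 + wdeg b m x)) 0"
  by (rule op_exp_mag(1)[OF zero_potential, of "-1" 0 "\<lambda>_. 0" 0]) (auto intro: order_trans[OF _ wdeg_ge])

lemma trans_prob_heat:
  assumes t: "0 \<le> t" shows "trans_prob b m t (Some x) (Some y) = heat t x y"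
proof -
  interpret ps: path_semigroup m rate C "hop (-1) (\<lambda>_ _. 0)" "\<lambda>x. - 1 * of_real (0 + wdeg b m x)" 0
    by (rule heat_semigroup)
  have eq: "op_exp m (scale_graph (-1) (mag_op b m (\<lambda>_. 0) (\<lambda>_ _. 0))) t f = ps.U t f" if "f \<in> H" for f
    by (rule op_exp_mag(2)[OF zero_potential, of "-1" 0 "\<lambda>_. 0" 0 f t])
      (use that t in \<open>auto intro: order_trans[OF _ wdeg_ge]\<close>)
  have "integral_kernel m (op_exp m (scale_graph (-1) (mag_op b m (\<lambda>_. 0) (\<lambda>_ _. 0))) t)
     = (\<lambda>x y. ps.U t (single y) x / of_real (m y))"
    by (rule bop_integral_kernel(2)[OF ps.U_bop[OF t] eq]) (simp_all add: m_gt[THEN less_imp_neq, THEN not_sym])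
  then show ?thesis using m_gt[of y] by (simp add: trans_prob_def Let_def heat_def)
qed

lemma heat_deriv: "((\<lambda>t. (heat t x y - single y x) / of_real t) \<longlongrightarrow> of_real (rate x y - (if x = y then wdeg b m x else 0))) (at_right 0)"
proof -
  interpret ps: path_semigroup m rate C "hop (-1) (\<lambda>_ _. 0)" "\<lambda>x. - 1 * of_real (0 + wdeg b m x)" 0
    by (rule heat_semigroup)
  have "ps.Kop (single y) x = hop (-1) (\<lambda>_ _. 0) x y * single y y"
    unfolding ps.Kop_def by (rule ps.tsum_single) auto
  also have "\<dots> = of_real (rate x y)" by (simp add: hop_def)
  finally show ?thesis
    using ps.U_pointwise_deriv[OF single_H, of y x] unfolding heat_def by (auto simp: algebra_simps)
qed

lemma heat_step_lim:
  assumes t: "0 < t"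
  shows "(\<lambda>n. of_nat n * (heat (t / real n) x y - single y x)) \<longlonglongrightarrow> of_real (t * (rate x y - (if x = y then wdeg b m x else 0)))"
proof -
  have "filterlim (\<lambda>n. t / real n) (at_right 0) sequentially"
    unfolding filterlim_at using lim_const_over_n[of t] t
    by (auto intro!: eventually_mono[OF eventually_gt_at_top[of 0]])
  from filterlim_compose[OF heat_deriv[of x y] this]
  have "(\<lambda>n. of_real t * ((heat (t / real n) x y - single y x) / of_real (t / real n))) \<longlonglongrightarrow> of_real t * of_real (rate x y - (if x = y then wdeg b m x else 0))"
    by (intro tendsto_intros)
  moreover have "\<forall>\<^sub>F n in sequentially. of_real t * ((heat (t / real n) x y - single y x) / of_real (t / real n)) = of_nat n * (heat (t / real n) x y - single y x)"
    using eventually_gt_at_top[of 0] by eventually_elim (use t in simp)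
  ultimately have "(\<lambda>n. of_nat n * (heat (t / real n) x y - single y x)) \<longlonglongrightarrow> of_real t * of_real (rate x y - (if x = y then wdeg b m x else 0))"
    by (rule Lim_transform_eventually)
  then show ?thesis by simp
qed

lemma step_exp_lim:
  fixes c :: complex
  shows "(\<lambda>n. exp (c * of_real (t / real n))) \<longlonglongrightarrow> 1"
proof -
  have "(\<lambda>n. exp (c * of_real (t / real n))) \<longlonglongrightarrow> exp (c * of_real 0)"
    by (intro tendsto_intros lim_const_over_n)
  then show ?thesis by simp
qed

text \<open>Staying at x for one grid step has probability exp(-deg t/n) up to smaller order. This
  is the place where a growth rate deg inside beta cancels the exponential holding time.\<close>

lemma heat_step_diag:
  fixes \<beta> :: complex
  assumes t: "0 < t"
  shows "(\<lambda>n. of_nat n * (heat (t / real n) x x * exp (\<beta> * of_real (t / real n)) - exp ((\<beta> - of_real (wdeg b m x)) * of_real (t / real n)))) \<longlonglongrightarrow> 0"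
proof -
  let ?w = "complex_of_real (wdeg b m x)"
  have 1: "(\<lambda>n. of_nat n * (heat (t / real n) x x - 1)) \<longlonglongrightarrow> - ?w * of_real t"
    using heat_step_lim[OF t, of x x] by (simp add: rate_def mult.commute)
  have "(\<lambda>n. (of_nat n * (heat (t / real n) x x - 1) - of_nat n * (exp (- ?w * of_real (t / real n)) - 1)) * exp (\<beta> * of_real (t / real n)))
      \<longlonglongrightarrow> (- ?w * of_real t - - ?w * of_real t) * 1"
    by (intro tendsto_mult tendsto_diff 1 n_exp_lim t step_exp_lim)
  then have "(\<lambda>n. (of_nat n * (heat (t / real n) x x - 1) - of_nat n * (exp (- ?w * of_real (t / real n)) - 1)) * exp (\<beta> * of_real (t / real n))) \<longlonglongrightarrow> 0"
    by (rule tendsto_eq_rhs) simp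
  moreover have "of_nat n * (h * exp (\<beta> * of_real d) - exp ((\<beta> - ?w) * of_real d))
      = (of_nat n * (h - 1) - of_nat n * (exp (- ?w * of_real d) - 1)) * exp (\<beta> * of_real d)" for n h d
  proof -
    have e: "exp ((\<beta> - ?w) * of_real d) = exp (- ?w * of_real d) * exp (\<beta> * of_real d)"
      by (simp add: exp_add[symmetric] algebra_simps)
    show ?thesis unfolding e by (simp only: right_diff_distrib left_diff_distrib mult.assoc) simp
  qed
  ultimately show ?thesis by (simp only:)
qed

text \<open>A jump within one grid step is itself of order 1/n, so its weight and the exponents a
  and c enter only at second order.\<close>

lemma heat_step_off_diag:
  fixes \<beta> a c :: complex
  assumes t: "0 < t" and "x \<noteq> y"
  shows "(\<lambda>n. of_nat n * (heat (t / real n) x y * exp (\<beta> * of_real (t / real n)) - of_real (rate x y) * dexp [a, c] (t / real n))) \<longlonglongrightarrow> 0"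
proof -
  have 1: "(\<lambda>n. of_nat n * heat (t / real n) x y) \<longlonglongrightarrow> of_real (t * rate x y)"
    using heat_step_lim[OF t, of x y] assms(2) by simp
  have "(\<lambda>n. (of_nat n * heat (t / real n) x y) * exp (\<beta> * of_real (t / real n)) - of_real (rate x y) * (of_nat n * dexp [a, c] (t / real n)))
      \<longlonglongrightarrow> of_real (t * rate x y) * 1 - of_real (rate x y) * of_real t"
    by (intro tendsto_mult tendsto_diff 1 n_dexp2_lim t step_exp_lim tendsto_const)
  then show ?thesis by (simp add: algebra_simps del: dexp.simps)
qed

end

lemma grid_eq_iff: "grid \<omega> t n = zs \<longleftrightarrow> length zs = Suc n \<and> (\<forall>i\<in>{..n}. \<omega> (t * real i / real n) = zs ! i)"
proof
  assume "grid \<omega> t n = zs"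
  then show "length zs = Suc n \<and> (\<forall>i\<in>{..n}. \<omega> (t * real i / real n) = zs ! i)"
    unfolding grid_def by (auto simp del: upt_Suc)
next
  assume "length zs = Suc n \<and> (\<forall>i\<in>{..n}. \<omega> (t * real i / real n) = zs ! i)"
  then show "grid \<omega> t n = zs"
    unfolding grid_def by (intro nth_equalityI) (auto simp del: upt_Suc)
qed

locale graph_process = bounded_graph b m C
  for b :: "'a::countable \<Rightarrow> 'a \<Rightarrow> real" and m C +
  fixes P :: "'a \<Rightarrow> (real \<Rightarrow> 'a option) measure"
  assumes law: "process_law b m x (P x)"
begin

lemma prob_P: "prob_space (P x)" and space_P: "space (P x) = paths" and sets_P: "sets (P x) = sets path_algebra"
  using law[of x] by (auto simp: process_law_def)

sublocale P: prob_space "P x" for x by (rule prob_P)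

lemma fdd:
  assumes "s 0 = 0" "\<And>j. j < l \<Longrightarrow> s j < s (Suc j)" "z 0 = Some x" "\<And>j. j \<in> {1..l} \<Longrightarrow> z j \<in> topspace Xhat"
  shows "of_real (P.prob x {\<omega> \<in> space (P x). \<forall>j\<in>{1..l}. \<omega> (s j) = z j}) = (\<Prod>j<l. trans_prob b m (s (Suc j) - s j) (z j) (z (Suc j)))"
  using law[of x] assms unfolding process_law_def by blast

lemma eval_sets: "0 \<le> s \<Longrightarrow> {\<omega> \<in> space (P x). \<omega> s \<in> A} \<in> sets (P x)"
proof -
  assume s: "0 \<le> s"
  have "{{\<omega> \<in> paths. \<omega> t \<in> A} | t A. 0 \<le> t} \<subseteq> Pow (paths :: (real \<Rightarrow> 'a option) set)" by auto
  then have "sets (path_algebra :: (real \<Rightarrow> 'a option) measure) = sigma_sets paths {{\<omega> \<in> paths. \<omega> t \<in> A} | t A. 0 \<le> t}"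
    unfolding path_algebra_def by (rule sets_measure_of)
  then show ?thesis unfolding sets_P space_P using s by (auto intro!: sigma_sets.Basic)
qed

lemma eval_sets': "0 \<le> s \<Longrightarrow> {\<omega> \<in> space (P x). \<omega> s = z} \<in> sets (P x)"
  using eval_sets[of s x "{z}"] by simp

lemma eval_measurable: "0 \<le> s \<Longrightarrow> (\<lambda>\<omega>. \<omega> s) \<in> measurable (P x) (count_space UNIV)"
  using eval_sets by (intro measurableI) (auto simp: vimage_def Int_def conj_commute)

lemma grid_sets: "0 \<le> t \<Longrightarrow> {\<omega> \<in> space (P x). grid \<omega> t n = zs} \<in> sets (P x)"
  unfolding grid_eq_iff
  by (cases "length zs = Suc n") (auto intro!: sets.sets_Collect_finite_All' eval_sets')

lemma grid_measurable: "0 \<le> t \<Longrightarrow> (\<lambda>\<omega>. grid \<omega> t n) \<in> measurable (P x) (count_space UNIV)"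
  using grid_sets by (subst measurable_count_space_eq2_countable) (auto simp: vimage_def Int_def conj_commute)

lemma grid_skel_sets:
  assumes "0 \<le> t" shows "{\<omega> \<in> space (P x). grid_skel \<omega> t n = p} \<in> sets (P x)"
  unfolding grid_skel_def
  using measurable_sets[OF grid_measurable[OF assms, of n x], of "{zs. remdups_adj zs = p}"]
  by (simp add: vimage_def Int_def conj_commute)

lemma one_step:
  assumes s: "0 < s" and z: "z \<in> topspace Xhat"
  shows "of_real (P.prob x {\<omega> \<in> space (P x). \<omega> s = z}) = trans_prob b m s (Some x) z"
  using fdd[of "\<lambda>j. if j = 0 then 0 else s" 1 "\<lambda>j. if j = 0 then Some x else z" x] s z by simp

lemma Some_topspace: "Some y \<in> topspace Xhat"
  by (simp add: topspace_Xhat)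

lemma one_step_heat:
  assumes "0 < s" shows "of_real (P.prob x {\<omega> \<in> space (P x). \<omega> s = Some y}) = heat s x y"
  using one_step[OF assms Some_topspace, of x y] trans_prob_heat[of s x y] assms by simp

lemma heat_Re: "0 < s \<Longrightarrow> Re (heat s x y) = P.prob x {\<omega> \<in> space (P x). \<omega> s = Some y}"
  by (simp add: one_step_heat[symmetric])

lemma heat_at_0: "(\<lambda>n. heat (1 / real (Suc n)) x x) \<longlonglongrightarrow> 1"
proof -
  have "(\<lambda>n. of_nat n * (heat (1 / real n) x x - 1) * of_real (1 / real n)) \<longlonglongrightarrow> of_real (1 * (rate x x - wdeg b m x)) * of_real 0"
    using heat_step_lim[of 1 x x] by (intro tendsto_mult tendsto_of_real lim_const_over_n) simp
  moreover have "\<forall>\<^sub>F n in sequentially. of_nat n * (heat (1 / real n) x x - 1) * of_real (1 / real n) = heat (1 / real n) x x - 1"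
    using eventually_gt_at_top[of 0] by eventually_elim simp
  ultimately have "(\<lambda>n. heat (1 / real n) x x - 1) \<longlonglongrightarrow> 0" by (simp add: Lim_transform_eventually)
  then have "(\<lambda>n. heat (1 / real n) x x) \<longlonglongrightarrow> 1" by (rule LIM_zero_cancel)
  then show ?thesis by (rule LIMSEQ_Suc)
qed

text \<open>The distributions prescribe nothing at time 0. The probability of being at x at time
  1/(n + 1) tends to 1, whereas by right continuity a path with another starting value eventually
  avoids x at these times.\<close>

lemma starts: "AE \<omega> in P x. \<omega> 0 = Some x"
proof -
  let ?B = "{\<omega> \<in> space (P x). \<omega> 0 \<noteq> Some x}"
  let ?A = "\<lambda>n. {\<omega> \<in> space (P x). \<omega> (1 / real (Suc n)) = Some x}"
  have A: "?A n \<in> sets (P x)" for n by (rule eval_sets') simp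
  have B: "?B \<in> sets (P x)" using eval_sets[of 0 x "- {Some x}"] by simp
  have "(\<lambda>n. P.prob x (?A n)) \<longlonglongrightarrow> 1"
    using tendsto_Re[OF heat_at_0[of x]] by (simp add: heat_Re)
  moreover have "(\<lambda>n. P.prob x (?B \<inter> ?A n)) \<longlonglongrightarrow> 0"
  proof -
    have "(\<lambda>n. \<integral>\<omega>. indicator (?B \<inter> ?A n) \<omega> \<partial>P x) \<longlonglongrightarrow> (\<integral>\<omega>. 0 \<partial>P x :: real)"
    proof (rule integral_dominated_convergence[where w = "\<lambda>_. 1"])
      show "AE \<omega> in P x. (\<lambda>n. indicator (?B \<inter> ?A n) \<omega> :: real) \<longlonglongrightarrow> 0"
      proof (rule AE_I2)
        fix \<omega> assume w: "\<omega> \<in> space (P x)"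
        show "(\<lambda>n. indicator (?B \<inter> ?A n) \<omega> :: real) \<longlonglongrightarrow> 0"
        proof (cases "\<omega> 0 = Some x")
          case False
          have "limitin Xhat \<omega> (\<omega> 0) (at_right 0)" using w space_P path_right[of \<omega> 0] by auto
          then have ev: "\<forall>\<^sub>F s in at_right 0. \<omega> s \<noteq> Some x" using False by (rule limitin_Xhat_not_Some)
          have "filterlim (\<lambda>n. 1 / real (Suc n)) (at_right 0) sequentially"
            unfolding filterlim_at using LIMSEQ_Suc[OF lim_const_over_n[of 1]] by auto
          from eventually_compose_filterlim[OF ev this]
          have "\<forall>\<^sub>F n in sequentially. indicator (?B \<inter> ?A n) \<omega> = (0::real)"
            by eventually_elim (simp add: indicator_def)
          then show ?thesis by (rule tendsto_eventually)
        qed (simp add: indicator_def)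
      qed
    qed (use A B in \<open>auto simp: indicator_def\<close>)
    then show ?thesis using A B by simp
  qed
  ultimately have "(\<lambda>n. P.prob x (?B \<inter> ?A n) + (1 - P.prob x (?A n))) \<longlonglongrightarrow> 0 + (1 - 1)" by (intro tendsto_intros)
  moreover have "P.prob x ?B \<le> P.prob x (?B \<inter> ?A n) + (1 - P.prob x (?A n))" for n
  proof -
    have "P.prob x ?B \<le> P.prob x ((?B \<inter> ?A n) \<union> (space (P x) - ?A n))"
      using A B by (intro P.finite_measure_mono) auto
    also have "\<dots> \<le> P.prob x (?B \<inter> ?A n) + P.prob x (space (P x) - ?A n)"
      using A B by (intro measure_Un_le) auto
    also have "P.prob x (space (P x) - ?A n) = 1 - P.prob x (?A n)" by (rule P.prob_compl[OF A])
    finally show ?thesis .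
  qed
  ultimately have "P.prob x ?B \<le> 0" by (intro tendsto_lowerbound[of "\<lambda>n. P.prob x (?B \<inter> ?A n) + (1 - P.prob x (?A n))"]) auto
  then have "P.prob x ?B = 0" using measure_nonneg[of "P x" ?B] by linarith
  then have "emeasure (P x) ?B = 0" using P.emeasure_eq_measure[of x ?B] by simp
  then show ?thesis using B by (intro AE_I[of _ _ ?B]) auto
qed

text \<open>The later entries of the sample are governed by the prescribed distributions; the entry
  at index 0 is supplied by \<open>starts\<close>.\<close>

lemma grid_law:
  assumes t: "0 < t" and n: "0 < n" and zs: "length zs = Suc n"
  shows "of_real (P.prob x {\<omega> \<in> space (P x). grid \<omega> t n = map Some zs})
    = (if hd zs = x then \<Prod>i<n. heat (t / real n) (zs ! i) (zs ! Suc i) else 0)"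
proof (cases "hd zs = x")
  case False
  have "AE \<omega> in P x. \<not> grid \<omega> t n = map Some zs"
    using starts[of x]
  proof eventually_elim
    case (elim \<omega>)
    show ?case
    proof
      assume "grid \<omega> t n = map Some zs"
      then have "\<omega> (t * real 0 / real n) = map Some zs ! 0" unfolding grid_eq_iff by blast
      moreover have "map Some zs ! 0 = Some (hd zs)" using zs by (cases zs) auto
      ultimately show False using elim False by simp
    qed
  qed
  then have "P.prob x {\<omega> \<in> space (P x). grid \<omega> t n = map Some zs} = 0" by (rule P.prob_eq_0_AE)
  then show ?thesis using False by simp
next
  case True
  let ?s = "\<lambda>i. t * real i / real n"
  have z0: "zs ! 0 = x" using True zs by (cases zs) auto
  have "P.prob x {\<omega> \<in> space (P x). grid \<omega> t n = map Some zs} = P.prob x {\<omega> \<in> space (P x). \<forall>j\<in>{1..n}. \<omega> (?s j) = Some (zs ! j)}"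
  proof (rule P.finite_measure_eq_AE)
    show "AE \<omega> in P x. (\<omega> \<in> {\<omega> \<in> space (P x). grid \<omega> t n = map Some zs}) = (\<omega> \<in> {\<omega> \<in> space (P x). \<forall>j\<in>{1..n}. \<omega> (?s j) = Some (zs ! j)})"
      using starts[of x]
    proof eventually_elim
      case (elim \<omega>)
      have "grid \<omega> t n = map Some zs \<longleftrightarrow> (\<forall>j\<in>{1..n}. \<omega> (?s j) = Some (zs ! j))"
        unfolding grid_eq_iff
      proof (intro iffI ballI conjI)
        fix i assume a: "\<forall>j\<in>{1..n}. \<omega> (?s j) = Some (zs ! j)" and i: "i \<in> {..n}"
        show "\<omega> (?s i) = map Some zs ! i"
          using a i elim z0 zs by (cases "i = 0") auto
      qed (use zs in auto)
      then show ?case by simp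
    qed
    show "{\<omega> \<in> space (P x). grid \<omega> t n = map Some zs} \<in> sets (P x)" using t by (intro grid_sets) simp
    show "{\<omega> \<in> space (P x). \<forall>j\<in>{1..n}. \<omega> (?s j) = Some (zs ! j)} \<in> sets (P x)"
      using t n by (intro sets.sets_Collect_finite_All' eval_sets') auto
  qed
  moreover have "of_real (P.prob x {\<omega> \<in> space (P x). \<forall>j\<in>{1..n}. \<omega> (?s j) = Some (zs ! j)})
    = (\<Prod>j<n. trans_prob b m (?s (Suc j) - ?s j) (Some (zs ! j)) (Some (zs ! Suc j)))"
  proof (rule fdd[where z = "\<lambda>j. Some (zs ! j)"])
    show "?s j < ?s (Suc j)" if "j < n" for j
      using t n by (simp add: divide_strict_right_mono)
  qed (use z0 Some_topspace in auto)
  moreover have "?s (Suc j) - ?s j = t / real n" for j by (simp add: add_divide_distrib distrib_left)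
  ultimately show ?thesis using True t trans_prob_heat[of "t / real n"] by simp
qed

end


section \<open>The law of the jump skeleton\<close>

definition skel_event :: "real \<Rightarrow> 'a option list \<Rightarrow> (real \<Rightarrow> 'a option) set" where
  "skel_event t p = {\<omega>. finite (jumps \<omega> t) \<and> skel \<omega> t = p}"

definition rate_fun :: "('a \<Rightarrow> real) \<Rightarrow> ('a \<Rightarrow> real) \<Rightarrow> 'a option \<Rightarrow> complex" where
  "rate_fun w1 w2 z = - \<i> * of_real (ext0 w1 z) + of_real (ext0 w2 z)"

text \<open>Here w1 enters as a phase and w2 as growth. The action corresponds to w1 = v + deg and
  w2 = deg; replacing w1 by 0 gives the modulus.\<close>

definition path_exp :: "('a \<Rightarrow> real) \<Rightarrow> ('a \<Rightarrow> real) \<Rightarrow> real \<Rightarrow> (real \<Rightarrow> 'a option) \<Rightarrow> complex" where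
  "path_exp w1 w2 t \<omega> = exp (- \<i> * of_real (time_integral w1 t \<omega>) + of_real (time_integral w2 t \<omega>))"

definition grid_exp :: "('a option \<Rightarrow> complex) \<Rightarrow> real \<Rightarrow> nat \<Rightarrow> (real \<Rightarrow> 'a option) \<Rightarrow> complex" where
  "grid_exp \<beta> t n \<omega> = exp (\<Sum>i<n. of_real (t / real n) * \<beta> (\<omega> (t * real i / real n)))"

lemma jumps_0: "jumps \<omega> 0 = {}"
  by (auto simp: jumps_def jump_at_def)

lemma skel_0: "skel \<omega> 0 = [\<omega> 0]"
  by (simp add: skel_def jumps_0)

lemma time_integral_0: "time_integral w 0 \<omega> = 0"
proof -
  have "set_lebesgue_integral lborel {0..0} (\<lambda>s. ext0 w (\<omega> s)) = (\<integral>s. indicator {0::real} s *\<^sub>R ext0 w (\<omega> 0) \<partial>lborel)"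
    unfolding set_lebesgue_integral_def
    by (rule Bochner_Integration.integral_cong[OF refl]) (auto simp: indicator_def)
  also have "\<dots> = 0" by simp
  finally have "set_lebesgue_integral lborel {0..0} (\<lambda>s. ext0 w (\<omega> s)) = 0" .
  then show ?thesis by (simp add: time_integral_def)
qed

lemma skel_event_0: "\<omega> \<in> skel_event 0 p \<longleftrightarrow> p = [\<omega> 0]"
  by (auto simp: skel_event_def skel_0 jumps_0)

lemma skel_event_eventually:
  assumes "\<omega> \<in> paths" "0 < t"
  shows "\<forall>\<^sub>F n in sequentially. (grid_skel \<omega> t n = p) = (\<omega> \<in> skel_event t p)"
proof (cases "finite (jumps \<omega> t)")
  case True
  interpret finite_jumps \<omega> t by unfold_locales (use assms True in auto)
  show ?thesis using grid_skel_eventually[OF assms(2)]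
    by eventually_elim (use True in \<open>simp add: skel_event_def\<close>)
next
  case False
  show ?thesis using infinite_jumps_grid_skel[OF assms(1) False, of p]
    by eventually_elim (use False in \<open>simp add: skel_event_def\<close>)
qed

lemma grid_exp_lim:
  assumes "\<omega> \<in> paths" "0 < t" "finite (jumps \<omega> t)"
  shows "(\<lambda>n. grid_exp (rate_fun w1 w2) t n \<omega>) \<longlonglongrightarrow> path_exp w1 w2 t \<omega>"
proof -
  interpret finite_jumps \<omega> t by unfold_locales (use assms in auto)
  have "(\<Sum>i<n. of_real (t / real n) * rate_fun w1 w2 (\<omega> (t * real i / real n)))
    = - \<i> * of_real (\<Sum>i<n. t / real n * ext0 w1 (\<omega> (t * real i / real n))) + of_real (\<Sum>i<n. t / real n * ext0 w2 (\<omega> (t * real i / real n)))" for n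
    unfolding of_real_sum sum_distrib_left sum.distrib[symmetric]
    by (intro sum.cong) (auto simp: rate_fun_def algebra_simps)
  then show ?thesis
    unfolding grid_exp_def path_exp_def by (simp only:) (intro tendsto_intros riemann_sum_lim assms)
qed

section \<open>Expectations over a fixed skeleton\<close>

context graph_process
begin

lemma indicator_integral:
  fixes c :: complex
  assumes "{\<omega> \<in> space (P x). Q \<omega>} \<in> sets (P x)"
  shows "has_bochner_integral (P x) (\<lambda>\<omega>. indicator {\<omega>. Q \<omega>} \<omega> *\<^sub>R c) (of_real (P.prob x {\<omega> \<in> space (P x). Q \<omega>}) * c)"
proof -
  have "has_bochner_integral (P x) (\<lambda>\<omega>. indicator {\<omega> \<in> space (P x). Q \<omega>} \<omega> *\<^sub>R c) (P.prob x {\<omega> \<in> space (P x). Q \<omega>} *\<^sub>R c)"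
    using assms by (intro has_bochner_integral_indicator) (simp_all add: less_top[symmetric])
  then show ?thesis
    by (subst has_bochner_integral_cong[OF refl]) (auto simp: indicator_def scaleR_conv_of_real)
qed

text \<open>Only finitely many samples reduce to the given list. On each of them the grid
  exponential is constant, and the sum over them is the Euler recursion.\<close>

lemma grid_expectation:
  assumes t: "0 < t" and n: "0 < n" and d: "distinct_adj (y # q)"
  shows "has_bochner_integral (P x) (\<lambda>\<omega>. indicator {\<omega>. grid_skel \<omega> t n = map Some (y # q)} \<omega> *\<^sub>R grid_exp \<beta> t n \<omega>)
     (if y = x then euler (\<lambda>z z'. heat (t / real n) z z' * exp (\<beta> (Some z) * of_real (t / real n))) y q n else 0)"
proof -
  let ?F = "fine_paths (y # q) n"
  define c where "c zs = (\<Prod>i<n. exp (\<beta> (Some (zs ! i)) * of_real (t / real n)))" for zs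
  have pw: "indicator {\<omega>. grid_skel \<omega> t n = map Some (y # q)} \<omega> *\<^sub>R grid_exp \<beta> t n \<omega>
     = (\<Sum>zs\<in>?F. indicator {\<omega>. grid \<omega> t n = map Some zs} \<omega> *\<^sub>R c zs)" for \<omega>
  proof (cases "grid_skel \<omega> t n = map Some (y # q)")
    case False
    have "grid \<omega> t n \<noteq> map Some zs" if "zs \<in> ?F" for zs
    proof
      assume "grid \<omega> t n = map Some zs"
      then have "grid_skel \<omega> t n = map Some (remdups_adj zs)"
        unfolding grid_skel_def by (simp add: remdups_adj_map_injective)
      then show False using that False by (simp add: fine_paths_def)
    qed
    then have "(\<Sum>zs\<in>?F. indicator {\<omega>. grid \<omega> t n = map Some zs} \<omega> *\<^sub>R c zs) = 0"
      by (intro sum.neutral) (auto simp: indicator_def)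
    then show ?thesis using False by (simp add: indicator_def)
  next
    case True
    define zs where "zs = map the (grid \<omega> t n)"
    have "None \<notin> set (grid \<omega> t n)"
      using True remdups_adj_set[of "grid \<omega> t n"] unfolding grid_skel_def by auto
    then have g: "grid \<omega> t n = map Some zs"
      unfolding zs_def by (auto simp: map_idI[symmetric] intro!: nth_equalityI) (metis nth_mem option.collapse)
    have "map Some (remdups_adj zs) = map Some (y # q)"
      using True unfolding grid_skel_def g by (simp add: remdups_adj_map_injective)
    then have "remdups_adj zs = y # q" using inj_map_eq_map[of Some] by auto
    moreover have len: "length zs = Suc n" using grid_eq_iff[THEN iffD1, OF g] by simp
    ultimately have zs: "zs \<in> ?F" by (simp add: fine_paths_def)
    have "(\<Sum>zs'\<in>?F. indicator {\<omega>. grid \<omega> t n = map Some zs'} \<omega> *\<^sub>R c zs') = (\<Sum>zs'\<in>?F. if zs' = zs then c zs else 0)"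
      using g by (intro sum.cong) (auto simp: indicator_def inj_map_eq_map)
    also have "\<dots> = c zs" using zs by (simp add: finite_fine_paths)
    also have "c zs = grid_exp \<beta> t n \<omega>"
    proof -
      have "\<omega> (t * real i / real n) = Some (zs ! i)" if "i < n" for i
      proof -
        have "\<omega> (t * real i / real n) = map Some zs ! i" using grid_eq_iff[THEN iffD1, OF g] that by auto
        then show ?thesis using that len by simp
      qed
      then show ?thesis unfolding c_def grid_exp_def exp_sum[OF finite_lessThan]
        by (intro prod.cong) (auto simp: mult.commute)
    qed
    finally show ?thesis using True by simp
  qed
  have "has_bochner_integral (P x) (\<lambda>\<omega>. \<Sum>zs\<in>?F. indicator {\<omega>. grid \<omega> t n = map Some zs} \<omega> *\<^sub>R c zs)
     (\<Sum>zs\<in>?F. of_real (P.prob x {\<omega> \<in> space (P x). grid \<omega> t n = map Some zs}) * c zs)"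
    using t by (intro has_bochner_integral_sum indicator_integral grid_sets) auto
  moreover have "(\<Sum>zs\<in>?F. of_real (P.prob x {\<omega> \<in> space (P x). grid \<omega> t n = map Some zs}) * c zs)
    = (if y = x then euler (\<lambda>z z'. heat (t / real n) z z' * exp (\<beta> (Some z) * of_real (t / real n))) y q n else 0)"
  proof -
    let ?T = "\<lambda>z z'. heat (t / real n) z z' * exp (\<beta> (Some z) * of_real (t / real n))"
    have "(\<Sum>zs\<in>?F. of_real (P.prob x {\<omega> \<in> space (P x). grid \<omega> t n = map Some zs}) * c zs)
      = (\<Sum>zs\<in>?F. if y = x then \<Prod>i<n. ?T (zs ! i) (zs ! Suc i) else 0)"
    proof (intro sum.cong refl)
      fix zs assume z: "zs \<in> ?F"
      then have len: "length zs = Suc n" by (simp add: fine_paths_def)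
      show "of_real (P.prob x {\<omega> \<in> space (P x). grid \<omega> t n = map Some zs}) * c zs
         = (if y = x then \<Prod>i<n. ?T (zs ! i) (zs ! Suc i) else 0)"
        unfolding grid_law[OF t n len] prod.distrib using fine_paths_hd[OF z] by (simp add: c_def)
    qed
    then show ?thesis unfolding sum_fine_paths[OF d, symmetric] by simp
  qed
  ultimately show ?thesis unfolding pw by simp
qed

lemma skel_distinct_adj:
  assumes "\<omega> \<in> paths" "0 \<le> t" "\<omega> \<in> skel_event t p"
  shows "distinct_adj p" "p \<noteq> []"
proof -
  interpret finite_jumps \<omega> t by unfold_locales (use assms in \<open>auto simp: skel_event_def\<close>)
  have p: "p = skel \<omega> t" using assms by (simp add: skel_event_def)
  show "p \<noteq> []" unfolding p using length_skel by auto
  show "distinct_adj p"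
    unfolding p distinct_adj_conv_nth
    using consecutive_neq length_skel skel_nth by auto
qed

lemma pathw_rate_zero: "\<not> distinct_adj (x # q) \<Longrightarrow> pathw (\<lambda>x y. complex_of_real (rate x y)) x q = 0"
  by (induction q arbitrary: x) (auto simp: rate_def)

text \<open>This is the limit of \<open>grid_expectation\<close> for vanishing mesh. A list with
  equal neighbours is no skeleton, and its path weight vanishes since b is 0 on the diagonal. At t =
  0 all grid points coincide, so this case is computed from \<open>starts\<close>.\<close>

lemma skel_expectation:
  assumes t: "0 \<le> t"
  shows "has_bochner_integral (P x) (\<lambda>\<omega>. indicator (skel_event t (map Some (y # q))) \<omega> *\<^sub>R path_exp w1 w2 t \<omega>)
    (if y = x then pathw (\<lambda>x y. of_real (rate x y)) x q * dexp (map (\<lambda>z. rate_fun w1 w2 (Some z) - of_real (wdeg b m z)) (x # q)) t else 0)"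
proof (cases "distinct_adj (y # q)")
  case False
  have "has_bochner_integral (P x) (\<lambda>\<omega>. indicator (skel_event t (map Some (y # q))) \<omega> *\<^sub>R path_exp w1 w2 t \<omega>) 0"
  proof (subst has_bochner_integral_cong[OF refl])
    fix \<omega> assume "\<omega> \<in> space (P x)"
    then have "\<omega> \<notin> skel_event t (map Some (y # q))"
      using skel_distinct_adj(1)[of \<omega> t "map Some (y # q)"] t False
      by (auto simp: space_P dest: distinct_adj_mapD simp del: list.map)
    then show "indicator (skel_event t (map Some (y # q))) \<omega> *\<^sub>R path_exp w1 w2 t \<omega> = 0" by simp
  qed (auto intro: has_bochner_integral_zero)
  then show ?thesis using False pathw_rate_zero by auto
next
  case d: True
  show ?thesis
  proof (cases "t = 0")
    case True
    have ind: "indicator (skel_event t (map Some (y # q))) \<omega> *\<^sub>R path_exp w1 w2 t \<omega>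
      = indicator {\<omega>. \<omega> 0 = Some y} \<omega> *\<^sub>R (if q = [] then 1 else 0)" for \<omega>
      unfolding True by (auto simp: indicator_def skel_event_0 path_exp_def time_integral_0)
    have "P.prob x {\<omega> \<in> space (P x). \<omega> 0 = Some y} = (if y = x then 1 else 0)"
    proof (cases "y = x")
      case True
      then show ?thesis using starts[of x] eval_sets'[of 0 x "Some y"] P.prob_Collect_eq_1[of x] by simp
    next
      case False
      then have "AE \<omega> in P x. \<not> \<omega> 0 = Some y" using starts[of x] by auto
      then show ?thesis using False P.prob_eq_0_AE by auto
    qed
    then show ?thesis
      using indicator_integral[of x "\<lambda>\<omega>. \<omega> 0 = Some y" "if q = [] then 1 else 0"] eval_sets'[of 0 x "Some y"]
      unfolding ind using True by (auto simp: dexp_at_0 split: if_splits)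
  next
    case False
    then have t': "0 < t" using t by simp
    let ?p = "map Some (y # q)" and ?\<beta> = "rate_fun w1 w2"
    let ?f = "\<lambda>n \<omega>. indicator {\<omega>. grid_skel \<omega> t n = ?p} \<omega> *\<^sub>R grid_exp ?\<beta> t n \<omega>"
    let ?g = "\<lambda>\<omega>. indicator (skel_event t ?p) \<omega> *\<^sub>R path_exp w1 w2 t \<omega>"
    \<comment> \<open>On the event all sampled values lie in the finite set of entries of the list,
      so one bound on the growth rate serves every mesh.\<close>
    define B where "B = (\<Sum>z\<in>set ?p. \<bar>ext0 w2 z\<bar>)"
    \<comment> \<open>The index is shifted by one because \<open>grid_expectation\<close> requires
      at least one cell.\<close>
    have lim: "(\<lambda>n. ?f (Suc n) \<omega>) \<longlonglongrightarrow> ?g \<omega>" if "\<omega> \<in> space (P x)" for \<omega>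
    proof (rule LIMSEQ_Suc)
      have w: "\<omega> \<in> paths" using that by (simp add: space_P)
      show "(\<lambda>n. ?f n \<omega>) \<longlonglongrightarrow> ?g \<omega>"
      proof (cases "\<omega> \<in> skel_event t ?p")
        case True
        then have "(\<lambda>n. grid_exp ?\<beta> t n \<omega>) \<longlonglongrightarrow> ?g \<omega>"
          using grid_exp_lim[OF w t', of w1 w2] by (simp add: skel_event_def)
        moreover have "\<forall>\<^sub>F n in sequentially. grid_exp ?\<beta> t n \<omega> = ?f n \<omega>"
          using skel_event_eventually[OF w t', of ?p] by eventually_elim (use True in simp)
        ultimately show ?thesis by (rule Lim_transform_eventually)
      next
        case False
        have "\<forall>\<^sub>F n in sequentially. ?f n \<omega> = ?g \<omega>"
          using skel_event_eventually[OF w t', of ?p] by eventually_elim (use False in simp)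
        then show ?thesis by (rule tendsto_eventually)
      qed
    qed
    have bound: "norm (?f (Suc n) \<omega>) \<le> exp (t * B)" for n \<omega>
    proof (cases "grid_skel \<omega> t (Suc n) = ?p")
      case True
      have "Re (?\<beta> (\<omega> (t * real i / real (Suc n)))) \<le> B" if i: "i < Suc n" for i
      proof -
        let ?z = "\<omega> (t * real i / real (Suc n))"
        have "length (grid \<omega> t (Suc n)) = Suc (Suc n) \<and> ?z = grid \<omega> t (Suc n) ! i"
          using grid_eq_iff[THEN iffD1, OF refl, of \<omega> t "Suc n"] i by (auto simp del: of_nat_Suc)
        then have "?z \<in> set (grid \<omega> t (Suc n))" using nth_mem[of i "grid \<omega> t (Suc n)"] i by simp
        then have "?z \<in> set ?p" using True remdups_adj_set[of "grid \<omega> t (Suc n)"] unfolding grid_skel_def by simp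
        then have "\<bar>ext0 w2 ?z\<bar> \<le> B" unfolding B_def by (intro member_le_sum) auto
        then show ?thesis by (simp add: rate_fun_def)
      qed
      then have "(\<Sum>i<Suc n. (t / real (Suc n)) * Re (?\<beta> (\<omega> (t * real i / real (Suc n))))) \<le> (\<Sum>i<Suc n. (t / real (Suc n)) * B)"
        using t by (intro sum_mono mult_left_mono) auto
      also have "\<dots> = t * B" by simp
      finally show ?thesis using True by (simp add: grid_exp_def del: of_nat_Suc sum.lessThan_Suc)
    qed simp
    have fi: "has_bochner_integral (P x) (?f (Suc n)) (if y = x then euler (\<lambda>z z'. heat (t / real (Suc n)) z z' * exp (?\<beta> (Some z) * of_real (t / real (Suc n)))) y q (Suc n) else 0)" for n
      by (rule grid_expectation[OF t' _ d]) simp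
    have gm: "?g \<in> borel_measurable (P x)"
      by (rule borel_measurable_LIMSEQ_metric[where f = "\<lambda>n. ?f (Suc n)"]) (use fi lim in \<open>auto dest: borel_measurable_has_bochner_integral\<close>)
    have conv: "(\<lambda>n. \<integral>\<omega>. ?f (Suc n) \<omega> \<partial>P x) \<longlonglongrightarrow> (\<integral>\<omega>. ?g \<omega> \<partial>P x)"
      by (rule integral_dominated_convergence[where w = "\<lambda>_. exp (t * B)"])
        (use gm fi lim bound in \<open>auto dest: borel_measurable_has_bochner_integral\<close>)
    have gi: "integrable (P x) ?g"
      by (rule integrable_dominated_convergence[where w = "\<lambda>_. exp (t * B)" and s = "\<lambda>n. ?f (Suc n)"])
        (use gm fi lim bound in \<open>auto dest: borel_measurable_has_bochner_integral\<close>)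
    have "(\<lambda>n. if y = x then euler (\<lambda>z z'. heat (t / real (Suc n)) z z' * exp (?\<beta> (Some z) * of_real (t / real (Suc n)))) y q (Suc n) else 0)
      \<longlonglongrightarrow> (if y = x then pathw (\<lambda>x y. of_real (rate x y)) x q * dexp (map (\<lambda>z. ?\<beta> (Some z) - of_real (wdeg b m z)) (x # q)) t else 0)"
    proof (cases "y = x")
      case True
      let ?T = "\<lambda>n z z'. heat (t / real n) z z' * exp (?\<beta> (Some z) * of_real (t / real n))"
      let ?l = "pathw (\<lambda>x y. of_real (rate x y)) x q * dexp (map (\<lambda>z. ?\<beta> (Some z) - of_real (wdeg b m z)) (x # q)) t"
      have "(\<lambda>n. euler (?T n) x q n) \<longlonglongrightarrow> ?l"
      proof (rule tendstoI)
        fix e :: real assume e: "0 < e"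
        have "\<forall>\<^sub>F n in sequentially. \<forall>k\<le>n. cmod (euler (?T n) x q k - pathw (\<lambda>x y. of_real (rate x y)) x q * dexp (map (\<lambda>z. ?\<beta> (Some z) - of_real (wdeg b m z)) (x # q)) (t * real k / real n)) \<le> e / 2"
          by (rule euler_converges[OF t' heat_step_diag[OF t'] heat_step_off_diag[OF t']]) (use d True e in auto)
        with eventually_gt_at_top[of 0] show "\<forall>\<^sub>F n in sequentially. dist (euler (?T n) x q n) ?l < e"
        proof eventually_elim
          case (elim n)
          have "t * real n / real n = t" using elim by simp
          then have "cmod (euler (?T n) x q n - ?l) \<le> e / 2" using elim(2)[rule_format, of n] by simp
          then show ?case using e unfolding dist_norm by linarith
        qed
      qed
      from LIMSEQ_Suc[OF this] show ?thesis unfolding True by (simp only: refl if_True)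
    qed simp
    moreover have "(\<lambda>n. \<integral>\<omega>. ?f (Suc n) \<omega> \<partial>P x) = (\<lambda>n. if y = x then euler (\<lambda>z z'. heat (t / real (Suc n)) z z' * exp (?\<beta> (Some z) * of_real (t / real (Suc n)))) y q (Suc n) else 0)"
      using has_bochner_integral_integral_eq[OF fi] by (intro ext)
    ultimately have "(\<integral>\<omega>. ?g \<omega> \<partial>P x) = (if y = x then pathw (\<lambda>x y. of_real (rate x y)) x q * dexp (map (\<lambda>z. ?\<beta> (Some z) - of_real (wdeg b m z)) (x # q)) t else 0)"
      using LIMSEQ_unique[OF conv] by simp
    then show ?thesis using gi unfolding has_bochner_integral_iff by blast
  qed
qed

lemma skel_event_sets:
  assumes t: "0 \<le> t" shows "{\<omega> \<in> space (P x). \<omega> \<in> skel_event t p} \<in> sets (P x)"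
proof (cases "t = 0")
  case True
  have "{\<omega> \<in> space (P x). \<omega> \<in> skel_event t p} = {\<omega> \<in> space (P x). \<omega> 0 \<in> {z. p = [z]}}"
    by (simp add: True skel_event_0)
  then show ?thesis using eval_sets[of 0 x "{z. p = [z]}"] by simp
next
  case False
  then have t': "0 < t" using t by simp
  have "(\<lambda>\<omega>. indicator (skel_event t p) \<omega> :: real) \<in> borel_measurable (P x)"
  proof (rule borel_measurable_LIMSEQ_metric[where f = "\<lambda>n \<omega>. indicator {\<omega> \<in> space (P x). grid_skel \<omega> t n = p} \<omega>"])
    show "indicator {\<omega> \<in> space (P x). grid_skel \<omega> t n = p} \<in> borel_measurable (P x)" for n
      using grid_skel_sets[OF t] by simp
    fix \<omega> assume w: "\<omega> \<in> space (P x)"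
    then have "\<omega> \<in> paths" by (simp add: space_P)
    from skel_event_eventually[OF this t', of p]
    have "\<forall>\<^sub>F n in sequentially. indicator {\<omega> \<in> space (P x). grid_skel \<omega> t n = p} \<omega> = (indicator (skel_event t p) \<omega> :: real)"
      by eventually_elim (use w in \<open>simp add: indicator_def\<close>)
    then show "(\<lambda>n. indicator {\<omega> \<in> space (P x). grid_skel \<omega> t n = p} \<omega>) \<longlonglongrightarrow> (indicator (skel_event t p) \<omega> :: real)"
      by (rule tendsto_eventually)
  qed
  from measurable_sets[OF this, of "{1}"] show ?thesis
    by (auto simp: vimage_def Int_def indicator_def conj_commute split: if_splits elim!: back_subst[where P = "\<lambda>A. A \<in> sets (P x)"])
qed

text \<open>No jump from a vertex to infinity occurs: conservation of the rates makes the escape probability in a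
  time step small relative to the step size, although infinity may be reached by infinitely many jumps.\<close>

definition escape :: "real \<Rightarrow> 'a \<Rightarrow> real" where
  "escape s l = P.prob l {\<omega> \<in> space (P l). \<omega> s = None}"

lemma escape_le:
  assumes s: "0 < s" and F: "finite F"
  shows "escape s l \<le> 1 - (\<Sum>z\<in>F. Re (heat s l z))"
proof -
  let ?E = "\<lambda>z. {\<omega> \<in> space (P l). \<omega> s = z}"
  let ?G = "insert None (Some ` F)"
  have E: "?E z \<in> sets (P l)" for z using s by (intro eval_sets') simp
  have "(\<Sum>z\<in>?G. P.prob l (?E z)) = P.prob l (\<Union>z\<in>?G. ?E z)"
    using F E by (intro P.finite_measure_finite_Union[symmetric]) (auto simp: disjoint_family_on_def)
  also have "\<dots> \<le> 1" by (rule P.prob_le_1)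
  finally show ?thesis
    using F s by (simp add: escape_def heat_Re sum.reindex)
qed

text \<open>Being at infinity excludes being in a finite set. To first order in time, the
  probability of missing a finite set containing l is governed by deg minus the rates into it, which
  is as small as desired because deg is the full sum of the rates.\<close>

lemma escape_lim:
  assumes t: "0 < t"
  shows "(\<lambda>n. real n * escape (t / real n) l) \<longlonglongrightarrow> 0"
proof (rule LIMSEQ_I)
  fix e :: real assume e: "0 < e"
  have W: "((\<lambda>z. rate l z) has_sum wdeg b m l) UNIV"
  proof -
    have "((\<lambda>z. b l z * (1 / m l)) has_sum (\<Sum>\<^sub>\<infinity>z. b l z) * (1 / m l)) UNIV"
      by (intro has_sum_cmult_left has_sum_infsum b_summable)
    then show ?thesis by (simp add: rate_def wdeg_def)
  qed
  then have "\<forall>\<^sub>F F in finite_subsets_at_top UNIV. dist (sum (rate l) F) (wdeg b m l) < e / (2 * t)"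
    unfolding has_sum_def using e t by (intro tendstoD) auto
  then obtain F0 where F0: "finite F0" "\<And>F. finite F \<Longrightarrow> F0 \<subseteq> F \<Longrightarrow> dist (sum (rate l) F) (wdeg b m l) < e / (2 * t)"
    by (auto simp: eventually_finite_subsets_at_top)
  define F where "F = F0 - {l}"
  have F: "finite F" "l \<notin> F" using F0 by (auto simp: F_def)
  have "sum (rate l) (insert l F0) = sum (rate l) F"
    using F0(1) unfolding F_def by (intro sum.mono_neutral_right) (auto simp: rate_def)
  then have "dist (sum (rate l) F) (wdeg b m l) < e / (2 * t)" using F0(2)[of "insert l F0"] F0(1) by auto
  then have "wdeg b m l - sum (rate l) F < e / (2 * t)" unfolding dist_real_def by linarith
  then have small: "t * (wdeg b m l - sum (rate l) F) < e" using t e by (simp add: field_simps)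
  have "(\<lambda>n. - Re (of_nat n * (heat (t / real n) l l - single l l)) - (\<Sum>z\<in>F. Re (of_nat n * (heat (t / real n) l z - single z l))))
     \<longlonglongrightarrow> - Re (of_real (t * (rate l l - (if l = l then wdeg b m l else 0)))) - (\<Sum>z\<in>F. Re (of_real (t * (rate l z - (if l = z then wdeg b m l else 0)))))"
    by (intro tendsto_intros heat_step_lim t)
  also have "- Re (of_real (t * (rate l l - (if l = l then wdeg b m l else 0)))) - (\<Sum>z\<in>F. Re (of_real (t * (rate l z - (if l = z then wdeg b m l else 0)))))
     = t * (wdeg b m l - sum (rate l) F)"
  proof -
    have "(\<Sum>z\<in>F. Re (of_real (t * (rate l z - (if l = z then wdeg b m l else 0))))) = (\<Sum>z\<in>F. t * rate l z)"
      using F by (intro sum.cong) auto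
    also have "\<dots> = t * sum (rate l) F" by (simp add: sum_distrib_left)
    finally have 1: "(\<Sum>z\<in>F. Re (of_real (t * (rate l z - (if l = z then wdeg b m l else 0))))) = t * sum (rate l) F" .
    have "rate l l = 0" by (simp add: rate_def)
    then show ?thesis unfolding 1 by (simp add: algebra_simps)
  qed
  finally have "\<forall>\<^sub>F n in sequentially. - Re (of_nat n * (heat (t / real n) l l - single l l)) - (\<Sum>z\<in>F. Re (of_nat n * (heat (t / real n) l z - single z l))) < e"
    using order_tendstoD(2) small by blast
  with eventually_gt_at_top[of 0] have "\<forall>\<^sub>F n in sequentially. norm (real n * escape (t / real n) l - 0) < e"
  proof eventually_elim
    case (elim n)
    let ?s = "t / real n"
    have s: "0 < ?s" using t elim by simp
    have "real n * escape ?s l \<le> real n * (1 - (\<Sum>z\<in>insert l F. Re (heat ?s l z)))"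
      using escape_le[OF s, of "insert l F" l] F by (intro mult_left_mono) auto
    also have "\<dots> = - Re (of_nat n * (heat ?s l l - single l l)) - (\<Sum>z\<in>F. Re (of_nat n * (heat ?s l z - single z l)))"
    proof -
      have "(\<Sum>z\<in>F. Re (of_nat n * (heat ?s l z - single z l))) = (\<Sum>z\<in>F. real n * Re (heat ?s l z))"
        using F by (intro sum.cong) auto
      then show ?thesis using F by (simp add: sum_distrib_left[symmetric] algebra_simps)
    qed
    also have "\<dots> < e" by (rule elim(2))
    finally show ?case by (simp add: escape_def)
  qed
  then show "\<exists>no. \<forall>n\<ge>no. norm (real n * escape (t / real n) l - 0) < e"
    by (simp add: eventually_sequentially)
qed

text \<open>Markov property at one grid time, read off from the joint distribution at two times. For
  i = 0 only one positive time occurs, and on a finite graph infinity is not a point of the state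
  space.\<close>

lemma escape_step:
  assumes t: "0 < t" and i: "i < n"
  shows "P.prob x {\<omega> \<in> space (P x). \<omega> (t * real i / real n) = Some l \<and> \<omega> (t * real (Suc i) / real n) = None} \<le> escape (t / real n) l"
proof (cases "None \<in> topspace (Xhat :: 'a option topology)")
  case False
  have "\<omega> (t * real (Suc i) / real n) \<noteq> None" if "\<omega> \<in> paths" for \<omega> :: "real \<Rightarrow> 'a option"
    using False path_topspace[OF that, of "t * real (Suc i) / real n"] t by (metis divide_nonneg_nonneg less_imp_le mult_nonneg_nonneg of_nat_0_le_iff)
  then have e: "{\<omega> \<in> space (P x). \<omega> (t * real i / real n) = Some l \<and> \<omega> (t * real (Suc i) / real n) = None} = {}"
    unfolding space_P by blast
  show ?thesis unfolding e by (simp add: escape_def)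
next
  case None: True
  have n: "0 < n" using i by simp
  let ?d = "t / real n"
  have d: "0 < ?d" using t n by simp
  have sd: "t * real (Suc i) / real n = t * real i / real n + ?d" by (simp add: add_divide_distrib distrib_left)
  show ?thesis
  proof (cases "i = 0")
    case True
    show ?thesis
    proof (cases "l = x")
      case l: True
      show ?thesis unfolding escape_def l using True t n
        by (intro P.finite_measure_mono) (auto intro!: eval_sets')
    next
      case False
      have "AE \<omega> in P x. \<not> (\<omega> (t * real i / real n) = Some l \<and> \<omega> (t * real (Suc i) / real n) = None)"
        using starts[of x] by eventually_elim (use True False in auto)
      then show ?thesis using P.prob_eq_0_AE by (simp add: escape_def)
    qed
  next
    case False
    let ?s = "\<lambda>j. if j = 0 then 0 else if j = 1 then t * real i / real n else t * real (Suc i) / real n"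
    let ?z = "\<lambda>j::nat. if j = 0 then Some x else if j = 1 then Some l else None"
    have pos: "0 < t * real i / real n" using False t n by simp
    have two: "{1..2} = {1, 2::nat}" by auto
    have "of_real (P.prob x {\<omega> \<in> space (P x). \<forall>j\<in>{1..2}. \<omega> (?s j) = ?z j}) = (\<Prod>j<2. trans_prob b m (?s (Suc j) - ?s j) (?z j) (?z (Suc j)))"
    proof (rule fdd)
      fix j :: nat assume "j < 2"
      then consider "j = 0" | "j = 1" by linarith
      then show "?s j < ?s (Suc j)" using pos d unfolding sd by cases auto
    qed (use None Some_topspace in auto)
    then have "of_real (P.prob x {\<omega> \<in> space (P x). \<omega> (t * real i / real n) = Some l \<and> \<omega> (t * real (Suc i) / real n) = None})
      = trans_prob b m (t * real i / real n) (Some x) (Some l) * trans_prob b m ?d (Some l) None"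
      unfolding two using sd by (simp add: numeral_2_eq_2)
    also have "\<dots> = of_real (P.prob x {\<omega> \<in> space (P x). \<omega> (t * real i / real n) = Some l}) * of_real (escape ?d l)"
      unfolding escape_def one_step[OF pos Some_topspace] one_step[OF d None] ..
    finally have "P.prob x {\<omega> \<in> space (P x). \<omega> (t * real i / real n) = Some l \<and> \<omega> (t * real (Suc i) / real n) = None}
      = P.prob x {\<omega> \<in> space (P x). \<omega> (t * real i / real n) = Some l} * escape ?d l"
      by (simp flip: of_real_mult)
    also have "\<dots> \<le> 1 * escape ?d l" by (intro mult_right_mono) (auto simp: escape_def)
    finally show ?thesis by simp
  qed
qed

lemma first_None:
  assumes "zs \<noteq> []" "hd zs \<noteq> None" "None \<in> set zs"
  shows "\<exists>i l. Suc i < length zs \<and> zs ! i = Some l \<and> zs ! Suc i = None"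
  using assms
proof (induction zs)
  case (Cons z zs)
  then obtain y where y: "z = Some y" by (cases z) auto
  have zs: "zs \<noteq> []" "None \<in> set zs" using Cons.prems y by auto
  show ?case
  proof (cases "hd zs = None")
    case True
    then show ?thesis using y zs by (intro exI[of _ 0] exI[of _ y]) (auto simp: hd_conv_nth)
  next
    case False
    then obtain i l where "Suc i < length zs" "zs ! i = Some l" "zs ! Suc i = None" using Cons.IH zs by blast
    then show ?thesis by (intro exI[of _ "Suc i"] exI[of _ l]) auto
  qed
qed simp

text \<open>A sample that starts at a vertex and meets infinity contains a step from a vertex of
  \<open>p\<close> to infinity. There are finitely many such vertices and n steps, and n times the
  escape probability tends to 0.\<close>

lemma skel_None_null:
  assumes t: "0 \<le> t" and p: "None \<in> set p"
  shows "AE \<omega> in P x. \<omega> \<notin> skel_event t p"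
proof (cases "t = 0")
  case True
  show ?thesis using starts[of x] by eventually_elim (use p True in \<open>auto simp: skel_event_0\<close>)
next
  case False
  then have t': "0 < t" using t by simp
  let ?L = "{l. Some l \<in> set p}"
  have L: "finite ?L" using finite_vimageI[of "set p" Some] by (simp add: vimage_def)
  let ?G = "\<lambda>n. {\<omega> \<in> space (P x). grid_skel \<omega> t n = p}"
  let ?S = "{\<omega> \<in> space (P x). \<omega> \<in> skel_event t p}"
  have G: "?G n \<in> sets (P x)" for n by (rule grid_skel_sets[OF t])
  have S: "?S \<in> sets (P x)" by (rule skel_event_sets[OF t])
  have "(\<lambda>n. \<integral>\<omega>. indicator (?G n) \<omega> \<partial>P x) \<longlonglongrightarrow> (\<integral>\<omega>. indicator ?S \<omega> \<partial>P x :: real)"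
  proof (rule integral_dominated_convergence[where w = "\<lambda>_. 1"])
    show "AE \<omega> in P x. (\<lambda>n. indicator (?G n) \<omega> :: real) \<longlonglongrightarrow> indicator ?S \<omega>"
    proof (rule AE_I2)
      fix \<omega> assume w: "\<omega> \<in> space (P x)"
      then have "\<omega> \<in> paths" by (simp add: space_P)
      from skel_event_eventually[OF this t', of p]
      have "\<forall>\<^sub>F n in sequentially. indicator (?G n) \<omega> = (indicator ?S \<omega> :: real)"
        by eventually_elim (use w in \<open>simp add: indicator_def\<close>)
      then show "(\<lambda>n. indicator (?G n) \<omega> :: real) \<longlonglongrightarrow> indicator ?S \<omega>" by (rule tendsto_eventually)
    qed
  qed (use G S in \<open>auto simp: indicator_def\<close>)
  then have lim: "(\<lambda>n. P.prob x (?G n)) \<longlonglongrightarrow> P.prob x ?S" using G S by simp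
  have "P.prob x (?G n) \<le> (\<Sum>l\<in>?L. real n * escape (t / real n) l)" for n
  proof -
    let ?E = "\<lambda>i l. {\<omega> \<in> space (P x). \<omega> (t * real i / real n) = Some l \<and> \<omega> (t * real (Suc i) / real n) = None}"
    have E: "?E i l \<in> sets (P x)" for i l
      using t by (intro sets.sets_Collect_conj eval_sets') auto
    have "P.prob x (?G n) \<le> P.prob x (\<Union>(l, i)\<in>?L \<times> {..<n}. ?E i l)"
    proof (rule P.finite_measure_mono_AE)
      show "AE \<omega> in P x. \<omega> \<in> ?G n \<longrightarrow> \<omega> \<in> (\<Union>(l, i)\<in>?L \<times> {..<n}. ?E i l)"
        using starts[of x]
      proof eventually_elim
        case (elim \<omega>)
        show ?case
        proof
          assume w: "\<omega> \<in> ?G n"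
          let ?g = "grid \<omega> t n"
          have g: "length ?g = Suc n" "\<And>i. i \<le> n \<Longrightarrow> \<omega> (t * real i / real n) = ?g ! i"
            using grid_eq_iff[THEN iffD1, OF refl, of \<omega> t n] by auto
          have sp: "set ?g = set p" using w remdups_adj_set[of ?g] by (simp add: grid_skel_def)
          have ne: "?g \<noteq> []" using g(1) by auto
          then have "hd ?g = Some x" using g(2)[of 0] elim by (simp add: hd_conv_nth)
          with ne obtain i l where i: "Suc i < length ?g" "?g ! i = Some l" "?g ! Suc i = None"
            using first_None[of ?g] p sp by auto
          have "Some l \<in> set ?g" using i nth_mem[of i ?g] by simp
          then have "l \<in> ?L" using sp by simp
          moreover have "i < n" using i g(1) by simp
          moreover have "\<omega> \<in> ?E i l" using w i g(2)[of i] g(2)[of "Suc i"] \<open>i < n\<close> by simp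
          ultimately show "\<omega> \<in> (\<Union>(l, i)\<in>?L \<times> {..<n}. ?E i l)" by blast
        qed
      qed
    qed (use E in auto)
    also have "\<dots> \<le> (\<Sum>(l, i)\<in>?L \<times> {..<n}. P.prob x (?E i l))"
      using L E by (subst case_prod_beta', subst case_prod_beta') (intro measure_UNION_le, auto)
    also have "\<dots> \<le> (\<Sum>(l, i)\<in>?L \<times> {..<n}. escape (t / real n) l)"
      using escape_step[OF t'] by (intro sum_mono) auto
    also have "\<dots> = (\<Sum>l\<in>?L. real n * escape (t / real n) l)"
      by (simp add: sum.cartesian_product[symmetric])
    finally show ?thesis .
  qed
  moreover have "(\<lambda>n. \<Sum>l\<in>?L. real n * escape (t / real n) l) \<longlonglongrightarrow> (\<Sum>l\<in>?L. 0)"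
    by (intro tendsto_sum escape_lim t')
  ultimately have "P.prob x ?S \<le> 0" using lim by (intro LIMSEQ_le[OF lim]) auto
  then have "P.prob x ?S = 0" using measure_nonneg[of "P x" ?S] by linarith
  then have "emeasure (P x) ?S = 0" using P.emeasure_eq_measure[of x ?S] by simp
  then show ?thesis using S by (intro AE_I[of _ _ ?S]) auto
qed

text \<open>There are countably many lists, so the null sets of all skeletons through infinity can
  be removed at once.\<close>

lemma skel_form:
  assumes t: "0 \<le> t"
  shows "AE \<omega> in P x. finite (jumps \<omega> t) \<longrightarrow> (\<exists>q. skel \<omega> t = map Some (x # q))"
proof -
  have "AE \<omega> in P x. \<forall>p. None \<in> set p \<longrightarrow> \<omega> \<notin> skel_event t p"
    unfolding AE_all_countable using skel_None_null[OF t] by (auto simp: AE_all_countable)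
  then show ?thesis using starts[of x]
  proof eventually_elim
    case (elim \<omega>)
    show ?case
    proof
      assume "finite (jumps \<omega> t)"
      then have "None \<notin> set (skel \<omega> t)" using elim(1) by (auto simp: skel_event_def)
      then have s: "skel \<omega> t = map Some (map the (skel \<omega> t))"
        by (auto simp: map_idI[symmetric] intro!: nth_equalityI) (metis nth_mem option.collapse)
      have "skel \<omega> t = \<omega> 0 # tl (skel \<omega> t)"
      proof -
        have "[0..<Suc c] = 0 # [1..<Suc c]" for c by (simp add: upt_conv_Cons del: upt_Suc)
        then show ?thesis unfolding skel_def by simp
      qed
      then have "skel \<omega> t = Some x # tl (skel \<omega> t)" using elim(2) by simp
      then have "map the (skel \<omega> t) = x # map the (tl (skel \<omega> t))" by (metis list.simps(9) option.sel)
      then show "\<exists>q. skel \<omega> t = map Some (x # q)" using s by metis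
    qed
  qed
qed

end


section \<open>Path integrals of Schroedinger semigroups\<close>

lemma dexp_cnj: "0 \<le> t \<Longrightarrow> cnj (dexp cs t) = dexp (map cnj cs) t"
proof (induction cs t rule: dexp.induct)
  case (3 a c cs t)
  have "continuous_on {0..t} (dexp (c # cs))"
    by (rule continuous_on_subset[OF dexp_cont]) auto
  then have "(\<lambda>s. exp (- a * of_real s) * dexp (c # cs) s) integrable_on {0..t}"
    by (intro integrable_continuous_real continuous_intros)
  from integral_linear[OF this bounded_linear_cnj]
  have "cnj (integral {0..t} (\<lambda>s. exp (- a * of_real s) * dexp (c # cs) s))
     = integral {0..t} (\<lambda>s. cnj (exp (- a * of_real s) * dexp (c # cs) s))"
    by (simp add: o_def)
  also have "\<dots> = integral {0..t} (\<lambda>s. exp (- cnj a * of_real s) * dexp (map cnj (c # cs)) s)"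
    using 3 by (intro Henstock_Kurzweil_Integration.integral_cong) (auto simp: exp_cnj)
  finally show ?case by (simp add: exp_cnj)
qed (auto simp: exp_cnj)

text \<open>Detailed balance along a path: the weights m of the inner vertices telescope, and those
  of the two ends remain.\<close>

lemma pathw_reverse:
  fixes K1 K2 :: "'a \<Rightarrow> 'a \<Rightarrow> complex" and m :: "'a \<Rightarrow> complex"
  assumes "\<And>x y. cnj (K1 x y) * m x = m y * K2 y x"
  shows "cnj (pathw K1 y q) * m y = m (last (y # q)) * pathw K2 (last (y # q)) (tl (rev (y # q)))"
proof (induction q arbitrary: y)
  case (Cons w q)
  let ?r = "tl (rev (w # q))" and ?l = "last (w # q)"
  have ne: "rev (w # q) = ?l # ?r" by (cases q rule: rev_cases) auto
  have tl: "tl (rev (y # w # q)) = ?r @ [y]"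
    using ne by (metis append_Cons list.sel(3) rev.simps(2))
  have la: "last (?l # ?r) = w" unfolding ne[symmetric] by simp
  have "cnj (pathw K1 y (w # q)) * m y = (cnj (K1 y w) * m y) * cnj (pathw K1 w q)" by simp
  also have "\<dots> = K2 w y * (cnj (pathw K1 w q) * m w)" unfolding assms by (simp only: mult_ac)
  also have "\<dots> = K2 w y * (m ?l * pathw K2 ?l ?r)" unfolding Cons.IH ..
  also have "\<dots> = m ?l * pathw K2 ?l (?r @ [y])" unfolding pathw_append la by (simp add: mult_ac)
  finally show ?case unfolding tl by simp
qed simp

lemma bij_reverse_path:
  "bij_betw (\<lambda>q. tl (rev (y # q))) {q. last (y # q) = z} {r. last (z # r) = y}"
proof (rule bij_betwI[where g = "\<lambda>r. tl (rev (z # r))"])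
  have *: "last (z # tl (rev (y # q))) = y \<and> tl (rev (z # tl (rev (y # q)))) = q" if "last (y # q) = z" for y z :: 'a and q
  proof -
    have "rev (y # q) = z # tl (rev (y # q))" using that by (cases q rule: rev_cases) auto
    then have "z # tl (rev (y # q)) = rev (y # q)" ..
    then show ?thesis by (metis last_rev list.sel(1) list.sel(3) list.distinct(1) rev_rev_ident)
  qed
  show "(\<lambda>q. tl (rev (y # q))) \<in> {q. last (y # q) = z} \<rightarrow> {r. last (z # r) = y}" using *[of y _ z] by blast
  show "(\<lambda>r. tl (rev (z # r))) \<in> {r. last (z # r) = y} \<rightarrow> {q. last (y # q) = z}" using *[of z _ y] by blast
  show "tl (rev (z # tl (rev (y # q)))) = q" if "q \<in> {q. last (y # q) = z}" for q using *[of y q z] that by blast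
  show "tl (rev (y # tl (rev (z # r)))) = r" if "r \<in> {r. last (z # r) = y}" for r using *[of z r y] that by blast
qed

lemma esum_inj:
  assumes "inj f" "\<And>p. p \<notin> range f \<Longrightarrow> F p = 0"
  shows "esum F = esum (\<lambda>q. F (f q))"
proof -
  have "esum F = esum (\<lambda>p. F p * indicator (range f) p)"
    using assms(2) by (intro nn_integral_cong) (auto simp: indicator_def)
  also have "\<dots> = (\<integral>\<^sup>+p. F p \<partial>count_space (range f))"
    by (simp add: nn_integral_count_space_indicator)
  also have "\<dots> = esum (\<lambda>q. F (f q))"
    using nn_integral_bij_count_space[OF inj_on_imp_bij_betw[OF assms(1)], of F] by simp
  finally show ?thesis .
qed

lemma tsum_lim:
  assumes "tsummable (F :: 'i::countable \<Rightarrow> complex)"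
  shows "(\<lambda>n. \<Sum>p\<in>initial_set n. F p) \<longlonglongrightarrow> tsum F"
proof -
  have "(\<lambda>n. \<integral>p. indicator (initial_set n) p *\<^sub>R F p \<partial>count_space UNIV) \<longlonglongrightarrow> (\<integral>p. F p \<partial>count_space UNIV)"
  proof (rule integral_dominated_convergence[where w = "\<lambda>p. cmod (F p)"])
    show "AE p in count_space UNIV. (\<lambda>n. indicator (initial_set n) p *\<^sub>R F p) \<longlonglongrightarrow> F p"
    proof (rule AE_I2)
      fix p
      have "\<forall>\<^sub>F n in sequentially. indicator (initial_set n) p *\<^sub>R F p = F p"
        using eventually_gt_at_top[of "to_nat p"] by eventually_elim (auto simp: initial_set_def)
      then show "(\<lambda>n. indicator (initial_set n) p *\<^sub>R F p) \<longlonglongrightarrow> F p" by (rule tendsto_eventually)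
    qed
  qed (use assms in \<open>auto simp: indicator_def\<close>)
  moreover have "(\<integral>p. indicator (initial_set n) p *\<^sub>R F p \<partial>count_space UNIV) = (\<Sum>p\<in>initial_set n. F p)" for n
  proof -
    have "tsum (\<lambda>p. indicator (initial_set n) p *\<^sub>R F p) = infsetsum F (initial_set n)"
      by (intro infsetsum_cong_neutral) (auto simp: indicator_def)
    then show ?thesis by (simp add: infsetsum_def[symmetric])
  qed
  ultimately show ?thesis by (simp add: infsetsum_def)
qed

text \<open>The stochastic line integral as a function of the skeleton alone, with the same default
  0 when a step crosses a missing edge.\<close>

definition lint :: "('a \<Rightarrow> 'a \<Rightarrow> real) \<Rightarrow> ('a \<Rightarrow> 'a \<Rightarrow> real) \<Rightarrow> 'a option list \<Rightarrow> real" where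
  "lint b \<theta> p = (if \<exists>n<length p - 1. ext0_2 b (p ! n) (p ! Suc n) = 0 then 0
     else \<Sum>n<length p - 1. ext0_2 \<theta> (p ! n) (p ! Suc n))"

definition phase :: "('a \<Rightarrow> 'a \<Rightarrow> real) \<Rightarrow> ('a \<Rightarrow> 'a \<Rightarrow> real) \<Rightarrow> 'a option list \<Rightarrow> complex" where
  "phase b \<theta> p = \<i> ^ (length p - 1) * exp (\<i> * of_real (lint b \<theta> p))"

lemma norm_phase: "cmod (phase b \<theta> p) = 1"
  by (simp add: phase_def norm_mult norm_power)

lemma (in finite_jumps) line_integral_skel: "line_integral b \<theta> t \<omega> = lint b \<theta> (skel \<omega> t)"
proof -
  have nth: "skel \<omega> t ! n = \<omega> (\<tau> n)" "skel \<omega> t ! Suc n = \<omega> (\<tau> (Suc n))" if "n < N" for n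
    using that by (auto simp: skel_nth simp del: jump_time.simps)
  have N: "num_jumps \<omega> t = enat N" by (rule the_num_jumps[OF fin])
  have ex: "(\<exists>n\<in>{1..N}. Q (n - 1) n) \<longleftrightarrow> (\<exists>n<N. Q n (Suc n))" for Q :: "nat \<Rightarrow> nat \<Rightarrow> bool"
  proof
    assume "\<exists>n\<in>{1..N}. Q (n - 1) n"
    then obtain n where "n \<in> {1..N}" "Q (n - 1) n" by blast
    then show "\<exists>n<N. Q n (Suc n)" by (intro exI[of _ "n - 1"]) auto
  next
    assume "\<exists>n<N. Q n (Suc n)"
    then obtain n where "n < N" "Q n (Suc n)" by blast
    then show "\<exists>n\<in>{1..N}. Q (n - 1) n" by (intro bexI[of _ "Suc n"]) auto
  qed
  have c: "(\<exists>n\<in>{1..N}. ext0_2 b (\<omega> (\<tau> (n - 1))) (\<omega> (\<tau> n)) = 0) \<longleftrightarrow> (\<exists>n<N. ext0_2 b (skel \<omega> t ! n) (skel \<omega> t ! Suc n) = 0)"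
    using ex[of "\<lambda>k n. ext0_2 b (\<omega> (\<tau> k)) (\<omega> (\<tau> n)) = 0"] nth by auto
  have s: "(\<Sum>n = 1..N. ext0_2 \<theta> (\<omega> (\<tau> (n - 1))) (\<omega> (\<tau> n))) = (\<Sum>n<N. ext0_2 \<theta> (skel \<omega> t ! n) (skel \<omega> t ! Suc n))"
    unfolding One_nat_def sum.atLeast1_atMost_eq using nth by (intro sum.cong) (auto simp del: jump_time.simps)
  show ?thesis
    unfolding line_integral_def Let_def N the_enat.simps c s lint_def length_skel
    by (auto simp: zero_enat_def)
qed

lemma (in finite_jumps) exp_action:
  "\<i> ^ the_enat (num_jumps \<omega> t) * exp (action b m v \<theta> t \<omega>)
     = phase b \<theta> (skel \<omega> t) * path_exp (\<lambda>x. v x + wdeg b m x) (wdeg b m) t \<omega>"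
  unfolding action_def line_integral_skel phase_def path_exp_def the_num_jumps[OF fin] length_skel
  by (simp add: exp_add[symmetric] mult.assoc algebra_simps)

lemma pathw_eq_prod: "pathw K x q = (\<Prod>n<length q. K ((x # q) ! n) (q ! n))"
proof (induction q arbitrary: x)
  case (Cons y q)
  show ?case by (simp add: Cons prod.lessThan_Suc_shift del: prod.lessThan_Suc)
qed simp

context bounded_graph
begin

text \<open>Across a missing edge the line integral takes its default value and the individual
  phases are lost, but then both path products vanish.\<close>

lemma phase_pathw:
  "phase b \<theta> (map Some (x # q)) * pathw (\<lambda>x y. of_real (rate x y)) x q = pathw (hop (- \<i>) \<theta>) x q"
proof (cases "\<exists>n<length q. b ((x # q) ! n) (q ! n) = 0")
  case True
  then obtain n where n: "n < length q" "b ((x # q) ! n) (q ! n) = 0" by blast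
  have "pathw (\<lambda>x y. complex_of_real (rate x y)) x q = 0"
    unfolding pathw_eq_prod using n by (intro prod_zero) (auto simp: rate_def intro!: bexI[of _ n])
  moreover have "pathw (hop (- \<i>) \<theta>) x q = 0"
    unfolding pathw_eq_prod using n by (intro prod_zero) (auto simp: rate_def hop_def intro!: bexI[of _ n])
  ultimately show ?thesis by simp
next
  case False
  have e: "ext0_2 c (map Some (x # q) ! n) (map Some (x # q) ! Suc n) = c ((x # q) ! n) (q ! n)" if "n < length q" for c n
  proof -
    have "map Some (x # q) ! n = Some ((x # q) ! n)" "map Some (x # q) ! Suc n = Some (q ! n)"
      using that by (auto simp del: list.map simp: nth_map)
    then show ?thesis by (simp add: ext0_2_def)
  qed
  have "lint b \<theta> (map Some (x # q)) = (\<Sum>n<length q. \<theta> ((x # q) ! n) (q ! n))"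
    unfolding lint_def using False e by (auto simp del: list.map intro!: sum.cong)
  then have ph: "phase b \<theta> (map Some (x # q)) = (\<Prod>n<length q. \<i> * exp (\<i> * of_real (\<theta> ((x # q) ! n) (q ! n))))"
    unfolding phase_def by (simp add: exp_sum sum_distrib_left prod.distrib)
  show ?thesis
    unfolding ph pathw_eq_prod prod.distrib[symmetric]
    by (intro prod.cong) (auto simp: hop_def)
qed

lemma hop_hermitian:
  assumes "magnetic_potential b \<theta>"
  shows "cnj (hop (- \<i>) \<theta> x y) * of_real (m x) = of_real (m y) * hop \<i> \<theta> y x"
proof (cases "0 < b x y")
  case True
  then have th: "\<theta> x y = - \<theta> y x" using assms by (simp add: magnetic_potential_def)
  have "complex_of_real (rate x y) * of_real (m x) = of_real (b x y)" "of_real (m y) * complex_of_real (rate y x) = of_real (b x y)"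
    using m_gt[of x] m_gt[of y] b_sym[of x y] by (simp_all add: rate_def)
  then show ?thesis unfolding hop_def th by (simp add: exp_cnj mult_ac)
next
  case False
  then have "b x y = 0" using b_ge[of x y] by linarith
  moreover from this have "b y x = 0" using b_sym[of x y] by simp
  ultimately show ?thesis by (simp add: hop_def rate_def)
qed

end

locale schroedinger = bounded_graph b m C
  for b :: "'a::countable \<Rightarrow> 'a \<Rightarrow> real" and m C +
  fixes v :: "'a \<Rightarrow> real" and \<theta> :: "'a \<Rightarrow> 'a \<Rightarrow> real"
  assumes magnetic: "magnetic_potential b \<theta>"
    and semibounded: "semibounded_form m Cc (mag_form b m v \<theta>)"
begin

definition pot :: "complex \<Rightarrow> 'a \<Rightarrow> complex" where "pot c x = c * of_real (v x + wdeg b m x)"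

lemma
  assumes "c = \<i> \<or> c = - \<i>"
  shows unitary: "path_semigroup m rate C (hop c \<theta>) (pot c) 0"
    and op_exp_unitary: "f \<in> H \<Longrightarrow> 0 \<le> t \<Longrightarrow> op_exp m (scale_graph c (mag_op b m v \<theta>)) t f
       = path_semigroup.U (hop c \<theta>) (pot c) t f"
proof -
  obtain d where d: "0 \<le> d" "\<And>x. - d \<le> v x + wdeg b m x"
    using potential_bounded_below[OF magnetic semibounded] by blast
  have c: "cmod c = 1" "\<And>x. Re (c * of_real (v x + wdeg b m x)) \<le> 0" using assms by auto
  have p: "pot c = (\<lambda>x. c * of_real (v x + wdeg b m x))" by (simp add: pot_def fun_eq_iff)
  show "path_semigroup m rate C (hop c \<theta>) (pot c) 0"
    unfolding p by (rule op_exp_mag(1)[OF magnetic c(1) d order_refl c(2)])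
  show "f \<in> H \<Longrightarrow> 0 \<le> t \<Longrightarrow> op_exp m (scale_graph c (mag_op b m v \<theta>)) t f = path_semigroup.U (hop c \<theta>) (pot c) t f"
    unfolding p by (rule op_exp_mag(2)[OF magnetic c(1) d order_refl c(2)])
qed

sublocale U1: path_semigroup m rate C "hop (- \<i>) \<theta>" "pot (- \<i>)" 0
  by (rule unitary) simp

sublocale U2: path_semigroup m rate C "hop \<i> \<theta>" "pot \<i>" 0
  by (rule unitary) simp

text \<open>Adjointness of exp(-itL) and exp(itL), term by term: reversing a path turns the
  conjugate hopping weights of one into those of the other relative to m, and time-ordered integrals
  are invariant under reversal.\<close>

lemma U_adjoint:
  assumes t: "0 \<le> t"
  shows "cnj (U1.U t (single z) y) * of_real (m y) = of_real (m z) * U2.U t (single y) z"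
proof -
  let ?r = "\<lambda>q. tl (rev (y # q))"
  let ?A = "{q. last (y # q) = z}" and ?B = "{r. last (z # r) = y}"
  let ?f = "\<lambda>q. pathw (hop (- \<i>) \<theta>) y q * dexp (map (pot (- \<i>)) (y # q)) t"
  let ?g = "\<lambda>r. pathw (hop \<i> \<theta>) z r * dexp (map (pot \<i>) (z # r)) t"
  have cp: "cnj \<circ> pot (- \<i>) = pot \<i>" by (simp add: pot_def fun_eq_iff)
  have 1: "U1.U t (single z) y = infsetsum ?f ?A"
    unfolding U1.U_def U1.pterm_def by (intro infsetsum_cong_neutral) auto
  have 2: "U2.U t (single y) z = infsetsum ?g ?B"
    unfolding U2.U_def U2.pterm_def by (intro infsetsum_cong_neutral) auto
  have "cnj (infsetsum ?f ?A) = infsetsum (\<lambda>q. cnj (?f q)) ?A"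
    unfolding infsetsum_def by (rule Bochner_Integration.integral_cnj[symmetric])
  then have "cnj (infsetsum ?f ?A) * of_real (m y) = infsetsum (\<lambda>q. cnj (?f q) * of_real (m y)) ?A"
    unfolding infsetsum_def by simp
  also have "\<dots> = infsetsum (\<lambda>q. of_real (m z) * ?g (?r q)) ?A"
  proof (intro infsetsum_cong refl)
    fix q assume "q \<in> ?A"
    then have l: "last (y # q) = z" by simp
    then have rv: "z # ?r q = rev (y # q)" by (cases q rule: rev_cases) auto
    have "cnj (?f q) * of_real (m y) = (cnj (pathw (hop (- \<i>) \<theta>) y q) * of_real (m y)) * cnj (dexp (map (pot (- \<i>)) (y # q)) t)"
      by (simp only: complex_cnj_mult mult_ac)
    also have "cnj (pathw (hop (- \<i>) \<theta>) y q) * of_real (m y) = of_real (m z) * pathw (hop \<i> \<theta>) z (?r q)"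
      using pathw_reverse[of "hop (- \<i>) \<theta>" "\<lambda>x. of_real (m x)" "hop \<i> \<theta>" y q, OF hop_hermitian[OF magnetic]] unfolding l .
    also have "cnj (dexp (map (pot (- \<i>)) (y # q)) t) = dexp (map (pot \<i>) (z # ?r q)) t"
      unfolding dexp_cnj[OF t] map_map cp rv rev_map[symmetric] dexp_rev[OF t] ..
    finally show "cnj (?f q) * of_real (m y) = of_real (m z) * ?g (?r q)" by (simp only: mult.assoc)
  qed
  also have "\<dots> = infsetsum (\<lambda>r. of_real (m z) * ?g r) ?B"
    by (rule infsetsum_reindex_bij_betw[OF bij_reverse_path])
  also have "\<dots> = of_real (m z) * infsetsum ?g ?B"
    unfolding infsetsum_def by simp
  finally show ?thesis unfolding 1 2 .
qed

end

section \<open>Expectations of functionals of the skeleton\<close>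

context graph_process
begin

text \<open>This includes skeletons through infinity, about which \<open>skel_expectation\<close>
  makes no statement.\<close>

lemma path_exp_measurable:
  assumes t: "0 \<le> t"
  shows "(\<lambda>\<omega>. indicator (skel_event t p) \<omega> *\<^sub>R path_exp w1 w2 t \<omega>) \<in> borel_measurable (P x)"
proof (cases "t = 0")
  case True
  have "(\<lambda>\<omega>. indicator {\<omega> \<in> space (P x). \<omega> \<in> skel_event t p} \<omega> *\<^sub>R (1::complex)) \<in> borel_measurable (P x)"
    using skel_event_sets[OF t] by (intro borel_measurable_scaleR) auto
  then show ?thesis
    by (rule measurable_cong[THEN iffD1, rotated]) (simp add: True path_exp_def time_integral_0 indicator_def)
next
  case False
  then have t': "0 < t" using t by simp
  let ?G = "\<lambda>n. {\<omega> \<in> space (P x). grid_skel \<omega> t n = p}"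
  show ?thesis
  proof (rule borel_measurable_LIMSEQ_metric[where f = "\<lambda>n \<omega>. indicator (?G n) \<omega> *\<^sub>R grid_exp (rate_fun w1 w2) t n \<omega>"])
    fix n
    have "(\<lambda>\<omega>. rate_fun w1 w2 (\<omega> (t * real i / real n))) \<in> borel_measurable (P x)" for i
      using t by (intro measurable_compose[OF eval_measurable]) auto
    then show "(\<lambda>\<omega>. indicator (?G n) \<omega> *\<^sub>R grid_exp (rate_fun w1 w2) t n \<omega>) \<in> borel_measurable (P x)"
      unfolding grid_exp_def using grid_skel_sets[OF t, of x n p]
      by (intro borel_measurable_scaleR measurable_compose[OF _ borel_measurable_exp]) auto
  next
    fix \<omega> assume w: "\<omega> \<in> space (P x)"
    then have wp: "\<omega> \<in> paths" by (simp add: space_P)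
    show "(\<lambda>n. indicator (?G n) \<omega> *\<^sub>R grid_exp (rate_fun w1 w2) t n \<omega>) \<longlonglongrightarrow> indicator (skel_event t p) \<omega> *\<^sub>R path_exp w1 w2 t \<omega>"
    proof (cases "\<omega> \<in> skel_event t p")
      case True
      then have "(\<lambda>n. grid_exp (rate_fun w1 w2) t n \<omega>) \<longlonglongrightarrow> indicator (skel_event t p) \<omega> *\<^sub>R path_exp w1 w2 t \<omega>"
        using grid_exp_lim[OF wp t', of w1 w2] by (simp add: skel_event_def)
      moreover have "\<forall>\<^sub>F n in sequentially. grid_exp (rate_fun w1 w2) t n \<omega> = indicator (?G n) \<omega> *\<^sub>R grid_exp (rate_fun w1 w2) t n \<omega>"
        using skel_event_eventually[OF wp t', of p] by eventually_elim (use True w in simp)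
      ultimately show ?thesis by (rule Lim_transform_eventually)
    next
      case False
      have "\<forall>\<^sub>F n in sequentially. indicator (?G n) \<omega> *\<^sub>R grid_exp (rate_fun w1 w2) t n \<omega> = indicator (skel_event t p) \<omega> *\<^sub>R path_exp w1 w2 t \<omega>"
        using skel_event_eventually[OF wp t', of p] by eventually_elim (use False in simp)
      then show ?thesis by (rule tendsto_eventually)
    qed
  qed
qed

definition functional :: "('a option list \<Rightarrow> complex) \<Rightarrow> ('a \<Rightarrow> real) \<Rightarrow> real \<Rightarrow> (real \<Rightarrow> 'a option) \<Rightarrow> complex" where
  "functional h w t \<omega> = (if finite (jumps \<omega> t) then h (skel \<omega> t) * path_exp w (wdeg b m) t \<omega> else 0)"

text \<open>The paths are decomposed by skeleton. Summability is checked on the moduli, whose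
  expectations come from \<open>skel_expectation\<close> with zero phase and are bounded by the
  summands of \<open>Rexp\<close>.\<close>

lemma functional_expectation:
  assumes t: "0 \<le> t"
    and sum: "esum (\<lambda>q. ennreal (pathw rate x q * (t ^ length q / fact (length q))) * ennreal (cmod (h (map Some (x # q))))) < \<infinity>"
  shows "has_bochner_integral (P x) (functional h w t)
    (tsum (\<lambda>q. pathw (\<lambda>x y. of_real (rate x y)) x q * dexp (map (\<lambda>z. - \<i> * of_real (w z)) (x # q)) t * h (map Some (x # q))))"
proof -
  let ?D = "wdeg b m"
  define e where "e p \<omega> = indicator (skel_event t p) \<omega> *\<^sub>R path_exp w ?D t \<omega>" for p \<omega>
  define F where "F p \<omega> = e p \<omega> * h p" for p \<omega>
  define W where "W = functional h w t"
  let ?i = "\<lambda>q. map Some (x # q)"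
  let ?v = "\<lambda>q. pathw (\<lambda>x y. of_real (rate x y)) x q * dexp (map (\<lambda>z. - \<i> * of_real (w z)) (x # q)) t * h (?i q)"
  have inj: "inj ?i" by (auto simp: inj_on_def inj_map_eq_map)
  have em: "e p \<in> borel_measurable (P x)" for p unfolding e_def by (rule path_exp_measurable[OF t])
  have Fm: "F p \<in> borel_measurable (P x)" for p
    unfolding F_def using em by (intro borel_measurable_times) auto
  have Fsum: "(\<Sum>p\<in>A. F p \<omega>) = (if skel \<omega> t \<in> A then W \<omega> else 0)" if "finite A" for A \<omega>
  proof -
    have "(\<Sum>p\<in>A. F p \<omega>) = (\<Sum>p\<in>A. if p = skel \<omega> t then W \<omega> else 0)"
      by (intro sum.cong) (auto simp: F_def e_def W_def functional_def skel_event_def indicator_def)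
    then show ?thesis using that by (simp add: sum.delta)
  qed
  have lim: "(\<lambda>n. \<Sum>p\<in>initial_set n. F p \<omega>) \<longlonglongrightarrow> W \<omega>" for \<omega>
  proof (rule tendsto_eventually)
    show "\<forall>\<^sub>F n in sequentially. (\<Sum>p\<in>initial_set n. F p \<omega>) = W \<omega>"
      using eventually_gt_at_top[of "to_nat (skel \<omega> t)"] by eventually_elim (subst Fsum, simp, simp add: initial_set_def)
  qed
  have Wm: "W \<in> borel_measurable (P x)"
    by (rule borel_measurable_LIMSEQ_metric[OF _ lim]) (intro borel_measurable_sum Fm)
  have null: "AE \<omega> in P x. F p \<omega> = 0" if "p \<notin> range ?i" for p
    using skel_form[OF t, of x] by eventually_elim (use that in \<open>auto simp: F_def e_def skel_event_def indicator_def\<close>)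
  have norm_e: "(\<integral>\<^sup>+\<omega>. ennreal (cmod (e (?i q) \<omega>)) \<partial>P x) \<le> ennreal (pathw rate x q * (t ^ length q / fact (length q)))" for q
  proof -
    \<comment> \<open>The modulus of \<open>e (?i q)\<close> is the same weight without its phase.
      Its exponents are deg - deg = 0 at every vertex, which leaves t^n / n!.\<close>
    let ?e0 = "\<lambda>\<omega>. indicator (skel_event t (?i q)) \<omega> *\<^sub>R path_exp (\<lambda>_. 0) ?D t \<omega>"
    let ?c = "pathw (\<lambda>x y. complex_of_real (rate x y)) x q * dexp (map (\<lambda>z. rate_fun (\<lambda>_. 0) ?D (Some z) - of_real (?D z)) (x # q)) t"
    have b0: "has_bochner_integral (P x) ?e0 ?c" using skel_expectation[OF t, of x x q "\<lambda>_. 0" ?D] by simp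
    have tz: "time_integral (\<lambda>_. 0) t \<omega> = 0" for \<omega> :: "real \<Rightarrow> 'a option"
    proof -
      have "ext0 (\<lambda>_. 0) = (\<lambda>z :: 'a option. 0)" by (auto simp: ext0_def fun_eq_iff split: option.split)
      then show ?thesis by (simp add: time_integral_def set_lebesgue_integral_def)
    qed
    have re: "?e0 \<omega> = of_real (cmod (e (?i q) \<omega>))" for \<omega>
      by (simp add: e_def path_exp_def tz scaleR_conv_of_real exp_of_real norm_mult norm_exp_eq_Re)
    have ei: "integrable (P x) (\<lambda>\<omega>. cmod (e (?i q) \<omega>))"
      using has_bochner_integral_iff[THEN iffD1, OF b0] unfolding re complex_of_real_integrable_eq by blast
    have "complex_of_real (\<integral>\<omega>. cmod (e (?i q) \<omega>) \<partial>P x) = ?c"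
      using has_bochner_integral_integral_eq[OF b0] unfolding re by simp
    then have "(\<integral>\<omega>. cmod (e (?i q) \<omega>) \<partial>P x) \<le> cmod ?c"
      by (metis abs_ge_self norm_of_real)
    also have "\<dots> \<le> pathw rate x q * (t ^ length q / fact (length q))"
      unfolding norm_mult
    proof (rule mult_mono)
      show "cmod (pathw (\<lambda>x y. complex_of_real (rate x y)) x q) \<le> pathw rate x q"
        by (rule pathw_norm_le) simp
      have "rate_fun (\<lambda>_. 0) ?D (Some z) - of_real (?D z) = 0" for z by (simp add: rate_fun_def ext0_def)
      then show "cmod (dexp (map (\<lambda>z. rate_fun (\<lambda>_. 0) ?D (Some z) - of_real (?D z)) (x # q)) t) \<le> t ^ length q / fact (length q)"
        using dexp_bound[of 0 "map (\<lambda>_. 0) q" 0 t] t by (force simp del: dexp.simps)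
    qed auto
    finally have "ennreal (\<integral>\<omega>. cmod (e (?i q) \<omega>) \<partial>P x) \<le> ennreal (pathw rate x q * (t ^ length q / fact (length q)))"
      by (rule ennreal_leI)
    then show ?thesis using ei by (subst nn_integral_eq_integral) auto
  qed
  define c where "c p = (\<integral>\<^sup>+\<omega>. ennreal (cmod (F p \<omega>)) \<partial>P x)" for p
  have c_eq: "c p = (\<integral>\<^sup>+\<omega>. ennreal (cmod (e p \<omega>)) \<partial>P x) * ennreal (cmod (h p))" for p
    unfolding c_def F_def norm_mult using em[of p] by (subst nn_integral_multc[symmetric]) (auto simp: ennreal_mult)
  have "esum c = esum (\<lambda>q. c (?i q))"
  proof (rule esum_inj[OF inj])
    fix p assume "p \<notin> range ?i"
    from null[OF this] have "AE \<omega> in P x. ennreal (cmod (F p \<omega>)) = 0" by eventually_elim simp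
    then show "c p = 0" unfolding c_def using nn_integral_cong_AE[of "\<lambda>\<omega>. ennreal (cmod (F p \<omega>))" "\<lambda>_. 0" "P x"] by simp
  qed
  also have "\<dots> \<le> esum (\<lambda>q. ennreal (pathw rate x q * (t ^ length q / fact (length q))) * ennreal (cmod (h (?i q))))"
    unfolding c_eq by (intro nn_integral_mono mult_right_mono norm_e) simp
  also have "\<dots> < \<infinity>" by (rule sum)
  finally have cfin: "esum c < \<infinity>" .
  have "(\<integral>\<^sup>+\<omega>. ennreal (cmod (W \<omega>)) \<partial>P x) \<le> (\<integral>\<^sup>+\<omega>. esum (\<lambda>p. ennreal (cmod (F p \<omega>))) \<partial>P x)"
  proof (intro nn_integral_mono)
    fix \<omega>
    have "W \<omega> = F (skel \<omega> t) \<omega>" using Fsum[of "{skel \<omega> t}" \<omega>] by simp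
    then show "ennreal (cmod (W \<omega>)) \<le> esum (\<lambda>p. ennreal (cmod (F p \<omega>)))"
      using esum_point[of "\<lambda>p. ennreal (cmod (F p \<omega>))" "skel \<omega> t"] by simp
  qed
  also have "\<dots> = esum c" unfolding c_def using Fm by (intro nn_integral_count_space_nn_integral) auto
  finally have Wi: "integrable (P x) W" using cfin Wm by (simp add: integrable_iff_bounded le_less_trans)
  have Fi: "integrable (P x) (F p)" for p
  proof -
    have "c p < \<infinity>" using esum_point[of c p] cfin by (rule le_less_trans)
    then show ?thesis using Fm by (simp add: integrable_iff_bounded c_def)
  qed
  define G where "G p = (\<integral>\<omega>. F p \<omega> \<partial>P x)" for p
  have "ennreal (cmod (G p)) \<le> c p" for p
  proof -
    have "ennreal (cmod (G p)) \<le> ennreal (\<integral>\<omega>. cmod (F p \<omega>) \<partial>P x)"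
      unfolding G_def by (intro ennreal_leI integral_norm_bound)
    also have "\<dots> = c p" unfolding c_def using Fi by (intro nn_integral_eq_integral[symmetric]) auto
    finally show ?thesis .
  qed
  then have Gs: "tsummable G"
    using cfin by (intro tsummableI) (meson le_less_trans nn_integral_mono)
  \<comment> \<open>On each path the partial sums are either 0 or the whole functional, so the
    functional itself dominates them.\<close>
  have "(\<lambda>n. \<integral>\<omega>. (\<Sum>p\<in>initial_set n. F p \<omega>) \<partial>P x) \<longlonglongrightarrow> (\<integral>\<omega>. W \<omega> \<partial>P x)"
  proof (rule integral_dominated_convergence[where w = "\<lambda>\<omega>. cmod (W \<omega>)"])
    show "(\<lambda>\<omega>. \<Sum>p\<in>initial_set n. F p \<omega>) \<in> borel_measurable (P x)" for n
      by (intro borel_measurable_sum Fm)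
  qed (use Wm Wi lim in \<open>auto simp: Fsum\<close>)
  moreover have "(\<integral>\<omega>. (\<Sum>p\<in>initial_set n. F p \<omega>) \<partial>P x) = (\<Sum>p\<in>initial_set n. G p)" for n
    unfolding G_def using Fi by (intro Bochner_Integration.integral_sum)
  ultimately have "(\<integral>\<omega>. W \<omega> \<partial>P x) = tsum G" using tsum_lim[OF Gs] LIMSEQ_unique by simp
  also have "tsum G = infsetsum G (range ?i)"
  proof (rule infsetsum_cong_neutral)
    fix p assume "p \<in> UNIV - range ?i"
    then have "AE \<omega> in P x. F p \<omega> = 0" by (intro null) auto
    then show "G p = 0" unfolding G_def by (rule integral_eq_zero_AE)
  qed auto
  also have "\<dots> = tsum (\<lambda>q. G (?i q))" by (rule infsetsum_reindex[OF inj])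
  also have "\<dots> = tsum ?v"
  proof (intro infsetsum_cong refl)
    fix q
    have "(\<integral>\<omega>. e (?i q) \<omega> \<partial>P x) = pathw (\<lambda>x y. of_real (rate x y)) x q * dexp (map (\<lambda>z. rate_fun w ?D (Some z) - of_real (?D z)) (x # q)) t"
      unfolding e_def using has_bochner_integral_integral_eq[OF skel_expectation[OF t, of x x q w ?D]] by simp
    moreover have "(\<lambda>z. rate_fun w ?D (Some z) - of_real (?D z)) = (\<lambda>z. - \<i> * of_real (w z))"
      by (simp add: rate_fun_def ext0_def fun_eq_iff)
    ultimately show "G (?i q) = ?v q"
      unfolding G_def F_def by (simp only: integral_mult_left_zero)
  qed
  finally show ?thesis using Wi unfolding W_def has_bochner_integral_iff by blast
qed

end

lemma (in graph_process) inner_eq_functional: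
  assumes "\<omega> \<in> space (P y)" "0 \<le> t"
  shows "inner_integrand b m v \<theta> t z \<omega>
    = cnj (functional (\<lambda>p. if last p = z then phase b \<theta> p else 0) (\<lambda>x. v x + wdeg b m x) t \<omega>)"
proof (cases "finite (jumps \<omega> t)")
  case True
  then interpret finite_jumps \<omega> t by unfold_locales (use assms in \<open>auto simp: space_P\<close>)
  have "indicator {\<omega>. \<omega> t = z \<and> num_jumps \<omega> t < \<infinity>} \<omega> = (if \<omega> t = z then 1 else 0 :: complex)"
    using True by (simp only: indicator_def mem_Collect_eq num_jumps_finite) simp
  then show ?thesis
    using True by (simp add: inner_integrand_def functional_def exp_action last_skel)
next
  case False
  then show ?thesis unfolding inner_integrand_def functional_def indicator_def mem_Collect_eq num_jumps_finite by simp
qed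

lemma (in graph_process) outer_eq_functional:
  assumes "\<omega> \<in> space (P x)" "0 \<le> t"
  shows "outer_integrand b m v \<theta> v' \<theta>' t M \<omega>
    = functional (\<lambda>p. phase b \<theta> p * (of_real (inverse (ext0 m (last p))) * (\<integral>\<omega>'. inner_integrand b m v' \<theta>' t (last p) \<omega>' \<partial>M)))
        (\<lambda>x. v x + wdeg b m x) t \<omega>"
proof (cases "finite (jumps \<omega> t)")
  case True
  then interpret finite_jumps \<omega> t by unfold_locales (use assms in \<open>auto simp: space_P\<close>)
  have "outer_integrand b m v \<theta> v' \<theta>' t M \<omega> = (\<i> ^ the_enat (num_jumps \<omega> t) * exp (action b m v \<theta> t \<omega>))
    * (of_real (inverse (ext0 m (\<omega> t))) * (\<integral>\<omega>'. inner_integrand b m v' \<theta>' t (\<omega> t) \<omega>' \<partial>M))"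
    using True unfolding outer_integrand_def indicator_def mem_Collect_eq num_jumps_finite by simp
  then show ?thesis
    unfolding exp_action using True by (simp add: functional_def last_skel)
next
  case False
  then show ?thesis unfolding outer_integrand_def functional_def indicator_def mem_Collect_eq num_jumps_finite by simp
qed

section \<open>Feynman-Kac-Ito formula and the product of two unitary groups\<close>

locale schroedinger_process = graph_process b m C P + schroedinger b m C v \<theta>
  for b :: "'a::countable \<Rightarrow> 'a \<Rightarrow> real" and m C P v \<theta>
begin

text \<open>A Feynman-Kac-Ito formula for exp(-itL) g. Both expectations are instances: the inner
  one, up to conjugation, with g a point mass, the outer one with g the inner expectation divided by
  m.\<close>

lemma functional_phase:
  assumes g: "g \<in> H" and t: "0 \<le> t" and h: "\<And>q. h (map Some (x # q)) = phase b \<theta> (map Some (x # q)) * g (last (x # q))"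
  shows "has_bochner_integral (P x) (functional h (\<lambda>x. v x + wdeg b m x) t) (U1.U t g x)"
proof -
  have "has_bochner_integral (P x) (functional h (\<lambda>x. v x + wdeg b m x) t)
    (tsum (\<lambda>q. pathw (\<lambda>x y. of_real (rate x y)) x q * dexp (map (\<lambda>z. - \<i> * of_real (v z + wdeg b m z)) (x # q)) t * h (map Some (x # q))))"
  proof (rule functional_expectation[OF t])
    have "cmod (h (map Some (x # q))) = cmod (g (last (x # q)))" for q
      unfolding h norm_mult norm_phase by simp
    then show "esum (\<lambda>q. ennreal (pathw rate x q * (t ^ length q / fact (length q))) * ennreal (cmod (h (map Some (x # q))))) < \<infinity>"
      using U1.Rexp_H(2)[OF g t, of x] unfolding Rexp_def by simp
  qed
  moreover have "pathw (\<lambda>x y. of_real (rate x y)) x q * dexp (map (\<lambda>z. - \<i> * of_real (v z + wdeg b m z)) (x # q)) t * h (map Some (x # q))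
      = U1.pterm t g x q" for q
  proof -
    have "pot (- \<i>) = (\<lambda>z. - \<i> * of_real (v z + wdeg b m z))" by (simp add: pot_def fun_eq_iff)
    then show ?thesis unfolding h U1.pterm_def phase_pathw[symmetric] by (simp only: mult_ac)
  qed
  ultimately show ?thesis unfolding U1.U_def by simp
qed

text \<open>At z = \<open>None\<close> the value is 0 because a path with finitely many jumps almost
  surely ends at a vertex.\<close>

lemma inner_expectation:
  assumes t: "0 \<le> t"
  shows "has_bochner_integral (P y) (inner_integrand b m v \<theta> t z)
    (case z of None \<Rightarrow> 0 | Some z \<Rightarrow> cnj (U1.U t (single z) y))"
proof -
  define g where "g = (case z of None \<Rightarrow> (\<lambda>_. 0) | Some z \<Rightarrow> single z)"
  have g: "g \<in> H" by (auto simp: g_def single_H split: option.split)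
  have lm: "last (map Some (y # q)) = Some (last (y # q))" for q by (rule last_map) simp
  have h: "(if last (map Some (y # q)) = z then phase b \<theta> (map Some (y # q)) else 0) = phase b \<theta> (map Some (y # q)) * g (last (y # q))" for q
    unfolding lm g_def single_def by (auto split: option.split simp del: last.simps list.map)
  have "has_bochner_integral (P y) (\<lambda>\<omega>. cnj (functional (\<lambda>p. if last p = z then phase b \<theta> p else 0) (\<lambda>x. v x + wdeg b m x) t \<omega>))
    (cnj (U1.U t g y))"
    by (rule has_bochner_integral_bounded_linear[OF bounded_linear_cnj functional_phase[OF g t h]])
  moreover have "cnj (U1.U t g y) = (case z of None \<Rightarrow> 0 | Some z \<Rightarrow> cnj (U1.U t (single z) y))"
    by (auto simp: g_def U1.U_def U1.pterm_def split: option.split)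
  ultimately show ?thesis
    by (subst has_bochner_integral_cong[OF refl inner_eq_functional refl]) (use t in auto)
qed

end

lemma (in weight) bop_comp:
  assumes S: "bounded_operator m S" and T: "bounded_operator m T"
  shows "bounded_operator m (\<lambda>f. S (T f))"
proof -
  obtain A where A: "0 < A" "\<And>f. f \<in> H \<Longrightarrow> nrm (S f) \<le> A * nrm f" using bop_bound[OF S] by blast
  obtain B where B: "0 < B" "\<And>f. f \<in> H \<Longrightarrow> nrm (T f) \<le> B * nrm f" using bop_bound[OF T] by blast
  have "nrm (S (T f)) \<le> A * B * nrm f" if "f \<in> H" for f
    unfolding mult.assoc
    by (rule order_trans[OF A(2)[OF bop_H[OF T that]] mult_left_mono[OF B(2)[OF that] less_imp_le[OF A(1)]]])
  then show ?thesis
    unfolding bounded_operator_def by (auto simp: bop_H[OF S] bop_H[OF T] bop_lin[OF S] bop_lin[OF T])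
qed

locale path_integral = S: schroedinger_process b m C P v \<theta> + S': schroedinger_process b m C P v' \<theta>'
  for b :: "'a::countable \<Rightarrow> 'a \<Rightarrow> real" and m C P v \<theta> v' \<theta>'
begin

lemma outer_expectation:
  assumes t: "0 \<le> t"
  shows "has_bochner_integral (P x) (outer_integrand b m v \<theta> v' \<theta>' t (P y))
    (S.U1.U t (S'.U2.U t (S.single y)) x / of_real (m y))"
proof -
  let ?J = "\<lambda>z. \<integral>\<omega>'. inner_integrand b m v' \<theta>' t z \<omega>' \<partial>P y"
  let ?h = "\<lambda>p. phase b \<theta> p * (of_real (inverse (ext0 m (last p))) * ?J (last p))"
  \<comment> \<open>By \<open>U_adjoint\<close>, the inner expectation at z divided by m z is the
    kernel at (z, y) of the second unitary operator. This is the terminal function for the outer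
    formula.\<close>
  define g where "g z = inverse (of_real (m y)) * S'.U2.U t (S.single y) z" for z
  have u: "S'.U2.U t (S.single y) \<in> ell2 m" by (rule S'.U2.U_H[OF S.single_H t])
  have J: "?J (Some z) = cnj (S'.U1.U t (S.single z) y)" for z
    using has_bochner_integral_integral_eq[OF S'.inner_expectation[OF t, of y "Some z"]] by simp
  have gz: "of_real (inverse (m z)) * ?J (Some z) = g z" for z
    using S'.U_adjoint[OF t, of z y] S.m_gt[of z] S.m_gt[of y]
    unfolding J g_def by (simp add: field_simps)
  have "has_bochner_integral (P x) (S.functional ?h (\<lambda>x. v x + wdeg b m x) t) (S.U1.U t g x)"
  proof (rule S.functional_phase[OF _ t])
    show "g \<in> ell2 m" unfolding g_def by (rule S.scale_H[OF u])
    have lm: "last (map Some (x # q)) = Some (last (x # q))" for q by (rule last_map) simp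
    show "?h (map Some (x # q)) = phase b \<theta> (map Some (x # q)) * g (last (x # q))" for q
      unfolding lm gz[symmetric] by (simp add: ext0_def)
  qed
  moreover have "S.U1.U t g x = S.U1.U t (S'.U2.U t (S.single y)) x / of_real (m y)"
  proof -
    have "S.U1.U t g = (\<lambda>x. inverse (of_real (m y)) * S.U1.U t (S'.U2.U t (S.single y)) x)"
      unfolding g_def by (rule S.bop_scale[OF S.U1.U_bop[OF t] u])
    then show ?thesis by (simp add: divide_inverse mult.commute)
  qed
  ultimately show ?thesis
    by (subst has_bochner_integral_cong[OF refl S.outer_eq_functional refl]) (use t in auto)
qed

lemma product_bop:
  assumes t: "0 \<le> t" shows "bounded_operator m (\<lambda>f. S.U1.U t (S'.U2.U t f))"
  by (rule S.bop_comp[OF S.U1.U_bop[OF t] S'.U2.U_bop[OF t]])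

lemma product_kernel:
  assumes t: "0 \<le> t"
  shows "is_integral_kernel m
      (\<lambda>f. op_exp m (scale_graph (- \<i>) (mag_op b m v \<theta>)) t (op_exp m (scale_graph \<i> (mag_op b m v' \<theta>')) t f))
      (\<lambda>x y. \<integral>\<omega>. outer_integrand b m v \<theta> v' \<theta>' t (P y) \<omega> \<partial>P x)"
proof (rule S.bop_integral_kernel(1)[OF product_bop[OF t]])
  fix f assume f: "f \<in> ell2 m"
  show "op_exp m (scale_graph (- \<i>) (mag_op b m v \<theta>)) t (op_exp m (scale_graph \<i> (mag_op b m v' \<theta>')) t f)
      = S.U1.U t (S'.U2.U t f)"
    using S.op_exp_unitary[of "- \<i>" "S'.U2.U t f" t] S'.op_exp_unitary[of \<i> f t] S'.U2.U_H[OF f t] f t by simp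
next
  fix x y
  show "(\<integral>\<omega>. outer_integrand b m v \<theta> v' \<theta>' t (P y) \<omega> \<partial>P x) * of_real (m y) = S.U1.U t (S'.U2.U t (S.single y)) x"
    using has_bochner_integral_integral_eq[OF outer_expectation[OF t, of x y]] S.m_gt[of y] by simp
qed

end

theorem proposition4p5:
  fixes b :: "'a::countable \<Rightarrow> 'a \<Rightarrow> real" and m v v' :: "'a \<Rightarrow> real"
    and \<theta> \<theta>' :: "'a \<Rightarrow> 'a \<Rightarrow> real"
    and P :: "'a \<Rightarrow> (real \<Rightarrow> 'a option) measure" and t :: real
  assumes "weighted_graph b m"
    and "magnetic_potential b \<theta>" and "magnetic_potential b \<theta>'"
    and "semibounded_form m Cc (mag_form b m v \<theta>)" and "closable_form m Cc (mag_form b m v \<theta>)"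
    and "semibounded_form m Cc (mag_form b m v' \<theta>')" and "closable_form m Cc (mag_form b m v' \<theta>')"
    and "semibounded_form m Cc (mag_form b m (\<lambda>x. - wdeg b m x) (\<lambda>_ _. 0))"
    and "closable_form m Cc (mag_form b m (\<lambda>x. - wdeg b m x) (\<lambda>_ _. 0))"
    and "\<And>x. process_law b m x (P x)"
    and "0 \<le> t"
  shows "(\<forall>y z. integrable (P y) (inner_integrand b m v' \<theta>' t z)) \<and>
    (\<forall>x y. integrable (P x) (outer_integrand b m v \<theta> v' \<theta>' t (P y))) \<and>
    is_integral_kernel m
      (\<lambda>f. op_exp m (scale_graph (- \<i>) (mag_op b m v \<theta>)) t
             (op_exp m (scale_graph \<i> (mag_op b m v' \<theta>')) t f))
      (\<lambda>x y. \<integral>\<omega>. outer_integrand b m v \<theta> v' \<theta>' t (P y) \<omega> \<partial>P x)"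
proof -
  have m: "\<And>x. 0 < m x" using assms(1) by (simp add: weighted_graph_def)
  interpret wgraph b m by unfold_locales (use assms(1) m in auto)
  obtain C where "bounded_matrix m rate C" using bounded_rate[OF assms(8)] by blast
  then interpret bounded_matrix m rate C .
  interpret path_integral b m C P v \<theta> v' \<theta>' by unfold_locales (use assms in auto)
  show ?thesis
    using S'.inner_expectation[OF assms(11)] outer_expectation[OF assms(11)] product_kernel[OF assms(11)]
    by (auto simp: has_bochner_integral_iff)
qed

end
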